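(* Let $N_1,N_2$ be positive integers and let $R=(R^{\lambda\alpha}_{\beta\mu})$ be complex numbers, $\lambda,\mu\in\{1,\dots,N_1\}$, $\alpha,\beta\in\{1,\dots,N_2\}$, satisfying the conditions (C1), (C2), (C3) listed in the context. Let $\mathcal{A}_R$ be the associated quadratic algebra and $\mathcal{A}_R^!$ its Koszul dual. Then $\mathcal{A}_R$ is Koszul of global dimension $N_1+N_2$ and Gorenstein. Moreover, $\mathcal{A}_R$ has polynomial growth, and the Poincaré series of $\mathcal{A}_R$ and $\mathcal{A}_R^!$ are $$P_{\mathcal{A}_R}(t)=\frac{1}{(1-t)^{N_1+N_2}},\qquad P_{\mathcal{A}_R^!}(t)=(1+t)^{N_1+N_2}.$$
   Context: Repeated up-down indices are summed; $\lambda,\mu,\nu,\rho,\dots$ run in $\{1,\dots,N_1\}$ and $\alpha,\beta,\gamma,\delta,\dots$ run in $\{1,\dots,N_2\}$; the bar is complex conjugation. The algebra $\mathcal{A}_R$ is the unital associative complex algebra ($*$-algebra with hermitian generators) generated by $x_1^\lambda$ and $x_2^\alpha$ with relations $$x_1^\lambda x_1^\mu=x_1^\mu x_1^\lambda,\qquad x_2^\alpha x_2^\beta=x_2^\beta x_2^\alpha,\qquad x_1^\lambda x_2^\alpha=R^{\lambda\alpha}_{\beta\mu}\,x_2^\beta x_1^\mu .$$ It is graded with generators in degree 1. Conditions (for all values of the free indices): (C1) $\overline{R}^{\lambda\alpha}_{\beta\mu}R^{\mu\beta}_{\gamma\nu}=\delta^\lambda_\nu\delta^\alpha_\gamma$.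 (C2) $R^{\lambda\alpha}_{\gamma\rho}R^{\rho\beta}_{\delta\mu}=R^{\lambda\beta}_{\delta\rho}R^{\rho\alpha}_{\gamma\mu}$, $\ \overline{R}^{\lambda\alpha}_{\gamma\rho}\overline{R}^{\rho\beta}_{\delta\mu}=\overline{R}^{\lambda\beta}_{\delta\rho}\overline{R}^{\rho\alpha}_{\gamma\mu}$, $\ \overline{R}^{\lambda\alpha}_{\gamma\rho}R^{\rho\beta}_{\delta\mu}=R^{\lambda\beta}_{\delta\rho}\overline{R}^{\rho\alpha}_{\gamma\mu}$. (C3) $R^{\lambda\alpha}_{\gamma\nu}R^{\mu\gamma}_{\beta\rho}=R^{\mu\alpha}_{\gamma\rho}R^{\lambda\gamma}_{\beta\nu}$, $\ \overline{R}^{\lambda\alpha}_{\gamma\nu}\overline{R}^{\mu\gamma}_{\beta\rho}=\overline{R}^{\mu\alpha}_{\gamma\rho}\overline{R}^{\lambda\gamma}_{\beta\nu}$, $\ R^{\lambda\alpha}_{\gamma\nu}\overline{R}^{\mu\gamma}_{\beta\rho}=\overline{R}^{\mu\alpha}_{\gamma\rho}R^{\lambda\gamma}_{\beta\nu}$. Quadratic algebras. For a finite-dimensional complex vector space $E$ and a subspace $V\subset E\otimes E$, put $\mathcal{A}=A(E,V)=T(E)/(V)$, graded with $\mathcal{A}_1=E$. Its Koszul dual is $\mathcal{A}^!=A(E^*,V^\perp)$, where $V^\perp\subset E^*\otimes E^*=(E\otimes E)^*$ is the annihilator of $V$. One has $\mathcal{A}^{!*}_0=\mathbb{C}$, $\mathcal{A}^{!*}_1=E$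 and $\mathcal{A}^{!*}_n=\bigcap_{r+s+2=n}E^{\otimes r}\otimes V\otimes E^{\otimes s}$ for $n\ge2$, where $\mathcal{A}^{!*}_n$ is the dual space of $\mathcal{A}^!_n$. The Koszul complex $K(\mathcal{A})$ is the complex of free left $\mathcal{A}$-modules $\mathcal{A}\otimes\mathcal{A}^{!*}_n$ ($n\geq 0$) with differential $b:\mathcal{A}\otimes\mathcal{A}^{!*}_{n+1}\to\mathcal{A}\otimes\mathcal{A}^{!*}_n$ induced by $a\otimes(y_0\otimes y_1\otimes\cdots\otimes y_n)\mapsto ay_0\otimes(y_1\otimes\cdots\otimes y_n)$. The algebra $\mathcal{A}$ is Koszul if $H_n(K(\mathcal{A}))=0$ for all $n\ge1$. An algebra $\mathcal{A}$ of finite global dimension $D$ is Gorenstein if $\mathrm{Ext}^n_{\mathcal{A}}(\mathbb{C},\mathcal{A})=0$ for $n\ne D$ and $\mathrm{Ext}^D_{\mathcal{A}}(\mathbb{C},\mathcal{A})=\mathbb{C}$, where $\mathbb{C}$ is the trivial module (for Koszul $\mathcal{A}$ these Ext groups are the cohomology of $\mathrm{Hom}_{\mathcal{A}}(K(\mathcal{A}),\mathcal{A})$). A graded algebra $\mathcal{A}=\oplus_n\mathcal{A}_n$ has polynomial growth if there are $C>0$ and $N\in\mathbb{N}$ with $\dim\mathcal{A}_n\le Cn^{N-1}$ for every $n \geq 1$. Its Poincaré series is $P_{\mathcal{A}}(t)=\sum_n\dim(\mathcal{A}_n)t^n$. *)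

theory Defs
  imports Complex_Main
    "HOL-Library.Cardinality"
    "HOL-Library.Extended_Nat"
    "HOL-Library.Poly_Mapping"
    "HOL-Computational_Algebra.Formal_Power_Series"
    "HOL-Algebra.Embedded_Algebras"
    "HOL-Algebra.QuotRing"
    "HOL-Algebra.Algebraic_Closure_Type"
begin

section \<open>Left modules, projective resolutions, global dimension\<close>

text \<open>HOL-Algebra's locale \<open>module\<close> requires a commutative base ring. We reuse its record type;
  the fields \<open>mult\<close> and \<open>one\<close> of that record play no role.\<close>

locale left_module = ring A + M: abelian_group M
  for A :: "('a, 'r) ring_scheme" (structure) and M :: "('a, 'b) module" +
  assumes smult_closed [simp, intro]:
      "\<lbrakk>a \<in> carrier A; x \<in> carrier M\<rbrakk> \<Longrightarrow> a \<odot>\<^bsub>M\<^esub> x \<in> carrier M"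
    and smult_l_distr:
      "\<lbrakk>a \<in> carrier A; b \<in> carrier A; x \<in> carrier M\<rbrakk> \<Longrightarrow>
        (a \<oplus> b) \<odot>\<^bsub>M\<^esub> x = a \<odot>\<^bsub>M\<^esub> x \<oplus>\<^bsub>M\<^esub> b \<odot>\<^bsub>M\<^esub> x"
    and smult_r_distr:
      "\<lbrakk>a \<in> carrier A; x \<in> carrier M; y \<in> carrier M\<rbrakk> \<Longrightarrow>
        a \<odot>\<^bsub>M\<^esub> (x \<oplus>\<^bsub>M\<^esub> y) = a \<odot>\<^bsub>M\<^esub> x \<oplus>\<^bsub>M\<^esub> a \<odot>\<^bsub>M\<^esub> y"
    and smult_assoc1:
      "\<lbrakk>a \<in> carrier A; b \<in> carrier A; x \<in> carrier M\<rbrakk> \<Longrightarrow>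
        (a \<otimes> b) \<odot>\<^bsub>M\<^esub> x = a \<odot>\<^bsub>M\<^esub> (b \<odot>\<^bsub>M\<^esub> x)"
    and smult_one [simp]:
      "x \<in> carrier M \<Longrightarrow> \<one> \<odot>\<^bsub>M\<^esub> x = x"

definition linear_maps ::
  "('a, 'r) ring_scheme \<Rightarrow> ('a, 'b) module \<Rightarrow> ('a, 'c) module \<Rightarrow> ('b \<Rightarrow> 'c) set" where
  "linear_maps A M N = {f \<in> carrier M \<rightarrow> carrier N.
     (\<forall>x\<in>carrier M. \<forall>y\<in>carrier M. f (x \<oplus>\<^bsub>M\<^esub> y) = f x \<oplus>\<^bsub>N\<^esub> f y) \<and>
     (\<forall>a\<in>carrier A. \<forall>x\<in>carrier M. f (a \<odot>\<^bsub>M\<^esub> x) = a \<odot>\<^bsub>N\<^esub> f x)}"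

definition module_isomorphic ::
  "('a, 'r) ring_scheme \<Rightarrow> ('a, 'b) module \<Rightarrow> ('a, 'c) module \<Rightarrow> bool" where
  "module_isomorphic A M N \<longleftrightarrow> (\<exists>f\<in>linear_maps A M N. bij_betw f (carrier M) (carrier N))"

definition free_module :: "('a, 'r) ring_scheme \<Rightarrow> 'j set \<Rightarrow> ('a, 'j \<Rightarrow> 'a) module" where
  "free_module A J =
     \<lparr>carrier = {f. (\<forall>j. f j \<in> carrier A) \<and> (\<forall>j. j \<notin> J \<longrightarrow> f j = \<zero>\<^bsub>A\<^esub>) \<and> finite {j. f j \<noteq> \<zero>\<^bsub>A\<^esub>}},
      monoid.mult = undefined, one = undefined, zero = (\<lambda>_. \<zero>\<^bsub>A\<^esub>), add = (\<lambda>f g j. f j \<oplus>\<^bsub>A\<^esub> g j),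
      module.smult = (\<lambda>a f j. a \<otimes>\<^bsub>A\<^esub> f j)\<rparr>"

text \<open>Projective means direct summand of a free module. Index sets inside the type of \<open>P\<close>
  suffice, because \<open>P\<close> generates itself.\<close>

definition projective_module :: "('a, 'r) ring_scheme \<Rightarrow> ('a, 'b) module \<Rightarrow> bool" where
  "projective_module A P \<longleftrightarrow> left_module A P \<and>
     (\<exists>J :: 'b set. \<exists>s\<in>linear_maps A P (free_module A J). \<exists>r\<in>linear_maps A (free_module A J) P.
        \<forall>x\<in>carrier P. r (s x) = x)"

definition projective_resolution ::
  "('a, 'r) ring_scheme \<Rightarrow> (nat \<Rightarrow> ('a, 'p) module) \<Rightarrow> (nat \<Rightarrow> 'p \<Rightarrow> 'p) \<Rightarrow> ('p \<Rightarrow> 'b) \<Rightarrow>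
     ('a, 'b) module \<Rightarrow> bool" where
  "projective_resolution A P d e M \<longleftrightarrow>
     (\<forall>n. projective_module A (P n)) \<and>
     (\<forall>n. d n \<in> linear_maps A (P (Suc n)) (P n)) \<and>
     e \<in> linear_maps A (P 0) M \<and>
     e ` carrier (P 0) = carrier M \<and>
     d 0 ` carrier (P 1) = a_kernel (P 0) M e \<and>
     (\<forall>n. d (Suc n) ` carrier (P (Suc (Suc n))) = a_kernel (P (Suc n)) (P n) (d n))"

text \<open>A module \<open>M\<close> over \<open>A\<close> with elements in \<open>'b\<close> has a free resolution whose terms have ranks
  bounded by the cardinality of \<open>'b \<times> 'a \<times> nat\<close>, and all its terms (and all their submodules)
  are realized inside the type \<open>'b \<times> 'a \<times> nat \<Rightarrow> 'a\<close>. So nothing is lost by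
  considering only projective resolutions with terms in this type.\<close>

type_synonym ('a, 'b) resolution_elem = "'b \<times> 'a \<times> nat \<Rightarrow> 'a"

definition projective_dimension :: "('a, 'r) ring_scheme \<Rightarrow> ('a, 'b) module \<Rightarrow> enat" where
  "projective_dimension A M =
     Inf {enat n | n. \<exists>(P :: nat \<Rightarrow> ('a, ('a, 'b) resolution_elem) module) d e.
            projective_resolution A P d e M \<and> (\<forall>k>n. carrier (P k) = {\<zero>\<^bsub>P k\<^esub>})}"

text \<open>The left global dimension: supremum over all left modules. HOL cannot quantify over types inside a formula, so the
  modules range over those with elements in \<open>'u \<Rightarrow> 'a\<close>, where \<open>'u\<close> is a parameter.
  Every module with elements in \<open>'u\<close> is isomorphic to one of these (if \<open>A\<close> is nonzero), so a
  statement about all \<open>'u\<close> covers modules of every size. By Auslander's theorem the value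
  does not depend on \<open>'u\<close>, as cyclic modules occur for each \<open>'u\<close>.\<close>

definition global_dimension :: "'u itself \<Rightarrow> ('a, 'r) ring_scheme \<Rightarrow> enat" where
  "global_dimension _ A =
     Sup {projective_dimension A M | M :: ('a, 'u \<Rightarrow> 'a) module. left_module A M}"

section \<open>Ext with coefficients in the regular module, Gorenstein algebras\<close>

text \<open>\<open>Hom\<^sub>A(M, A)\<close> with its right \<open>A\<close>-module structure \<open>(f a)(x) = f(x) a\<close>. Right modules are stored
  in the same record type, \<open>a \<odot> f\<close> standing for \<open>f a\<close>.\<close>

definition dual_module :: "('a, 'r) ring_scheme \<Rightarrow> ('a, 'b) module \<Rightarrow> ('a, 'b \<Rightarrow> 'a) module" where
  "dual_module A M =
     \<lparr>carrier = {f \<in> carrier M \<rightarrow>\<^sub>E carrier A.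
        (\<forall>x\<in>carrier M. \<forall>y\<in>carrier M. f (x \<oplus>\<^bsub>M\<^esub> y) = f x \<oplus>\<^bsub>A\<^esub> f y) \<and>
        (\<forall>a\<in>carrier A. \<forall>x\<in>carrier M. f (a \<odot>\<^bsub>M\<^esub> x) = a \<otimes>\<^bsub>A\<^esub> f x)},
      monoid.mult = undefined, one = undefined, zero = (\<lambda>x\<in>carrier M. \<zero>\<^bsub>A\<^esub>),
      add = (\<lambda>f g. \<lambda>x\<in>carrier M. f x \<oplus>\<^bsub>A\<^esub> g x),
      module.smult = (\<lambda>a f. \<lambda>x\<in>carrier M. f x \<otimes>\<^bsub>A\<^esub> a)\<rparr>"

text \<open>\<open>Z / B\<close> for submodules \<open>B \<subseteq> Z\<close> of \<open>M\<close>.\<close>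

definition subquotient_module ::
  "('a, 'b) module \<Rightarrow> 'b set \<Rightarrow> 'b set \<Rightarrow> ('a, 'b set) module" where
  "subquotient_module M Z B =
     \<lparr>carrier = (\<lambda>z. B +>\<^bsub>M\<^esub> z) ` Z, monoid.mult = undefined, one = undefined, zero = B,
      add = set_add M, module.smult = (\<lambda>a C. \<Union>x\<in>C. B +>\<^bsub>M\<^esub> (a \<odot>\<^bsub>M\<^esub> x))\<rparr>"

definition dual_cocycles ::
  "('a, 'r) ring_scheme \<Rightarrow> (nat \<Rightarrow> ('a, 'p) module) \<Rightarrow> (nat \<Rightarrow> 'p \<Rightarrow> 'p) \<Rightarrow> nat \<Rightarrow> ('p \<Rightarrow> 'a) set" where
  "dual_cocycles A P d n =
     {f \<in> carrier (dual_module A (P n)). \<forall>x\<in>carrier (P (Suc n)). f (d n x) = \<zero>\<^bsub>A\<^esub>}"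

definition dual_coboundaries ::
  "('a, 'r) ring_scheme \<Rightarrow> (nat \<Rightarrow> ('a, 'p) module) \<Rightarrow> (nat \<Rightarrow> 'p \<Rightarrow> 'p) \<Rightarrow> nat \<Rightarrow> ('p \<Rightarrow> 'a) set" where
  "dual_coboundaries A P d n =
     (case n of
        0 \<Rightarrow> {\<zero>\<^bsub>dual_module A (P 0)\<^esub>}
      | Suc m \<Rightarrow> (\<lambda>f. \<lambda>x\<in>carrier (P (Suc m)). f (d m x)) ` carrier (dual_module A (P m)))"

definition some_resolution ::
  "('a, 'r) ring_scheme \<Rightarrow> ('a, 'b) module \<Rightarrow>
     (nat \<Rightarrow> ('a, ('a, 'b) resolution_elem) module) \<times>
     (nat \<Rightarrow> ('a, 'b) resolution_elem \<Rightarrow> ('a, 'b) resolution_elem) \<times>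
     (('a, 'b) resolution_elem \<Rightarrow> 'b)" where
  "some_resolution A M = (SOME (P, d, e). projective_resolution A P d e M)"

text \<open>\<open>Ext\<^sup>n\<^sub>A(M, A)\<close> as a right \<open>A\<close>-module.\<close>

definition Ext_regular ::
  "nat \<Rightarrow> ('a, 'r) ring_scheme \<Rightarrow> ('a, 'b) module \<Rightarrow>
     ('a, (('a, 'b) resolution_elem \<Rightarrow> 'a) set) module" where
  "Ext_regular n A M =
     (case some_resolution A M of (P, d, e) \<Rightarrow>
        subquotient_module (dual_module A (P n)) (dual_cocycles A P d n) (dual_coboundaries A P d n))"

text \<open>\<open>T\<close> is the trivial module \<open>\<complex>\<close>, given by the augmentation of \<open>A\<close>; being defined by a character,
  it is both a left and a right module.\<close>

definition gorenstein :: "'u itself \<Rightarrow> ('a, 'r) ring_scheme \<Rightarrow> ('a, complex) module \<Rightarrow> bool" where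
  "gorenstein u A T \<longleftrightarrow> (\<exists>D. global_dimension u A = enat D \<and>
     (\<forall>n. n \<noteq> D \<longrightarrow> carrier (Ext_regular n A T) = {\<zero>\<^bsub>Ext_regular n A T\<^esub>}) \<and>
     module_isomorphic A (Ext_regular D A T) T)"

section \<open>The tensor algebra\<close>

text \<open>Words form the free monoid, so \<open>'i list \<Rightarrow>\<^sub>0 complex\<close>, with the convolution product of
  \<open>Poly_Mapping\<close>, is the tensor algebra of the space with basis \<open>'i\<close>.\<close>

instantiation list :: (type) monoid_add
begin

definition zero_list :: "'a list" where "zero_list = []"

definition plus_list :: "'a list \<Rightarrow> 'a list \<Rightarrow> 'a list" where "plus_list = (@)"

instance by standard (simp_all add: zero_list_def plus_list_def)

end

type_synonym 'i tensor = "'i list \<Rightarrow>\<^sub>0 complex"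

abbreviation tensor_algebra :: "'i tensor ring" where
  "tensor_algebra \<equiv> ring_of_type_algebra"

definition tensor_word :: "'i list \<Rightarrow> 'i tensor" where
  "tensor_word w = Poly_Mapping.single w 1"

definition tensor_const :: "complex \<Rightarrow> 'i tensor" where
  "tensor_const c = Poly_Mapping.single [] c"

definition tensor_scale :: "complex \<Rightarrow> 'i tensor \<Rightarrow> 'i tensor" where
  "tensor_scale c t = tensor_const c * t"

global_interpretation tensor: vector_space tensor_scale
proof
  fix a b :: complex and s t :: "'i tensor"
  show "tensor_scale a (s + t) = tensor_scale a s + tensor_scale a t"
    by (simp add: tensor_scale_def distrib_left)
  show "tensor_scale (a + b) t = tensor_scale a t + tensor_scale b t"
    by (simp add: tensor_scale_def tensor_const_def single_add distrib_right)
  show "tensor_scale a (tensor_scale b t) = tensor_scale (a * b) t"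
    by (simp add: tensor_scale_def tensor_const_def mult.assoc [symmetric] mult_single plus_list_def)
  show "tensor_scale 1 t = t"
    by (simp add: tensor_scale_def tensor_const_def single_one flip: zero_list_def)
qed

definition tensor_degree :: "nat \<Rightarrow> 'i tensor set" where
  "tensor_degree n = {t. \<forall>w\<in>Poly_Mapping.keys t. length w = n}"

section \<open>Quadratic algebras\<close>

text \<open>\<open>V\<close> always stands for a linear subspace of \<open>tensor_degree 2\<close>, i.e. of \<open>E \<otimes> E\<close>.\<close>

definition quadratic_ideal :: "'i tensor set \<Rightarrow> 'i tensor set" where
  "quadratic_ideal V = Idl\<^bsub>tensor_algebra\<^esub> V"

definition quadratic_algebra :: "'i tensor set \<Rightarrow> 'i tensor set ring" where
  "quadratic_algebra V = tensor_algebra Quot quadratic_ideal V"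

definition quadratic_class :: "'i tensor set \<Rightarrow> 'i tensor \<Rightarrow> 'i tensor set" where
  "quadratic_class V t = quadratic_ideal V +>\<^bsub>tensor_algebra\<^esub> t"

definition quadratic_degree :: "'i tensor set \<Rightarrow> nat \<Rightarrow> 'i tensor set set" where
  "quadratic_degree V n = quadratic_class V ` tensor_degree n"

definition quadratic_scalars :: "'i tensor set \<Rightarrow> 'i tensor set set" where
  "quadratic_scalars V = range (\<lambda>c. quadratic_class V (tensor_const c))"

text \<open>\<open>dim\<^sub>\<complex> \<A>\<^sub>n\<close>\<close>

definition quadratic_dim :: "'i tensor set \<Rightarrow> nat \<Rightarrow> nat" where
  "quadratic_dim V n =
     (THE k. ring.dimension (quadratic_algebra V) k (quadratic_scalars V) (quadratic_degree V n))"

definition poincare_series :: "'i tensor set \<Rightarrow> real fps" where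
  "poincare_series V = Abs_fps (\<lambda>n. real (quadratic_dim V n))"

definition polynomial_growth :: "'i tensor set \<Rightarrow> bool" where
  "polynomial_growth V \<longleftrightarrow>
     (\<exists>C>0. \<exists>N::nat. \<forall>n\<ge>1. real (quadratic_dim V n) \<le> C * real n powi (int N - 1))"

text \<open>The augmentation of \<open>T(E)/(V)\<close> sends the class of \<open>t\<close> to the coefficient of \<open>t\<close> at the empty word.\<close>

definition trivial_module :: "'i tensor set \<Rightarrow> ('i tensor set, complex) module" where
  "trivial_module V =
     \<lparr>carrier = UNIV, monoid.mult = (*), one = 1, zero = 0, add = (+),
      module.smult = (\<lambda>a c. the_elem ((\<lambda>t. Poly_Mapping.lookup t []) ` a) * c)\<rparr>"

text \<open>\<open>V\<^sup>\<bottom>\<close>, with \<open>E\<^sup>*\<close> identified with the span of the same alphabet by means of the dual basis. The Koszul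
  dual of \<open>quadratic_algebra V\<close> is \<open>quadratic_algebra (quadratic_dual V)\<close>.\<close>

definition quadratic_dual :: "'i::finite tensor set \<Rightarrow> 'i tensor set" where
  "quadratic_dual V = {s \<in> tensor_degree 2. \<forall>t\<in>V.
     (\<Sum>i\<in>UNIV. \<Sum>j\<in>UNIV. Poly_Mapping.lookup s [i, j] * Poly_Mapping.lookup t [i, j]) = 0}"

section \<open>The Koszul complex\<close>

text \<open>\<open>\<A>\<^sup>!\<^sup>*\<^sub>n\<close> as a subspace of the \<open>n\<close>-th tensor power of \<open>E\<close>; for \<open>n < 2\<close> there is no condition and it is
  \<open>\<complex>\<close> resp. \<open>E\<close>.\<close>

definition koszul_space :: "'i tensor set \<Rightarrow> nat \<Rightarrow> 'i tensor set" where
  "koszul_space V n = {t \<in> tensor_degree n. \<forall>r s. r + s + 2 = n \<longrightarrow>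
     t \<in> tensor.span {u * v * w | u v w. u \<in> tensor_degree r \<and> v \<in> V \<and> w \<in> tensor_degree s}}"

text \<open>\<open>\<A> \<otimes> \<A>\<^sup>!\<^sup>*\<^sub>n\<close> is a subspace of \<open>\<A> \<otimes> E \<otimes> \<dots> \<otimes> E\<close>, and the elements of the latter are given by their
  coefficients in \<open>\<A>\<close> with respect to the words of length \<open>n\<close>: the elementary tensor \<open>a \<otimes> t\<close> is
  the function \<open>u \<mapsto> a t\<^sub>u\<close>.\<close>

definition koszul_chains :: "'i tensor set \<Rightarrow> nat \<Rightarrow> ('i list \<Rightarrow> 'i tensor set) set" where
  "koszul_chains V n =
     {\<lambda>u. \<Oplus>\<^bsub>quadratic_algebra V\<^esub>t\<in>S. a t \<otimes>\<^bsub>quadratic_algebra V\<^esub>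
            quadratic_class V (tensor_const (Poly_Mapping.lookup t u))
       | S a. finite S \<and> S \<subseteq> koszul_space V n \<and> a \<in> S \<rightarrow> carrier (quadratic_algebra V)}"

text \<open>\<open>b(a \<otimes> (y\<^sub>0 \<otimes> y\<^sub>1 \<otimes> \<dots> \<otimes> y\<^sub>n)) = a y\<^sub>0 \<otimes> (y\<^sub>1 \<otimes> \<dots> \<otimes> y\<^sub>n)\<close> in these coordinates.\<close>

definition koszul_diff ::
  "'i::finite tensor set \<Rightarrow> ('i list \<Rightarrow> 'i tensor set) \<Rightarrow> 'i list \<Rightarrow> 'i tensor set" where
  "koszul_diff V f = (\<lambda>u. \<Oplus>\<^bsub>quadratic_algebra V\<^esub>i\<in>UNIV.
     f (i # u) \<otimes>\<^bsub>quadratic_algebra V\<^esub> quadratic_class V (tensor_word [i]))"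

definition koszul :: "'i::finite tensor set \<Rightarrow> bool" where
  "koszul V \<longleftrightarrow> (\<forall>n\<ge>1.
     {f \<in> koszul_chains V n. koszul_diff V f = (\<lambda>_. \<zero>\<^bsub>quadratic_algebra V\<^esub>)} =
     koszul_diff V ` koszul_chains V (Suc n))"

section \<open>The algebra of the matrix \<open>R\<close>\<close>

text \<open>\<open>R \<lambda> \<alpha> \<beta> \<mu>\<close> is the entry with upper indices \<open>\<lambda>, \<alpha>\<close> and lower indices \<open>\<beta>, \<mu>\<close>. The generators
  \<open>x\<^sub>1\<close> and \<open>x\<^sub>2\<close> are the letters \<open>Inl \<lambda>\<close> and \<open>Inr \<alpha>\<close>.\<close>

type_synonym ('m, 'n) rmatrix = "'m \<Rightarrow> 'n \<Rightarrow> 'n \<Rightarrow> 'm \<Rightarrow> complex"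

definition relations :: "('m::finite, 'n::finite) rmatrix \<Rightarrow> ('m + 'n) tensor set" where
  "relations R = tensor.span (
     {tensor_word [Inl l, Inl m] - tensor_word [Inl m, Inl l] | l m. True} \<union>
     {tensor_word [Inr a, Inr b] - tensor_word [Inr b, Inr a] | a b. True} \<union>
     {tensor_word [Inl l, Inr a] -
        (\<Sum>b\<in>UNIV. \<Sum>m\<in>UNIV. tensor_scale (R l a b m) (tensor_word [Inr b, Inl m])) | l a. True})"

definition condition_C1 :: "('m::finite, 'n::finite) rmatrix \<Rightarrow> bool" where
  "condition_C1 R \<longleftrightarrow> (\<forall>l a c n.
     (\<Sum>b\<in>UNIV. \<Sum>m\<in>UNIV. cnj (R l a b m) * R m b c n) = (if l = n \<and> a = c then 1 else 0))"

definition condition_C2 :: "('m::finite, 'n::finite) rmatrix \<Rightarrow> bool" where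
  "condition_C2 R \<longleftrightarrow> (\<forall>l m a b c d.
     (\<Sum>r\<in>UNIV. R l a c r * R r b d m) = (\<Sum>r\<in>UNIV. R l b d r * R r a c m) \<and>
     (\<Sum>r\<in>UNIV. cnj (R l a c r) * cnj (R r b d m)) = (\<Sum>r\<in>UNIV. cnj (R l b d r) * cnj (R r a c m)) \<and>
     (\<Sum>r\<in>UNIV. cnj (R l a c r) * R r b d m) = (\<Sum>r\<in>UNIV. R l b d r * cnj (R r a c m)))"

definition condition_C3 :: "('m::finite, 'n::finite) rmatrix \<Rightarrow> bool" where
  "condition_C3 R \<longleftrightarrow> (\<forall>l m n r a b.
     (\<Sum>c\<in>UNIV. R l a c n * R m c b r) = (\<Sum>c\<in>UNIV. R m a c r * R l c b n) \<and>
     (\<Sum>c\<in>UNIV. cnj (R l a c n) * cnj (R m c b r)) = (\<Sum>c\<in>UNIV. cnj (R m a c r) * cnj (R l c b n)) \<and>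
     (\<Sum>c\<in>UNIV. R l a c n * cnj (R m c b r)) = (\<Sum>c\<in>UNIV. cnj (R m a c r) * R l c b n))"

end

theory Submission
  imports Defs
begin

text \<open>The relations say that \<open>x y\<close> equals the product of the two tensor factors of \<open>s (x \<otimes> y)\<close>, where \<open>s\<close> is the flip on
  each of the two blocks of generators and is given by the matrix \<open>R\<close> and its conjugate between them. Condition (C1)
  makes \<open>s\<close> an involution, and (C2) and (C3) give the Yang-Baxter equation, so the symmetric groups act on the tensor
  powers. In characteristic zero this identifies the algebra with the symmetric tensors, by means of the
  symmetrizer, and the dual of its Koszul dual with the antisymmetric tensors. The partial trace of \<open>s\<close>
  is the identity, as for the flip, so the traces of the symmetrizers, which are the dimensions of the homogeneous
  components, are the same as for a polynomial ring.

  Differentiation with respect to the generators yields a contracting homotopy of the Koszul complex, by the Euler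
  identity. With coefficients in a module \<open>M\<close> with a linear basis \<open>B\<close>, an induction on the degree gives a projective
  resolution of \<open>M\<close> whose terms vanish beyond the number of generators; this bounds the global dimension. On the
  complex dual to the resolution of the trivial module there is a similar homotopy, for which the Euler identity fails
  only on the constants in top degree; this computes the extensions by the algebra, and their nonvanishing in top
  degree shows that the bound on the global dimension is sharp.\<close>

section \<open>Complex vector spaces\<close>

text \<open>The argument runs on explicit normal forms: a class of the algebra is stored as its
  symmetric tensor \<open>rep\<close>, multiplication is concatenation followed by
  \<open>tsym\<close>, and a derivative deletes an outer letter and multiplies by the degree. The
  homotopies then act by explicit scalars. On chains of internal degree p with n antisymmetric
  letters the scalar is p + n, which vanishes only on constants in chain degree 0; on the dual
  complex it is N - n + p, with N the number of generators, which for n at most N vanishes only for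
  n = N and p = 0. With coefficients in M the homotopy inverts only the part of the differential
  that multiplies into the algebra; the other part preserves the internal degree, so the error has
  lower degree. Besides the braid relation two contractions of s enter, \<open>ptrace\<close> and
  \<open>dual_inverse\<close>; the latter comes from (C1) by the mixed part of (C2). Signs, duals
  and reversed words are handled by changing the braiding. Ext is defined by an unspecified
  resolution with elements in a prescribed type, whence the comparison theorem and the encoding of
  chains.\<close>

class cvec = ab_group_add +
  fixes cscale :: "complex \<Rightarrow> 'a \<Rightarrow> 'a" (infixr "*\<^sub>C" 75)
  assumes cscale_right_distrib: "c *\<^sub>C (x + y) = c *\<^sub>C x + c *\<^sub>C y"
    and cscale_left_distrib: "(c + d) *\<^sub>C x = c *\<^sub>C x + d *\<^sub>C x"
    and cscale_cscale: "c *\<^sub>C d *\<^sub>C x = (c * d) *\<^sub>C x"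
    and cscale_one [simp]: "1 *\<^sub>C x = x"

interpretation cvec: vector_space cscale
  by standard (simp_all add: cscale_right_distrib cscale_left_distrib cscale_cscale)

lemmas cscale_simps [simp] = cvec.scale_zero_left cvec.scale_zero_right cvec.scale_minus_left
  cvec.scale_minus_right

lemmas cscale_sum_right = cvec.scale_sum_right
lemmas cscale_sum_left = cvec.scale_sum_left

instantiation complex :: cvec
begin
definition "cscale_complex c x = c * (x :: complex)"
instance by standard (simp_all add: cscale_complex_def algebra_simps)
end

text \<open>Coefficients are taken in the complex numbers, in tensors, and in finitely supported
  families of tensors, the model of a tensor product with a based module. One class for all three
  lets the lemmas on the braid action be stated once.\<close>

instantiation poly_mapping :: (type, cvec) cvec
begin
lift_definition cscale_poly_mapping :: "complex \<Rightarrow> ('a \<Rightarrow>\<^sub>0 'b) \<Rightarrow> 'a \<Rightarrow>\<^sub>0 'b" is "\<lambda>c p k. c *\<^sub>C p k"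
  by (rule finite_subset [rotated], assumption) auto
instance
  by standard (transfer; simp add: cscale_right_distrib cscale_left_distrib cscale_cscale)+
end

lemma lookup_cscale: "Poly_Mapping.lookup (c *\<^sub>C p) k = c *\<^sub>C Poly_Mapping.lookup p k"
  by transfer simp

lemma delta_cscale_sum:
  fixes f :: "'a::finite \<Rightarrow> 'w::cvec"
  shows "(\<Sum>x\<in>UNIV. (if x = a then 1 else 0) *\<^sub>C f x) = f a"
    "(\<Sum>x\<in>UNIV. (if a = x then 1 else 0) *\<^sub>C f x) = f a"
proof -
  have "(\<Sum>x\<in>UNIV. (if x = a then 1 else 0) *\<^sub>C f x) = (\<Sum>x\<in>UNIV. if x = a then f x else 0)"
    by (intro sum.cong) auto
  then show "(\<Sum>x\<in>UNIV. (if x = a then 1 else 0) *\<^sub>C f x) = f a" by simp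
  then show "(\<Sum>x\<in>UNIV. (if a = x then 1 else 0) *\<^sub>C f x) = f a" by (simp add: eq_commute)
qed

section \<open>Involutive braidings\<close>

lemma length_Suc_SucE:
  assumes "length w = Suc (Suc n)"
  obtains j k v where "w = j # k # v" "length v = n"
  using assms by (cases w; cases "tl w") auto

text \<open>\<open>s a b j k\<close> is the coefficient of \<open>e\<^sub>j \<otimes> e\<^sub>k\<close> in the image of \<open>e\<^sub>a \<otimes> e\<^sub>b\<close>. Tensors are given by their
  coefficient functions on words, with values in an arbitrary vector space.\<close>

type_synonym 'i braid = "'i \<Rightarrow> 'i \<Rightarrow> 'i \<Rightarrow> 'i \<Rightarrow> complex"

text \<open>On coefficient functions the matrix is summed over its source indices, so this is the
  image of a tensor under s on the first two factors. Words of length below 2 are left alone, which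
  spares side conditions on lengths.\<close>

definition act0 :: "'i::finite braid \<Rightarrow> ('i list \<Rightarrow> 'w::cvec) \<Rightarrow> 'i list \<Rightarrow> 'w" where
  "act0 s f w = (case w of j # k # v \<Rightarrow> (\<Sum>a\<in>UNIV. \<Sum>b\<in>UNIV. s a b j k *\<^sub>C f (a # b # v)) | _ \<Rightarrow> f w)"

lemma act0_simps [simp]:
  "act0 s f [] = f []" "act0 s f [j] = f [j]"
  "act0 s f (j # k # v) = (\<Sum>a\<in>UNIV. \<Sum>b\<in>UNIV. s a b j k *\<^sub>C f (a # b # v))"
  by (simp_all add: act0_def)

primrec actn :: "'i::finite braid \<Rightarrow> nat \<Rightarrow> ('i list \<Rightarrow> 'w::cvec) \<Rightarrow> 'i list \<Rightarrow> 'w" where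
  "actn s 0 f w = act0 s f w"
| "actn s (Suc r) f w = (case w of [] \<Rightarrow> f [] | j # v \<Rightarrow> actn s r (\<lambda>v. f (j # v)) v)"

text \<open>Invariance under all adjacent transpositions, arranged so that tails inherit it by
  definition; \<open>symt_iff\<close> is the form without recursion. With the negated braiding it
  expresses antisymmetry.\<close>

primrec symt :: "'i::finite braid \<Rightarrow> nat \<Rightarrow> ('i list \<Rightarrow> 'w::cvec) \<Rightarrow> bool" where
  "symt s 0 f \<longleftrightarrow> True"
| "symt s (Suc n) f \<longleftrightarrow>
     (\<forall>w. length w = Suc n \<longrightarrow> act0 s f w = f w) \<and> (\<forall>i. symt s n (\<lambda>v. f (i # v)))"

text \<open>\<open>ins\<close> moves the first letter to all possible positions and adds up the results. So \<open>symz\<close> is the average over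
  the symmetric group, the projection onto the functions satisfying \<open>symt\<close>.\<close>

fun ins :: "'i::finite braid \<Rightarrow> ('i list \<Rightarrow> 'w::cvec) \<Rightarrow> 'i list \<Rightarrow> 'w" where
  "ins s f [] = 0"
| "ins s f (j # w) = f (j # w) + ins s (\<lambda>v. act0 s f (j # v)) w"

primrec symz :: "'i::finite braid \<Rightarrow> nat \<Rightarrow> ('i list \<Rightarrow> 'w::cvec) \<Rightarrow> 'i list \<Rightarrow> 'w" where
  "symz s 0 f w = f w"
| "symz s (Suc n) f w = inverse (of_nat (Suc n)) *\<^sub>C
     ins s (\<lambda>v. case v of [] \<Rightarrow> 0 | i # v \<Rightarrow> symz s n (\<lambda>v. f (i # v)) v) w"

section \<open>Dependence on words of one length, and linearity\<close>

lemma act0_cong: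
  assumes "\<And>v. length v = length w \<Longrightarrow> f v = g v"
  shows "act0 s f w = act0 s g w"
  unfolding act0_def by (auto split: list.splits intro!: sum.cong assms arg_cong2 [where f = cscale])

lemma ins_cong:
  assumes "\<And>v. length v = length w \<Longrightarrow> f v = g v"
  shows "ins s f w = ins s g w"
  using assms
proof (induction w arbitrary: f g)
  case (Cons j w)
  have "ins s (\<lambda>v. act0 s f (j # v)) w = ins s (\<lambda>v. act0 s g (j # v)) w"
    by (rule Cons.IH) (rule act0_cong, simp add: Cons.prems)
  then show ?case by (simp add: Cons.prems)
qed simp

lemma symt_cong:
  assumes "\<And>v. length v = n \<Longrightarrow> f v = g v"
  shows "symt s n f \<longleftrightarrow> symt s n g"
  using assms
proof (induction n arbitrary: f g)
  case (Suc n)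
  have "symt s n (\<lambda>v. f (i # v)) = symt s n (\<lambda>v. g (i # v))" for i
    by (rule Suc.IH) (simp add: Suc.prems)
  moreover have "act0 s f w = act0 s g w" if "length w = Suc n" for w
    by (rule act0_cong) (simp add: Suc.prems that)
  ultimately show ?case by (auto simp: Suc.prems)
qed simp

lemma symz_cong:
  assumes "\<And>v. length v = n \<Longrightarrow> f v = g v" and "length w = n"
  shows "symz s n f w = symz s n g w"
  using assms
proof (induction n arbitrary: f g w)
  case (Suc n)
  have "ins s (\<lambda>v. case v of [] \<Rightarrow> 0 | i # v \<Rightarrow> symz s n (\<lambda>v. f (i # v)) v) w =
      ins s (\<lambda>v. case v of [] \<Rightarrow> 0 | i # v \<Rightarrow> symz s n (\<lambda>v. g (i # v)) v) w"
    by (rule ins_cong) (auto split: list.splits intro!: Suc simp: Suc.prems)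
  then show ?case by simp
qed simp

lemma act0_add: "act0 s (\<lambda>v. f v + g v) w = act0 s f w + act0 s g w"
  unfolding act0_def by (auto split: list.splits simp: cscale_right_distrib sum.distrib)

lemma act0_scale: "act0 s (\<lambda>v. c *\<^sub>C f v) w = c *\<^sub>C act0 s f w"
  unfolding act0_def by (auto split: list.splits simp: cscale_sum_right cscale_cscale mult.commute)

lemma act0_zero [simp]: "act0 s (\<lambda>v. 0) w = 0"
  unfolding act0_def by (auto split: list.splits)

lemma ins_add: "ins s (\<lambda>v. f v + g v) w = ins s f w + ins s g w"
  by (induction w arbitrary: f g) (simp_all add: act0_add)

lemma ins_scale: "ins s (\<lambda>v. c *\<^sub>C f v) w = c *\<^sub>C ins s f w"
  by (induction w arbitrary: f) (simp_all add: act0_scale cscale_right_distrib)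

lemma ins_zero [simp]: "ins s (\<lambda>v. 0) w = 0"
  by (induction w) simp_all

lemma ins_sum: "ins s (\<lambda>v. \<Sum>x\<in>Y. f x v) w = (\<Sum>x\<in>Y. ins s (f x) w)"
  by (induction Y rule: infinite_finite_induct) (simp_all add: ins_add)

lemma actn_scale: "actn s r (\<lambda>v. c *\<^sub>C f v) w = c *\<^sub>C actn s r f w"
  by (induction r arbitrary: w f) (auto simp: act0_scale split: list.splits)

lemma symt_add: "symt s n f \<Longrightarrow> symt s n g \<Longrightarrow> symt s n (\<lambda>v. f v + g v)"
  by (induction n arbitrary: f g) (simp_all add: act0_add)

lemma symt_scale: "symt s n f \<Longrightarrow> symt s n (\<lambda>v. c *\<^sub>C f v)"
  by (induction n arbitrary: f) (simp_all add: act0_scale)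

lemma symt_zero [simp]: "symt s n (\<lambda>v. 0)"
  by (induction n) simp_all

lemma symt_sum: "(\<And>x. x \<in> Y \<Longrightarrow> symt s n (f x)) \<Longrightarrow> symt s n (\<lambda>v. \<Sum>x\<in>Y. f x v)"
  by (induction Y rule: infinite_finite_induct) (simp_all add: symt_add)

lemma symz_add: "symz s n (\<lambda>v. f v + g v) w = symz s n f w + symz s n g w"
proof (induction n arbitrary: f g w)
  case (Suc n)
  have *: "(case v of [] \<Rightarrow> 0 | i # v \<Rightarrow> symz s n (\<lambda>v. f (i # v) + g (i # v)) v) =
      (case v of [] \<Rightarrow> 0 | i # v \<Rightarrow> symz s n (\<lambda>v. f (i # v)) v) +
      (case v of [] \<Rightarrow> 0 | i # v \<Rightarrow> symz s n (\<lambda>v. g (i # v)) v)" for v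
    by (cases v) (simp_all add: Suc)
  show ?case by (simp add: * ins_add cscale_right_distrib)
qed simp

lemma symz_scale: "symz s n (\<lambda>v. c *\<^sub>C f v) w = c *\<^sub>C symz s n f w"
proof (induction n arbitrary: f w)
  case (Suc n)
  have *: "(case v of [] \<Rightarrow> 0 | i # v \<Rightarrow> symz s n (\<lambda>v. c *\<^sub>C f (i # v)) v) =
      c *\<^sub>C (case v of [] \<Rightarrow> 0 | i # v \<Rightarrow> symz s n (\<lambda>v. f (i # v)) v)" for v
    by (cases v) (simp_all add: Suc)
  show ?case by (simp add: * ins_scale cscale_cscale mult.commute)
qed simp

lemma symz_zero [simp]: "symz s n (\<lambda>v. 0) w = 0"
  using symz_scale [of s n 0 "\<lambda>_. 0" w] by simp

lemma symz_sum: "symz s n (\<lambda>v. \<Sum>x\<in>Y. f x v) w = (\<Sum>x\<in>Y. symz s n (f x) w)"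
  by (induction Y rule: infinite_finite_induct) (simp_all add: symz_add)

text \<open>Each of the n insertions leaves a symmetric function unchanged.\<close>

lemma ins_symt:
  assumes "symt s n f" and "length w = n"
  shows "ins s f w = of_nat n *\<^sub>C f w"
  using assms
proof (induction n arbitrary: f w)
  case (Suc n)
  obtain j v where w: "w = j # v" "length v = n" using Suc.prems by (cases w) auto
  have "ins s (\<lambda>v. act0 s f (j # v)) v = ins s (\<lambda>v. f (j # v)) v"
    by (rule ins_cong) (use Suc.prems w in auto)
  also have "\<dots> = of_nat n *\<^sub>C f (j # v)"
    by (rule Suc.IH) (use Suc.prems w in auto)
  finally show ?case by (simp add: w cscale_left_distrib)
qed simp

lemma symt_Cons: "symt s (Suc n) f \<Longrightarrow> symt s n (\<lambda>v. f (i # v))"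
  by simp

lemma symt_act0: "symt s n f \<Longrightarrow> length w = n \<Longrightarrow> act0 s f w = f w"
  by (cases n) auto

lemma symz_symt:
  assumes "symt s n f" and "length w = n"
  shows "symz s n f w = f w"
  using assms
proof (induction n arbitrary: f w)
  case (Suc n)
  have "ins s (\<lambda>v. case v of [] \<Rightarrow> 0 | i # v \<Rightarrow> symz s n (\<lambda>v. f (i # v)) v) w = ins s f w"
    by (rule ins_cong) (auto split: list.splits intro!: Suc simp: Suc.prems symt_Cons [OF Suc.prems(1)])
  then show ?case by (simp add: ins_symt [OF Suc.prems] cscale_cscale del: of_nat_Suc)
qed simp

text \<open>In operator form: s is an involution, and s1 s2 s1 = s2 s1 s2 on words of three letters,
  with source indices x y z and target indices j k l. These are the relations of the symmetric
  groups.\<close>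

locale braiding =
  fixes s :: "'i::finite braid"
  assumes invol: "(\<Sum>a\<in>UNIV. \<Sum>b\<in>UNIV. s x y a b * s a b j k) = (if x = j \<and> y = k then 1 else 0)"
    and yang_baxter: "(\<Sum>a\<in>UNIV. \<Sum>b\<in>UNIV. \<Sum>c\<in>UNIV. s a b j k * s c z b l * s x y a c) =
      (\<Sum>a\<in>UNIV. \<Sum>b\<in>UNIV. \<Sum>d\<in>UNIV. s a b k l * s x d j a * s y z d b)"
begin

lemma invol_sum:
  fixes F :: "'i \<Rightarrow> 'i \<Rightarrow> 'w::cvec"
  shows "(\<Sum>a\<in>UNIV. \<Sum>b\<in>UNIV. s a b j k *\<^sub>C (\<Sum>x\<in>UNIV. \<Sum>y\<in>UNIV. s x y a b *\<^sub>C F x y)) = F j k"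
proof -
  have "(\<Sum>a\<in>UNIV. \<Sum>b\<in>UNIV. s a b j k *\<^sub>C (\<Sum>x\<in>UNIV. \<Sum>y\<in>UNIV. s x y a b *\<^sub>C F x y)) =
      (\<Sum>(a, b, x, y)\<in>UNIV. (s x y a b * s a b j k) *\<^sub>C F x y)"
    by (simp add: cscale_sum_right cscale_cscale sum.cartesian_product split_def mult.commute
        flip: UNIV_Times_UNIV)
  also have "\<dots> = (\<Sum>(x, y, a, b)\<in>UNIV. (s x y a b * s a b j k) *\<^sub>C F x y)"
    by (rule sum.reindex_bij_witness [where i = "\<lambda>(x, y, a, b). (a, b, x, y)"
          and j = "\<lambda>(a, b, x, y). (x, y, a, b)"]) auto
  also have "\<dots> = (\<Sum>x\<in>UNIV. \<Sum>y\<in>UNIV. (\<Sum>a\<in>UNIV. \<Sum>b\<in>UNIV. s x y a b * s a b j k) *\<^sub>C F x y)"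
    by (simp add: cscale_sum_left cscale_cscale sum.cartesian_product split_def flip: UNIV_Times_UNIV)
  also have "\<dots> = (\<Sum>x\<in>UNIV. \<Sum>y\<in>UNIV. if x = j then if y = k then F x y else 0 else 0)"
    unfolding invol by (intro sum.cong) auto
  also have "\<dots> = (\<Sum>x\<in>UNIV. if x = j then F x k else 0)"
    by (intro sum.cong) auto
  finally show ?thesis by simp
qed

lemma yang_baxter_sum:
  fixes F :: "'i \<Rightarrow> 'i \<Rightarrow> 'i \<Rightarrow> 'w::cvec"
  shows "(\<Sum>a\<in>UNIV. \<Sum>b\<in>UNIV. s a b j k *\<^sub>C (\<Sum>c\<in>UNIV. \<Sum>d\<in>UNIV. s c d b l *\<^sub>C
      (\<Sum>x\<in>UNIV. \<Sum>y\<in>UNIV. s x y a c *\<^sub>C F x y d))) =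
    (\<Sum>a\<in>UNIV. \<Sum>b\<in>UNIV. s a b k l *\<^sub>C (\<Sum>x\<in>UNIV. \<Sum>d\<in>UNIV. s x d j a *\<^sub>C
      (\<Sum>y\<in>UNIV. \<Sum>z\<in>UNIV. s y z d b *\<^sub>C F x y z)))"
proof -
  have "(\<Sum>a\<in>UNIV. \<Sum>b\<in>UNIV. s a b j k *\<^sub>C (\<Sum>c\<in>UNIV. \<Sum>d\<in>UNIV. s c d b l *\<^sub>C
      (\<Sum>x\<in>UNIV. \<Sum>y\<in>UNIV. s x y a c *\<^sub>C F x y d))) =
      (\<Sum>(a, b, c, z, x, y)\<in>UNIV. (s a b j k * s c z b l * s x y a c) *\<^sub>C F x y z)"
    by (simp add: cscale_sum_right cscale_cscale sum.cartesian_product split_def mult.assoc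
        flip: UNIV_Times_UNIV)
  also have "\<dots> = (\<Sum>(x, y, z, a, b, c)\<in>UNIV. (s a b j k * s c z b l * s x y a c) *\<^sub>C F x y z)"
    by (rule sum.reindex_bij_witness [where i = "\<lambda>(x, y, z, a, b, c). (a, b, c, z, x, y)"
          and j = "\<lambda>(a, b, c, z, x, y). (x, y, z, a, b, c)"]) auto
  also have "\<dots> = (\<Sum>x\<in>UNIV. \<Sum>y\<in>UNIV. \<Sum>z\<in>UNIV.
      (\<Sum>a\<in>UNIV. \<Sum>b\<in>UNIV. \<Sum>c\<in>UNIV. s a b j k * s c z b l * s x y a c) *\<^sub>C F x y z)"
    by (simp add: cscale_sum_left cscale_cscale sum.cartesian_product split_def flip: UNIV_Times_UNIV)
  also have "\<dots> = (\<Sum>x\<in>UNIV. \<Sum>y\<in>UNIV. \<Sum>z\<in>UNIV.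
      (\<Sum>a\<in>UNIV. \<Sum>b\<in>UNIV. \<Sum>d\<in>UNIV. s a b k l * s x d j a * s y z d b) *\<^sub>C F x y z)"
    by (simp only: yang_baxter)
  also have "\<dots> = (\<Sum>(x, y, z, a, b, d)\<in>UNIV. (s a b k l * s x d j a * s y z d b) *\<^sub>C F x y z)"
    by (simp add: cscale_sum_left cscale_cscale sum.cartesian_product split_def flip: UNIV_Times_UNIV)
  also have "\<dots> = (\<Sum>(a, b, x, d, y, z)\<in>UNIV. (s a b k l * s x d j a * s y z d b) *\<^sub>C F x y z)"
    by (rule sum.reindex_bij_witness [where j = "\<lambda>(x, y, z, a, b, d). (a, b, x, d, y, z)"
          and i = "\<lambda>(a, b, x, d, y, z). (x, y, z, a, b, d)"]) auto
  also have "\<dots> = (\<Sum>a\<in>UNIV. \<Sum>b\<in>UNIV. s a b k l *\<^sub>C (\<Sum>x\<in>UNIV. \<Sum>d\<in>UNIV. s x d j a *\<^sub>C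
      (\<Sum>y\<in>UNIV. \<Sum>z\<in>UNIV. s y z d b *\<^sub>C F x y z)))"
    by (simp add: cscale_sum_right cscale_cscale sum.cartesian_product split_def mult.assoc
        flip: UNIV_Times_UNIV)
  finally show ?thesis .
qed

lemma act0_act0: "act0 s (act0 s f) w = f w"
proof (cases w)
  case (Cons j v)
  then show ?thesis by (cases v) (simp_all add: invol_sum)
qed simp

lemma act0_act0_fun: "act0 s (act0 s f) = f"
  by (rule ext) (rule act0_act0)

lemma act0_braid:
  "act0 s (actn s 1 (act0 s f)) (j # k # l # v) = actn s 1 (act0 s (actn s 1 f)) (j # k # l # v)"
  using yang_baxter_sum [of j k l "\<lambda>x y z. f (x # y # z # v)"] by simp

text \<open>Write s1, s2 for the transpositions of the first two adjacent pairs. In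
  \<open>ins s f\<close> the summands f and s1 f are exchanged by s1. The remaining ones come from
  s2 s1 f, and s1 s2 s1 f = s2 s1 s2 f = s2 s1 f because f is symmetric in its tail. Invariance at
  the later positions is the induction hypothesis, applied to the tails.\<close>

lemma symt_ins:
  assumes "\<And>i. symt s n (\<lambda>v. f (i # v))"
  shows "symt s (Suc n) (ins s f)"
  using assms
proof (induction n arbitrary: f)
  case 0
  then show ?case by (auto simp: length_Suc_conv)
next
  case (Suc n)
  have tails: "symt s (Suc n) (\<lambda>v. ins s f (j # v))" for j
  proof -
    have "symt s (Suc n) (ins s (\<lambda>v. act0 s f (j # v)))"
    proof (rule Suc.IH)
      fix i
      have "symt s n (\<lambda>v. f (a # b # v))" for a b
        using symt_Cons [OF Suc.prems [of a]] .
      then show "symt s n (\<lambda>v. act0 s f (j # i # v))"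
        by (auto intro!: symt_sum symt_scale)
    qed
    from symt_add [OF Suc.prems [of j] this] show ?thesis by (simp only: ins.simps)
  qed
  have "act0 s (ins s f) w = ins s f w" if len2: "length w = Suc (Suc n)" for w
  proof -
    obtain j k v where w: "w = j # k # v" and len: "length v = n"
      using len2 by (rule length_Suc_SucE)
    define g where "g a b = (\<lambda>v. act0 s (\<lambda>v. act0 s f (a # v)) (b # v))" for a b
    have ins2: "ins s f (a # b # v) = f (a # b # v) + act0 s f (a # b # v) + ins s (g a b) v" for a b
      by (simp only: g_def ins.simps add.assoc)
    have "ins s (\<lambda>v. \<Sum>a\<in>UNIV. \<Sum>b\<in>UNIV. s a b j k *\<^sub>C g a b v) v = ins s (g j k) v"
    proof (cases v)
      case (Cons l v0)
      show ?thesis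
      proof (rule ins_cong)
        fix u :: "'i list" assume "length u = length v"
        then obtain l' u' where u: "u = l' # u'" and len': "length u' = length v0" using Cons
          by (cases u) auto
        \<comment> \<open>The symmetry of f in its tail, used to drop the innermost s2 on the right
          side of the braid relation.\<close>
        have sy: "(\<Sum>y\<in>UNIV. \<Sum>z\<in>UNIV. s y z d b *\<^sub>C f (x # y # z # u')) = f (x # d # b # u')" for x d b
          using symt_act0 [OF Suc.prems [of x], of "d # b # u'"] len len' Cons by (simp only: act0_simps list.size add_Suc_right add_0_right)
        show "(\<Sum>a\<in>UNIV. \<Sum>b\<in>UNIV. s a b j k *\<^sub>C g a b u) = g j k u"
          using yang_baxter_sum [of j k l' "\<lambda>x y z. f (x # y # z # u')"] by (simp only: g_def u sy act0_simps)
      qed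
    qed simp
    then have "(\<Sum>a\<in>UNIV. \<Sum>b\<in>UNIV. s a b j k *\<^sub>C ins s (g a b) v) = ins s (g j k) v"
      by (simp only: ins_sum ins_scale)
    then have "act0 s (ins s f) w = act0 s f w + act0 s (act0 s f) w + ins s (g j k) v"
      unfolding w act0_simps(3) [of s "ins s f"] ins2
      by (simp only: cscale_right_distrib sum.distrib act0_simps)
    then show ?thesis unfolding w ins2 act0_act0 by (simp only: add.commute)
  qed
  then show ?case using tails by simp
qed

lemma symt_symz: "symt s n (symz s n f)"
proof (induction n arbitrary: f)
  case (Suc n)
  have "symt s (Suc n) (ins s (\<lambda>v. case v of [] \<Rightarrow> 0 | i # v \<Rightarrow> symz s n (\<lambda>v. f (i # v)) v))"
    by (rule symt_ins) (simp add: Suc)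
  then show ?case unfolding symz.simps by (rule symt_scale)
qed simp

text \<open>Insertion of the second letter into the tail, followed by insertion of the first: a sum
  over coset representatives for the permutations of the last n letters among those of n + 2
  letters. It isolates what is needed to see that symmetrizing forgets a transposition of the first
  two letters.\<close>

definition ins2 :: "('i list \<Rightarrow> 'w::cvec) \<Rightarrow> 'i list \<Rightarrow> 'w" where
  "ins2 f = ins s (\<lambda>v. case v of [] \<Rightarrow> 0 | i # v \<Rightarrow> ins s (\<lambda>v. f (i # v)) v)"

lemma ins2_cong: "(\<And>v. length v = length w \<Longrightarrow> f v = g v) \<Longrightarrow> ins2 f w = ins2 g w"
  unfolding ins2_def by (rule ins_cong) (auto split: list.splits intro: ins_cong)

text \<open>The summands are sorted by where the two moved letters end. In the first bracket both
  stay in the first two places; in the second, one of them is in the first place and the other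
  beyond the second; in the last term neither is in the first place, and the form of
  \<open>ins2\<close> recurs on a shorter word.\<close>

lemma ins2_rec:
  "ins2 f (j # k # v) = (f (j # k # v) + act0 s f (j # k # v)) +
     (ins s (\<lambda>v. actn s 1 f (j # k # v)) v + ins s (\<lambda>v. actn s 1 (act0 s f) (j # k # v)) v) +
     ins2 (\<lambda>v. act0 s (actn s 1 f) (j # v)) (k # v)"
proof -
  define F where "F = (\<lambda>v. case v of [] \<Rightarrow> 0 | i # v \<Rightarrow> ins s (\<lambda>v. f (i # v)) v)"
  have F: "F (i # k # v) = f (i # k # v) + ins s (\<lambda>v. actn s 1 f (i # k # v)) v" for i k v
    by (simp add: F_def)
  have aF: "act0 s F (j # k # v) = act0 s f (j # k # v) +
      ins s (\<lambda>v. act0 s (actn s 1 f) (j # k # v)) v" for k v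
    by (simp only: act0_simps F cscale_right_distrib sum.distrib ins_sum ins_scale)
  have "ins2 f (j # k # v) = F (j # k # v) + ins s (\<lambda>v. act0 s F (j # v)) (k # v)"
    unfolding ins2_def F_def by (subst ins.simps(2)) (rule refl)
  also have "ins s (\<lambda>v. act0 s F (j # v)) (k # v) = ins s (\<lambda>v. act0 s f (j # v) +
      (case v of [] \<Rightarrow> 0 | k # v \<Rightarrow> ins s (\<lambda>v. act0 s (actn s 1 f) (j # k # v)) v)) (k # v)"
    by (rule ins_cong) (auto simp: aF simp del: act0_simps(3) split: list.splits)
  also have "\<dots> = ins s (\<lambda>v. act0 s f (j # v)) (k # v) + ins2 (\<lambda>v. act0 s (actn s 1 f) (j # v)) (k # v)"
    unfolding ins_add ins2_def by (rule refl)
  also have "ins s (\<lambda>v. act0 s f (j # v)) (k # v) =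
      act0 s f (j # k # v) + ins s (\<lambda>v. actn s 1 (act0 s f) (j # k # v)) v"
    by (simp del: act0_simps)
  finally show ?thesis unfolding F by (simp only: add_ac)
qed

lemma ins2_single [simp]: "ins2 f [k] = 0" "ins2 f [] = 0"
  by (simp_all add: ins2_def)

text \<open>Replacing f by s1 f permutes the terms inside each bracket of \<open>ins2_rec\<close>,
  as s1 is an involution. In the last term the braid relation turns the transposition of the first
  pair into that of the next pair, and induction applies.\<close>

lemma ins2_act0: "ins2 (act0 s f) w = ins2 f w"
proof (induction w arbitrary: f)
  case (Cons j w)
  show ?case
  proof (cases w)
    case w: (Cons k v)
    have "ins2 (\<lambda>v. act0 s (actn s 1 (act0 s f)) (j # v)) w = ins2 (\<lambda>v. act0 s (actn s 1 f) (j # v)) w"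
    proof (cases v)
      case (Cons l v0)
      have "ins2 (\<lambda>v. act0 s (actn s 1 (act0 s f)) (j # v)) w =
          ins2 (act0 s (\<lambda>v. act0 s (actn s 1 f) (j # v))) w"
      proof (rule ins2_cong)
        fix u :: "'i list" assume "length u = length w"
        then obtain k' l' u' where "u = k' # l' # u'" using w Cons by (auto simp: length_Suc_conv)
        then show "act0 s (actn s 1 (act0 s f)) (j # u) = act0 s (\<lambda>v. act0 s (actn s 1 f) (j # v)) u"
          using act0_braid [of f j k' l' u'] by simp
      qed
      then show ?thesis using Cons.IH by simp
    qed (simp add: w)
    then show ?thesis
      unfolding w ins2_rec by (simp only: act0_act0 act0_act0_fun add_ac)
  qed simp
qed simp

lemma symz_Suc_Suc:
  assumes "length w = Suc (Suc n)"
  shows "symz s (Suc (Suc n)) f w = (inverse (of_nat (Suc (Suc n))) * inverse (of_nat (Suc n))) *\<^sub>C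
    ins2 (\<lambda>v. case v of i # j # v \<Rightarrow> symz s n (\<lambda>v. f (i # j # v)) v | _ \<Rightarrow> 0) w"
proof -
  have *: "symz s (Suc (Suc n)) f w = inverse (of_nat (Suc (Suc n))) *\<^sub>C
     ins s (\<lambda>v. case v of [] \<Rightarrow> 0 | i # v \<Rightarrow> symz s (Suc n) (\<lambda>v. f (i # v)) v) w"
    by (simp only: symz.simps)
  have "ins s (\<lambda>v. case v of [] \<Rightarrow> 0 | i # v \<Rightarrow> symz s (Suc n) (\<lambda>v. f (i # v)) v) w =
      ins s (\<lambda>v. inverse (of_nat (Suc n)) *\<^sub>C (case v of [] \<Rightarrow> 0 | i # v \<Rightarrow>
        ins s (\<lambda>v. case i # v of i # j # v \<Rightarrow> symz s n (\<lambda>v. f (i # j # v)) v | _ \<Rightarrow> 0) v)) w"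
    by (rule ins_cong) (use assms in \<open>auto simp del: of_nat_Suc intro!: arg_cong [where f = "\<lambda>f. ins s f _"]
        arg_cong2 [where f = cscale] split: list.splits\<close>)
  then show ?thesis
    unfolding * ins2_def by (simp only: ins_scale cscale_cscale)
qed

text \<open>For r = 0 this is the invariance of \<open>ins2\<close>; for larger r the transposition
  acts inside the tail and is absorbed by the symmetrizer of one degree less. The bound on r says
  that the letters number r and r + 1, counted from 0, exist.\<close>

lemma symz_actn:
  assumes "Suc r < n" and "length w = n"
  shows "symz s n (actn s r f) w = symz s n f w"
  using assms
proof (induction r arbitrary: n f w)
  case 0
  then have "n = Suc (Suc (n - 2))" by simp
  then obtain m where n: "n = Suc (Suc m)" by blast
  let ?G = "\<lambda>f v. case v of i # j # v \<Rightarrow> symz s m (\<lambda>v. f (i # j # v)) v | _ \<Rightarrow> 0"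
  have "ins2 (?G (act0 s f)) w = ins2 (act0 s (?G f)) w"
  proof (rule ins2_cong)
    fix v :: "'i list" assume "length v = length w"
    then have "length v = Suc (Suc m)" using n 0 by simp
    then obtain i j u where v: "v = i # j # u" by (rule length_Suc_SucE)
    show "?G (act0 s f) v = act0 s (?G f) v" unfolding v by (simp add: symz_sum symz_scale)
  qed
  then have "ins2 (?G (act0 s f)) w = ins2 (?G f) w"
    by (simp only: ins2_act0)
  moreover have "actn s 0 f = act0 s f" by (rule ext) simp
  moreover have "length w = Suc (Suc m)" using 0 n by simp
  ultimately show ?case unfolding n by (simp only: symz_Suc_Suc)
next
  case (Suc r)
  then obtain m where n: "n = Suc m" by (cases n) auto
  have "ins s (\<lambda>v. case v of [] \<Rightarrow> 0 | i # v \<Rightarrow> symz s m (\<lambda>v. actn s (Suc r) f (i # v)) v) w =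
      ins s (\<lambda>v. case v of [] \<Rightarrow> 0 | i # v \<Rightarrow> symz s m (\<lambda>v. f (i # v)) v) w"
  proof (rule ins_cong)
    fix v :: "'i list" assume v: "length v = length w"
    have "symz s m (\<lambda>v. actn s (Suc r) f (i # v)) u = symz s m (\<lambda>v. f (i # v)) u" if "length u = m" for i u
    proof -
      have "Suc r < m" using Suc.prems(1) n by simp
      from Suc.IH [OF this that, of "\<lambda>v. f (i # v)"] show ?thesis
        by (simp only: actn.simps list.case)
    qed
    then show "(case v of [] \<Rightarrow> 0 | i # v \<Rightarrow> symz s m (\<lambda>v. actn s (Suc r) f (i # v)) v) =
        (case v of [] \<Rightarrow> 0 | i # v \<Rightarrow> symz s m (\<lambda>v. f (i # v)) v)"
      using v Suc.prems(2) n by (cases v) (simp_all only: list.case list.size add_Suc_right add_0_right nat.inject)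
  qed
  then show ?case unfolding n symz.simps by (rule arg_cong)
qed

end

section \<open>Transformations of braidings\<close>

text \<open>\<open>neg_braid\<close> turns symmetric into antisymmetric tensors,
  \<open>transp_braid\<close> passes to the dual space, and \<open>mirror_braid\<close> reads words
  backwards. Each preserves the axioms of a braiding.\<close>

definition neg_braid :: "'i braid \<Rightarrow> 'i braid" where "neg_braid s = (\<lambda>a b j k. - s a b j k)"
definition transp_braid :: "'i braid \<Rightarrow> 'i braid" where "transp_braid s = (\<lambda>a b j k. s j k a b)"
definition mirror_braid :: "'i braid \<Rightarrow> 'i braid" where "mirror_braid s = (\<lambda>a b j k. s b a k j)"

lemma sum_perm3:
  fixes f :: "'a::finite \<Rightarrow> 'b::finite \<Rightarrow> 'c::finite \<Rightarrow> 'd::comm_monoid_add"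
  shows "(\<Sum>a\<in>UNIV. \<Sum>b\<in>UNIV. \<Sum>c\<in>UNIV. f a b c) = (\<Sum>a\<in>UNIV. \<Sum>c\<in>UNIV. \<Sum>b\<in>UNIV. f a b c)"
    and "(\<Sum>a\<in>UNIV. \<Sum>b\<in>UNIV. \<Sum>c\<in>UNIV. f a b c) = (\<Sum>b\<in>UNIV. \<Sum>a\<in>UNIV. \<Sum>c\<in>UNIV. f a b c)"
    and "(\<Sum>a\<in>UNIV. \<Sum>b\<in>UNIV. \<Sum>c\<in>UNIV. f a b c) = (\<Sum>c\<in>UNIV. \<Sum>b\<in>UNIV. \<Sum>a\<in>UNIV. f a b c)"
proof -
  show 1: "(\<Sum>a\<in>UNIV. \<Sum>b\<in>UNIV. \<Sum>c\<in>UNIV. f a b c) = (\<Sum>a\<in>UNIV. \<Sum>c\<in>UNIV. \<Sum>b\<in>UNIV. f a b c)"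
    by (rule sum.cong [OF refl], rule sum.swap)
  show "(\<Sum>a\<in>UNIV. \<Sum>b\<in>UNIV. \<Sum>c\<in>UNIV. f a b c) = (\<Sum>b\<in>UNIV. \<Sum>a\<in>UNIV. \<Sum>c\<in>UNIV. f a b c)"
    by (rule sum.swap)
  have "(\<Sum>a\<in>UNIV. \<Sum>b\<in>UNIV. \<Sum>c\<in>UNIV. f a b c) = (\<Sum>c\<in>UNIV. \<Sum>a\<in>UNIV. \<Sum>b\<in>UNIV. f a b c)"
    unfolding 1 by (rule sum.swap)
  also have "\<dots> = (\<Sum>c\<in>UNIV. \<Sum>b\<in>UNIV. \<Sum>a\<in>UNIV. f a b c)"
    by (rule sum.cong [OF refl], rule sum.swap)
  finally show "(\<Sum>a\<in>UNIV. \<Sum>b\<in>UNIV. \<Sum>c\<in>UNIV. f a b c) = (\<Sum>c\<in>UNIV. \<Sum>b\<in>UNIV. \<Sum>a\<in>UNIV. f a b c)" .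
qed

context braiding
begin

lemma braiding_neg: "braiding (neg_braid s)"
  by standard (simp_all add: neg_braid_def invol yang_baxter sum_negf)

text \<open>Transposition reverses the order of composition, and both sides of the braid relation
  are palindromes.\<close>

lemma braiding_transp: "braiding (transp_braid s)"
proof
  fix x y z j k l :: 'i
  show "(\<Sum>a\<in>UNIV. \<Sum>b\<in>UNIV. transp_braid s x y a b * transp_braid s a b j k) = (if x = j \<and> y = k then 1 else 0)"
    using invol [of j k x y] by (simp add: transp_braid_def mult.commute eq_commute)
  have "(\<Sum>a\<in>UNIV. \<Sum>b\<in>UNIV. \<Sum>c\<in>UNIV. s j k a b * s b l c z * s a c x y) =
      (\<Sum>a\<in>UNIV. \<Sum>c\<in>UNIV. \<Sum>b\<in>UNIV. s j k a b * s b l c z * s a c x y)"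
    by (rule sum_perm3(1))
  also have "\<dots> = (\<Sum>a\<in>UNIV. \<Sum>b\<in>UNIV. \<Sum>c\<in>UNIV. s a b x y * s c l b z * s j k a c)"
    by (simp add: mult_ac)
  also have "\<dots> = (\<Sum>a\<in>UNIV. \<Sum>b\<in>UNIV. \<Sum>d\<in>UNIV. s a b y z * s j d x a * s k l d b)"
    by (rule yang_baxter)
  also have "\<dots> = (\<Sum>d\<in>UNIV. \<Sum>b\<in>UNIV. \<Sum>a\<in>UNIV. s a b y z * s j d x a * s k l d b)"
    by (rule sum_perm3(3))
  finally show "(\<Sum>a\<in>UNIV. \<Sum>b\<in>UNIV. \<Sum>c\<in>UNIV. transp_braid s a b j k * transp_braid s c z b l *
        transp_braid s x y a c) =
      (\<Sum>a\<in>UNIV. \<Sum>b\<in>UNIV. \<Sum>d\<in>UNIV. transp_braid s a b k l * transp_braid s x d j a * transp_braid s y z d b)"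
    by (simp add: transp_braid_def mult_ac)
qed

text \<open>Reading backwards exchanges the two sides of the braid relation.\<close>

lemma braiding_mirror: "braiding (mirror_braid s)"
proof
  fix x y z j k l :: 'i
  have "(\<Sum>a\<in>UNIV. \<Sum>b\<in>UNIV. s y x b a * s b a k j) = (\<Sum>b\<in>UNIV. \<Sum>a\<in>UNIV. s y x b a * s b a k j)"
    by (rule sum.swap)
  then show "(\<Sum>a\<in>UNIV. \<Sum>b\<in>UNIV. mirror_braid s x y a b * mirror_braid s a b j k) = (if x = j \<and> y = k then 1 else 0)"
    by (simp add: mirror_braid_def invol conj_commute)
  have "(\<Sum>a\<in>UNIV. \<Sum>b\<in>UNIV. \<Sum>c\<in>UNIV. s b a k j * s z c l b * s y x c a) =
      (\<Sum>b\<in>UNIV. \<Sum>a\<in>UNIV. \<Sum>c\<in>UNIV. s b a k j * s z c l b * s y x c a)"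
    by (rule sum_perm3(2))
  also have "\<dots> = (\<Sum>a\<in>UNIV. \<Sum>b\<in>UNIV. \<Sum>c\<in>UNIV. s a b l k * s c x b j * s z y a c)"
    by (rule yang_baxter [symmetric])
  also have "\<dots> = (\<Sum>b\<in>UNIV. \<Sum>a\<in>UNIV. \<Sum>c\<in>UNIV. s a b l k * s c x b j * s z y a c)"
    by (rule sum_perm3(2))
  finally show "(\<Sum>a\<in>UNIV. \<Sum>b\<in>UNIV. \<Sum>c\<in>UNIV. mirror_braid s a b j k * mirror_braid s c z b l *
        mirror_braid s x y a c) =
      (\<Sum>a\<in>UNIV. \<Sum>b\<in>UNIV. \<Sum>d\<in>UNIV. mirror_braid s a b k l * mirror_braid s x d j a * mirror_braid s y z d b)"
    by (simp add: mirror_braid_def mult_ac)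
qed

end

text \<open>All positions are treated alike here, as arguments at the right end of a word require:
  reversal and removal of the last letter.\<close>

lemma symt_iff:
  fixes s :: "'i::finite braid" and f :: "'i list \<Rightarrow> 'w::cvec"
  shows
  "symt s n f \<longleftrightarrow> (\<forall>u j k v. length u + length v + 2 = n \<longrightarrow>
     (\<Sum>a\<in>UNIV. \<Sum>b\<in>UNIV. s a b j k *\<^sub>C f (u @ a # b # v)) = f (u @ j # k # v))"
proof (induction n arbitrary: f)
  case (Suc n)
  show ?case (is "?l \<longleftrightarrow> ?r")
  proof
    assume l: ?l
    show ?r
    proof (intro allI impI)
      fix u v :: "'i list" and j k assume len: "length u + length v + 2 = Suc n"
      show "(\<Sum>a\<in>UNIV. \<Sum>b\<in>UNIV. s a b j k *\<^sub>C f (u @ a # b # v)) = f (u @ j # k # v)"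
      proof (cases u)
        case Nil
        then show ?thesis using l len by (simp flip: act0_simps(3))
      next
        case (Cons i u')
        have "symt s n (\<lambda>v. f (i # v))" using l by simp
        then show ?thesis using len unfolding Suc Cons by simp
      qed
    qed
  next
    assume r: ?r
    have "act0 s f w = f w" if "length w = Suc n" for w
    proof (cases w)
      case (Cons j w')
      then show ?thesis using r [rule_format, of "[]"] that by (cases w') simp_all
    qed simp
    moreover have "symt s n (\<lambda>v. f (i # v))" for i
      unfolding Suc using r [rule_format, of "i # _"] by simp
    ultimately show ?l by simp
  qed
qed simp

lemma symt_rev:
  fixes s :: "'i::finite braid" and f :: "'i list \<Rightarrow> 'w::cvec"
  assumes "symt s n f"
  shows "symt (mirror_braid s) n (\<lambda>w. f (rev w))"
  unfolding symt_iff
proof (intro allI impI)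
  fix u v :: "'i list" and j k assume "length u + length v + 2 = n"
  then have "(\<Sum>b\<in>UNIV. \<Sum>a\<in>UNIV. s b a k j *\<^sub>C f (rev v @ b # a # rev u)) = f (rev v @ k # j # rev u)"
    using assms [unfolded symt_iff, rule_format, of "rev v" "rev u" k j] by simp
  then show "(\<Sum>a\<in>UNIV. \<Sum>b\<in>UNIV. mirror_braid s a b j k *\<^sub>C f (rev (u @ a # b # v))) = f (rev (u @ j # k # v))"
    by (subst sum.swap) (simp add: mirror_braid_def)
qed

lemma symt_butlast:
  fixes s :: "'i::finite braid" and f :: "'i list \<Rightarrow> 'w::cvec"
  assumes "symt s (Suc n) f" and "length v = 1"
  shows "symt s n (\<lambda>w. f (w @ v))"
  unfolding symt_iff
proof (intro allI impI)
  fix u w :: "'i list" and j k assume "length u + length w + 2 = n"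
  then show "(\<Sum>a\<in>UNIV. \<Sum>b\<in>UNIV. s a b j k *\<^sub>C f ((u @ a # b # w) @ v)) = f ((u @ j # k # w) @ v)"
    using assms(2) assms(1) [unfolded symt_iff, rule_format, of u "w @ v" j k] by simp
qed

section \<open>The pairing of functions on words\<close>

definition words :: "nat \<Rightarrow> 'i list set" where "words n = {w. length w = n}"

lemma mem_words: "w \<in> words n \<longleftrightarrow> length w = n"
  by (simp add: words_def)

lemma finite_words [simp]: "finite (words n :: 'i::finite list set)"
  unfolding words_def using finite_lists_length_eq [of "UNIV :: 'i set" n] by simp

lemma words_0 [simp]: "words 0 = {[]}"
  by (auto simp: words_def)

lemma sum_words_Suc:
  "(\<Sum>w\<in>words (Suc n). f w) = (\<Sum>i\<in>UNIV. \<Sum>w\<in>words n. f ((i :: 'i::finite) # w))"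
proof -
  have "(\<Sum>w\<in>words (Suc n). f w) = (\<Sum>(i, w)\<in>UNIV \<times> words n. f (i # w))"
    by (rule sum.reindex_bij_witness [where i = "\<lambda>(i, w). i # w" and j = "\<lambda>w. (hd w, tl w)"])
      (auto simp: words_def length_Suc_conv)
  then show ?thesis by (simp add: sum.cartesian_product)
qed

text \<open>B will be the product of complex numbers and the product of tensors in either order, so
  that scalar and tensor valued pairings share the adjointness of s and its transpose.\<close>

locale pairing =
  fixes B :: "'w::cvec \<Rightarrow> 'v::cvec \<Rightarrow> 'u::cvec"
  assumes add_left: "B (x + y) z = B x z + B y z" and add_right: "B x (z + z') = B x z + B x z'"
    and scale_left: "B (c *\<^sub>C x) z = c *\<^sub>C B x z" and scale_right: "B x (c *\<^sub>C z) = c *\<^sub>C B x z"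
begin

lemma zero_left [simp]: "B 0 z = 0" using scale_left [of 0 0 z] by simp
lemma zero_right [simp]: "B z 0 = 0" using scale_right [of z 0 0] by simp

lemma sum_left: "B (\<Sum>x\<in>Y. f x) z = (\<Sum>x\<in>Y. B (f x) z)"
  by (induction Y rule: infinite_finite_induct) (simp_all add: add_left)

lemma sum_right: "B z (\<Sum>x\<in>Y. f x) = (\<Sum>x\<in>Y. B z (f x))"
  by (induction Y rule: infinite_finite_induct) (simp_all add: add_right)

lemma pair_act0:
  "(\<Sum>w\<in>words n. B (act0 s f w) (g w)) = (\<Sum>w\<in>words n. B (f w) (act0 (transp_braid s) g w))"
proof -
  consider "n < 2" | m where "n = Suc (Suc m)" by (metis less_2_cases_iff not0_implies_Suc One_nat_def)
  then show ?thesis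
  proof cases
    case 1
    have "act0 s f w = f w" "act0 (transp_braid s) g w = g w" if "w \<in> words n" for w
      using that 1 unfolding act0_def words_def by (auto split: list.split)
    then show ?thesis by simp
  next
    case 2
    let ?f = "\<lambda>w j k a b. s a b j k *\<^sub>C B (f (a # b # w)) (g (j # k # w))"
    have "(\<Sum>w\<in>words n. B (act0 s f w) (g w)) =
        (\<Sum>j\<in>UNIV. \<Sum>k\<in>UNIV. \<Sum>w\<in>words m. \<Sum>a\<in>UNIV. \<Sum>b\<in>UNIV. ?f w j k a b)"
      by (simp add: 2 sum_words_Suc sum_left scale_left)
    also have "\<dots> = (\<Sum>(j, k, w, a, b)\<in>UNIV \<times> UNIV \<times> words m \<times> UNIV \<times> UNIV. ?f w j k a b)"
      by (simp add: sum.cartesian_product split_def)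
    also have "\<dots> = (\<Sum>(a, b, w, j, k)\<in>UNIV \<times> UNIV \<times> words m \<times> UNIV \<times> UNIV. ?f w j k a b)"
      by (rule sum.reindex_bij_witness [where i = "\<lambda>(j, k, w, a, b). (a, b, w, j, k)"
            and j = "\<lambda>(a, b, w, j, k). (j, k, w, a, b)"]) auto
    also have "\<dots> = (\<Sum>a\<in>UNIV. \<Sum>b\<in>UNIV. \<Sum>w\<in>words m. \<Sum>j\<in>UNIV. \<Sum>k\<in>UNIV. ?f w j k a b)"
      by (simp add: sum.cartesian_product split_def)
    also have "\<dots> = (\<Sum>w\<in>words n. B (f w) (act0 (transp_braid s) g w))"
      by (simp add: 2 sum_words_Suc sum_right scale_right transp_braid_def)
    finally show ?thesis .
  qed
qed

text \<open>The adjoint of each transposition fixes g, so every one of the n insertions of f pairs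
  with g like f itself.\<close>

lemma pair_ins:
  assumes "symt (transp_braid s) n g"
  shows "(\<Sum>w\<in>words n. B (ins s f w) (g w)) = of_nat n *\<^sub>C (\<Sum>w\<in>words n. B (f w) (g w))"
  using assms
proof (induction n arbitrary: f g)
  case (Suc n)
  have "(\<Sum>w\<in>words (Suc n). B (ins s f w) (g w)) =
      (\<Sum>w\<in>words (Suc n). B (f w) (g w)) +
      (\<Sum>j\<in>UNIV. \<Sum>w\<in>words n. B (ins s (\<lambda>v. act0 s f (j # v)) w) (g (j # w)))"
    by (simp add: sum_words_Suc add_left sum.distrib)
  also have "(\<Sum>j\<in>UNIV. \<Sum>w\<in>words n. B (ins s (\<lambda>v. act0 s f (j # v)) w) (g (j # w))) =
      (\<Sum>j\<in>UNIV. of_nat n *\<^sub>C (\<Sum>w\<in>words n. B (act0 s f (j # w)) (g (j # w))))"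
    by (rule sum.cong [OF refl], rule Suc.IH) (use Suc.prems in simp)
  also have "\<dots> = of_nat n *\<^sub>C (\<Sum>w\<in>words (Suc n). B (act0 s f w) (g w))"
    by (simp add: sum_words_Suc cscale_sum_right)
  also have "(\<Sum>w\<in>words (Suc n). B (act0 s f w) (g w)) = (\<Sum>w\<in>words (Suc n). B (f w) (g w))"
    unfolding pair_act0 by (rule sum.cong) (use Suc.prems in \<open>auto simp: words_def\<close>)
  finally show ?case by (simp add: cscale_left_distrib)
qed simp

lemma pair_symz:
  assumes "symt (transp_braid s) n g"
  shows "(\<Sum>w\<in>words n. B (symz s n f w) (g w)) = (\<Sum>w\<in>words n. B (f w) (g w))"
  using assms
proof (induction n arbitrary: f g)
  case (Suc n)
  let ?h = "\<lambda>v. case v of [] \<Rightarrow> 0 | i # v \<Rightarrow> symz s n (\<lambda>v. f (i # v)) v"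
  have "(\<Sum>w\<in>words (Suc n). B (symz s (Suc n) f w) (g w)) =
      inverse (of_nat (Suc n)) *\<^sub>C (\<Sum>w\<in>words (Suc n). B (ins s ?h w) (g w))"
    unfolding symz.simps scale_left by (rule cscale_sum_right [symmetric])
  also have "\<dots> = (\<Sum>w\<in>words (Suc n). B (?h w) (g w))"
    by (simp only: pair_ins [OF Suc.prems] cscale_cscale) (simp del: of_nat_Suc)
  also have "\<dots> = (\<Sum>w\<in>words (Suc n). B (f w) (g w))"
    unfolding sum_words_Suc list.case by (rule sum.cong [OF refl], rule Suc.IH) (use Suc.prems in simp)
  finally show ?case .
qed simp

end

section \<open>The dimension of the space of symmetric tensors\<close>

text \<open>The trace of the matrix of the projection \<open>symz\<close> on words of length n,
  hence the dimension of its image, see \<open>sym_degree_basis\<close>.\<close>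

definition symz_trace :: "'i::finite braid \<Rightarrow> nat \<Rightarrow> complex" where
  "symz_trace s n = (\<Sum>w\<in>words n. symz s n (\<lambda>v. if v = w then 1 else 0) w)"

context braiding
begin

text \<open>The trace is taken over the first letter first. The summand of \<open>ins\<close>
  without a move gives the number of letters. In the others the partial trace replaces the first
  transposition by c and leaves the n insertions of a symmetric function. So c = 1 and c = -1 lead
  to the dimensions of symmetric and exterior powers.\<close>

lemma symz_trace_Suc:
  assumes ptr: "\<And>b y. (\<Sum>j\<in>UNIV. s j b j y) = (if b = y then c else 0)"
  shows "of_nat (Suc n) * symz_trace s (Suc n) = (of_nat CARD('i) + c * of_nat n) * symz_trace s n"
proof -
  define p where "p w = symz s n (\<lambda>v. if v = w then 1 else 0 :: complex)" for w
  \<comment> \<open>The column, at the word j # w, of the identity on the first letter tensored with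
    the symmetrizer on the rest.\<close>
  define F where "F j w = (\<lambda>v. case v of [] \<Rightarrow> 0 | i # v \<Rightarrow> if i = j then p w v else 0)" for j :: 'i and w
  have 1: "symz s n (\<lambda>v. if i # v = j # w then 1 else 0) u = (if i = j then p w u else (0 :: complex))" for i j w u
    by (simp add: p_def)
  have "of_nat (Suc n) * symz_trace s (Suc n) = (\<Sum>j\<in>UNIV. \<Sum>w\<in>words n. ins s (F j w) (j # w))"
    unfolding symz_trace_def sum_words_Suc symz.simps 1
    by (simp add: F_def sum_distrib_left cscale_complex_def mult.assoc [symmetric] del: of_nat_Suc)
  also have "\<dots> = (\<Sum>j\<in>(UNIV :: 'i set). \<Sum>w\<in>words n. p w w) +
      (\<Sum>j\<in>UNIV. \<Sum>w\<in>words n. ins s (\<lambda>v. act0 s (F j w) (j # v)) w)"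
    by (simp add: F_def sum.distrib)
  also have "(\<Sum>j\<in>UNIV. \<Sum>w\<in>words n. ins s (\<lambda>v. act0 s (F j w) (j # v)) w) =
      (\<Sum>w\<in>words n. ins s (\<lambda>v. \<Sum>j\<in>UNIV. act0 s (F j w) (j # v)) w)"
    by (subst sum.swap) (simp add: ins_sum)
  also have "\<dots> = (\<Sum>w\<in>words n. c * of_nat n * p w w)"
  proof (rule sum.cong [OF refl])
    fix w :: "'i list" assume w: "w \<in> words n"
    have act: "(\<Sum>j\<in>UNIV. act0 s (F j w) (j # y # v)) = c * p w (y # v)" for y v
    proof -
      have "(\<Sum>a\<in>UNIV. \<Sum>b\<in>UNIV. s a b j y *\<^sub>C F j w (a # b # v)) =
          (\<Sum>b\<in>UNIV. \<Sum>a\<in>UNIV. if a = j then s a b j y * p w (b # v) else 0)" for j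
        by (subst sum.swap) (auto simp: F_def cscale_complex_def intro!: sum.cong)
      then have "(\<Sum>j\<in>UNIV. act0 s (F j w) (j # y # v)) = (\<Sum>j\<in>UNIV. \<Sum>b\<in>UNIV. s j b j y * p w (b # v))"
        by simp
      also have "\<dots> = (\<Sum>b\<in>UNIV. (\<Sum>j\<in>UNIV. s j b j y) * p w (b # v))"
        by (subst sum.swap) (simp add: sum_distrib_right)
      also have "\<dots> = (\<Sum>b\<in>UNIV. if b = y then c * p w (b # v) else 0)"
        unfolding ptr by (rule sum.cong) auto
      finally show ?thesis by simp
    qed
    show "ins s (\<lambda>v. \<Sum>j\<in>UNIV. act0 s (F j w) (j # v)) w = c * of_nat n * p w w"
    proof (cases w)
      case Nil
      then show ?thesis using w by (simp add: words_def)
    next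
      case (Cons y w')
      have "ins s (\<lambda>v. \<Sum>j\<in>UNIV. act0 s (F j w) (j # v)) w = ins s (\<lambda>v. c *\<^sub>C p w v) w"
      proof (rule ins_cong)
        fix v :: "'i list" assume "length v = length w"
        then obtain y' v' where "v = y' # v'" using Cons by (cases v) auto
        then show "(\<Sum>j\<in>UNIV. act0 s (F j w) (j # v)) = c *\<^sub>C p w v"
          by (simp only: act cscale_complex_def)
      qed
      also have "\<dots> = c * (of_nat n * p w w)"
        unfolding ins_scale using w by (subst ins_symt [where n = n])
          (auto simp: cscale_complex_def p_def words_def intro: symt_symz)
      finally show ?thesis by simp
    qed
  qed
  finally show ?thesis
    by (simp add: symz_trace_def p_def sum_distrib_left [symmetric] distrib_right)
qed

end

lemma symz_trace_0 [simp]: "symz_trace s 0 = 1"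
  by (simp add: symz_trace_def)

section \<open>The tensor algebra\<close>

abbreviation letter :: "'i \<Rightarrow> 'i tensor" where "letter i \<equiv> tensor_word [i]"

section \<open>Coefficients of products of tensors\<close>

lemma lookup_word: "Poly_Mapping.lookup (tensor_word u) w = (if u = w then 1 else 0)"
  by (simp add: tensor_word_def lookup_single when_def)

lemma word_mult_word: "tensor_word u * tensor_word v = tensor_word (u @ v)"
  by (simp add: tensor_word_def mult_single plus_list_def)

lemma word_Nil: "tensor_word [] = 1"
  by (simp add: tensor_word_def flip: zero_list_def single_one)

lemma lookup_const_mult: "Poly_Mapping.lookup (tensor_const c * t) w = c * Poly_Mapping.lookup t w"
  by (simp add: lookup_mult tensor_const_def lookup_single when_mult plus_list_def)

lemma lookup_mult_single_append:
  "Poly_Mapping.lookup (t * Poly_Mapping.single u c) (v @ u) = Poly_Mapping.lookup t v * c"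
proof -
  have "(\<Sum>q. (c when u = q) when v @ u = l @ q) = (c when v = l)" for l
  proof -
    have "(\<Sum>q. (c when u = q) when v @ u = l @ q) = (\<Sum>q. (c when v @ u = l @ q) when u = q)"
      by (rule Sum_any.cong) (simp add: when_def)
    then show ?thesis by simp
  qed
  then show ?thesis by (simp add: lookup_mult lookup_single plus_list_def mult_when)
qed

lemma lookup_mult_const: "Poly_Mapping.lookup (t * tensor_const c) w = Poly_Mapping.lookup t w * c"
  using lookup_mult_single_append [of t "[]" c w] by (simp add: tensor_const_def)

lemma tensor_scale_eq: "tensor_scale c t = c *\<^sub>C t"
  by (rule poly_mapping_eqI) (simp add: tensor_scale_def lookup_const_mult lookup_cscale cscale_complex_def)

lemma tensor_scale_fun: "tensor_scale = cscale"
  by (intro ext) (rule tensor_scale_eq)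

lemma const_mult: "tensor_const c * t = c *\<^sub>C t"
  by (simp flip: tensor_scale_eq add: tensor_scale_def)

lemma mult_const: "t * tensor_const c = c *\<^sub>C t"
  by (rule poly_mapping_eqI) (simp add: lookup_mult_const lookup_cscale cscale_complex_def)

lemma cscale_mult_left: "(c *\<^sub>C s) * t = c *\<^sub>C (s * t)" for s t :: "'i tensor"
  by (simp flip: const_mult add: mult.assoc)

lemma cscale_mult_right: "s * (c *\<^sub>C t) = c *\<^sub>C (s * t)" for s t :: "'i tensor"
  by (metis const_mult mult_const mult.assoc)

lemma lookup_word_mult: "Poly_Mapping.lookup (tensor_word u * t) (u @ v) = Poly_Mapping.lookup t v"
  by (simp add: lookup_mult tensor_word_def lookup_single when_mult plus_list_def)

lemma lookup_mult_word: "Poly_Mapping.lookup (t * tensor_word u) (v @ u) = Poly_Mapping.lookup t v"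
  by (simp add: tensor_word_def lookup_mult_single_append)

lemma lookup_word_mult_0:
  assumes "\<And>v. w \<noteq> u @ v"
  shows "Poly_Mapping.lookup (tensor_word u * t) w = 0"
  using assms by (simp add: lookup_mult tensor_word_def lookup_single when_mult plus_list_def)

lemma lookup_mult_word_0:
  assumes "\<And>v. w \<noteq> v @ u"
  shows "Poly_Mapping.lookup (t * tensor_word u) w = 0"
proof -
  have "w \<notin> Poly_Mapping.keys (t * tensor_word u)"
    using keys_mult [of t "tensor_word u"] assms
    by (auto simp: tensor_word_def plus_list_def split: if_splits)
  then show ?thesis by (simp add: in_keys_iff)
qed

lemma lookup_letter_mult:
  "Poly_Mapping.lookup (letter i * t) (j # w) = (if i = j then Poly_Mapping.lookup t w else 0)"
  "Poly_Mapping.lookup (letter i * t) [] = 0"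
  using lookup_word_mult [of "[i]" t w] by (auto intro!: lookup_word_mult_0)

lemma lookup_mult_letter:
  "Poly_Mapping.lookup (t * letter i) (w @ [j]) = (if i = j then Poly_Mapping.lookup t w else 0)"
  "Poly_Mapping.lookup (t * letter i) [] = 0"
  using lookup_mult_word [of t "[i]" w] by (auto intro!: lookup_mult_word_0)

lemma mult_delta_right: "x * (if P then 1 else 0) = (if P then x else 0)" for x :: "'a::semiring_1"
  by simp

lemma tensor_sum_words:
  "t = (\<Sum>w\<in>Poly_Mapping.keys t. Poly_Mapping.lookup t w *\<^sub>C tensor_word w)"
proof (rule poly_mapping_eqI)
  fix k
  have "(\<Sum>w\<in>Poly_Mapping.keys t. Poly_Mapping.lookup t w * (if w = k then 1 else 0)) = Poly_Mapping.lookup t k"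
    by (simp add: in_keys_iff mult_delta_right)
  then show "Poly_Mapping.lookup t k =
      Poly_Mapping.lookup (\<Sum>w\<in>Poly_Mapping.keys t. Poly_Mapping.lookup t w *\<^sub>C tensor_word w) k"
    by (simp add: lookup_sum lookup_cscale lookup_word cscale_complex_def)
qed

text \<open>Restricting the last case to words that occur in t keeps information on the degree of t
  available.\<close>

lemma tensor_induct [case_names zero add scale word]:
  assumes "Q 0" and "\<And>s t. Q s \<Longrightarrow> Q t \<Longrightarrow> Q (s + t)" and "\<And>c t. Q t \<Longrightarrow> Q (c *\<^sub>C t)"
    and "\<And>w. w \<in> Poly_Mapping.keys t \<Longrightarrow> Q (tensor_word w)"
  shows "Q (t :: 'i tensor)"
proof -
  have "Q (\<Sum>w\<in>W. Poly_Mapping.lookup t w *\<^sub>C tensor_word w)" if "W \<subseteq> Poly_Mapping.keys t" "finite W" for W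
    using that(2,1) by (induction W rule: finite_induct) (simp_all add: assms)
  then have "Q (\<Sum>w\<in>Poly_Mapping.keys t. Poly_Mapping.lookup t w *\<^sub>C tensor_word w)" by simp
  then show ?thesis by (simp only: tensor_sum_words [symmetric])
qed

text \<open>There are finitely many words of each length, so an operator that sees only words of the
  same length keeps supports finite.\<close>

lemma finite_word_op:
  fixes f :: "'i::finite list \<Rightarrow> 'w::zero" and \<Phi> :: "'i list \<Rightarrow> 'v::zero"
  assumes "finite {v. f v \<noteq> 0}" and "\<And>w. (\<And>v. length v = length w \<Longrightarrow> f v = 0) \<Longrightarrow> \<Phi> w = 0"
  shows "finite {w. \<Phi> w \<noteq> 0}"
proof (rule finite_subset)
  show "{w. \<Phi> w \<noteq> 0} \<subseteq> (\<Union>v\<in>{v. f v \<noteq> 0}. {w. length w = length v})"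
    using assms(2) by (smt (verit) UN_iff mem_Collect_eq subsetI)
  show "finite (\<Union>v\<in>{v. f v \<noteq> 0}. {w :: 'i list. length w = length v})"
    using assms(1) finite_words by (auto simp: words_def)
qed

lift_definition tact :: "'i::finite braid \<Rightarrow> 'i tensor \<Rightarrow> 'i tensor" is act0
proof -
  fix s :: "'i::finite braid" and f :: "'i list \<Rightarrow> complex" assume "finite {v. f v \<noteq> 0}"
  then show "finite {w. act0 s f w \<noteq> 0}"
  proof (rule finite_word_op)
    fix w :: "'i list" assume "\<And>v. length v = length w \<Longrightarrow> f v = 0"
    then show "act0 s f w = 0" using act0_cong [of w f "\<lambda>_. 0" s] by simp
  qed
qed

lift_definition tins :: "'i::finite braid \<Rightarrow> 'i tensor \<Rightarrow> 'i tensor" is ins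
proof -
  fix s :: "'i::finite braid" and f :: "'i list \<Rightarrow> complex" assume "finite {v. f v \<noteq> 0}"
  then show "finite {w. ins s f w \<noteq> 0}"
  proof (rule finite_word_op)
    fix w :: "'i list" assume "\<And>v. length v = length w \<Longrightarrow> f v = 0"
    then show "ins s f w = 0" using ins_cong [of w f "\<lambda>_. 0" s] by simp
  qed
qed

lift_definition tsym :: "'i::finite braid \<Rightarrow> 'i tensor \<Rightarrow> 'i tensor" is "\<lambda>s f w. symz s (length w) f w"
proof -
  fix s :: "'i::finite braid" and f :: "'i list \<Rightarrow> complex" assume "finite {v. f v \<noteq> 0}"
  then show "finite {w. symz s (length w) f w \<noteq> 0}"
  proof (rule finite_word_op)
    fix w :: "'i list" assume "\<And>v. length v = length w \<Longrightarrow> f v = 0"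
    then show "symz s (length w) f w = 0" using symz_cong [of "length w" f "\<lambda>_. 0" w s] by simp
  qed
qed

lift_definition lquot :: "'i \<Rightarrow> 'i tensor \<Rightarrow> 'i tensor" is "\<lambda>i f w. f (i # w)"
  by (drule finite_vimageI [where h = "Cons _"]) (auto simp: vimage_def)

text \<open>For the plain flip, the derivative of a symmetric tensor is the deletion of a first
  letter i times the degree, here \<open>Suc (length w)\<close>. The same formula is taken for every
  braiding; \<open>rder\<close> deletes at the other end.\<close>

lift_definition lder :: "'i \<Rightarrow> 'i tensor \<Rightarrow> 'i tensor" is "\<lambda>i f w. of_nat (Suc (length w)) * f (i # w)"
  by (drule finite_vimageI [where h = "Cons _"]) (auto simp: vimage_def simp del: of_nat_Suc)

lift_definition rder :: "'i \<Rightarrow> 'i tensor \<Rightarrow> 'i tensor" is "\<lambda>i f w. of_nat (Suc (length w)) * f (w @ [i])"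
  by (drule finite_vimageI [where h = "\<lambda>w. w @ [_]"]) (auto simp: vimage_def inj_def simp del: of_nat_Suc)

lift_definition tdeg :: "'i tensor \<Rightarrow> 'i tensor" is "\<lambda>f w. of_nat (length w) * f w"
  by (erule finite_subset [rotated]) auto

lift_definition trev :: "'i tensor \<Rightarrow> 'i tensor" is "\<lambda>f w. f (rev w)"
  by (drule finite_vimageI [where h = rev]) (auto simp: vimage_def inj_def)

lift_definition tpart :: "nat \<Rightarrow> 'i tensor \<Rightarrow> 'i tensor" is "\<lambda>n f w. if length w = n then f w else 0"
  by (erule finite_subset [rotated]) auto

lemmas tlookup = tact.rep_eq tins.rep_eq tsym.rep_eq lquot.rep_eq lder.rep_eq rder.rep_eq tdeg.rep_eq
  trev.rep_eq tpart.rep_eq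

lemma lookup_fun_add: "Poly_Mapping.lookup (s + t) = (\<lambda>w. Poly_Mapping.lookup s w + Poly_Mapping.lookup t w)"
  by (rule ext) (simp add: lookup_add)

lemma lookup_fun_cscale: "Poly_Mapping.lookup (c *\<^sub>C t) = (\<lambda>w. c *\<^sub>C Poly_Mapping.lookup t w)"
  by (rule ext) (simp add: lookup_cscale)

locale cvec_linear =
  fixes L :: "'v::cvec \<Rightarrow> 'w::cvec"
  assumes add: "L (x + y) = L x + L y" and scale: "L (c *\<^sub>C x) = c *\<^sub>C L x"
begin

lemma zero [simp]: "L 0 = 0" using scale [of 0 0] by simp
lemma neg: "L (- x) = - L x" using scale [of "- 1" x] by simp
lemma diff: "L (x - y) = L x - L y" using add [of x "- y"] by (simp add: neg)
lemma sum: "L (\<Sum>x\<in>Y. f x) = (\<Sum>x\<in>Y. L (f x))"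
  by (induction Y rule: infinite_finite_induct) (simp_all add: add)

end

lemma cvec_linearI: "(\<And>x y. L (x + y) = L x + L y) \<Longrightarrow> (\<And>c x. L (c *\<^sub>C x) = c *\<^sub>C L x) \<Longrightarrow> cvec_linear L"
  by (simp add: cvec_linear_def)

interpretation tact: cvec_linear "tact s"
  by (rule cvec_linearI; rule poly_mapping_eqI)
    (simp_all add: tlookup lookup_add lookup_cscale lookup_fun_add lookup_fun_cscale act0_add act0_scale)

interpretation tins: cvec_linear "tins s"
  by (rule cvec_linearI; rule poly_mapping_eqI)
    (simp_all add: tlookup lookup_add lookup_cscale lookup_fun_add lookup_fun_cscale ins_add ins_scale)

interpretation tsym: cvec_linear "tsym s"
  by (rule cvec_linearI; rule poly_mapping_eqI)
    (simp_all add: tlookup lookup_add lookup_cscale lookup_fun_add lookup_fun_cscale symz_add symz_scale)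

interpretation lquot: cvec_linear "lquot i"
  by (rule cvec_linearI; rule poly_mapping_eqI) (simp_all add: tlookup lookup_add lookup_cscale)

interpretation lder: cvec_linear "lder i"
  by (rule cvec_linearI; rule poly_mapping_eqI)
    (simp_all add: tlookup lookup_add lookup_cscale cscale_complex_def algebra_simps)

interpretation rder: cvec_linear "rder i"
  by (rule cvec_linearI; rule poly_mapping_eqI)
    (simp_all add: tlookup lookup_add lookup_cscale cscale_complex_def algebra_simps)

interpretation tdeg: cvec_linear tdeg
  by (rule cvec_linearI; rule poly_mapping_eqI)
    (simp_all add: tlookup lookup_add lookup_cscale cscale_complex_def algebra_simps)

interpretation trev: cvec_linear trev
  by (rule cvec_linearI; rule poly_mapping_eqI) (simp_all add: tlookup lookup_add lookup_cscale)

interpretation tpart: cvec_linear "tpart n"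
  by (rule cvec_linearI; rule poly_mapping_eqI) (simp_all add: tlookup lookup_add lookup_cscale)

lemma tensor_degree_iff: "t \<in> tensor_degree n \<longleftrightarrow> (\<forall>w. length w \<noteq> n \<longrightarrow> Poly_Mapping.lookup t w = 0)"
  by (auto simp: tensor_degree_def in_keys_iff)

lemma word_degree [simp]: "tensor_word w \<in> tensor_degree (length w)"
  by (auto simp: tensor_degree_iff lookup_word)

lemma trev_trev [simp]: "trev (trev t) = t"
  by (rule poly_mapping_eqI) (simp add: tlookup)

lemma trev_word: "trev (tensor_word w) = tensor_word (rev w)"
  by (rule poly_mapping_eqI) (auto simp: tlookup lookup_word)

lemma trev_mult: "trev (s * t) = trev t * trev s"
proof (induction s rule: tensor_induct)
  case (word u)
  show ?case
  proof (induction t rule: tensor_induct)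
    case (word w)
    show ?case by (simp add: word_mult_word trev_word)
  qed (simp_all add: trev.add trev.scale distrib_left distrib_right cscale_mult_left cscale_mult_right)
qed (simp_all add: trev.add trev.scale distrib_left distrib_right cscale_mult_left cscale_mult_right)

lemma tensor_split:
  fixes t :: "'i::finite tensor"
  shows "t = tensor_const (Poly_Mapping.lookup t []) + (\<Sum>i\<in>UNIV. letter i * lquot i t)"
proof (rule poly_mapping_eqI)
  fix w
  show "Poly_Mapping.lookup t w =
      Poly_Mapping.lookup (tensor_const (Poly_Mapping.lookup t []) + (\<Sum>i\<in>UNIV. letter i * lquot i t)) w"
    by (cases w) (simp_all add: lookup_add lookup_sum lookup_letter_mult tlookup tensor_const_def lookup_single)
qed

section \<open>The two-sided ideal of a braiding, and symmetrization modulo this ideal\<close>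

definition braid_rel :: "'i::finite braid \<Rightarrow> 'i \<Rightarrow> 'i \<Rightarrow> 'i tensor" where
  "braid_rel s a b = tensor_word [a, b] - (\<Sum>j\<in>UNIV. \<Sum>k\<in>UNIV. s a b j k *\<^sub>C tensor_word [j, k])"

text \<open>A linear span, so that facts about the ideal are proved by induction over its
  generators. The agreement with the ideal generated in the sense of rings is
  \<open>quadratic_ideal_braid\<close>.\<close>

definition braid_ideal :: "'i::finite braid \<Rightarrow> 'i tensor set" where
  "braid_ideal s = cvec.span {tensor_word u * braid_rel s a b * tensor_word w | u a b w. True}"

lemma braid_ideal_subspace: "cvec.subspace (braid_ideal s)"
  unfolding braid_ideal_def by (rule cvec.subspace_span)

lemma braid_ideal_add: "x \<in> braid_ideal s \<Longrightarrow> y \<in> braid_ideal s \<Longrightarrow> x + y \<in> braid_ideal s"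
  by (rule cvec.subspace_add [OF braid_ideal_subspace])
lemma braid_ideal_scale: "x \<in> braid_ideal s \<Longrightarrow> c *\<^sub>C x \<in> braid_ideal s"
  by (rule cvec.subspace_scale [OF braid_ideal_subspace])
lemma braid_ideal_0: "0 \<in> braid_ideal s"
  by (rule cvec.subspace_0 [OF braid_ideal_subspace])
lemma braid_ideal_sum: "(\<And>x. x \<in> Y \<Longrightarrow> f x \<in> braid_ideal s) \<Longrightarrow> (\<Sum>x\<in>Y. f x) \<in> braid_ideal s"
  by (rule cvec.subspace_sum [OF braid_ideal_subspace])

lemma braid_ideal_gen: "tensor_word u * braid_rel s a b * tensor_word w \<in> braid_ideal s"
  unfolding braid_ideal_def by (rule cvec.span_base) auto

lemma braid_ideal_induct [consumes 1, case_names zero add scale gen]: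
  assumes "t \<in> braid_ideal s" and "Q 0" and "\<And>x y. Q x \<Longrightarrow> Q y \<Longrightarrow> Q (x + y)"
    and "\<And>c x. Q x \<Longrightarrow> Q (c *\<^sub>C x)" and "\<And>u a b w. Q (tensor_word u * braid_rel s a b * tensor_word w)"
  shows "Q t"
  using assms(1) unfolding braid_ideal_def
proof (induction rule: cvec.span_induct_alt)
  case (step c x y)
  then show ?case using assms by auto
qed (rule assms)

lemma braid_ideal_mult_left:
  assumes "t \<in> braid_ideal s" shows "x * t \<in> braid_ideal s"
proof (induction x rule: tensor_induct)
  case (word v)
  show ?case using assms
  proof (induction rule: braid_ideal_induct)
    case (gen u a b w)
    show ?case using braid_ideal_gen [of "v @ u" s a b w] by (simp add: mult.assoc flip: word_mult_word)
  qed (simp_all add: distrib_left cscale_mult_right braid_ideal_add braid_ideal_scale braid_ideal_0)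
qed (simp_all add: distrib_right cscale_mult_left braid_ideal_add braid_ideal_scale braid_ideal_0)

lemma braid_ideal_mult_right:
  assumes "t \<in> braid_ideal s" shows "t * x \<in> braid_ideal s"
proof (induction x rule: tensor_induct)
  case (word v)
  show ?case using assms
  proof (induction rule: braid_ideal_induct)
    case (gen u a b w)
    show ?case using braid_ideal_gen [of u s a b "w @ v"] by (simp add: mult.assoc flip: word_mult_word)
  qed (simp_all add: distrib_right cscale_mult_left braid_ideal_add braid_ideal_scale braid_ideal_0)
qed (simp_all add: distrib_left cscale_mult_right braid_ideal_add braid_ideal_scale braid_ideal_0)

lemma tact_word: "tact s (tensor_word (a # b # w)) = (\<Sum>j\<in>UNIV. \<Sum>k\<in>UNIV. s a b j k *\<^sub>C tensor_word (j # k # w))"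
proof (rule poly_mapping_eqI)
  fix v
  show "Poly_Mapping.lookup (tact s (tensor_word (a # b # w))) v =
      Poly_Mapping.lookup (\<Sum>j\<in>UNIV. \<Sum>k\<in>UNIV. s a b j k *\<^sub>C tensor_word (j # k # w)) v"
  proof (cases v)
    case 1: (Cons j v1)
    show ?thesis
    proof (cases v1)
      case (Cons k v2)
      have "(\<Sum>a'\<in>UNIV. \<Sum>b'\<in>UNIV. s a' b' j k * (if a = a' \<and> b = b' \<and> w = v2 then 1 else 0)) =
          (\<Sum>a'\<in>UNIV. if a = a' then if w = v2 then s a' b j k else 0 else 0)"
        by (intro sum.cong) (auto simp: mult_delta_right)
      moreover have "(\<Sum>j'\<in>UNIV. \<Sum>k'\<in>UNIV. s a b j' k' * (if j' = j \<and> k' = k \<and> w = v2 then 1 else 0)) =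
          (\<Sum>j'\<in>UNIV. if j' = j then if w = v2 then s a b j' k else 0 else 0)"
        by (intro sum.cong) (auto simp: mult_delta_right)
      ultimately show ?thesis
        by (simp add: 1 Cons tlookup lookup_sum lookup_cscale lookup_word cscale_complex_def)
    qed (simp add: 1 tlookup lookup_sum lookup_cscale lookup_word cscale_complex_def)
  qed (simp add: tlookup lookup_sum lookup_cscale lookup_word cscale_complex_def)
qed

lemma braid_rel_mult_word: "braid_rel s a b * tensor_word w = tensor_word (a # b # w) - tact s (tensor_word (a # b # w))"
  unfolding braid_rel_def tact_word by (simp add: left_diff_distrib sum_distrib_right cscale_mult_left word_mult_word)

lemma tact_ideal: "tact s t - t \<in> braid_ideal s"
proof (induction t rule: tensor_induct)
  case (word w)
  consider "length w < 2" | a b v where "w = a # b # v"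
    by (cases w rule: remdups_adj.cases) auto
  then show ?case
  proof cases
    case 1
    have "tact s (tensor_word w) = tensor_word w"
    proof (rule poly_mapping_eqI)
      fix v
      show "Poly_Mapping.lookup (tact s (tensor_word w)) v = Poly_Mapping.lookup (tensor_word w) v"
        using 1 by (auto simp: tlookup act0_def lookup_word split: list.split intro!: sum.neutral)
    qed
    then show ?thesis by (simp add: braid_ideal_0)
  next
    case 2
    then show ?thesis
      using braid_ideal_scale [OF braid_ideal_gen [of "[]" s a b v], of "-1"]
      by (simp add: word_Nil braid_rel_mult_word)
  qed
next
  case (add x y)
  show ?case using braid_ideal_add [OF add] by (simp add: tact.add algebra_simps)
next
  case (scale c x)
  show ?case using braid_ideal_scale [OF scale, of c] by (simp add: tact.scale cvec.scale_right_diff_distrib)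
qed (simp add: braid_ideal_0)

lemma tensor_split':
  fixes t :: "'i::finite tensor"
  shows "t \<in> tensor_degree (Suc n) \<Longrightarrow> t = (\<Sum>i\<in>UNIV. letter i * lquot i t)"
  by (subst tensor_split) (simp add: tensor_degree_iff tensor_const_def)

lemma lquot_degree: "t \<in> tensor_degree (Suc n) \<Longrightarrow> lquot i t \<in> tensor_degree n"
  by (simp add: tensor_degree_iff tlookup)

lemma tact_degree: "t \<in> tensor_degree n \<Longrightarrow> tact s t \<in> tensor_degree n"
  using act0_cong [of _ "Poly_Mapping.lookup t" "\<lambda>_. 0" s] by (simp add: tensor_degree_iff tlookup)

lemma tins_degree: "t \<in> tensor_degree n \<Longrightarrow> tins s t \<in> tensor_degree n"
  using ins_cong [of _ "Poly_Mapping.lookup t" "\<lambda>_. 0" s] by (simp add: tensor_degree_iff tlookup)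

lemma tsym_degree: "t \<in> tensor_degree n \<Longrightarrow> tsym s t \<in> tensor_degree n"
  using symz_cong [of _ "Poly_Mapping.lookup t" "\<lambda>_. 0" _ s] by (simp add: tensor_degree_iff tlookup)

lemma letter_mult_degree: "t \<in> tensor_degree n \<Longrightarrow> letter i * t \<in> tensor_degree (Suc n)"
  unfolding tensor_degree_iff
proof (intro allI impI)
  fix w :: "'a list" assume "\<forall>w. length w \<noteq> n \<longrightarrow> Poly_Mapping.lookup t w = 0" "length w \<noteq> Suc n"
  then show "Poly_Mapping.lookup (letter i * t) w = 0" by (cases w) (auto simp: lookup_letter_mult)
qed

lemma tins_split: "t \<in> tensor_degree (Suc n) \<Longrightarrow> tins s t = t + (\<Sum>j\<in>UNIV. letter j * tins s (lquot j (tact s t)))"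
proof (rule poly_mapping_eqI)
  fix w assume t: "t \<in> tensor_degree (Suc n)"
  have l: "Poly_Mapping.lookup (lquot j (tact s t)) = (\<lambda>v. act0 s (Poly_Mapping.lookup t) (j # v))" for j
    by (rule ext) (simp add: tlookup)
  show "Poly_Mapping.lookup (tins s t) w =
      Poly_Mapping.lookup (t + (\<Sum>j\<in>UNIV. letter j * tins s (lquot j (tact s t)))) w"
    using t by (cases w) (simp_all add: l tlookup lookup_add lookup_sum lookup_letter_mult tensor_degree_iff)
qed

text \<open>Modulo the ideal the transposition of the first pair is the identity, and the ideal
  absorbs a letter on the left; so each of the n insertions is congruent to t.\<close>

lemma tins_ideal: "t \<in> tensor_degree n \<Longrightarrow> tins s t - of_nat n *\<^sub>C t \<in> braid_ideal s"
proof (induction n arbitrary: t)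
  case 0
  have "tins s t = 0"
  proof (rule poly_mapping_eqI)
    fix w
    show "Poly_Mapping.lookup (tins s t) w = Poly_Mapping.lookup 0 w"
      using tins_degree [OF 0, of s] by (cases w) (auto simp: tensor_degree_iff tlookup)
  qed
  then show ?case by (simp add: braid_ideal_0)
next
  case (Suc n)
  let ?u = "\<lambda>j. lquot j (tact s t)"
  have "tact s t = (\<Sum>j\<in>UNIV. letter j * ?u j)"
    by (rule tensor_split' [OF tact_degree [OF Suc.prems]])
  then have "of_nat n *\<^sub>C tact s t = (\<Sum>j\<in>UNIV. letter j * (of_nat n *\<^sub>C ?u j))"
    by (metis (no_types, lifting) cscale_mult_right cscale_sum_right sum.cong)
  then have "tins s t - of_nat (Suc n) *\<^sub>C t =
      (\<Sum>j\<in>UNIV. letter j * (tins s (?u j) - of_nat n *\<^sub>C ?u j)) + of_nat n *\<^sub>C (tact s t - t)"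
    by (simp add: tins_split [OF Suc.prems] right_diff_distrib sum_subtractf cvec.scale_right_diff_distrib
        cscale_left_distrib)
  also have "\<dots> \<in> braid_ideal s"
    by (intro braid_ideal_add braid_ideal_sum braid_ideal_mult_left Suc.IH lquot_degree tact_degree Suc.prems
        braid_ideal_scale tact_ideal)
  finally show ?case .
qed

lemma tsym_split:
  "t \<in> tensor_degree (Suc n) \<Longrightarrow>
    tsym s t = inverse (of_nat (Suc n)) *\<^sub>C tins s (\<Sum>j\<in>UNIV. letter j * tsym s (lquot j t))"
proof (rule poly_mapping_eqI)
  fix w assume t: "t \<in> tensor_degree (Suc n)"
  let ?u = "\<Sum>j\<in>UNIV. letter j * tsym s (lquot j t)"
  show "Poly_Mapping.lookup (tsym s t) w =
      Poly_Mapping.lookup (inverse (of_nat (Suc n)) *\<^sub>C tins s ?u) w"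
  proof (cases "length w = Suc n")
    case True
    have "ins s (\<lambda>v. case v of [] \<Rightarrow> 0 | i # v \<Rightarrow> symz s n (\<lambda>v. Poly_Mapping.lookup t (i # v)) v) w =
        ins s (Poly_Mapping.lookup ?u) w"
    proof (rule ins_cong)
      fix v :: "'a list" assume "length v = length w"
      then show "(case v of [] \<Rightarrow> 0 | i # v \<Rightarrow> symz s n (\<lambda>v. Poly_Mapping.lookup t (i # v)) v) =
          Poly_Mapping.lookup ?u v"
        using True by (cases v) (simp_all add: lookup_sum lookup_letter_mult tlookup if_distrib cong: if_cong)
    qed
    then show ?thesis using True by (simp add: tlookup lookup_cscale)
  next
    case False
    have "?u \<in> tensor_degree (Suc n)"
      using letter_mult_degree [OF tsym_degree [OF lquot_degree [OF t]]]
      by (simp add: tensor_degree_iff lookup_sum)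
    then have "tins s ?u \<in> tensor_degree (Suc n)" by (rule tins_degree)
    then show ?thesis using False tsym_degree [OF t, of s] by (simp add: tensor_degree_iff lookup_cscale)
  qed
qed

text \<open>Symmetrizing the tails changes t by an element of the ideal, and by
  \<open>tins_ideal\<close> so does the averaged insertion. Together with \<open>tsym_eq_0\<close>
  this makes the ideal of a braiding the kernel of \<open>tsym\<close>.\<close>

lemma tsym_ideal_deg: "t \<in> tensor_degree n \<Longrightarrow> tsym s t - t \<in> braid_ideal s"
proof (induction n arbitrary: t)
  case 0
  have "tsym s t = t"
  proof (rule poly_mapping_eqI)
    fix w
    show "Poly_Mapping.lookup (tsym s t) w = Poly_Mapping.lookup t w"
      using tsym_degree [OF 0, of s] 0
      by (cases w) (simp add: tlookup, simp add: tensor_degree_iff del: symz.simps)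
  qed
  then show ?case by (simp add: braid_ideal_0)
next
  case (Suc n)
  define u where "u = (\<Sum>j\<in>UNIV. letter j * tsym s (lquot j t))"
  have "u \<in> tensor_degree (Suc n)"
    using letter_mult_degree [OF tsym_degree [OF lquot_degree [OF Suc.prems]]]
    by (simp add: u_def tensor_degree_iff lookup_sum)
  then have 1: "inverse (of_nat (Suc n)) *\<^sub>C (tins s u - of_nat (Suc n) *\<^sub>C u) \<in> braid_ideal s"
    by (intro braid_ideal_scale tins_ideal)
  have "(\<Sum>j\<in>UNIV. letter j * (tsym s (lquot j t) - lquot j t)) \<in> braid_ideal s"
    by (intro braid_ideal_sum braid_ideal_mult_left Suc.IH lquot_degree Suc.prems)
  then have 2: "u - t \<in> braid_ideal s"
    using tensor_split' [OF Suc.prems] by (simp add: u_def right_diff_distrib sum_subtractf)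
  have "tsym s t - t = inverse (of_nat (Suc n)) *\<^sub>C (tins s u - of_nat (Suc n) *\<^sub>C u) + (u - t)"
    unfolding tsym_split [OF Suc.prems] u_def
    by (simp add: cvec.scale_right_diff_distrib cscale_cscale del: of_nat_Suc)
  then show ?case using braid_ideal_add [OF 1 2] by (simp only: add_diff_eq)
qed

lemma tsym_ideal: "tsym s t - t \<in> braid_ideal s"
proof (induction t rule: tensor_induct)
  case (word w)
  show ?case by (rule tsym_ideal_deg) (rule word_degree)
next
  case (add x y)
  show ?case using braid_ideal_add [OF add] by (simp add: tsym.add algebra_simps)
next
  case (scale c x)
  show ?case using braid_ideal_scale [OF scale, of c] by (simp add: tsym.scale cvec.scale_right_diff_distrib)
qed (simp add: braid_ideal_0)

lemma actn_short: "length w < Suc (Suc r) \<Longrightarrow> actn s r f w = f w"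
proof (induction r arbitrary: f w)
  case 0
  then show ?case by (auto simp: act0_def split: list.split)
qed (auto split: list.split)

text \<open>A prefix u shifts the transposition to position \<open>length u\<close>. This brings the
  generators of the ideal, which carry a prefix, into the scope of \<open>symz_actn\<close>.\<close>

lemma lookup_word_mult_tact:
  "Poly_Mapping.lookup (tensor_word u * tact s x) v = actn s (length u) (Poly_Mapping.lookup (tensor_word u * x)) v"
proof (induction u arbitrary: v)
  case Nil
  then show ?case by (simp add: word_Nil tlookup)
next
  case (Cons i u)
  have *: "tensor_word (i # u) * y = letter i * (tensor_word u * y)" for y
    by (simp add: word_mult_word flip: mult.assoc)
  have 0: "actn s r (\<lambda>v. 0 :: complex) w = 0" for r w
    using actn_scale [of s r 0 "\<lambda>_. 0 :: complex" w] by simp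
  show ?case
    by (cases v) (simp_all add: * lookup_letter_mult Cons 0)
qed

lemma tpart_add_all: "\<exists>n. \<forall>m\<ge>n. (\<Sum>k<m. tpart k t) = t"
proof -
  obtain n where n: "\<And>w. w \<in> Poly_Mapping.keys t \<Longrightarrow> length w < n"
    using finite_nat_set_iff_bounded [of "length ` Poly_Mapping.keys t"] by auto
  have "(\<Sum>k<m. tpart k t) = t" if "m \<ge> n" for m
  proof (rule poly_mapping_eqI)
    fix w
    have "length w \<ge> m \<Longrightarrow> Poly_Mapping.lookup t w = 0"
      using n [of w] that by (auto simp: in_keys_iff)
    then show "Poly_Mapping.lookup (\<Sum>k<m. tpart k t) w = Poly_Mapping.lookup t w"
      by (auto simp: lookup_sum tlookup)
  qed
  then show ?thesis by blast
qed

lemma tsym_tdeg: "tsym s (tdeg t) = tdeg (tsym s t)"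
proof (rule poly_mapping_eqI)
  fix w
  have "symz s (length w) (Poly_Mapping.lookup (tdeg t)) w =
      symz s (length w) (\<lambda>v. of_nat (length w) *\<^sub>C Poly_Mapping.lookup t v) w"
    by (rule symz_cong) (simp_all add: tlookup cscale_complex_def)
  then show "Poly_Mapping.lookup (tsym s (tdeg t)) w = Poly_Mapping.lookup (tdeg (tsym s t)) w"
    by (simp add: tlookup symz_scale flip: cscale_complex_def)
qed

lemma tsym_tpart: "tsym s (tpart n t) = tpart n (tsym s t)"
proof (rule poly_mapping_eqI)
  fix w
  have "symz s (length w) (Poly_Mapping.lookup (tpart n t)) w =
      symz s (length w) (\<lambda>v. (if length w = n then 1 else 0) *\<^sub>C Poly_Mapping.lookup t v) w"
    by (rule symz_cong) (simp_all add: tlookup cscale_complex_def)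
  then show "Poly_Mapping.lookup (tsym s (tpart n t)) w = Poly_Mapping.lookup (tpart n (tsym s t)) w"
    by (auto simp: tlookup symz_scale cscale_complex_def)
qed

lemma tpart_mult_letter: "tpart (Suc n) (t * letter i) = tpart n t * letter i"
proof (rule poly_mapping_eqI)
  fix w
  show "Poly_Mapping.lookup (tpart (Suc n) (t * letter i)) w = Poly_Mapping.lookup (tpart n t * letter i) w"
    by (cases w rule: rev_cases) (simp_all add: tlookup lookup_mult_letter)
qed

lemma tpart_mult_letter_0: "tpart 0 (t * letter i) = 0" "tpart 0 (letter i * t) = 0"
  by (rule poly_mapping_eqI, simp add: tlookup lookup_mult_letter lookup_letter_mult)+

lemma tpart_rder: "tpart n (rder i t) = rder i (tpart (Suc n) t)"
  by (rule poly_mapping_eqI) (simp add: tlookup)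

lemma tpart_tpart: "tpart m (tpart n t) = (if m = n then tpart n t else 0)"
  by (rule poly_mapping_eqI) (simp add: tlookup)

lemma tdeg_tpart: "tdeg (tpart n t) = of_nat n *\<^sub>C tpart n t"
  by (rule poly_mapping_eqI) (simp add: tlookup lookup_cscale cscale_complex_def)

lemma lder_euler:
  fixes t :: "'i::finite tensor"
  shows "(\<Sum>i\<in>UNIV. letter i * lder i t) = tdeg t"
proof (rule poly_mapping_eqI)
  fix w
  show "Poly_Mapping.lookup (\<Sum>i\<in>UNIV. letter i * lder i t) w = Poly_Mapping.lookup (tdeg t) w"
    by (cases w) (simp_all add: lookup_sum tlookup lookup_letter_mult)
qed

lemma rder_euler:
  fixes t :: "'i::finite tensor"
  shows "(\<Sum>i\<in>UNIV. rder i t * letter i) = tdeg t"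
proof (rule poly_mapping_eqI)
  fix w
  show "Poly_Mapping.lookup (\<Sum>i\<in>UNIV. rder i t * letter i) w = Poly_Mapping.lookup (tdeg t) w"
    by (cases w rule: rev_cases) (simp_all add: lookup_sum tlookup lookup_mult_letter)
qed

lemma rder_trev: "rder i t = trev (lder i (trev t))"
  by (rule poly_mapping_eqI) (simp add: tlookup)

lemma trev_ideal: "t \<in> braid_ideal s \<Longrightarrow> trev t \<in> braid_ideal (mirror_braid s)"
proof (induction rule: braid_ideal_induct)
  case (gen u a b w)
  have "trev (braid_rel s a b) = braid_rel (mirror_braid s) b a"
    unfolding braid_rel_def mirror_braid_def
    by (subst sum.swap) (simp add: trev.diff trev.sum trev.scale trev_word)
  then show ?case
    using braid_ideal_gen [of "rev w" "mirror_braid s" b a "rev u"] by (simp add: trev_mult trev_word mult.assoc)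
qed (simp_all add: trev.add trev.scale braid_ideal_add braid_ideal_scale braid_ideal_0)

section \<open>Symmetric tensors as normal forms, and twisted Leibniz rules\<close>

context braiding
begin

lemma tsym_word_mult_tact: "tsym s (tensor_word u * tact s x) = tsym s (tensor_word u * x)"
proof (rule poly_mapping_eqI)
  fix w
  let ?f = "Poly_Mapping.lookup (tensor_word u * x)"
  have "symz s (length w) (actn s (length u) ?f) w = symz s (length w) ?f w"
  proof (cases "Suc (length u) < length w")
    case True
    then show ?thesis by (rule symz_actn) simp
  next
    case False
    then show ?thesis by (intro symz_cong actn_short) auto
  qed
  then show "Poly_Mapping.lookup (tsym s (tensor_word u * tact s x)) w = Poly_Mapping.lookup (tsym s (tensor_word u * x)) w"
    by (simp add: tsym.rep_eq lookup_word_mult_tact [abs_def])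
qed

lemma tsym_eq_0: "t \<in> braid_ideal s \<Longrightarrow> tsym s t = 0"
proof (induction rule: braid_ideal_induct)
  case (gen u a b w)
  show ?case by (simp add: mult.assoc braid_rel_mult_word right_diff_distrib tsym.diff tsym_word_mult_tact)
qed (simp_all add: tsym.add tsym.scale)

lemma tsym_eq_0_iff: "tsym s t = 0 \<longleftrightarrow> t \<in> braid_ideal s"
proof
  assume "tsym s t = 0"
  then show "t \<in> braid_ideal s"
    using braid_ideal_scale [OF tsym_ideal [of s t], of "-1"] by simp
qed (rule tsym_eq_0)

lemma tsym_eq_iff: "tsym s t = tsym s t' \<longleftrightarrow> t - t' \<in> braid_ideal s"
  using tsym_eq_0_iff [of "t - t'"] by (simp add: tsym.diff)

lemma tsym_tsym [simp]: "tsym s (tsym s t) = tsym s t"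
  unfolding tsym_eq_iff by (rule tsym_ideal)

text \<open>Since the ideal is two-sided, symmetrizing a factor changes the product only by the
  ideal; so \<open>tsym\<close> of a product is an associative multiplication on normal
  forms.\<close>

lemma tsym_mult_left [simp]: "tsym s (tsym s a * b) = tsym s (a * b)"
  unfolding tsym_eq_iff left_diff_distrib [symmetric] by (intro braid_ideal_mult_right tsym_ideal)

lemma tsym_mult_right [simp]: "tsym s (a * tsym s b) = tsym s (a * b)"
  unfolding tsym_eq_iff right_diff_distrib [symmetric] by (intro braid_ideal_mult_left tsym_ideal)

lemma tsym_fix_iff: "tsym s t = t \<longleftrightarrow> (\<forall>n. symt s n (Poly_Mapping.lookup t))"
proof
  assume t: "tsym s t = t"
  show "\<forall>n. symt s n (Poly_Mapping.lookup t)"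
  proof
    fix n
    have "symt s n (Poly_Mapping.lookup (tsym s t)) = symt s n (symz s n (Poly_Mapping.lookup t))"
      by (rule symt_cong) (simp add: tlookup)
    then show "symt s n (Poly_Mapping.lookup t)" by (simp add: t symt_symz)
  qed
next
  assume "\<forall>n. symt s n (Poly_Mapping.lookup t)"
  then show "tsym s t = t"
    by (intro poly_mapping_eqI) (simp add: tlookup symz_symt)
qed

text \<open>The reversal of a symmetric tensor is symmetric for the mirrored braiding and congruent
  to the reversal of the original tensor, so uniqueness of normal forms applies. The lemma transfers
  statements from the left end to the right end.\<close>

lemma trev_tsym: "trev (tsym s t) = tsym (mirror_braid s) (trev t)"
proof -
  interpret m: braiding "mirror_braid s" by (rule braiding_mirror)
  have "\<forall>n. symt (mirror_braid s) n (Poly_Mapping.lookup (trev (tsym s t)))"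
  proof
    fix n
    have "symt s n (Poly_Mapping.lookup (tsym s t))"
      using tsym_fix_iff [of "tsym s t"] by simp
    from symt_rev [OF this] show "symt (mirror_braid s) n (Poly_Mapping.lookup (trev (tsym s t)))"
      by (simp add: tlookup [abs_def])
  qed
  then have "tsym (mirror_braid s) (trev (tsym s t)) = trev (tsym s t)"
    by (simp add: m.tsym_fix_iff)
  moreover have "tsym (mirror_braid s) (trev (tsym s t - t)) = 0"
    by (intro m.tsym_eq_0 trev_ideal tsym_ideal)
  ultimately show ?thesis by (simp add: trev.diff tsym.diff)
qed

lemma tsym_lder:
  assumes "tsym s a = a" shows "tsym s (lder i a) = lder i a"
  unfolding tsym_fix_iff
proof
  fix n
  have "symt s (Suc n) (Poly_Mapping.lookup a)" using assms tsym_fix_iff by blast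
  then have "symt s n (\<lambda>w. of_nat (Suc n) *\<^sub>C Poly_Mapping.lookup a (i # w))"
    by (intro symt_scale symt_Cons)
  also have "?this = symt s n (Poly_Mapping.lookup (lder i a))"
    by (rule symt_cong) (simp add: tlookup cscale_complex_def)
  finally show "symt s n (Poly_Mapping.lookup (lder i a))" .
qed

text \<open>As a is symmetric, the symmetrizer on the tail does nothing and only the outer insertion
  is left. Multiplying by the length avoids the inverse in the average.\<close>

lemma tsym_letter_mult:
  assumes "tsym s a = a"
  shows "of_nat (length w) * Poly_Mapping.lookup (tsym s (letter i * a)) w =
    ins s (Poly_Mapping.lookup (letter i * a)) w"
proof (cases w)
  case (Cons j v)
  let ?n = "length v"
  have "ins s (\<lambda>u. case u of [] \<Rightarrow> 0 | k # u \<Rightarrow> symz s ?n (\<lambda>u. Poly_Mapping.lookup (letter i * a) (k # u)) u) w =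
      ins s (Poly_Mapping.lookup (letter i * a)) w"
  proof (rule ins_cong)
    fix u :: "'i list" assume u: "length u = length w"
    then obtain k u' where [simp]: "u = k # u'" "length u' = ?n" using Cons by (cases u) auto
    have "symz s ?n (Poly_Mapping.lookup a) u' = Poly_Mapping.lookup a u'"
      using assms by (intro symz_symt) (auto simp: tsym_fix_iff)
    then show "(case u of [] \<Rightarrow> 0 | k # u \<Rightarrow> symz s ?n (\<lambda>u. Poly_Mapping.lookup (letter i * a) (k # u)) u) =
        Poly_Mapping.lookup (letter i * a) u"
      by (simp add: lookup_letter_mult)
  qed
  moreover have "length w = Suc ?n" by (simp add: Cons)
  ultimately show ?thesis
    by (simp add: tlookup cscale_complex_def mult.assoc [symmetric] del: of_nat_Suc)
qed simp

text \<open>A twisted Leibniz rule: either the letter i stays in front and is removed, or s carries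
  i z to j y, so that the derivative falls on a and the letter y remains.\<close>

lemma lder_letter_mult:
  assumes a: "tsym s a = a"
  shows "lder j (tsym s (letter i * a)) =
    (if i = j then a else 0) + (\<Sum>z\<in>UNIV. \<Sum>y\<in>UNIV. s i z j y *\<^sub>C tsym s (letter y * lder z a))"
proof (rule poly_mapping_eqI)
  fix w :: "'i list"
  let ?a = "Poly_Mapping.lookup a"
  have "Poly_Mapping.lookup (lder j (tsym s (letter i * a))) w = ins s (Poly_Mapping.lookup (letter i * a)) (j # w)"
    using tsym_letter_mult [OF a, of "j # w" i] by (simp add: lder.rep_eq)
  also have "\<dots> = (if i = j then ?a w else 0) +
      ins s (\<lambda>v. act0 s (Poly_Mapping.lookup (letter i * a)) (j # v)) w"
    by (simp add: lookup_letter_mult)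
  also have "ins s (\<lambda>v. act0 s (Poly_Mapping.lookup (letter i * a)) (j # v)) w =
      Poly_Mapping.lookup (\<Sum>z\<in>UNIV. \<Sum>y\<in>UNIV. s i z j y *\<^sub>C tsym s (letter y * lder z a)) w"
  proof (cases w)
    case Nil
    then show ?thesis by (simp add: lookup_sum lookup_cscale tlookup lookup_letter_mult)
  next
    case (Cons k v)
    let ?n = "of_nat (length w) :: complex"
    \<comment> \<open>Multiplication by the length of w turns \<open>tsym\<close> into
      \<open>ins\<close> on one side; the same factor appears on the other side as the weight of
      \<open>lder z a\<close>, and can be cancelled.\<close>
    have n: "?n \<noteq> 0" by (simp add: Cons del: of_nat_Suc)
    have "?n * Poly_Mapping.lookup (\<Sum>z\<in>UNIV. \<Sum>y\<in>UNIV. s i z j y *\<^sub>C tsym s (letter y * lder z a)) w =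
        (\<Sum>z\<in>UNIV. \<Sum>y\<in>UNIV. s i z j y *\<^sub>C (?n * Poly_Mapping.lookup (tsym s (letter y * lder z a)) w))"
      by (simp add: lookup_sum lookup_cscale cscale_complex_def sum_distrib_left mult_ac)
    also have "\<dots> = (\<Sum>z\<in>UNIV. \<Sum>y\<in>UNIV. s i z j y *\<^sub>C ins s (Poly_Mapping.lookup (letter y * lder z a)) w)"
      by (simp only: tsym_letter_mult [OF tsym_lder [OF a]])
    also have "\<dots> = ins s (\<lambda>v. \<Sum>z\<in>UNIV. \<Sum>y\<in>UNIV. s i z j y *\<^sub>C Poly_Mapping.lookup (letter y * lder z a) v) w"
      by (simp add: ins_sum ins_scale)
    also have "\<dots> = ins s (\<lambda>v. ?n *\<^sub>C act0 s (Poly_Mapping.lookup (letter i * a)) (j # v)) w"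
    proof (rule ins_cong)
      fix u :: "'i list" assume u: "length u = length w"
      then obtain y u' where [simp]: "u = y # u'" and n: "?n = of_nat (Suc (length u'))" using Cons by (cases u) auto
      have "(\<Sum>z\<in>UNIV. \<Sum>y'\<in>UNIV. s i z j y' *\<^sub>C Poly_Mapping.lookup (letter y' * lder z a) u) =
          (\<Sum>z\<in>UNIV. \<Sum>y'\<in>UNIV. if y' = y then s i z j y' * (?n * ?a (z # u')) else 0)"
        unfolding n by (intro sum.cong) (auto simp: lookup_letter_mult tlookup cscale_complex_def)
      also have "\<dots> = (\<Sum>z\<in>UNIV. s i z j y * (?n * ?a (z # u')))" by simp
      also have "\<dots> = ?n * (\<Sum>z\<in>UNIV. s i z j y * ?a (z # u'))" by (simp add: sum_distrib_left mult_ac)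
      also have "(\<Sum>z\<in>UNIV. s i z j y * ?a (z # u')) =
          (\<Sum>x\<in>UNIV. if i = x then \<Sum>z\<in>UNIV. s x z j y * ?a (z # u') else 0)" by simp
      also have "\<dots> = act0 s (Poly_Mapping.lookup (letter i * a)) (j # u)"
        unfolding \<open>u = y # u'\<close> act0_simps by (rule sum.cong) (simp_all add: lookup_letter_mult cscale_complex_def)
      finally show "(\<Sum>z\<in>UNIV. \<Sum>y'\<in>UNIV. s i z j y' *\<^sub>C Poly_Mapping.lookup (letter y' * lder z a) u) =
          ?n *\<^sub>C act0 s (Poly_Mapping.lookup (letter i * a)) (j # u)"
        by (simp only: cscale_complex_def)
    qed
    also have "\<dots> = ?n *\<^sub>C ins s (\<lambda>v. act0 s (Poly_Mapping.lookup (letter i * a)) (j # v)) w"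
      by (rule ins_scale)
    also have "\<dots> = ?n * ins s (\<lambda>v. act0 s (Poly_Mapping.lookup (letter i * a)) (j # v)) w"
      by (rule cscale_complex_def)
    finally show ?thesis using n by simp
  qed
  finally show "Poly_Mapping.lookup (lder j (tsym s (letter i * a))) w =
      Poly_Mapping.lookup ((if i = j then a else 0) +
        (\<Sum>z\<in>UNIV. \<Sum>y\<in>UNIV. s i z j y *\<^sub>C tsym s (letter y * lder z a))) w"
    by (simp add: lookup_add)
qed

lemma tsym_rder:
  assumes "tsym s a = a" shows "tsym s (rder i a) = rder i a"
proof -
  interpret m: braiding "mirror_braid s" by (rule braiding_mirror)
  have "tsym (mirror_braid s) (trev a) = trev a" using trev_tsym [of a] assms by simp
  from m.tsym_lder [OF this, of i] have "tsym (mirror_braid s) (trev (rder i a)) = trev (rder i a)"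
    by (simp add: rder_trev)
  then show ?thesis using trev_tsym [of "rder i a"] by (metis trev_trev)
qed

text \<open>The rule for \<open>lder\<close> and the mirrored braiding, read backwards.\<close>

lemma rder_mult_letter:
  assumes a: "tsym s a = a"
  shows "rder k (tsym s (a * letter i)) =
    (if i = k then a else 0) + (\<Sum>z\<in>UNIV. \<Sum>y\<in>UNIV. s z i y k *\<^sub>C tsym s (rder z a * letter y))"
proof -
  interpret m: braiding "mirror_braid s" by (rule braiding_mirror)
  have a': "tsym (mirror_braid s) (trev a) = trev a" using trev_tsym [of a] assms by simp
  have "trev (tsym s (rder z a * letter y)) = tsym (mirror_braid s) (letter y * lder z (trev a))" for z y
    by (simp add: trev_tsym trev_mult trev_word rder_trev)
  then have tr: "trev (tsym (mirror_braid s) (letter y * lder z (trev a))) = tsym s (rder z a * letter y)" for z y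
    by (metis trev_trev)
  have "rder k (tsym s (a * letter i)) = trev (lder k (tsym (mirror_braid s) (letter i * trev a)))"
    by (simp add: rder_trev trev_tsym trev_mult trev_word)
  also have "\<dots> = (if i = k then a else 0) +
      (\<Sum>z\<in>UNIV. \<Sum>y\<in>UNIV. mirror_braid s i z k y *\<^sub>C tsym s (rder z a * letter y))"
    unfolding m.lder_letter_mult [OF a'] by (simp add: trev.add trev.sum trev.scale tr)
  finally show ?thesis by (simp add: mirror_braid_def)
qed

lemma tsym_euler_left: "tsym s a = a \<Longrightarrow> (\<Sum>i\<in>UNIV. tsym s (letter i * lder i a)) = tdeg a"
  by (simp add: tsym.sum [symmetric] lder_euler tsym_tdeg)

lemma tsym_euler_right: "tsym s a = a \<Longrightarrow> (\<Sum>i\<in>UNIV. tsym s (rder i a * letter i)) = tdeg a"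
  by (simp add: tsym.sum [symmetric] rder_euler tsym_tdeg)

end

section \<open>The quadratic algebra of a braiding\<close>

text \<open>As s is an involution, its eigenspace for -1 is the image of 1 - s, the span of the
  \<open>braid_rel\<close>. The eigenspace form makes the annihilator easy to determine.\<close>

definition braid_space :: "'i::finite braid \<Rightarrow> 'i tensor set" where
  "braid_space s = {t \<in> tensor_degree 2. tact s t = - t}"

abbreviation braid_algebra :: "'i::finite braid \<Rightarrow> 'i tensor set ring" where
  "braid_algebra s \<equiv> quadratic_algebra (braid_space s)"

abbreviation cls :: "'i::finite braid \<Rightarrow> 'i tensor \<Rightarrow> 'i tensor set" where
  "cls s \<equiv> quadratic_class (braid_space s)"

text \<open>Every class contains exactly one tensor fixed by \<open>tsym\<close>, and \<open>rep\<close> selects it.\<close>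

definition rep :: "'i::finite braid \<Rightarrow> 'i tensor set \<Rightarrow> 'i tensor" where
  "rep s a = tsym s (SOME t. cls s t = a)"

lemma tensor_algebra_simps [simp]:
  "carrier tensor_algebra = UNIV" "x \<oplus>\<^bsub>tensor_algebra\<^esub> y = x + y" "x \<otimes>\<^bsub>tensor_algebra\<^esub> y = x * y"
  "\<zero>\<^bsub>tensor_algebra\<^esub> = 0" "\<one>\<^bsub>tensor_algebra\<^esub> = 1"
  by (simp_all add: ring_of_type_algebra_def)

lemma ring_tensor_algebra: "ring (tensor_algebra :: 'i tensor ring)"
proof -
  have "\<exists>y. x + y = 0" for x :: "'i tensor" using add.right_inverse by blast
  then show ?thesis
    unfolding ring_of_type_algebra_def using add.right_inverse
    by unfold_locales (auto simp: algebra_simps Units_def)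
qed

lemma braid_ideal_uminus: "x \<in> braid_ideal s \<Longrightarrow> - x \<in> braid_ideal s"
  using braid_ideal_scale [of x s "-1"] by simp

lemma ideal_braid_ideal: "ideal (braid_ideal s) tensor_algebra"
proof (rule idealI [OF ring_tensor_algebra])
  interpret ring "tensor_algebra :: 'a tensor ring" by (rule ring_tensor_algebra)
  have "\<ominus>\<^bsub>tensor_algebra\<^esub> x = - x" for x :: "'a tensor"
    by (rule minus_equality) simp_all
  then have inv: "inv\<^bsub>add_monoid tensor_algebra\<^esub> x = - x" for x :: "'a tensor"
    by (simp add: a_inv_def)
  show "subgroup (braid_ideal s) (add_monoid tensor_algebra)"
  proof (rule subgroup.intro)
    show "inv\<^bsub>add_monoid tensor_algebra\<^esub> x \<in> braid_ideal s" if "x \<in> braid_ideal s" for x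
      unfolding inv using that by (rule braid_ideal_uminus)
  qed (simp_all add: braid_ideal_add braid_ideal_0)
qed (simp_all add: braid_ideal_mult_left braid_ideal_mult_right)

context braiding
begin

lemma tact_tact: "tact s (tact s t) = t"
  by (rule poly_mapping_eqI) (simp add: tact.rep_eq act0_act0)

lemma braid_rel_space: "braid_rel s a b \<in> braid_space s"
proof -
  have eq: "braid_rel s a b = tensor_word [a, b] - tact s (tensor_word [a, b])"
    using braid_rel_mult_word [of s a b "[]"] by (simp add: word_Nil)
  have "tensor_word [a, b] \<in> tensor_degree 2" using word_degree [of "[a, b]"] by (simp add: numeral_2_eq_2)
  moreover from this have "tact s (tensor_word [a, b]) \<in> tensor_degree 2" by (rule tact_degree)
  ultimately have "braid_rel s a b \<in> tensor_degree 2"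
    by (simp add: eq tensor_degree_iff lookup_minus)
  then show ?thesis by (simp add: braid_space_def eq tact.diff tact_tact)
qed

lemma braid_space_ideal: "braid_space s \<subseteq> braid_ideal s"
proof
  fix t assume "t \<in> braid_space s"
  \<comment> \<open>On the eigenspace s t - t = -2 t.\<close>
  then have "t = - (1 / 2) *\<^sub>C (tact s t - t)"
    by (simp add: braid_space_def cvec.scale_right_diff_distrib flip: cscale_left_distrib)
  then show "t \<in> braid_ideal s" using braid_ideal_scale [OF tact_ideal] by metis
qed

lemma quadratic_ideal_braid: "quadratic_ideal (braid_space s) = braid_ideal s"
proof
  interpret T: ring "tensor_algebra :: 'i tensor ring" by (rule ring_tensor_algebra)
  show "quadratic_ideal (braid_space s) \<subseteq> braid_ideal s"
    unfolding quadratic_ideal_def by (intro T.genideal_minimal ideal_braid_ideal braid_space_ideal)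
  let ?I = "Idl\<^bsub>tensor_algebra\<^esub> (braid_space s)"
  interpret I: ideal ?I tensor_algebra by (rule T.genideal_ideal) simp
  have sub: "braid_space s \<subseteq> ?I" by (rule T.genideal_self) simp
  have mult: "x * t \<in> ?I" "t * x \<in> ?I" if "t \<in> ?I" for x t
    using I.I_l_closed [OF that, of x] I.I_r_closed [OF that, of x] by simp_all
  show "braid_ideal s \<subseteq> quadratic_ideal (braid_space s)"
    unfolding quadratic_ideal_def
  proof
    fix t assume "t \<in> braid_ideal s"
    then show "t \<in> ?I"
    proof (induction rule: braid_ideal_induct)
      case zero
      then show ?case using I.zero_closed by simp
    next
      case (add x y)
      then show ?case using I.a_closed by simp
    next
      case (scale c x)
      then show ?case using mult(1) [of x "tensor_const c"] by (simp add: const_mult)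
    next
      case (gen u a b w)
      show ?case using braid_rel_space sub by (intro mult) auto
    qed
  qed
qed

sublocale A: ring "braid_algebra s"
  unfolding quadratic_algebra_def quadratic_ideal_braid
  by (rule ideal.quotient_is_ring [OF ideal_braid_ideal])

lemma cls_hom: "ring_hom_ring tensor_algebra (braid_algebra s) (cls s)"
  using ideal.rcos_ring_hom_ring [OF ideal_braid_ideal, of s]
  unfolding quadratic_algebra_def quadratic_class_def [abs_def] quadratic_ideal_braid .

sublocale cls: ring_hom_ring tensor_algebra "braid_algebra s" "cls s"
  by (rule cls_hom)

lemma cls_closed [simp]: "cls s t \<in> carrier (braid_algebra s)"
  using cls.hom_closed by simp

lemma cls_add: "cls s x \<oplus>\<^bsub>braid_algebra s\<^esub> cls s y = cls s (x + y)"
  using cls.hom_add [of x y] by simp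

lemma cls_mult: "cls s x \<otimes>\<^bsub>braid_algebra s\<^esub> cls s y = cls s (x * y)"
  using cls.hom_mult [of x y] by simp

lemma cls_zero: "\<zero>\<^bsub>braid_algebra s\<^esub> = cls s 0"
  using cls.hom_zero by simp

lemma cls_one: "\<one>\<^bsub>braid_algebra s\<^esub> = cls s 1"
  using cls.hom_one by simp

lemma cls_finsum: "finite Y \<Longrightarrow> finsum (braid_algebra s) (\<lambda>x. cls s (f x)) Y = cls s (\<Sum>x\<in>Y. f x)"
  by (induction Y rule: finite_induct) (simp_all add: cls_zero cls_add A.finsum_insert)

text \<open>The ideal is the kernel of \<open>tsym\<close>, so equality of cosets becomes a
  computation with symmetrizers.\<close>

lemma cls_eq_iff: "cls s x = cls s y \<longleftrightarrow> tsym s x = tsym s y"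
proof -
  interpret I: ideal "braid_ideal s" tensor_algebra by (rule ideal_braid_ideal)
  have "cls s x = cls s y \<longleftrightarrow> x - y \<in> braid_ideal s"
  proof
    assume eq: "cls s x = cls s y"
    have "x \<in> braid_ideal s +>\<^bsub>tensor_algebra\<^esub> y"
      using I.a_rcos_self [of x] eq by (simp add: quadratic_class_def quadratic_ideal_braid)
    then show "x - y \<in> braid_ideal s" by (auto simp: a_r_coset_def r_coset_def)
  next
    assume "x - y \<in> braid_ideal s"
    then have "x \<in> braid_ideal s +>\<^bsub>tensor_algebra\<^esub> y"
      by (auto simp: a_r_coset_def r_coset_def intro!: bexI [of _ "x - y"])
    then show "cls s x = cls s y"
      using I.a_repr_independence' [of x y] by (simp add: quadratic_class_def quadratic_ideal_braid)
  qed
  then show ?thesis by (simp add: tsym_eq_iff)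
qed

lemma carrier_cls: "carrier (braid_algebra s) = range (cls s)"
  unfolding quadratic_algebra_def quadratic_class_def
  by (auto simp: FactRing_def A_RCOSETS_def RCOSETS_def a_r_coset_def)

lemma rep_cls [simp]: "rep s (cls s t) = tsym s t"
  unfolding rep_def using someI [of "\<lambda>t'. cls s t' = cls s t" t] cls_eq_iff by blast

lemma cls_tsym [simp]: "cls s (tsym s t) = cls s t"
  by (simp add: cls_eq_iff)

lemma cls_rep [simp]: "a \<in> carrier (braid_algebra s) \<Longrightarrow> cls s (rep s a) = a"
  by (auto simp: carrier_cls)

lemma tsym_rep: "a \<in> carrier (braid_algebra s) \<Longrightarrow> tsym s (rep s a) = rep s a"
  by (auto simp: carrier_cls)

lemma rep_add: "a \<in> carrier (braid_algebra s) \<Longrightarrow> b \<in> carrier (braid_algebra s) \<Longrightarrow>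
    rep s (a \<oplus>\<^bsub>braid_algebra s\<^esub> b) = rep s a + rep s b"
  by (auto simp: carrier_cls cls_add tsym.add)

lemma rep_mult: "a \<in> carrier (braid_algebra s) \<Longrightarrow> b \<in> carrier (braid_algebra s) \<Longrightarrow>
    rep s (a \<otimes>\<^bsub>braid_algebra s\<^esub> b) = tsym s (rep s a * rep s b)"
  by (auto simp: carrier_cls cls_mult)

lemma rep_zero [simp]: "rep s \<zero>\<^bsub>braid_algebra s\<^esub> = 0"
  by (simp add: cls_zero)

lemma tsym_1 [simp]: "tsym s (tensor_const c) = tensor_const c"
proof (rule poly_mapping_eqI)
  fix w
  have c: "tensor_const c \<in> tensor_degree 0" by (simp add: tensor_degree_iff tensor_const_def lookup_single)
  show "Poly_Mapping.lookup (tsym s (tensor_const c)) w = Poly_Mapping.lookup (tensor_const c) w"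
  proof (cases w)
    case Nil
    then show ?thesis by (simp add: tlookup)
  next
    case (Cons i v)
    then show ?thesis using c tsym_degree [OF c, of s] unfolding tensor_degree_iff by (metis length_0_conv list.distinct(1))
  qed
qed

lemma cls_one_neq_zero: "\<one>\<^bsub>braid_algebra s\<^esub> \<noteq> \<zero>\<^bsub>braid_algebra s\<^esub>"
proof -
  have "tsym s 1 = (1 :: 'i tensor)" using tsym_1 [of 1] by (simp add: tensor_const_def flip: zero_list_def)
  then show ?thesis by (simp add: cls_one cls_zero cls_eq_iff)
qed

subsection \<open>Hilbert series\<close>

text \<open>The dimension in \<open>quadratic_dim\<close> is taken over a subfield of the ring; here
  it is the image of the complex numbers, a field because 1 and 0 differ in the algebra.\<close>

lemma subfield_scalars: "subfield (quadratic_scalars (braid_space s)) (braid_algebra s)"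
proof -
  interpret C: field "ring_of_type_algebra :: complex ring" by (rule field_from_type_algebra)
  interpret h: ring_hom_ring "ring_of_type_algebra :: complex ring" "braid_algebra s" "\<lambda>c. cls s (tensor_const c)"
  proof (rule ring_hom_ringI2)
    show "(\<lambda>c. cls s (tensor_const c)) \<in> ring_hom ring_of_type_algebra (braid_algebra s)"
      by (rule ring_hom_memI)
        (simp_all add: ring_of_type_algebra_def cls_add cls_mult cls_one tensor_const_def single_add
          mult_single plus_list_def word_Nil [unfolded tensor_word_def])
  qed (unfold_locales)
  show ?thesis
    using h.img_is_subfield(2) [OF C.carrier_is_subfield cls_one_neq_zero]
    by (simp add: quadratic_scalars_def ring_of_type_algebra_def)
qed

definition sym_degree :: "nat \<Rightarrow> 'i tensor set" where
  "sym_degree n = tsym s ` tensor_degree n"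

lemma subspace_tensor_degree: "cvec.subspace (tensor_degree n :: 'i tensor set)"
  by (auto simp: cvec.subspace_def tensor_degree_iff lookup_add lookup_cscale)

lemma sym_degree_iff: "t \<in> sym_degree n \<longleftrightarrow> t \<in> tensor_degree n \<and> tsym s t = t"
  unfolding sym_degree_def by (auto simp: tsym_degree intro: image_eqI [of _ _ t])

lemma subspace_sym_degree: "cvec.subspace (sym_degree n)"
  using subspace_tensor_degree [of n] unfolding cvec.subspace_def
  by (auto simp: sym_degree_iff tsym.add tsym.scale)

text \<open>\<open>A.dimension\<close> grows by line extensions, which correspond to adding one
  vector to an independent set. As \<open>cls\<close> is injective on symmetric tensors,
  independence carries over.\<close>

lemma dimension_cls_span:
  assumes "finite B" "cvec.independent B" "\<And>b. b \<in> B \<Longrightarrow> tsym s b = b"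
  shows "A.dimension (card B) (quadratic_scalars (braid_space s)) (cls s ` cvec.span B)"
  using assms
proof (induction B rule: finite_induct)
  case empty
  have "cls s ` cvec.span {} = {\<zero>\<^bsub>braid_algebra s\<^esub>}" by (simp add: cls_zero)
  then show ?case by (metis A.zero_dim card.empty)
next
  case (insert b B)
  let ?K = "quadratic_scalars (braid_space s)"
  have ind: "cvec.independent B" "b \<notin> cvec.span B"
    using insert.prems(1) insert.hyps(2) by (simp_all add: cvec.independent_insert)
  have fx: "tsym s t = t" if "t \<in> cvec.span B" for t
    using that
    by (induction rule: cvec.span_induct_alt) (use insert.prems in \<open>auto simp: tsym.add tsym.scale\<close>)
  have "cls s b \<notin> cls s ` cvec.span B"
    using ind(2) fx insert.prems(2) [of b] by (auto simp: cls_eq_iff)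
  then have "A.dimension (Suc (card B)) ?K (A.line_extension ?K (cls s b) (cls s ` cvec.span B))"
    using insert ind by (intro A.Suc_dim) auto
  moreover have "A.line_extension ?K (cls s b) (cls s ` cvec.span B) = cls s ` cvec.span (insert b B)"
  proof -
    have "A.line_extension ?K (cls s b) (cls s ` cvec.span B) =
        {cls s (c *\<^sub>C b + t) | c t. t \<in> cvec.span B}"
      unfolding A.line_extension_def set_add_def' r_coset_def quadratic_scalars_def
      by (auto simp: cls_add cls_mult const_mult)
    also have "\<dots> = cls s ` cvec.span (insert b B)"
    proof (intro Set.set_eqI iffI)
      fix x assume "x \<in> cls s ` cvec.span (insert b B)"
      then obtain t c where "x = cls s t" "t - c *\<^sub>C b \<in> cvec.span B"
        by (auto simp: cvec.span_insert)
      then show "x \<in> {cls s (c *\<^sub>C b + t) | c t. t \<in> cvec.span B}"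
        by (auto intro!: exI [of _ c] exI [of _ "t - c *\<^sub>C b"])
    next
      fix x assume "x \<in> {cls s (c *\<^sub>C b + t) | c t. t \<in> cvec.span B}"
      then obtain c t where x: "x = cls s (c *\<^sub>C b + t)" and "t \<in> cvec.span B" by blast
      then have "c *\<^sub>C b + t - c *\<^sub>C b \<in> cvec.span B" by simp
      then have "c *\<^sub>C b + t \<in> cvec.span (insert b B)" unfolding cvec.span_insert by blast
      then show "x \<in> cls s ` cvec.span (insert b B)" unfolding x by (rule imageI)
    qed
    finally show ?thesis .
  qed
  ultimately show ?case using insert by simp
qed

text \<open>The trace of a projection is its rank: if the projections of the words are expanded in a
  basis B of the image and the sums exchanged, each b contributes its own coordinate in
  \<open>tsym s b\<close>, which is 1 because b is fixed.\<close>

lemma sym_degree_basis: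
  obtains B where "finite B" "cvec.independent B" "cvec.span B = sym_degree n" "symz_trace s n = of_nat (card B)"
proof -
  obtain B where B: "B \<subseteq> sym_degree n" "cvec.independent B" "sym_degree n \<subseteq> cvec.span B"
    using cvec.maximal_independent_subset by blast
  have span: "cvec.span B = sym_degree n"
    using B cvec.span_minimal [OF B(1) subspace_sym_degree] by blast
  have expand: "t = (\<Sum>w\<in>words n. Poly_Mapping.lookup t w *\<^sub>C tensor_word w)" if "t \<in> tensor_degree n" for t :: "'i tensor"
    using that
    by (intro poly_mapping_eqI)
      (auto simp: lookup_sum lookup_cscale lookup_word cscale_complex_def mult_delta_right tensor_degree_iff mem_words)
  have "B \<subseteq> cvec.span (tensor_word ` words n)"
  proof
    fix t assume "t \<in> B"
    then have "t \<in> tensor_degree n" using B(1) by (auto simp: sym_degree_iff)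
    have "(\<Sum>w\<in>words n. Poly_Mapping.lookup t w *\<^sub>C tensor_word w) \<in> cvec.span (tensor_word ` words n)"
      by (intro cvec.span_sum cvec.span_scale cvec.span_base imageI)
    then show "t \<in> cvec.span (tensor_word ` words n)"
      by (simp only: expand [OF \<open>t \<in> tensor_degree n\<close>, symmetric])
  qed
  from cvec.independent_span_bound [OF finite_imageI [OF finite_words] B(2) this]
  have fin: "finite B" by simp
  have "symz_trace s n = of_nat (card B)"
  proof -
    define \<rho> where "\<rho> t b = cvec.representation B (tsym s t) b" for t b
    have mem: "tsym s t \<in> cvec.span B" if "t \<in> tensor_degree n" for t
      unfolding span using that by (auto simp: sym_degree_def)
    have wd: "tensor_word w \<in> tensor_degree n" if "w \<in> words n" for w :: "'i list"
      using that word_degree [of w] by (simp add: words_def)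
    have "symz_trace s n = (\<Sum>w\<in>words n. Poly_Mapping.lookup (tsym s (tensor_word w)) w)"
    proof -
      have "Poly_Mapping.lookup (tensor_word w) = (\<lambda>v. if v = w then 1 else 0)" for w :: "'i list"
        by (rule ext) (auto simp: lookup_word)
      then show ?thesis
        unfolding symz_trace_def by (intro sum.cong) (simp_all add: tsym.rep_eq mem_words)
    qed
    also have "\<dots> = (\<Sum>w\<in>words n. \<Sum>b\<in>B. \<rho> (tensor_word w) b * Poly_Mapping.lookup b w)"
    proof (rule sum.cong [OF refl])
      fix w :: "'i list" assume "w \<in> words n"
      from cvec.sum_representation_eq [OF B(2) mem [OF wd [OF this]] fin subset_refl]
      have "tsym s (tensor_word w) = (\<Sum>b\<in>B. \<rho> (tensor_word w) b *\<^sub>C b)" by (simp add: \<rho>_def)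
      then have "Poly_Mapping.lookup (tsym s (tensor_word w)) w =
          Poly_Mapping.lookup (\<Sum>b\<in>B. \<rho> (tensor_word w) b *\<^sub>C b) w" by simp
      then show "Poly_Mapping.lookup (tsym s (tensor_word w)) w =
          (\<Sum>b\<in>B. \<rho> (tensor_word w) b * Poly_Mapping.lookup b w)"
        by (simp add: lookup_sum lookup_cscale cscale_complex_def)
    qed
    also have "\<dots> = (\<Sum>b\<in>B. \<Sum>w\<in>words n. Poly_Mapping.lookup b w * \<rho> (tensor_word w) b)"
      by (subst sum.swap) (simp add: mult.commute)
    also have "\<dots> = (\<Sum>b\<in>B. 1)"
    proof (rule sum.cong [OF refl])
      fix b assume b: "b \<in> B"
      have bd: "b \<in> tensor_degree n" "tsym s b = b" using b B(1) by (auto simp: sym_degree_iff)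
      have "tsym s b = (\<Sum>w\<in>words n. Poly_Mapping.lookup b w *\<^sub>C tsym s (tensor_word w))"
        by (subst expand [OF bd(1)]) (simp add: tsym.sum tsym.scale)
      then have "cvec.representation B b b = cvec.representation B (\<Sum>w\<in>words n. Poly_Mapping.lookup b w *\<^sub>C tsym s (tensor_word w)) b"
        by (simp add: bd)
      also have "\<dots> = (\<Sum>w\<in>words n. Poly_Mapping.lookup b w * \<rho> (tensor_word w) b)"
        by (simp add: cvec.representation_sum [OF B(2)] cvec.representation_scale [OF B(2)] \<rho>_def
            mem wd cvec.span_scale)
      finally show "(\<Sum>w\<in>words n. Poly_Mapping.lookup b w * \<rho> (tensor_word w) b) = 1"
        by (simp add: cvec.representation_basis [OF B(2) b])
    qed
    finally show ?thesis by simp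
  qed
  then show ?thesis using that fin B(2) span by blast
qed

lemma quadratic_dim_braid: "of_nat (quadratic_dim (braid_space s) n) = symz_trace s n"
proof -
  obtain B where fin: "finite B" and B: "cvec.independent B" and span: "cvec.span B = sym_degree n"
    and tr: "symz_trace s n = of_nat (card B)"
    by (rule sym_degree_basis)
  have "B \<subseteq> sym_degree n" using span cvec.span_superset by blast
  then have fxB: "tsym s b = b" if "b \<in> B" for b using that by (auto simp: sym_degree_iff)
  have "quadratic_degree (braid_space s) n = cls s ` cvec.span B"
    unfolding span sym_degree_def quadratic_degree_def by (simp add: image_image)
  then have "A.dimension (card B) (quadratic_scalars (braid_space s)) (quadratic_degree (braid_space s) n)"
    using dimension_cls_span [OF fin B fxB] by simp
  then have "quadratic_dim (braid_space s) n = card B"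
    unfolding quadratic_dim_def
    using A.dimension_is_inj [OF subfield_scalars] by (intro the_equality)
  then show ?thesis using tr by simp
qed

lemma quadratic_dim_0: "quadratic_dim (braid_space s) 0 = 1"
  using quadratic_dim_braid [of 0] by simp

lemma quadratic_dim_Suc:
  assumes "\<And>b y. (\<Sum>j\<in>UNIV. s j b j y) = (if b = y then of_int c else 0)"
  shows "int (Suc n) * int (quadratic_dim (braid_space s) (Suc n)) =
    (int CARD('i) + c * int n) * int (quadratic_dim (braid_space s) n)"
proof -
  have "complex_of_int (int (Suc n) * int (quadratic_dim (braid_space s) (Suc n))) =
      of_int ((int CARD('i) + c * int n) * int (quadratic_dim (braid_space s) n))"
    using symz_trace_Suc [OF assms, of n] by (simp add: quadratic_dim_braid)
  then show ?thesis by (simp only: of_int_eq_iff)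
qed

text \<open>The recursion gives the coefficients N (N + 1) ... (N + n - 1) / n!. By Pascal's rule
  for them, multiplication by 1 - X lowers N by one.\<close>

lemma poincare_series_plus:
  assumes "\<And>b y. (\<Sum>j\<in>UNIV. s j b j y) = (if b = y then 1 else 0)"
  shows "poincare_series (braid_space s) = 1 / (1 - fps_X) ^ CARD('i)"
proof -
  let ?F = "\<lambda>N. Abs_fps (\<lambda>n. pochhammer (of_nat N) n / fact n) :: real fps"
  have "real (quadratic_dim (braid_space s) n) = pochhammer (of_nat CARD('i)) n / fact n" for n
  proof (induction n)
    case (Suc n)
    have "real_of_int (int (Suc n) * int (quadratic_dim (braid_space s) (Suc n))) =
        real_of_int ((int CARD('i) + 1 * int n) * int (quadratic_dim (braid_space s) n))"
      by (subst quadratic_dim_Suc [of 1]) (simp_all add: assms)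
    then have "real (quadratic_dim (braid_space s) (Suc n)) =
        (real CARD('i) + real n) * real (quadratic_dim (braid_space s) n) / real (Suc n)"
      by (simp add: nonzero_eq_divide_eq mult.commute del: of_nat_Suc)
    then show ?case unfolding Suc by (simp add: pochhammer_Suc mult.commute)
  qed (simp add: quadratic_dim_0)
  then have P: "poincare_series (braid_space s) = ?F CARD('i)"
    by (simp add: poincare_series_def)
  have rec: "?F (Suc N) * (1 - fps_X) = ?F N" for N
  proof (rule fps_ext)
    fix n
    show "(?F (Suc N) * (1 - fps_X)) $ n = ?F N $ n"
    proof (cases n)
      case (Suc m)
      have "pochhammer (real (Suc N)) (Suc m) / fact (Suc m) - pochhammer (real (Suc N)) m / fact m =
          pochhammer (real N) (Suc m) / fact (Suc m)"
      proof -
        have e1: "pochhammer (real (Suc N)) (Suc m) = pochhammer (real (Suc N)) m * (real (Suc N) + real m)"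
          by (rule pochhammer_Suc)
        have e2: "pochhammer (real N) (Suc m) = real N * pochhammer (real (Suc N)) m"
          by (simp add: pochhammer_rec add.commute)
        have e3: "q / fact m = q * real (Suc m) / fact (Suc m)" for q :: real
          by (simp del: of_nat_Suc)
        show ?thesis unfolding e1 e2 e3 diff_divide_distrib [symmetric] by (simp add: algebra_simps)
      qed
      then show ?thesis by (simp add: Suc algebra_simps)
    qed simp
  qed
  have "?F N * (1 - fps_X) ^ N = 1" for N
  proof (induction N)
    case 0
    show ?case by (rule fps_ext) (simp add: pochhammer_0_left)
  next
    case (Suc N)
    have "?F (Suc N) * (1 - fps_X) ^ Suc N = (?F (Suc N) * (1 - fps_X)) * (1 - fps_X) ^ N"
      by (simp only: power_Suc mult.assoc)
    then show ?case using Suc by (simp only: rec)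
  qed
  then have "inverse ((1 - fps_X) ^ CARD('i)) = ?F CARD('i)"
    by (intro fps_inverse_unique) (simp only: mult.commute)
  moreover have "((1 - fps_X) ^ CARD('i) :: real fps) $ 0 \<noteq> 0" by (simp add: fps_nth_power_0)
  from fps_divide_unit [OF this, of 1]
  have "1 / (1 - fps_X) ^ CARD('i) = inverse ((1 - fps_X) ^ CARD('i) :: real fps)" by simp
  ultimately show ?thesis unfolding P by simp
qed

text \<open>The factor N - n in the recursion makes the dimensions vanish above N; this is what
  later bounds the length of the resolutions.\<close>

lemma symz_trace_minus:
  assumes "\<And>b y. (\<Sum>j\<in>UNIV. s j b j y) = (if b = y then - 1 else 0)"
  shows "symz_trace s n = of_nat (CARD('i) choose n)"
proof (induction n)
  case (Suc n)
  have "of_nat (Suc n) * symz_trace s (Suc n) = (of_nat CARD('i) - of_nat n) * (of_nat CARD('i) gchoose n :: complex)"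
    using symz_trace_Suc [of "- 1" n] assms Suc by (simp add: binomial_gbinomial del: of_nat_Suc)
  also have "\<dots> = of_nat (Suc n) * (of_nat CARD('i) gchoose Suc n)"
    unfolding left_diff_distrib gbinomial_mult_1 by simp
  finally show ?case by (simp add: binomial_gbinomial del: of_nat_Suc)
qed simp

lemma poincare_series_minus:
  assumes "\<And>b y. (\<Sum>j\<in>UNIV. s j b j y) = (if b = y then - 1 else 0)"
  shows "poincare_series (braid_space s) = (1 + fps_X) ^ CARD('i)"
proof -
  have "quadratic_dim (braid_space s) n = CARD('i) choose n" for n
    using quadratic_dim_braid [of n] symz_trace_minus [OF assms, of n] by simp
  then have "poincare_series (braid_space s) = fps_binomial (of_nat CARD('i))"
    by (intro fps_ext) (simp add: poincare_series_def binomial_gbinomial)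
  then show ?thesis by (simp add: fps_binomial_of_nat)
qed

lemma polynomial_growth_plus:
  assumes "\<And>b y. (\<Sum>j\<in>UNIV. s j b j y) = (if b = y then 1 else 0)"
  shows "polynomial_growth (braid_space s)"
proof -
  let ?N = "CARD('i)" and ?d = "\<lambda>n. real (quadratic_dim (braid_space s) n)"
  have rec: "real (Suc n) * ?d (Suc n) = real (?N + n) * ?d n" for n
  proof -
    have "real_of_int (int (Suc n) * int (quadratic_dim (braid_space s) (Suc n))) =
        real_of_int ((int CARD('i) + 1 * int n) * int (quadratic_dim (braid_space s) n))"
      by (subst quadratic_dim_Suc [of 1]) (simp_all add: assms)
    then show ?thesis by simp
  qed
  have N: "?N = Suc (?N - 1)" by (simp add: card_gt_0_iff)
  have "?d (Suc n) \<le> real ?N * real (Suc n) ^ (?N - 1)" for n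
  proof (induction n)
    case 0
    then show ?case using rec [of 0] by (simp add: quadratic_dim_0)
  next
    case (Suc n)
    \<comment> \<open>Consecutive dimensions have ratio 1 + (N - 1) / (n + 2), which is at most 1 +
      (N - 1) / (n + 1); Bernoulli's inequality bounds this by the ratio of consecutive values of
      the power with exponent N - 1.\<close>
    have "1 + real (?N - 1) * (1 / real (Suc n)) \<le> (1 + 1 / real (Suc n)) ^ (?N - 1)"
      by (rule Bernoulli_inequality) (simp add: field_simps)
    also have "\<dots> = (real (Suc (Suc n)) / real (Suc n)) ^ (?N - 1)"
      by (rule arg_cong [where f = "\<lambda>x. x ^ _"]) (simp add: field_simps)
    finally have bern: "(1 + real (?N - 1) / real (Suc n)) * real (Suc n) ^ (?N - 1) \<le> real (Suc (Suc n)) ^ (?N - 1)"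
      by (simp add: power_divide pos_le_divide_eq del: of_nat_Suc)
    have "real (?N + Suc n) / real (Suc (Suc n)) = 1 + real (?N - 1) / real (Suc (Suc n))"
      by (subst N) (simp add: field_simps)
    also have "\<dots> \<le> 1 + real (?N - 1) / real (Suc n)"
      by (simp add: frac_le)
    finally have le: "real (?N + Suc n) / real (Suc (Suc n)) \<le> 1 + real (?N - 1) / real (Suc n)" .
    have "?d (Suc (Suc n)) = real (?N + Suc n) / real (Suc (Suc n)) * ?d (Suc n)"
      using rec [of "Suc n"] by (simp add: field_simps del: of_nat_Suc)
    also have "\<dots> \<le> (1 + real (?N - 1) / real (Suc n)) * (real ?N * real (Suc n) ^ (?N - 1))"
      by (rule mult_mono [OF le Suc]) simp_all
    also have "\<dots> = real ?N * ((1 + real (?N - 1) / real (Suc n)) * real (Suc n) ^ (?N - 1))" by simp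
    also have "\<dots> \<le> real ?N * real (Suc (Suc n)) ^ (?N - 1)"
      by (rule mult_left_mono [OF bern]) simp
    finally show ?case .
  qed
  then have *: "?d n \<le> real ?N * real n ^ (?N - 1)" if "n \<ge> 1" for n
    using that by (cases n) simp_all
  have eq: "int ?N - 1 = int (?N - 1)" using N by linarith
  have "\<forall>n\<ge>1. ?d n \<le> real ?N * real n powi (int ?N - 1)"
    unfolding eq power_int_of_nat using * by blast
  moreover have "real ?N > 0" using N by linarith
  ultimately show ?thesis unfolding polynomial_growth_def by blast
qed

end

text \<open>Two contractions that the flip satisfies as well. \<open>ptrace\<close> determines the
  dimensions and gives the degree term in the homotopy of the dual complex.
  \<open>dual_inverse\<close> says that two partial transposes of s are inverse to each other; it
  identifies the mixed terms of that homotopy.\<close>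

locale normalized_braiding = braiding s for s :: "'i::finite braid" +
  assumes ptrace: "(\<Sum>j\<in>UNIV. s j b j y) = (if b = y then 1 else 0)"
    and dual_inverse: "(\<Sum>j\<in>UNIV. \<Sum>t\<in>UNIV. s j x t b * s t z j y) = (if x = y \<and> z = b then 1 else 0)"

text \<open>The annihilator of the eigenspace of s for -1 is the eigenspace of the transpose for 1,
  that is, the eigenspace of its negative for -1. Hence the Koszul dual is again the algebra of a
  braiding.\<close>

lemma (in braiding) quadratic_dual_braid:
  "quadratic_dual (braid_space s) = braid_space (neg_braid (transp_braid s))"
proof -
  interpret pairing "\<lambda>x y. x * y :: complex"
    by standard (simp_all add: algebra_simps cscale_complex_def)
  have pair: "(\<Sum>i\<in>UNIV. \<Sum>j\<in>UNIV. Poly_Mapping.lookup p [i, j] * Poly_Mapping.lookup t [i, j]) =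
      (\<Sum>w\<in>words 2. Poly_Mapping.lookup t w * Poly_Mapping.lookup p w)" for p t :: "'i tensor"
    by (simp add: numeral_2_eq_2 sum_words_Suc mult.commute)
  have dual: "p \<in> braid_space (neg_braid (transp_braid s)) \<longleftrightarrow>
      p \<in> tensor_degree 2 \<and> (\<forall>w\<in>words 2. act0 (transp_braid s) (Poly_Mapping.lookup p) w = Poly_Mapping.lookup p w)" (is "_ \<longleftrightarrow> ?r")
    for p
  proof -
    have neg: "Poly_Mapping.lookup (tact (neg_braid (transp_braid s)) p) w = - act0 (transp_braid s) (Poly_Mapping.lookup p) w"
      if "w \<in> words 2" for w
      using that by (auto simp: words_def numeral_2_eq_2 length_Suc_conv tlookup neg_braid_def sum_negf)
    show ?thesis
    proof
      assume p: "p \<in> braid_space (neg_braid (transp_braid s))"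
      then show ?r using neg by (auto simp: braid_space_def)
    next
      assume r: ?r
      have "tact (neg_braid (transp_braid s)) p = - p"
      proof (rule poly_mapping_eqI)
        fix w
        show "Poly_Mapping.lookup (tact (neg_braid (transp_braid s)) p) w = Poly_Mapping.lookup (- p) w"
        proof (cases "w \<in> words 2")
          case False
          then show ?thesis using r tact_degree [of p 2 "neg_braid (transp_braid s)"]
            by (simp add: tensor_degree_iff mem_words)
        qed (use r neg in auto)
      qed
      then show "p \<in> braid_space (neg_braid (transp_braid s))" using r by (simp add: braid_space_def)
    qed
  qed
  show ?thesis
  proof (intro Set.set_eqI iffI)
    fix p assume p: "p \<in> quadratic_dual (braid_space s)"
    have "act0 (transp_braid s) (Poly_Mapping.lookup p) [a, b] = Poly_Mapping.lookup p [a, b]" for a b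
    proof -
      have rel: "braid_rel s a b = tensor_word [a, b] - tact s (tensor_word [a, b])"
        using braid_rel_mult_word [of s a b "[]"] by (simp add: word_Nil)
      have "(\<Sum>w\<in>words 2. Poly_Mapping.lookup (braid_rel s a b) w * Poly_Mapping.lookup p w) = 0"
        using p braid_rel_space [of a b] by (simp add: quadratic_dual_def flip: pair)
      moreover have "(\<Sum>w\<in>words 2. Poly_Mapping.lookup (tensor_word [a, b]) w * f w) = f [a, b]" for f
        by (simp add: lookup_word mem_words if_distrib [where f = "\<lambda>x. x * _"] cong: if_cong)
      ultimately show ?thesis
        by (simp only: rel lookup_minus left_diff_distrib sum_subtractf tact.rep_eq pair_act0) simp
    qed
    then show "p \<in> braid_space (neg_braid (transp_braid s))"
      using p by (auto simp: dual quadratic_dual_def words_def numeral_2_eq_2 length_Suc_conv)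
  next
    fix p assume "p \<in> braid_space (neg_braid (transp_braid s))"
    then have p: "p \<in> tensor_degree 2"
      "\<And>w. w \<in> words 2 \<Longrightarrow> act0 (transp_braid s) (Poly_Mapping.lookup p) w = Poly_Mapping.lookup p w"
      by (auto simp: dual)
    have "(\<Sum>w\<in>words 2. Poly_Mapping.lookup t w * Poly_Mapping.lookup p w) = 0" if "t \<in> braid_space s" for t
    proof -
      have "(\<Sum>w\<in>words 2. Poly_Mapping.lookup t w * Poly_Mapping.lookup p w) =
          (\<Sum>w\<in>words 2. Poly_Mapping.lookup (- tact s t) w * Poly_Mapping.lookup p w)"
        using that by (simp add: braid_space_def)
      also have "\<dots> = - (\<Sum>w\<in>words 2. act0 s (Poly_Mapping.lookup t) w * Poly_Mapping.lookup p w)"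
        by (simp add: tact.rep_eq sum_negf)
      also have "\<dots> = - (\<Sum>w\<in>words 2. Poly_Mapping.lookup t w * Poly_Mapping.lookup p w)"
        unfolding pair_act0 by (simp add: p)
      finally show ?thesis by simp
    qed
    then show "p \<in> quadratic_dual (braid_space s)"
      using p by (auto simp: quadratic_dual_def pair)
  qed
qed

section \<open>The braiding of the matrix R\<close>

text \<open>A constant of its own keeps the simplifier from splitting cases before sums with
  Kronecker symbols have been evaluated.\<close>

definition kron :: "'a \<Rightarrow> 'a \<Rightarrow> complex" where "kron x y = (if x = y then 1 else 0)"

text \<open>The second mixed case is the inverse of the first one; by (C1) it is given by the
  conjugate of R. Source letters precede target letters.\<close>

fun R_braid :: "('m::finite, 'n::finite) rmatrix \<Rightarrow> ('m + 'n) braid" where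
  "R_braid R (Inl l) (Inl m) (Inl j) (Inl k) = kron j m * kron k l"
| "R_braid R (Inr a) (Inr b) (Inr j) (Inr k) = kron j b * kron k a"
| "R_braid R (Inl l) (Inr a) (Inr b) (Inl m) = R l a b m"
| "R_braid R (Inr b) (Inl m) (Inl n) (Inr c) = cnj (R m b c n)"
| "R_braid R _ _ _ _ = 0"

lemma sum_UNIV_Plus:
  fixes f :: "'a::finite + 'b::finite \<Rightarrow> 'c::comm_monoid_add"
  shows "(\<Sum>x\<in>UNIV. f x) = (\<Sum>l\<in>UNIV. f (Inl l)) + (\<Sum>a\<in>UNIV. f (Inr a))"
  unfolding UNIV_Plus_UNIV [symmetric] by (subst sum.Plus) simp_all

lemma kron_sum [simp]:
  fixes f :: "'a::finite \<Rightarrow> complex"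
  shows "(\<Sum>x\<in>UNIV. kron x y * f x) = f y" "(\<Sum>x\<in>UNIV. kron y x * f x) = f y"
    "(\<Sum>x\<in>UNIV. f x * kron x y) = f y" "(\<Sum>x\<in>UNIV. f x * kron y x) = f y"
    "(\<Sum>x\<in>UNIV. kron x y) = (1 :: complex)" "(\<Sum>x\<in>UNIV. kron y x) = (1 :: complex)"
  by (simp_all add: kron_def if_distrib [where f = "\<lambda>x. x * _"] if_distrib [where f = "\<lambda>x. _ * x"] cong: if_cong)

lemma kron_sum' [simp]:
  fixes f g :: "'a::finite \<Rightarrow> complex"
  shows "(\<Sum>x\<in>UNIV. f x * kron x y * g x) = f y * g y" "(\<Sum>x\<in>UNIV. f x * kron y x * g x) = f y * g y"
    "(\<Sum>x\<in>UNIV. f x * (kron x y * g x)) = f y * g y" "(\<Sum>x\<in>UNIV. f x * (kron y x * g x)) = f y * g y"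
  using kron_sum(3) [of "\<lambda>x. f x * g x" y] kron_sum(4) [of "\<lambda>x. f x * g x" y] by (simp_all add: mult_ac)

lemma kron_sum_const [simp]:
  fixes f g :: "'a::finite \<Rightarrow> complex"
  shows "(\<Sum>x\<in>UNIV. f x * (g x * kron y z)) = (\<Sum>x\<in>UNIV. f x * g x) * kron y z"
    "(\<Sum>x\<in>UNIV. f x * (kron y z * g x)) = (\<Sum>x\<in>UNIV. f x * g x) * kron y z"
  unfolding sum_distrib_right by (simp_all only: mult_ac)

lemma kron_sum'' [simp]:
  fixes f g :: "'a::finite \<Rightarrow> complex"
  shows "(\<Sum>x\<in>UNIV. f x * (g x * kron x y)) = f y * g y"
    "(\<Sum>x\<in>UNIV. f x * (c * kron x y)) = f y * c"
    "(\<Sum>x\<in>UNIV. f x * (kron z w * kron x y)) = f y * kron z w"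
  using kron_sum(3) [of "\<lambda>x. f x * g x" y] kron_sum(3) [of "\<lambda>x. f x * c" y]
    kron_sum(3) [of "\<lambda>x. f x * kron z w" y] by (simp_all add: mult_ac)

lemma normalized_braiding_R:
  assumes "condition_C1 R" and "condition_C2 R" and "condition_C3 R"
  shows "normalized_braiding (R_braid R)"
proof -
  have C1: "(\<Sum>b\<in>UNIV. \<Sum>m\<in>UNIV. cnj (R l a b m) * R m b c n) = kron l n * kron a c" for l a c n
    using assms(1) by (auto simp: condition_C1_def kron_def)
  have C1': "(\<Sum>b\<in>UNIV. \<Sum>m\<in>UNIV. R l a b m * cnj (R m b c n)) = kron l n * kron a c" for l a c n
    using arg_cong [OF C1, of cnj l a c n] by (simp add: kron_def)
  have C2: "(\<Sum>r\<in>UNIV. R l a c r * R r b d m) = (\<Sum>r\<in>UNIV. R l b d r * R r a c m)"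
    "(\<Sum>r\<in>UNIV. cnj (R l a c r) * cnj (R r b d m)) = (\<Sum>r\<in>UNIV. cnj (R l b d r) * cnj (R r a c m))"
    "(\<Sum>r\<in>UNIV. cnj (R l a c r) * R r b d m) = (\<Sum>r\<in>UNIV. R l b d r * cnj (R r a c m))" for l a c b d m
    using assms(2) unfolding condition_C2_def by blast+
  have C3: "(\<Sum>c\<in>UNIV. R l a c n * R m c b r) = (\<Sum>c\<in>UNIV. R m a c r * R l c b n)"
    "(\<Sum>c\<in>UNIV. cnj (R l a c n) * cnj (R m c b r)) = (\<Sum>c\<in>UNIV. cnj (R m a c r) * cnj (R l c b n))"
    "(\<Sum>c\<in>UNIV. R l a c n * cnj (R m c b r)) = (\<Sum>c\<in>UNIV. cnj (R m a c r) * R l c b n)" for l a n m b r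
    using assms(3) unfolding condition_C3_def by blast+
  have C2': "(\<Sum>r\<in>UNIV. R r b d m * R l a c r) = (\<Sum>r\<in>UNIV. R r a c m * R l b d r)"
    "(\<Sum>r\<in>UNIV. cnj (R r b d m) * cnj (R l a c r)) = (\<Sum>r\<in>UNIV. cnj (R r a c m) * cnj (R l b d r))"
    "(\<Sum>r\<in>UNIV. R r b d m * cnj (R l a c r)) = (\<Sum>r\<in>UNIV. cnj (R r a c m) * R l b d r)" for l a c b d m
    using C2 [of l a c b d m] by (simp_all add: mult.commute)
  have C3': "(\<Sum>c\<in>UNIV. R m c b r * R l a c n) = (\<Sum>c\<in>UNIV. R l c b n * R m a c r)"
    "(\<Sum>c\<in>UNIV. cnj (R m c b r) * cnj (R l a c n)) = (\<Sum>c\<in>UNIV. cnj (R l c b n) * cnj (R m a c r))"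
    "(\<Sum>c\<in>UNIV. cnj (R m c b r) * R l a c n) = (\<Sum>c\<in>UNIV. R l c b n * cnj (R m a c r))" for l a n m b r
    using C3 [of l a n m b r] by (simp_all add: mult.commute)
  \<comment> \<open>The mixed part of (C2) moves the conjugate to the other factor, after which the
    contraction is the one in (C1).\<close>
  have D1: "(\<Sum>d\<in>UNIV. \<Sum>l\<in>UNIV. cnj (R a d c l) * R l b d n) = kron a n * kron b c" for a b c n
    unfolding C2(3) by (rule C1')
  have D2: "(\<Sum>l\<in>UNIV. \<Sum>d\<in>UNIV. R l b d n * cnj (R a d c l)) = kron a n * kron b c" for a b c n
    using D1 [of a c b n] by (subst sum.swap) (simp add: mult.commute)
  let ?s = "R_braid R"
  show ?thesis
  proof
    fix x y j k :: "'a + 'b"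
    show "(\<Sum>a\<in>UNIV. \<Sum>b\<in>UNIV. ?s x y a b * ?s a b j k) = (if x = j \<and> y = k then 1 else 0)"
    proof (cases x; cases y; cases j; cases k)
      fix l a n c assume "x = Inl l" "y = Inr a" "j = Inl n" "k = Inr c"
      then show ?thesis using C1' [of l a c n] by (simp add: sum_UNIV_Plus kron_def)
    next
      fix b m d l assume *: "x = Inr b" "y = Inl m" "j = Inr d" "k = Inl l"
      have "(\<Sum>n\<in>UNIV. \<Sum>c\<in>UNIV. cnj (R m b c n) * R n c d l) = (\<Sum>c\<in>UNIV. \<Sum>n\<in>UNIV. cnj (R m b c n) * R n c d l)"
        by (rule sum.swap)
      then show ?thesis using C1 [of m b d l] * by (simp add: sum_UNIV_Plus kron_def)
    qed (simp_all add: sum_UNIV_Plus sum_distrib_left [symmetric] mult.assoc, simp_all add: kron_def)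
  next
    fix x y z j k l :: "'a + 'b"
    \<comment> \<open>Both sides vanish unless the target reverses the pattern of blocks. One letter
      of the first block among two of the second leads to (C2), the opposite case to (C3); the place
      of the single letter decides which factors are conjugated.\<close>
    show "(\<Sum>a\<in>UNIV. \<Sum>b\<in>UNIV. \<Sum>c\<in>UNIV. ?s a b j k * ?s c z b l * ?s x y a c) =
        (\<Sum>a\<in>UNIV. \<Sum>b\<in>UNIV. \<Sum>d\<in>UNIV. ?s a b k l * ?s x d j a * ?s y z d b)"
      by (cases x; cases y; cases z; cases j; cases k; cases l; 
        simp add: sum_UNIV_Plus mult.assoc sum_distrib_left [symmetric]) (rule C2' C3')+
  next
    fix b y :: "'a + 'b"
    show "(\<Sum>j\<in>UNIV. ?s j b j y) = (if b = y then 1 else 0)"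
      by (cases b; cases y; simp add: sum_UNIV_Plus) (simp_all add: kron_def)
  next
    fix x b z y :: "'a + 'b"
    show "(\<Sum>j\<in>UNIV. \<Sum>t\<in>UNIV. ?s j x t b * ?s t z j y) = (if x = y \<and> z = b then 1 else 0)"
      by (cases x; cases y; cases z; cases b; simp add: sum_UNIV_Plus D1 D2) (auto simp: kron_def)
  qed
qed

lemma tact_degree_2:
  assumes "t \<in> tensor_degree 2"
  shows "t - tact s t = (\<Sum>a\<in>UNIV. \<Sum>b\<in>UNIV. Poly_Mapping.lookup t [a, b] *\<^sub>C braid_rel s a b)"
proof -
  have "t = (\<Sum>a\<in>UNIV. \<Sum>b\<in>UNIV. Poly_Mapping.lookup t [a, b] *\<^sub>C tensor_word [a, b])"
  proof (rule poly_mapping_eqI)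
    fix w
    have "(\<Sum>w'\<in>words 2. Poly_Mapping.lookup t w' * (if w' = w then 1 else 0)) = Poly_Mapping.lookup t w"
      using assms by (auto simp: mult_delta_right tensor_degree_iff mem_words)
    then show "Poly_Mapping.lookup t w = Poly_Mapping.lookup
        (\<Sum>a\<in>UNIV. \<Sum>b\<in>UNIV. Poly_Mapping.lookup t [a, b] *\<^sub>C tensor_word [a, b]) w"
      by (simp add: numeral_2_eq_2 sum_words_Suc lookup_sum lookup_cscale lookup_word cscale_complex_def)
  qed
  then have "t - tact s t = (\<Sum>a\<in>UNIV. \<Sum>b\<in>UNIV. Poly_Mapping.lookup t [a, b] *\<^sub>C tensor_word [a, b]) -
      tact s (\<Sum>a\<in>UNIV. \<Sum>b\<in>UNIV. Poly_Mapping.lookup t [a, b] *\<^sub>C tensor_word [a, b])"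
    by (rule arg_cong [where f = "\<lambda>x. x - tact s x"])
  also have "\<dots> = (\<Sum>a\<in>UNIV. \<Sum>b\<in>UNIV. Poly_Mapping.lookup t [a, b] *\<^sub>C braid_rel s a b)"
  proof -
    have "braid_rel s a b = tensor_word [a, b] - tact s (tensor_word [a, b])" for a b
      using braid_rel_mult_word [of s a b "[]"] by (simp add: word_Nil)
    then show ?thesis by (simp add: tact.sum tact.scale cvec.scale_right_diff_distrib sum_subtractf)
  qed
  finally show ?thesis .
qed

text \<open>The given relations are the \<open>braid_rel\<close> of all pairs of letters except
  those with the second block before the first. Since s is an involution, these are combinations of
  the others.\<close>

lemma relations_braid_space:
  assumes "condition_C1 R" and "condition_C2 R" and "condition_C3 R"
  shows "relations R = braid_space (R_braid R)"
proof -
  interpret normalized_braiding "R_braid R" by (rule normalized_braiding_R [OF assms])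
  let ?G = "{tensor_word [Inl l, Inl m] - tensor_word [Inl m, Inl l] | l m. True} \<union>
     {tensor_word [Inr a, Inr b] - tensor_word [Inr b, Inr a] | a b. True} \<union>
     {tensor_word [Inl l, Inr a] -
        (\<Sum>b\<in>UNIV. \<Sum>m\<in>UNIV. R l a b m *\<^sub>C tensor_word [Inr b, Inl m]) | l a. True}"
  have kron_scale: "(\<Sum>j\<in>UNIV. \<Sum>k\<in>UNIV. (kron j m * kron k l) *\<^sub>C f j k) = f m l"
    for f :: "'c::finite \<Rightarrow> 'd::finite \<Rightarrow> ('a + 'b) tensor" and m l
  proof -
    have "(\<Sum>j\<in>UNIV. \<Sum>k\<in>UNIV. (kron j m * kron k l) *\<^sub>C f j k) =
        (\<Sum>j\<in>UNIV. if j = m then f j l else 0)"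
      by (rule sum.cong) (auto simp: kron_def delta_cscale_sum)
    then show ?thesis by simp
  qed
  have rel: "relations R = cvec.span ?G"
    unfolding relations_def tensor_scale_fun ..
  have G1: "braid_rel (R_braid R) (Inl l) (Inl m) = tensor_word [Inl l, Inl m] - tensor_word [Inl m, Inl l]" for l m
    by (simp add: braid_rel_def sum_UNIV_Plus kron_scale)
  have G2: "braid_rel (R_braid R) (Inr a) (Inr b) = tensor_word [Inr a, Inr b] - tensor_word [Inr b, Inr a]" for a b
    by (simp add: braid_rel_def sum_UNIV_Plus kron_scale)
  have G3: "braid_rel (R_braid R) (Inl l) (Inr a) = tensor_word [Inl l, Inr a] -
      (\<Sum>b\<in>UNIV. \<Sum>m\<in>UNIV. R l a b m *\<^sub>C tensor_word [Inr b, Inl m])" for l a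
    by (simp add: braid_rel_def sum_UNIV_Plus)
  have in_rel: "braid_rel (R_braid R) x y \<in> relations R" for x y
  proof -
    have base: "braid_rel (R_braid R) (Inl l) y \<in> relations R" for l y
      unfolding rel by (cases y; rule cvec.span_base) (auto simp: G1 G3)
    show ?thesis
    proof (cases x)
      case (Inl l)
      then show ?thesis using base by simp
    next
      case x: (Inr b)
      show ?thesis
      proof (cases y)
        case (Inr a)
        then show ?thesis unfolding rel x by (intro cvec.span_base) (auto simp: G2)
      next
        case y: (Inl m)
        \<comment> \<open>With e the word x y, this is s e - s s e = s e - e, the negative of the
          missing relation.\<close>
        have "tact (R_braid R) (tensor_word [x, y]) - tact (R_braid R) (tact (R_braid R) (tensor_word [x, y])) =
            (\<Sum>j\<in>UNIV. \<Sum>k\<in>UNIV. R_braid R x y j k *\<^sub>C braid_rel (R_braid R) j k)"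
          using braid_rel_mult_word [of "R_braid R" _ _ "[]"]
          by (simp add: tact_word tact.sum tact.scale word_Nil cvec.scale_right_diff_distrib sum_subtractf)
        then have "- braid_rel (R_braid R) x y = (\<Sum>j\<in>UNIV. \<Sum>k\<in>UNIV. R_braid R x y j k *\<^sub>C braid_rel (R_braid R) j k)"
          using braid_rel_mult_word [of "R_braid R" x y "[]"] by (simp add: tact_tact word_Nil)
        also have "\<dots> = (\<Sum>l\<in>UNIV. \<Sum>a\<in>UNIV. cnj (R m b a l) *\<^sub>C braid_rel (R_braid R) (Inl l) (Inr a))"
          by (simp add: x y sum_UNIV_Plus)
        also have "\<dots> \<in> relations R"
          using base unfolding rel by (intro cvec.span_sum cvec.span_scale)
        finally have "- (- braid_rel (R_braid R) x y) \<in> relations R"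
          unfolding rel by (rule cvec.span_neg)
        then show ?thesis by simp
      qed
    qed
  qed
  show ?thesis
  proof
    show "relations R \<subseteq> braid_space (R_braid R)"
      unfolding rel
    proof (rule cvec.span_minimal)
      show "?G \<subseteq> braid_space (R_braid R)"
        using braid_rel_space by (auto simp flip: G1 G2 G3)
      show "cvec.subspace (braid_space (R_braid R))"
        by (auto simp: cvec.subspace_def braid_space_def tensor_degree_iff lookup_add lookup_cscale tact.add tact.scale)
    qed
    show "braid_space (R_braid R) \<subseteq> relations R"
    proof
      fix t assume t: "t \<in> braid_space (R_braid R)"
      then have "t - tact (R_braid R) t \<in> relations R"
        using in_rel unfolding rel
        by (subst tact_degree_2) (auto simp: braid_space_def intro!: cvec.span_sum cvec.span_scale)
      then have "(1 / 2) *\<^sub>C (t - tact (R_braid R) t) \<in> relations R"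
        unfolding rel by (rule cvec.span_scale)
      also have "(1 / 2) *\<^sub>C (t - tact (R_braid R) t) = t"
        using t by (simp add: braid_space_def cscale_right_distrib flip: cscale_left_distrib)
      finally show "t \<in> relations R" .
    qed
  qed
qed

section \<open>Linear maps between coefficient spaces\<close>

lemma act0_linear:
  assumes "cvec_linear L" shows "L (act0 s f w) = act0 s (\<lambda>v. L (f v)) w"
proof -
  interpret cvec_linear L by fact
  show ?thesis by (auto simp: act0_def sum scale split: list.split)
qed

lemma ins_linear:
  assumes "cvec_linear L" shows "L (ins s f w) = ins s (\<lambda>v. L (f v)) w"
proof -
  interpret cvec_linear L by fact
  show ?thesis by (induction w arbitrary: f) (simp_all add: add act0_linear [OF assms])
qed

lemma symt_linear:
  assumes "cvec_linear L" and "symt s n f" shows "symt s n (\<lambda>v. L (f v))"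
  using assms(2) by (induction n arbitrary: f) (simp_all flip: act0_linear [OF assms(1)])

lemma act0_subspace:
  assumes "cvec.subspace S" and "\<And>v. f v \<in> S" shows "act0 s f w \<in> S"
  using assms by (auto simp: act0_def split: list.split intro!: cvec.subspace_sum cvec.subspace_scale)

lemma ins_subspace:
  assumes "cvec.subspace S" and "\<And>v. f v \<in> S" shows "ins s f w \<in> S"
  using assms(2)
proof (induction w arbitrary: f)
  case (Cons a w)
  have "ins s (\<lambda>v. act0 s f (a # v)) w \<in> S"
    by (rule Cons.IH) (rule act0_subspace [OF assms(1) Cons.prems])
  then show ?case by (simp add: cvec.subspace_add [OF assms(1)] Cons.prems)
qed (simp add: cvec.subspace_0 [OF assms(1)])

lemma cvec_neg_eq: "x = - x \<Longrightarrow> x = (0 :: 'w::cvec)"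
proof -
  assume "x = - x"
  then have "x + x = 0" by (simp add: eq_neg_iff_add_eq_0)
  then have "2 *\<^sub>C x = 0" using cscale_left_distrib [of 1 1 x] by simp
  then show ?thesis by (simp add: cvec.scale_eq_0_iff)
qed

section \<open>Koszul complexes with coefficients\<close>

text \<open>\<open>rho\<close> stands for the right multiplication by the generators on the first factor of \<open>A \<otimes> M\<close>, \<open>der\<close> for
  the right derivatives of the first factor, \<open>lam\<close> for the action of the generators on \<open>M\<close>, and \<open>part\<close> for
  the projections to the homogeneous components of the first factor.\<close>

locale koszul_complex = braiding s for s :: "'i::finite braid" +
  fixes S :: "'w::cvec set" and rho der lam :: "'i \<Rightarrow> 'w \<Rightarrow> 'w" and part :: "nat \<Rightarrow> 'w \<Rightarrow> 'w"
  assumes S_subspace: "cvec.subspace S"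
    and lin_rho: "cvec_linear (rho i)" and lin_der: "cvec_linear (der i)"
    and lin_lam: "cvec_linear (lam i)" and lin_part: "cvec_linear (part p)"
    and S_rho: "w \<in> S \<Longrightarrow> rho i w \<in> S" and S_der: "w \<in> S \<Longrightarrow> der i w \<in> S"
    and S_lam: "w \<in> S \<Longrightarrow> lam i w \<in> S" and S_part: "w \<in> S \<Longrightarrow> part p w \<in> S"
    and der_rho: "w \<in> S \<Longrightarrow> der k (rho i w) =
      (if i = k then w else 0) + (\<Sum>z\<in>UNIV. \<Sum>y\<in>UNIV. s z i y k *\<^sub>C rho y (der z w))"
    and euler: "w \<in> S \<Longrightarrow> (\<Sum>i\<in>UNIV. rho i (der i (part p w))) = of_nat p *\<^sub>C part p w"
    and rho_rho: "w \<in> S \<Longrightarrow> rho b (rho a w) = (\<Sum>j\<in>UNIV. \<Sum>k\<in>UNIV. s a b j k *\<^sub>C rho k (rho j w))"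
    and lam_lam: "w \<in> S \<Longrightarrow> lam a (lam b w) = (\<Sum>j\<in>UNIV. \<Sum>k\<in>UNIV. s a b j k *\<^sub>C lam j (lam k w))"
    and rho_lam: "w \<in> S \<Longrightarrow> rho i (lam j w) = lam j (rho i w)"
    and part_rho: "w \<in> S \<Longrightarrow> part (Suc p) (rho i w) = rho i (part p w)" "w \<in> S \<Longrightarrow> part 0 (rho i w) = 0"
    and part_der: "w \<in> S \<Longrightarrow> part p (der i w) = der i (part (Suc p) w)"
    and part_lam: "w \<in> S \<Longrightarrow> part p (lam i w) = lam i (part p w)"
    and part_part: "w \<in> S \<Longrightarrow> part p (part q w) = (if p = q then part p w else 0)"
    and part_bound: "w \<in> S \<Longrightarrow> \<exists>p. \<forall>q\<ge>p. part q w = 0"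
    and part_zero: "w \<in> S \<Longrightarrow> (\<And>q. part q w = 0) \<Longrightarrow> w = 0"
begin

sublocale rho: cvec_linear "rho i" by (rule lin_rho)
sublocale der: cvec_linear "der i" by (rule lin_der)
sublocale lam: cvec_linear "lam i" by (rule lin_lam)
sublocale part: cvec_linear "part p" by (rule lin_part)

lemma S_0 [simp]: "0 \<in> S" by (rule cvec.subspace_0 [OF S_subspace])
lemma S_add: "x \<in> S \<Longrightarrow> y \<in> S \<Longrightarrow> x + y \<in> S" by (rule cvec.subspace_add [OF S_subspace])
lemma S_diff: "x \<in> S \<Longrightarrow> y \<in> S \<Longrightarrow> x - y \<in> S" by (rule cvec.subspace_diff [OF S_subspace])
lemma S_scale: "x \<in> S \<Longrightarrow> c *\<^sub>C x \<in> S" by (rule cvec.subspace_scale [OF S_subspace])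
lemma S_sum: "(\<And>x. x \<in> Y \<Longrightarrow> f x \<in> S) \<Longrightarrow> (\<Sum>x\<in>Y. f x) \<in> S" by (rule cvec.subspace_sum [OF S_subspace])

text \<open>The algebra tensored with the antisymmetric n-tensors and with M: the value at u is the
  coefficient of the word u, and S is the set of admissible coefficients.\<close>

definition chains :: "nat \<Rightarrow> ('i list \<Rightarrow> 'w) set" where
  "chains n = {g. (\<forall>u. length u \<noteq> n \<longrightarrow> g u = 0) \<and> symt (neg_braid s) n g \<and> (\<forall>u. g u \<in> S)}"

definition dL :: "('i list \<Rightarrow> 'w) \<Rightarrow> 'i list \<Rightarrow> 'w" where "dL g u = (\<Sum>i\<in>UNIV. rho i (g (i # u)))"
definition dR :: "('i list \<Rightarrow> 'w) \<Rightarrow> 'i list \<Rightarrow> 'w" where "dR g u = (\<Sum>i\<in>UNIV. lam i (g (u @ [i])))"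

text \<open>The index is the degree of the target. Since \<open>dL\<close> and \<open>dR\<close>
  commute and have square 0, the alternating sign makes the cross terms in the square
  cancel.\<close>

definition bdry :: "nat \<Rightarrow> ('i list \<Rightarrow> 'w) \<Rightarrow> 'i list \<Rightarrow> 'w" where
  "bdry n g u = dL g u + (- 1) ^ Suc n *\<^sub>C dR g u"

text \<open>Differentiates the coefficient and distributes the resulting letter antisymmetrically
  over all places: the analogue of the de Rham differential, opposite to \<open>dL\<close>.\<close>

definition hmt :: "('i list \<Rightarrow> 'w) \<Rightarrow> 'i list \<Rightarrow> 'w" where
  "hmt g = ins (neg_braid s) (\<lambda>v. case v of [] \<Rightarrow> 0 | i # v \<Rightarrow> der i (g v))"

lemma chainsD: "g \<in> chains n \<Longrightarrow> length u \<noteq> n \<Longrightarrow> g u = 0" "g \<in> chains n \<Longrightarrow> symt (neg_braid s) n g"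
  "g \<in> chains n \<Longrightarrow> g u \<in> S"
  by (simp_all add: chains_def)

lemma chains_add: "g \<in> chains n \<Longrightarrow> h \<in> chains n \<Longrightarrow> (\<lambda>u. g u + h u) \<in> chains n"
  by (auto simp: chains_def intro: symt_add S_add)

lemma chains_scale: "g \<in> chains n \<Longrightarrow> (\<lambda>u. c *\<^sub>C g u) \<in> chains n"
  by (auto simp: chains_def intro: symt_scale S_scale)

lemma chains_diff: "g \<in> chains n \<Longrightarrow> h \<in> chains n \<Longrightarrow> (\<lambda>u. g u - h u) \<in> chains n"
  using chains_add [of g n "\<lambda>u. - 1 *\<^sub>C h u"] chains_scale [of h n "- 1"] by simp

lemma chains_part: "g \<in> chains n \<Longrightarrow> (\<lambda>u. part p (g u)) \<in> chains n"
  by (auto simp: chains_def intro: symt_linear [OF lin_part] S_part)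

lemma dL_chains: "g \<in> chains (Suc n) \<Longrightarrow> dL g \<in> chains n"
  unfolding chains_def dL_def mem_Collect_eq
  by (auto intro!: symt_sum symt_linear [OF lin_rho] S_sum S_rho)

lemma dR_chains:
  assumes "g \<in> chains (Suc n)" shows "dR g \<in> chains n"
proof -
  have "symt (neg_braid s) n (\<lambda>u. lam i (g (u @ [i])))" for i
    by (rule symt_linear [OF lin_lam], rule symt_butlast) (use assms in \<open>auto simp: chains_def\<close>)
  then show ?thesis
    using assms unfolding chains_def dR_def mem_Collect_eq by (auto intro!: symt_sum S_sum S_lam)
qed

lemma bdry_chains: "g \<in> chains (Suc n) \<Longrightarrow> bdry n g \<in> chains n"
  unfolding bdry_def by (intro chains_add chains_scale dL_chains dR_chains)

lemma dL_add: "dL (\<lambda>u. g u + h u) u = dL g u + dL h u" by (simp add: dL_def rho.add sum.distrib)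
lemma dR_add: "dR (\<lambda>u. g u + h u) u = dR g u + dR h u" by (simp add: dR_def lam.add sum.distrib)
lemma dL_scale: "dL (\<lambda>u. c *\<^sub>C g u) u = c *\<^sub>C dL g u" by (simp add: dL_def rho.scale cscale_sum_right)
lemma dR_scale: "dR (\<lambda>u. c *\<^sub>C g u) u = c *\<^sub>C dR g u" by (simp add: dR_def lam.scale cscale_sum_right)

lemma bdry_add: "bdry n (\<lambda>u. g u + h u) u = bdry n g u + bdry n h u"
  by (simp add: bdry_def dL_add dR_add cscale_right_distrib add_ac)
lemma bdry_scale: "bdry n (\<lambda>u. c *\<^sub>C g u) u = c *\<^sub>C bdry n g u"
  by (simp add: bdry_def dL_scale dR_scale cscale_right_distrib cvec.scale_right_diff_distrib cscale_cscale mult_ac)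
lemma bdry_diff: "bdry n (\<lambda>u. g u - h u) u = bdry n g u - bdry n h u"
  using bdry_add [of n g "\<lambda>u. - 1 *\<^sub>C h u" u] bdry_scale [of n "- 1" h u] by simp

text \<open>Transposing the first two letters changes the sign of g, but by the commutation rule for
  \<open>rho\<close> it does not change the sum; so the sum is its own negative.\<close>

lemma dL_dL:
  assumes "g \<in> chains (Suc (Suc n))" shows "dL (dL g) u = 0"
proof (cases "length u = n")
  case True
  have *: "g (j # i # u) = - (\<Sum>a\<in>UNIV. \<Sum>b\<in>UNIV. s a b j i *\<^sub>C g (a # b # u))" for i j
    using symt_act0 [OF chainsD(2) [OF assms], of "j # i # u"] True by (simp add: neg_braid_def sum_negf)
  have "dL (dL g) u = (\<Sum>i\<in>UNIV. \<Sum>j\<in>UNIV. rho i (rho j (g (j # i # u))))"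
    by (simp add: dL_def rho.sum)
  also have "\<dots> = - (\<Sum>(i, j, a, b)\<in>UNIV. s a b j i *\<^sub>C rho i (rho j (g (a # b # u))))"
    by (subst *) (simp add: rho.neg rho.sum rho.scale sum_negf sum.cartesian_product split_def flip: UNIV_Times_UNIV)
  also have "(\<Sum>(i, j, a, b)\<in>UNIV. s a b j i *\<^sub>C rho i (rho j (g (a # b # u)))) =
      (\<Sum>(b, a, j, i)\<in>UNIV. s a b j i *\<^sub>C rho i (rho j (g (a # b # u))))"
    by (rule sum.reindex_bij_witness [where i = "\<lambda>(b, a, j, i). (i, j, a, b)" and j = "\<lambda>(i, j, a, b). (b, a, j, i)"]) auto
  also have "\<dots> = (\<Sum>b\<in>UNIV. \<Sum>a\<in>UNIV. rho b (rho a (g (a # b # u))))"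
  proof -
    have "rho b (rho a (g (a # b # u))) = (\<Sum>j\<in>UNIV. \<Sum>i\<in>UNIV. s a b j i *\<^sub>C rho i (rho j (g (a # b # u))))" for a b
      by (rule rho_rho [OF chainsD(3) [OF assms]])
    then show ?thesis by (simp add: sum.cartesian_product split_def flip: UNIV_Times_UNIV)
  qed
  also have "\<dots> = dL (dL g) u"
    by (simp add: dL_def rho.sum)
  finally show ?thesis by (rule cvec_neg_eq)
next
  case False
  then show ?thesis using chainsD(1) [OF dL_chains [OF dL_chains [OF assms]]] by blast
qed

lemma dR_dR:
  assumes "g \<in> chains (Suc (Suc n))" shows "dR (dR g) u = 0"
proof (cases "length u = n")
  case True
  have *: "g (u @ [i, j]) = - (\<Sum>a\<in>UNIV. \<Sum>b\<in>UNIV. s a b i j *\<^sub>C g (u @ [a, b]))" for i j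
    using chainsD(2) [OF assms, unfolded symt_iff, rule_format, of u "[]" i j] True
    by (simp add: neg_braid_def sum_negf)
  have "dR (dR g) u = (\<Sum>i\<in>UNIV. \<Sum>j\<in>UNIV. lam i (lam j (g (u @ [i, j]))))"
    by (simp add: dR_def lam.sum)
  also have "\<dots> = - (\<Sum>(i, j, a, b)\<in>UNIV. s a b i j *\<^sub>C lam i (lam j (g (u @ [a, b]))))"
    by (subst *) (simp add: lam.neg lam.sum lam.scale sum_negf sum.cartesian_product split_def flip: UNIV_Times_UNIV)
  also have "(\<Sum>(i, j, a, b)\<in>UNIV. s a b i j *\<^sub>C lam i (lam j (g (u @ [a, b])))) =
      (\<Sum>(a, b, i, j)\<in>UNIV. s a b i j *\<^sub>C lam i (lam j (g (u @ [a, b]))))"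
    by (rule sum.reindex_bij_witness [where i = "\<lambda>(a, b, i, j). (i, j, a, b)" and j = "\<lambda>(i, j, a, b). (a, b, i, j)"]) auto
  also have "\<dots> = (\<Sum>a\<in>UNIV. \<Sum>b\<in>UNIV. lam a (lam b (g (u @ [a, b]))))"
  proof -
    have "lam a (lam b (g (u @ [a, b]))) = (\<Sum>i\<in>UNIV. \<Sum>j\<in>UNIV. s a b i j *\<^sub>C lam i (lam j (g (u @ [a, b]))))" for a b
      by (rule lam_lam [OF chainsD(3) [OF assms]])
    then show ?thesis by (simp add: sum.cartesian_product split_def flip: UNIV_Times_UNIV)
  qed
  also have "\<dots> = dR (dR g) u"
    by (simp add: dR_def lam.sum)
  finally show ?thesis by (rule cvec_neg_eq)
next
  case False
  then show ?thesis using chainsD(1) [OF dR_chains [OF dR_chains [OF assms]]] by blast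
qed

lemma dL_dR:
  assumes "g \<in> chains n" shows "dL (dR g) u = dR (dL g) u"
  unfolding dL_def dR_def by (simp add: rho.sum lam.sum rho_lam [OF chainsD(3) [OF assms]]) (rule sum.swap)

lemma bdry_bdry:
  assumes "g \<in> chains (Suc (Suc n))" shows "bdry n (bdry (Suc n) g) u = 0"
proof -
  have "bdry n (bdry (Suc n) g) u = dL (bdry (Suc n) g) u + (- 1) ^ Suc n *\<^sub>C dR (bdry (Suc n) g) u"
    by (simp only: bdry_def)
  also have "dL (bdry (Suc n) g) u = (- 1) ^ Suc (Suc n) *\<^sub>C dL (dR g) u"
    unfolding bdry_def [abs_def] by (simp only: dL_add dL_scale dL_dL [OF assms] add_0_left)
  also have "dR (bdry (Suc n) g) u = dL (dR g) u"
    unfolding bdry_def [abs_def] by (simp only: dR_add dR_scale dR_dR [OF assms] cvec.scale_zero_right add_0_right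
        dL_dR [OF assms])
  finally show ?thesis by simp
qed

lemma hmt_chains:
  assumes "g \<in> chains n" shows "hmt g \<in> chains (Suc n)"
proof -
  interpret n: braiding "neg_braid s" by (rule braiding_neg)
  let ?F = "\<lambda>v. case v of [] \<Rightarrow> 0 | i # v \<Rightarrow> der i (g v)"
  have "symt (neg_braid s) (Suc n) (hmt g)"
    unfolding hmt_def by (rule n.symt_ins) (simp add: symt_linear [OF lin_der chainsD(2) [OF assms]])
  moreover have "hmt g u = 0" if "length u \<noteq> Suc n" for u
  proof -
    have "hmt g u = ins (neg_braid s) (\<lambda>v. 0) u"
      unfolding hmt_def
    proof (rule ins_cong)
      fix v :: "'i list" assume "length v = length u"
      then show "?F v = 0" using that chainsD(1) [OF assms] by (auto split: list.split)
    qed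
    then show ?thesis by simp
  qed
  moreover have "hmt g u \<in> S" for u
    unfolding hmt_def by (rule ins_subspace [OF S_subspace])
      (auto split: list.split intro: S_der chainsD(3) [OF assms])
  ultimately show ?thesis by (simp add: chains_def)
qed

text \<open>In \<open>hmt (dL g)\<close> the derivative splits by the twisted Leibniz rule. The
  untwisted term is g, and its n insertions give n copies. The twisted terms cancel against the
  summands of \<open>dL (hmt g)\<close> in which the new letter has left the first place; the
  summand in which it stays gives the Euler operator.\<close>

lemma dL_hmt:
  assumes g: "g \<in> chains n" and u: "length u = n"
  shows "dL (hmt g) u + hmt (dL g) u = (\<Sum>i\<in>UNIV. rho i (der i (g u))) + of_nat n *\<^sub>C g u"
proof -
  let ?F = "\<lambda>v. case v of [] \<Rightarrow> 0 | i # v \<Rightarrow> der i (g v)"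
  let ?G = "\<lambda>y v. case v of [] \<Rightarrow> 0 | k # v \<Rightarrow> \<Sum>z\<in>UNIV. \<Sum>i\<in>UNIV. s z i y k *\<^sub>C rho y (der z (g (i # v)))"
  have "dL (hmt g) u = (\<Sum>i\<in>UNIV. rho i (der i (g u))) +
      (\<Sum>i\<in>UNIV. rho i (ins (neg_braid s) (\<lambda>v. act0 (neg_braid s) ?F (i # v)) u))"
    by (simp add: dL_def hmt_def rho.add sum.distrib)
  also have "(\<Sum>i\<in>UNIV. rho i (ins (neg_braid s) (\<lambda>v. act0 (neg_braid s) ?F (i # v)) u)) =
      - (\<Sum>i\<in>UNIV. ins (neg_braid s) (?G i) u)"
  proof -
    have "rho y (ins (neg_braid s) (\<lambda>v. act0 (neg_braid s) ?F (y # v)) u) = - ins (neg_braid s) (?G y) u" for y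
    proof (cases u)
      case (Cons k v)
      have "rho y (ins (neg_braid s) (\<lambda>v. act0 (neg_braid s) ?F (y # v)) u) =
          ins (neg_braid s) (\<lambda>v. rho y (act0 (neg_braid s) ?F (y # v))) u"
        by (rule ins_linear [OF lin_rho])
      also have "\<dots> = ins (neg_braid s) (\<lambda>v. - 1 *\<^sub>C ?G y v) u"
        by (rule ins_cong) (auto simp: Cons length_Suc_conv neg_braid_def rho.sum rho.scale rho.neg sum_negf)
      finally show ?thesis unfolding ins_scale by simp
    qed simp
    then show ?thesis by (simp add: sum_negf)
  qed
  finally have 1: "dL (hmt g) u = (\<Sum>i\<in>UNIV. rho i (der i (g u))) - (\<Sum>y\<in>UNIV. ins (neg_braid s) (?G y) u)"
    by simp
  have "hmt (dL g) u = ins (neg_braid s) (\<lambda>v. g v + (\<Sum>y\<in>UNIV. ?G y v)) u"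
  proof (cases u)
    case (Cons k0 v0)
    show ?thesis unfolding hmt_def
    proof (rule ins_cong)
      fix w :: "'i list" assume "length w = length u"
      then obtain k v where w: "w = k # v" using Cons by (cases w) auto
      have "der k (dL g v) = (\<Sum>i\<in>UNIV. (if i = k then g (i # v) else 0) +
          (\<Sum>z\<in>UNIV. \<Sum>y\<in>UNIV. s z i y k *\<^sub>C rho y (der z (g (i # v)))))"
        by (simp add: dL_def der.sum der_rho [OF chainsD(3) [OF g]])
      also have "\<dots> = g (k # v) + (\<Sum>i\<in>UNIV. \<Sum>z\<in>UNIV. \<Sum>y\<in>UNIV. s z i y k *\<^sub>C rho y (der z (g (i # v))))"
        by (simp add: sum.distrib)
      also have "(\<Sum>i\<in>UNIV. \<Sum>z\<in>UNIV. \<Sum>y\<in>UNIV. s z i y k *\<^sub>C rho y (der z (g (i # v)))) =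
          (\<Sum>y\<in>UNIV. \<Sum>z\<in>UNIV. \<Sum>i\<in>UNIV. s z i y k *\<^sub>C rho y (der z (g (i # v))))"
        by (rule sum_perm3(3))
      finally show "(case w of [] \<Rightarrow> 0 | i # v \<Rightarrow> der i (dL g v)) = g w + (\<Sum>y\<in>UNIV. ?G y w)"
        by (simp add: w)
    qed
  qed (simp add: hmt_def)
  also have "\<dots> = of_nat n *\<^sub>C g u + (\<Sum>y\<in>UNIV. ins (neg_braid s) (?G y) u)"
    unfolding ins_add ins_sum using ins_symt [OF chainsD(2) [OF g] u] by simp
  finally show ?thesis using 1 by simp
qed

lemma chain_bound:
  assumes g: "g \<in> chains n" shows "\<exists>p. \<forall>q\<ge>p. \<forall>u. part q (g u) = 0"
proof -
  obtain b where b: "part q (g u) = 0" if "q \<ge> b u" for u q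
    using part_bound [OF chainsD(3) [OF g]] by metis
  have "part q (g u) = 0" if q: "q \<ge> Max (insert 0 (b ` words n))" for q u
  proof (cases "length u = n")
    case True
    then have "b u \<le> Max (insert 0 (b ` words n))" by (intro Max_ge) (auto simp: mem_words)
    then show ?thesis using b q by (meson order_trans)
  qed (simp add: chainsD(1) [OF g])
  then show ?thesis by blast
qed

text \<open>The top component of a cycle is a \<open>dL\<close>-cycle, hence a \<open>dL\<close>-boundary; subtracting the corresponding boundary
  lowers the degree of the cycle.\<close>

lemma bdry_exact_aux:
  assumes "z \<in> chains n" and "n = 0 \<or> (\<forall>u. bdry (n - 1) z u = 0)" and "\<And>q u. q \<ge> p \<Longrightarrow> part q (z u) = 0"
  shows "\<exists>w\<in>chains (Suc n). \<forall>u q. (n = 0 \<longrightarrow> q \<ge> 1) \<longrightarrow> part q (z u - bdry n w u) = 0"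
  using assms
proof (induction p arbitrary: z)
  case 0
  have "(\<lambda>u. 0) \<in> chains (Suc n)" by (simp add: chains_def)
  moreover have "bdry n (\<lambda>u. 0) u = 0" for u by (simp add: bdry_def dL_def dR_def)
  ultimately show ?case using 0 by (intro bexI [of _ "\<lambda>u. 0"]) auto
next
  case (Suc p)
  show ?case
  \<comment> \<open>The scalar of the homotopy is p + n. If it is 0, only the component of degree 0
    in chain degree 0 is left, about which nothing is claimed.\<close>
  proof (cases "p + n = 0")
    case True
    have "(\<lambda>u. 0) \<in> chains (Suc n)" by (simp add: chains_def)
    moreover have "bdry n (\<lambda>u. 0) u = 0" for u by (simp add: bdry_def dL_def dR_def)
    ultimately show ?thesis using Suc.prems(3) True by (intro bexI [of _ "\<lambda>u. 0"]) auto
  next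
    case False
    define zp where "zp u = part p (z u)" for u
    have zp: "zp \<in> chains n" unfolding zp_def [abs_def] by (rule chains_part [OF Suc.prems(1)])
    have "dL zp u = 0" for u
    proof (cases n)
      case 0
      then show ?thesis using chainsD(1) [OF zp] by (simp add: dL_def)
    next
      case n: (Suc m)
      \<comment> \<open>In degree p + 1, \<open>dL\<close> sees the top component of z, of degree p,
        while \<open>dR\<close> preserves the degree and sees a component that vanishes.\<close>
      have "part (Suc p) (bdry m z u) = dL zp u + (- 1) ^ Suc m *\<^sub>C dR (\<lambda>u. part (Suc p) (z u)) u"
        by (simp add: bdry_def dL_def dR_def part.add part.diff part.scale part.sum part.neg part_rho part_lam zp_def
            chainsD(3) [OF Suc.prems(1)])
      moreover have "dR (\<lambda>u. part (Suc p) (z u)) u = 0" using Suc.prems(3) by (simp add: dR_def)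
      ultimately show ?thesis using Suc.prems(2) n by simp
    qed
    then have dLzp: "dL zp = (\<lambda>u. 0)" by auto
    have hom: "dL (hmt zp) u = of_nat (p + n) *\<^sub>C zp u" if "length u = n" for u
    proof -
      have "hmt (dL zp) u = 0" unfolding dLzp hmt_def
        by (subst ins_cong [of u _ "\<lambda>_. 0"]) (auto split: list.split)
      moreover have "(\<Sum>i\<in>UNIV. rho i (der i (zp u))) = of_nat p *\<^sub>C zp u"
        unfolding zp_def by (rule euler [OF chainsD(3) [OF Suc.prems(1)]])
      ultimately show ?thesis using dL_hmt [OF zp that] by (simp add: cscale_left_distrib)
    qed
    define w0 where "w0 u = inverse (of_nat (p + n)) *\<^sub>C hmt zp u" for u
    have w0: "w0 \<in> chains (Suc n)"
      unfolding w0_def [abs_def] by (intro chains_scale hmt_chains zp)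
    have dLw0: "dL w0 u = zp u" for u
    proof (cases "length u = n")
      case True
      have "dL w0 u = inverse (of_nat (p + n)) *\<^sub>C dL (hmt zp) u"
        unfolding w0_def [abs_def] by (rule dL_scale)
      then show ?thesis using False by (simp only: hom [OF True] cscale_cscale) (simp del: of_nat_add)
    qed (simp add: chainsD(1) [OF zp] chainsD(1) [OF dL_chains [OF w0]])
    \<comment> \<open>\<open>hmt\<close> lowers the degree, so \<open>dR w0\<close> cannot disturb
      the components of degree p and above.\<close>
    have pw0: "part q (w0 u) = 0" if "q \<ge> p" for q u
    proof -
      have "part q (hmt zp u) = ins (neg_braid s) (\<lambda>v. part q (case v of [] \<Rightarrow> 0 | i # v \<Rightarrow> der i (zp v))) u"
        unfolding hmt_def by (rule ins_linear [OF lin_part])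
      also have "\<dots> = ins (neg_braid s) (\<lambda>v. 0) u"
        by (rule ins_cong) (use that in \<open>auto simp: part_der zp_def part_part S_part
            chainsD(3) [OF Suc.prems(1)] split: list.split\<close>)
      finally show ?thesis by (simp add: w0_def part.scale)
    qed
    define z' where "z' u = z u - bdry n w0 u" for u
    have z': "z' \<in> chains n"
      unfolding z'_def [abs_def] by (intro chains_diff Suc.prems(1) bdry_chains w0)
    have "n = 0 \<or> (\<forall>u. bdry (n - 1) z' u = 0)"
    proof (cases n)
      case (Suc m)
      then show ?thesis using Suc.prems(2) bdry_bdry [of w0 m] w0
        unfolding z'_def [abs_def] by (simp add: bdry_diff)
    qed simp
    moreover have "part q (z' u) = 0" if "q \<ge> p" for q u
    proof -
      have "part q (dR w0 u) = 0"
        using pw0 [OF that] by (simp add: dR_def part.sum part_lam chainsD(3) [OF w0])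
      moreover have "part q (z u) = part q (zp u)"
        using that Suc.prems(3) [of q u] by (cases "q = p") (auto simp: zp_def part_part chainsD(3) [OF Suc.prems(1)])
      ultimately show ?thesis
        by (simp add: z'_def bdry_def part.diff part.add part.scale part.neg dLw0)
    qed
    ultimately obtain w' where w': "w' \<in> chains (Suc n)"
      "\<And>u q. (n = 0 \<longrightarrow> q \<ge> 1) \<Longrightarrow> part q (z' u - bdry n w' u) = 0"
      using Suc.IH [OF z'] by blast
    show ?thesis
    proof (intro bexI allI impI)
      show "(\<lambda>u. w0 u + w' u) \<in> chains (Suc n)" by (intro chains_add w0 w'(1))
      show "part q (z u - bdry n (\<lambda>u. w0 u + w' u) u) = 0" if "n = 0 \<longrightarrow> q \<ge> 1" for u q
        using w'(2) [OF that, of u] by (simp add: z'_def bdry_add diff_diff_eq)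
    qed
  qed
qed

lemma bdry_exact:
  assumes "z \<in> chains (Suc n)" and "\<And>u. bdry n z u = 0"
  shows "\<exists>w\<in>chains (Suc (Suc n)). bdry (Suc n) w = z"
proof -
  obtain p where p: "\<And>q u. q \<ge> p \<Longrightarrow> part q (z u) = 0" using chain_bound [OF assms(1)] by blast
  obtain w where w: "w \<in> chains (Suc (Suc n))" "\<And>u q. part q (z u - bdry (Suc n) w u) = 0"
    using bdry_exact_aux [where p = p, OF assms(1) _ p] assms(2) by auto
  have "z u - bdry (Suc n) w u = 0" for u
    by (rule part_zero) (use w chainsD(3) [OF assms(1)] chainsD(3) [OF bdry_chains [OF w(1)]] S_diff in auto)
  then show ?thesis using w(1) by (intro bexI [of _ w]) auto
qed

text \<open>In chain degree 0 the homotopy fails in internal degree 0 only, so modulo boundaries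
  every chain is constant in the algebra factor.\<close>

lemma bdry_exact_0:
  assumes "z \<in> chains 0"
  shows "\<exists>w\<in>chains 1. \<forall>u q. q \<ge> 1 \<longrightarrow> part q (z u - bdry 0 w u) = 0"
proof -
  obtain p where p: "\<And>q u. q \<ge> p \<Longrightarrow> part q (z u) = 0" using chain_bound [OF assms] by blast
  show ?thesis using bdry_exact_aux [where p = p, OF assms _ p] by simp
qed

end

section \<open>The dual of the Koszul complex\<close>

text \<open>Inverts multiplication by \<open>c\<close> plus the degree; the junk value of \<open>1 / 0\<close> makes it vanish in degree 0 if \<open>c = 0\<close>.\<close>

lift_definition twt :: "complex \<Rightarrow> 'i tensor \<Rightarrow> 'i tensor" is "\<lambda>c f w. f w / (c + of_nat (length w))"
  by (erule finite_subset [rotated]) auto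

interpretation twt: cvec_linear "twt c"
  by (rule cvec_linearI; rule poly_mapping_eqI)
    (simp_all add: twt.rep_eq lookup_add lookup_cscale cscale_complex_def add_divide_distrib)

lemma tsym_twt: "tsym s (twt c t) = twt c (tsym s t)"
proof (rule poly_mapping_eqI)
  fix w
  have "symz s (length w) (Poly_Mapping.lookup (twt c t)) w =
      symz s (length w) (\<lambda>v. inverse (c + of_nat (length w)) *\<^sub>C Poly_Mapping.lookup t v) w"
    by (rule symz_cong) (simp_all add: twt.rep_eq cscale_complex_def field_simps)
  then show "Poly_Mapping.lookup (tsym s (twt c t)) w = Poly_Mapping.lookup (twt c (tsym s t)) w"
    by (simp add: tsym.rep_eq twt.rep_eq symz_scale) (simp add: cscale_complex_def field_simps)
qed

lemma letter_mult_twt: "letter i * twt c t = twt (c - 1) (letter i * t)"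
proof (rule poly_mapping_eqI)
  fix w
  show "Poly_Mapping.lookup (letter i * twt c t) w = Poly_Mapping.lookup (twt (c - 1) (letter i * t)) w"
    by (cases w) (auto simp: twt.rep_eq lookup_letter_mult algebra_simps)
qed

lemma lookup_word_fun: "Poly_Mapping.lookup (tensor_word w) = (\<lambda>v. if v = w then 1 else 0)"
  by (rule ext) (auto simp: lookup_word)

lemma lookup_pmap: "cvec_linear L \<Longrightarrow> Poly_Mapping.lookup (Poly_Mapping.map L w) b = L (Poly_Mapping.lookup w b)"
  by (auto simp: map.rep_eq when_def cvec_linear.zero)

lemma pmap_linear: "cvec_linear L \<Longrightarrow> cvec_linear (Poly_Mapping.map L)"
  by (rule cvec_linearI; rule poly_mapping_eqI)
    (simp_all add: lookup_pmap lookup_add lookup_cscale cvec_linear.add cvec_linear.scale)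

lemma keys_pmap: "Poly_Mapping.keys (Poly_Mapping.map L w) \<subseteq> Poly_Mapping.keys w"
  by (auto simp: in_keys_iff map.rep_eq)

text \<open>As c is a natural number, c plus the degree vanishes only for c = 0 on
  constants.\<close>

lemma tpart_wt:
  fixes t :: "'i tensor"
  assumes that: "c = of_nat k"
  shows "c *\<^sub>C twt c t + tdeg (twt c t) = t - (if c = 0 then tpart 0 t else 0)"
proof (rule poly_mapping_eqI)
  fix w :: "'i list"
  have "c + of_nat (length w) = 0 \<longleftrightarrow> c = 0 \<and> length w = 0"
    unfolding that of_nat_add [symmetric] of_nat_eq_0_iff by simp
  moreover have "c * x / (c + y) + y * x / (c + y) = x" if "c + y \<noteq> 0" for x y
    using that by (simp add: add_divide_distrib [symmetric] distrib_right [symmetric])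
  ultimately show "Poly_Mapping.lookup (c *\<^sub>C twt c t + tdeg (twt c t)) w =
      Poly_Mapping.lookup (t - (if c = 0 then tpart 0 t else 0)) w"
    by (auto simp: lookup_add lookup_minus lookup_cscale twt.rep_eq tlookup cscale_complex_def)
qed

context braiding
begin

text \<open>Linear maps from the n-th term of the Koszul complex to the algebra, given by their
  values on words and therefore antisymmetric for the transposed braiding.\<close>

definition cochains :: "nat \<Rightarrow> ('i list \<Rightarrow> 'i tensor) set" where
  "cochains n = {f. (\<forall>u. length u \<noteq> n \<longrightarrow> f u = 0) \<and> symt (neg_braid (transp_braid s)) n f \<and> (\<forall>u. tsym s (f u) = f u)}"

text \<open>A sum over insertions instead of an average. On cochains of degree n it is therefore n +
  1 times the transpose of the Koszul differential, see \<open>pr_delta\<close>.\<close>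

definition delta :: "('i list \<Rightarrow> 'i tensor) \<Rightarrow> 'i list \<Rightarrow> 'i tensor" where
  "delta f = ins (neg_braid (transp_braid s)) (\<lambda>v. case v of [] \<Rightarrow> 0 | i # v \<Rightarrow> tsym s (letter i * f v))"

definition kap :: "('i list \<Rightarrow> 'i tensor) \<Rightarrow> 'i list \<Rightarrow> 'i tensor" where
  "kap f u = (\<Sum>j\<in>UNIV. lder j (f (j # u)))"

lemma cochainsD: "f \<in> cochains n \<Longrightarrow> length u \<noteq> n \<Longrightarrow> f u = 0"
  "f \<in> cochains n \<Longrightarrow> symt (neg_braid (transp_braid s)) n f" "f \<in> cochains n \<Longrightarrow> tsym s (f u) = f u"
  by (simp_all add: cochains_def)

lemma twt_cochains: "f \<in> cochains n \<Longrightarrow> (\<lambda>u. twt c (f u)) \<in> cochains n"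
  by (auto simp: cochains_def tsym_twt intro: symt_linear [OF twt.cvec_linear_axioms])

lemma delta_twt: "delta (\<lambda>u. twt c (f u)) u = twt (c - 1) (delta f u)"
proof -
  have "(case v of [] \<Rightarrow> 0 | i # v \<Rightarrow> tsym s (letter i * twt c (f v))) =
      twt (c - 1) (case v of [] \<Rightarrow> 0 | i # v \<Rightarrow> tsym s (letter i * f v))" for v
    by (cases v) (simp_all add: letter_mult_twt tsym_twt)
  then show ?thesis
    unfolding delta_def ins_linear [OF twt.cvec_linear_axioms] by (intro ins_cong)
qed

end

context normalized_braiding
begin

text \<open>Up to a scalar on each bigraded piece, \<open>kap\<close> is a contracting homotopy for \<open>delta\<close>.\<close>

lemma kap_delta:
  assumes f: "f \<in> cochains n" and u: "length u = n"
  shows "kap (delta f) u + delta (kap f) u = (of_nat CARD('i) - of_nat n) *\<^sub>C f u + tdeg (f u)"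
proof -
  let ?t = "neg_braid (transp_braid s)"
  let ?G = "\<lambda>v. case v of [] \<Rightarrow> 0 | i # v \<Rightarrow> tsym s (letter i * f v)"
  let ?K = "\<lambda>v. case v of [] \<Rightarrow> 0 | i # v \<Rightarrow> tsym s (letter i * kap f v)"
  have L: "lder j (tsym s (letter i * f v)) = (if i = j then f v else 0) +
      (\<Sum>z\<in>UNIV. \<Sum>y\<in>UNIV. s i z j y *\<^sub>C tsym s (letter y * lder z (f v)))" for i j v
    by (rule lder_letter_mult [OF cochainsD(3) [OF f]])
  have "kap (delta f) u = (\<Sum>j\<in>UNIV. lder j (tsym s (letter j * f u))) +
      (\<Sum>j\<in>UNIV. lder j (ins ?t (\<lambda>v. act0 ?t ?G (j # v)) u))"
    by (simp add: kap_def delta_def lder.add sum.distrib)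
  \<comment> \<open>The new letter stays in front: the untwisted term of the Leibniz rule gives the
    number of generators, and \<open>ptrace\<close> turns the twisted one into the Euler
    operator.\<close>
  also have "(\<Sum>j\<in>UNIV. lder j (tsym s (letter j * f u))) = of_nat CARD('i) *\<^sub>C f u + tdeg (f u)"
  proof -
    have "(\<Sum>j\<in>UNIV. lder j (tsym s (letter j * f u))) =
        (\<Sum>j\<in>(UNIV::'i set). f u) + (\<Sum>j\<in>UNIV. \<Sum>z\<in>UNIV. \<Sum>y\<in>UNIV. s j z j y *\<^sub>C tsym s (letter y * lder z (f u)))"
      unfolding L by (simp add: sum.distrib)
    also have "(\<Sum>j\<in>UNIV. \<Sum>z\<in>UNIV. \<Sum>y\<in>UNIV. s j z j y *\<^sub>C tsym s (letter y * lder z (f u))) =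
        (\<Sum>y\<in>UNIV. \<Sum>z\<in>UNIV. \<Sum>j\<in>UNIV. s j z j y *\<^sub>C tsym s (letter y * lder z (f u)))"
      by (rule sum_perm3(3))
    also have "\<dots> = (\<Sum>y\<in>UNIV. \<Sum>z\<in>UNIV. (if z = y then 1 else 0) *\<^sub>C tsym s (letter y * lder z (f u)))"
      by (simp only: cscale_sum_left [symmetric] ptrace)
    also have "\<dots> = tdeg (f u)"
      by (simp only: delta_cscale_sum tsym_euler_left [OF cochainsD(3) [OF f]])
    also have "(\<Sum>j\<in>(UNIV::'i set). f u) = of_nat CARD('i) *\<^sub>C f u"
    proof -
      have "(\<Sum>j\<in>(UNIV::'i set). f u) = (\<Sum>j\<in>(UNIV::'i set). 1 *\<^sub>C f u)" by simp
      also have "\<dots> = (\<Sum>j\<in>(UNIV::'i set). 1) *\<^sub>C f u" by (rule cscale_sum_left [symmetric])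
      finally show ?thesis by simp
    qed
    finally show ?thesis .
  qed
  \<comment> \<open>The new letter has moved: the untwisted terms give -f, with n insertions, and
    the twisted ones become \<open>- delta (kap f)\<close> by \<open>dual_inverse\<close>.\<close>
  also have "(\<Sum>j\<in>UNIV. lder j (ins ?t (\<lambda>v. act0 ?t ?G (j # v)) u)) =
      ins ?t (\<lambda>v. \<Sum>j\<in>UNIV. lder j (act0 ?t ?G (j # v))) u"
    by (simp add: ins_linear [OF lder.cvec_linear_axioms] ins_sum)
  also have "\<dots> = ins ?t (\<lambda>v. - 1 *\<^sub>C f v + - 1 *\<^sub>C ?K v) u"
  proof (cases u)
    case (Cons y0 v0)
    show ?thesis
    proof (rule ins_cong)
      fix w :: "'i list" assume "length w = length u"
      then obtain y v where w: "w = y # v" using Cons by (cases w) auto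
      let ?T = "\<lambda>z y'. \<lambda>b. tsym s (letter y' * lder z (f (b # v)))"
      have "(\<Sum>j\<in>UNIV. lder j (act0 ?t ?G (j # w))) =
          - (\<Sum>j\<in>UNIV. \<Sum>a\<in>UNIV. \<Sum>b\<in>UNIV. s j y a b *\<^sub>C lder j (tsym s (letter a * f (b # v))))"
        by (simp add: w neg_braid_def transp_braid_def lder.sum lder.scale lder.neg sum_negf)
      also have "(\<Sum>j\<in>UNIV. \<Sum>a\<in>UNIV. \<Sum>b\<in>UNIV. s j y a b *\<^sub>C lder j (tsym s (letter a * f (b # v)))) =
          (\<Sum>j\<in>UNIV. \<Sum>a\<in>UNIV. \<Sum>b\<in>UNIV. if a = j then s j y a b *\<^sub>C f (b # v) else 0) +
          (\<Sum>j\<in>UNIV. \<Sum>a\<in>UNIV. \<Sum>b\<in>UNIV. s j y a b *\<^sub>C (\<Sum>z\<in>UNIV. \<Sum>y'\<in>UNIV. s a z j y' *\<^sub>C ?T z y' b))"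
        unfolding sum.distrib [symmetric] L by (intro sum.cong refl) (simp add: cscale_right_distrib)
      also have "(\<Sum>j\<in>UNIV. \<Sum>a\<in>UNIV. \<Sum>b\<in>UNIV. if a = j then s j y a b *\<^sub>C f (b # v) else 0) = f (y # v)"
      proof -
        have "(\<Sum>j\<in>UNIV. \<Sum>a\<in>UNIV. \<Sum>b\<in>UNIV. if a = j then s j y a b *\<^sub>C f (b # v) else 0) =
            (\<Sum>j\<in>UNIV. \<Sum>b\<in>UNIV. \<Sum>a\<in>UNIV. if a = j then s j y a b *\<^sub>C f (b # v) else 0)"
          by (rule sum_perm3(1))
        also have "\<dots> = (\<Sum>b\<in>UNIV. \<Sum>j\<in>UNIV. s j y j b *\<^sub>C f (b # v))"
          by (subst sum.swap) simp
        also have "\<dots> = (\<Sum>b\<in>UNIV. (if y = b then 1 else 0) *\<^sub>C f (b # v))"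
          by (simp only: cscale_sum_left [symmetric] ptrace)
        finally show ?thesis by (simp only: delta_cscale_sum)
      qed
      also have "(\<Sum>j\<in>UNIV. \<Sum>a\<in>UNIV. \<Sum>b\<in>UNIV. s j y a b *\<^sub>C (\<Sum>z\<in>UNIV. \<Sum>y'\<in>UNIV. s a z j y' *\<^sub>C ?T z y' b)) =
          (\<Sum>(j, a, b, z, y')\<in>UNIV. (s j y a b * s a z j y') *\<^sub>C ?T z y' b)"
        by (simp add: cscale_sum_right cscale_cscale sum.cartesian_product split_def flip: UNIV_Times_UNIV)
      also have "\<dots> = (\<Sum>(b, y', z, j, a)\<in>UNIV. (s j y a b * s a z j y') *\<^sub>C ?T z y' b)"
        by (rule sum.reindex_bij_witness [where i = "\<lambda>(b, y', z, j, a). (j, a, b, z, y')"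
              and j = "\<lambda>(j, a, b, z, y'). (b, y', z, j, a)"]) auto
      also have "\<dots> = (\<Sum>b\<in>UNIV. \<Sum>y'\<in>UNIV. \<Sum>z\<in>UNIV. (\<Sum>j\<in>UNIV. \<Sum>a\<in>UNIV. s j y a b * s a z j y') *\<^sub>C ?T z y' b)"
        by (simp add: cscale_sum_left sum.cartesian_product split_def flip: UNIV_Times_UNIV)
      also have "\<dots> = (\<Sum>b\<in>UNIV. \<Sum>y'\<in>UNIV. \<Sum>z\<in>UNIV. if z = b then if y' = y then ?T z y' b else 0 else 0)"
        unfolding dual_inverse by (intro sum.cong refl) auto
      also have "\<dots> = (\<Sum>b\<in>UNIV. ?T b y b)" by simp
      also have "\<dots> = tsym s (letter y * kap f v)"
        by (simp add: kap_def sum_distrib_left tsym.sum)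
      finally show "(\<Sum>j\<in>UNIV. lder j (act0 ?t ?G (j # w))) = - 1 *\<^sub>C f w + - 1 *\<^sub>C ?K w"
        by (simp add: w)
    qed
  qed simp
  also have "\<dots> = - (of_nat n *\<^sub>C f u) - delta (kap f) u"
    unfolding ins_add ins_scale delta_def using ins_symt [OF cochainsD(2) [OF f] u] by simp
  finally show ?thesis by (simp add: cvec.scale_left_diff_distrib)
qed

text \<open>On a cocycle of degree n, \<open>delta (kap f)\<close> multiplies the component of
  degree p by N - n + p, and \<open>twt\<close> divides by this scalar beforehand. For n at most N
  it vanishes only for n = N and p = 0, where the constant term remains as an error.\<close>

lemma cocycle_eq:
  assumes f: "f \<in> cochains n" and "n \<le> CARD('i)" and "\<And>u. delta f u = 0" and "length u = n"
  shows "delta (kap (\<lambda>v. twt (of_nat (CARD('i) - n)) (f v))) u = f u - (if n = CARD('i) then tpart 0 (f u) else 0)"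
proof -
  let ?c = "of_nat (CARD('i) - n) :: complex"
  have "kap (delta (\<lambda>v. twt ?c (f v))) u = 0"
    by (simp add: kap_def delta_twt assms(3))
  then have "delta (kap (\<lambda>v. twt ?c (f v))) u =
      (of_nat CARD('i) - of_nat n) *\<^sub>C twt ?c (f u) + tdeg (twt ?c (f u))"
    using kap_delta [OF twt_cochains [OF f, of ?c] assms(4)] by simp
  also have "of_nat CARD('i) - of_nat n = ?c" using assms(2) by simp
  finally show ?thesis using tpart_wt [of ?c "CARD('i) - n" "f u"] assms(2) by (auto split: if_splits)
qed

end

section \<open>Antisymmetric tensors of top degree\<close>

text \<open>The symmetrizer is a matrix with scalar entries, so what is known for complex
  coefficients passes to every vector space.\<close>

lemma symz_expand:
  fixes f :: "'i::finite list \<Rightarrow> 'w::cvec"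
  assumes "length u = n"
  shows "symz s n f u = (\<Sum>w\<in>words n. symz s n (\<lambda>v. if v = w then 1 else 0) u *\<^sub>C f w)"
proof -
  have lin: "cvec_linear (\<lambda>c :: complex. c *\<^sub>C x)" for x :: 'w
    by (rule cvec_linearI) (simp_all add: cscale_left_distrib cscale_cscale cscale_complex_def)
  have L: "L (symz s n g u) = symz s n (\<lambda>v. L (g v)) u" if "cvec_linear L"
    for L :: "complex \<Rightarrow> 'w" and g :: "'i list \<Rightarrow> complex" and u n
  proof (induction n arbitrary: g u)
    case (Suc n)
    interpret cvec_linear L by fact
    have "L (symz s (Suc n) g u) = inverse (of_nat (Suc n)) *\<^sub>C
        ins s (\<lambda>v. L (case v of [] \<Rightarrow> 0 | i # v \<Rightarrow> symz s n (\<lambda>v. g (i # v)) v)) u"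
      by (simp only: symz.simps scale ins_linear [OF that])
    also have "(\<lambda>v. L (case v of [] \<Rightarrow> 0 | i # v \<Rightarrow> symz s n (\<lambda>v. g (i # v)) v)) =
        (\<lambda>v. case v of [] \<Rightarrow> 0 | i # v \<Rightarrow> symz s n (\<lambda>v. L (g (i # v))) v)"
      by (rule ext) (auto simp: Suc split: list.split)
    finally show ?case by (simp only: symz.simps)
  qed simp
  have "symz s n f u = symz s n (\<lambda>v. \<Sum>w\<in>words n. (if v = w then 1 else 0) *\<^sub>C f w) u"
  proof (rule symz_cong [OF _ assms])
    fix v :: "'i list" assume "length v = n"
    then have "f v = (\<Sum>w\<in>words n. if v = w then f w else 0)" by (simp add: mem_words)
    also have "\<dots> = (\<Sum>w\<in>words n. (if v = w then 1 else 0) *\<^sub>C f w)" by (rule sum.cong) auto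
    finally show "f v = (\<Sum>w\<in>words n. (if v = w then 1 else 0) *\<^sub>C f w)" .
  qed
  also have "\<dots> = (\<Sum>w\<in>words n. symz s n (\<lambda>v. (if v = w then 1 else 0) *\<^sub>C f w) u)"
    by (rule symz_sum)
  finally show ?thesis by (simp only: L [OF lin])
qed

context braiding
begin

text \<open>Trace 0 forces dimension 0; then the matrix of the projection is 0, and with it every
  symmetric function, whatever its values.\<close>

lemma symt_trace_0:
  assumes "symz_trace s n = 0" and "symt s n f" and "length u = n"
  shows "f u = 0"
proof -
  obtain B where B: "finite B" "cvec.span B = sym_degree n" "symz_trace s n = of_nat (card B)"
    using sym_degree_basis [of n] by metis
  then have "sym_degree n = {0}" using assms(1) by auto
  then have z: "tsym s (tensor_word w) = 0" if "w \<in> words n" for w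
    using that word_degree [of w] unfolding sym_degree_def mem_words by blast
  have "symz s n (\<lambda>v. if v = w then 1 else 0 :: complex) u = 0" if "w \<in> words n" for w
  proof -
    have "Poly_Mapping.lookup (tsym s (tensor_word w)) u = 0" using z [OF that] by simp
    then show ?thesis using assms(3) by (simp add: tsym.rep_eq lookup_word_fun)
  qed
  then have "symz s n f u = 0" by (subst symz_expand [OF assms(3)]) simp
  then show ?thesis using symz_symt [OF assms(2,3)] by simp
qed

text \<open>The image of the projection is a line. Dividing a spanning vector by a nonzero
  coefficient, at u0, makes the value at u0 the coordinate. In top antisymmetric degree \<omega>
  plays the part of the determinant.\<close>

lemma symt_trace_1:
  assumes "symz_trace s n = 1"
  obtains \<omega> :: "'i list \<Rightarrow> complex" and u0 where "length u0 = n" "\<omega> u0 = 1" "symt s n \<omega>"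
    "\<And>(f :: 'i list \<Rightarrow> 'w::cvec) u. symt s n f \<Longrightarrow> length u = n \<Longrightarrow> f u = \<omega> u *\<^sub>C f u0"
proof -
  obtain B where B: "finite B" "cvec.independent B" "cvec.span B = sym_degree n" "symz_trace s n = of_nat (card B)"
    using sym_degree_basis [of n] by metis
  then have "card B = 1" using assms by simp
  then obtain b where b: "B = {b}" by (rule card_1_singletonE)
  then have "b \<noteq> 0" using B(2) cvec.dependent_zero by blast
  have bS: "b \<in> sym_degree n" using B(3) b cvec.span_base by blast
  then have bd: "b \<in> tensor_degree n" "symt s n (Poly_Mapping.lookup b)"
    using tsym_fix_iff by (auto simp: sym_degree_iff)
  obtain u0 where u0: "Poly_Mapping.lookup b u0 \<noteq> 0"
    using \<open>b \<noteq> 0\<close> by (metis poly_mapping_eqI lookup_zero)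
  then have len: "length u0 = n" using bd(1) by (auto simp: tensor_degree_iff)
  have "\<exists>k. tsym s (tensor_word w) = k *\<^sub>C b" if "w \<in> words n" for w
  proof -
    have "tsym s (tensor_word w) \<in> cvec.span {b}"
      using that word_degree [of w] B(3) b unfolding sym_degree_def mem_words by blast
    then show ?thesis by (auto simp: cvec.span_singleton)
  qed
  then obtain k where k: "\<And>w. w \<in> words n \<Longrightarrow> tsym s (tensor_word w) = k w *\<^sub>C b" by metis
  define \<omega> where "\<omega> u = Poly_Mapping.lookup b u / Poly_Mapping.lookup b u0" for u
  have kb: "symz s n (\<lambda>v. if v = w then 1 else 0) u = k w * Poly_Mapping.lookup b u" if "w \<in> words n" "length u = n" for w u
    using arg_cong [where f = "\<lambda>t. Poly_Mapping.lookup t u", OF k [OF that(1)]] that(2)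
    by (simp add: tsym.rep_eq lookup_word_fun lookup_cscale cscale_complex_def)
  have ex: "f u = Poly_Mapping.lookup b u *\<^sub>C (\<Sum>w\<in>words n. k w *\<^sub>C f w)" if "symt s n f" "length u = n"
    for f :: "'i list \<Rightarrow> 'w" and u
    using symz_symt [OF that] symz_expand [OF that(2), of s f] that(2)
    by (simp add: kb cscale_sum_right cscale_cscale mult.commute)
  have "f u = \<omega> u *\<^sub>C f u0" if "symt s n f" "length u = n" for f :: "'i list \<Rightarrow> 'w" and u
    by (subst (1 2) ex [OF that(1)]) (use that len u0 in \<open>simp_all add: cscale_cscale \<omega>_def\<close>)
  moreover have "symt s n \<omega>"
    using symt_scale [OF bd(2), of "inverse (Poly_Mapping.lookup b u0)"]
    by (simp add: \<omega>_def [abs_def] cscale_complex_def divide_inverse mult.commute)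
  moreover have "\<omega> u0 = 1" using u0 by (simp add: \<omega>_def)
  ultimately show ?thesis using that len by blast
qed

end

section \<open>Coefficients in a module with a basis\<close>

text \<open>\<open>B\<close> is a basis of the module and \<open>mu i b\<close> are the coordinates of the product of the generator \<open>i\<close> with the
  basis element \<open>b\<close>.\<close>

locale coeff_module = normalized_braiding s for s :: "'i::finite braid" +
  fixes B :: "'b set" and mu :: "'i \<Rightarrow> 'b \<Rightarrow> 'b \<Rightarrow>\<^sub>0 complex"
  assumes mu_keys: "Poly_Mapping.keys (mu i m) \<subseteq> B"
    and mu_rel: "m \<in> B \<Longrightarrow>
      (\<Sum>m'\<in>Poly_Mapping.keys (mu b m). Poly_Mapping.lookup (mu b m) m' *\<^sub>C mu a m') =
      (\<Sum>j\<in>UNIV. \<Sum>k\<in>UNIV. s a b j k *\<^sub>C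
        (\<Sum>m'\<in>Poly_Mapping.keys (mu k m). Poly_Mapping.lookup (mu k m) m' *\<^sub>C mu j m'))"
begin

text \<open>A family w stands for the sum of all \<open>w b\<close> tensor b in the tensor product
  of the algebra and the module; the generator acts on the second factor.\<close>

definition lam :: "'i \<Rightarrow> ('b \<Rightarrow>\<^sub>0 'i tensor) \<Rightarrow> 'b \<Rightarrow>\<^sub>0 'i tensor" where
  "lam i w = (\<Sum>b\<in>Poly_Mapping.keys w. Poly_Mapping.map (\<lambda>c. c *\<^sub>C Poly_Mapping.lookup w b) (mu i b))"

lemma lin_scale_left: "cvec_linear (\<lambda>c :: complex. c *\<^sub>C (x :: 'w::cvec))"
  by (rule cvec_linearI) (simp_all add: cscale_left_distrib cscale_cscale cscale_complex_def)

lemma lam_superset: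
  assumes "finite K" "Poly_Mapping.keys w \<subseteq> K"
  shows "lam i w = (\<Sum>b\<in>K. Poly_Mapping.map (\<lambda>c. c *\<^sub>C Poly_Mapping.lookup w b) (mu i b))"
  unfolding lam_def
proof (rule sum.mono_neutral_left [OF assms])
  show "\<forall>b\<in>K - Poly_Mapping.keys w. Poly_Mapping.map (\<lambda>c. c *\<^sub>C Poly_Mapping.lookup w b) (mu i b) = 0"
    by (auto intro!: poly_mapping_eqI simp: map.rep_eq in_keys_iff)
qed

lemma lookup_lam:
  assumes "finite K" "Poly_Mapping.keys w \<subseteq> K"
  shows "Poly_Mapping.lookup (lam i w) b' = (\<Sum>b\<in>K. Poly_Mapping.lookup (mu i b) b' *\<^sub>C Poly_Mapping.lookup w b)"
  unfolding lam_superset [OF assms] by (simp add: lookup_sum lookup_pmap [OF lin_scale_left])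

lemma lam_linear: "cvec_linear (lam i)"
proof (rule cvec_linearI)
  fix x y :: "'b \<Rightarrow>\<^sub>0 'i tensor" and c
  let ?K = "Poly_Mapping.keys x \<union> Poly_Mapping.keys y"
  have K: "finite ?K" "Poly_Mapping.keys x \<subseteq> ?K" "Poly_Mapping.keys y \<subseteq> ?K" "Poly_Mapping.keys (x + y) \<subseteq> ?K"
    using keys_add [of x y] by auto
  show "lam i (x + y) = lam i x + lam i y"
    by (rule poly_mapping_eqI)
      (simp add: lookup_lam [OF K(1,2)] lookup_lam [OF K(1,3)] lookup_lam [OF K(1,4)] lookup_add
        cscale_right_distrib sum.distrib)
  have K: "finite (Poly_Mapping.keys x)" "Poly_Mapping.keys (c *\<^sub>C x) \<subseteq> Poly_Mapping.keys x"
    by (auto simp: in_keys_iff lookup_cscale)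
  show "lam i (c *\<^sub>C x) = c *\<^sub>C lam i x"
    by (rule poly_mapping_eqI)
      (simp add: lookup_lam [OF K] lookup_lam [OF K(1) subset_refl] lookup_cscale cscale_sum_right cscale_cscale
        mult.commute)
qed

lemma lam_pmap:
  assumes "cvec_linear L" shows "lam i (Poly_Mapping.map L w) = Poly_Mapping.map L (lam i w)"
proof -
  interpret cvec_linear L by fact
  have "Poly_Mapping.lookup (lam i (Poly_Mapping.map L w)) k =
      (\<Sum>b\<in>Poly_Mapping.keys w. Poly_Mapping.lookup (mu i b) k *\<^sub>C L (Poly_Mapping.lookup w b))" for k
    by (subst lookup_lam [OF finite_keys keys_pmap]) (simp add: lookup_pmap [OF assms])
  then show ?thesis
    by (intro poly_mapping_eqI) (simp add: lookup_lam [OF finite_keys subset_refl] lookup_pmap [OF assms] sum scale)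
qed

lemma lam_single: "lam i (Poly_Mapping.single b t) = Poly_Mapping.map (\<lambda>c. c *\<^sub>C t) (mu i b)"
  by (subst lam_superset [of "{b}"]) auto

lemma lam_pmap_scale:
  "lam i (Poly_Mapping.map (\<lambda>c. c *\<^sub>C t) p) =
    Poly_Mapping.map (\<lambda>c. c *\<^sub>C t) (\<Sum>m\<in>Poly_Mapping.keys p. Poly_Mapping.lookup p m *\<^sub>C mu i m)"
  by (rule poly_mapping_eqI)
    (simp add: lookup_lam [OF finite_keys keys_pmap] lookup_pmap [OF lin_scale_left] lookup_sum lookup_cscale
      cscale_sum_left cscale_cscale cscale_complex_def mult.commute)

lemma lam_keys: "Poly_Mapping.keys (lam i w) \<subseteq> B"
proof
  fix b' assume "b' \<in> Poly_Mapping.keys (lam i w)"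
  then have "(\<Sum>b\<in>Poly_Mapping.keys w. Poly_Mapping.lookup (mu i b) b' *\<^sub>C Poly_Mapping.lookup w b) \<noteq> 0"
    by (simp add: in_keys_iff lookup_lam [OF finite_keys subset_refl])
  then obtain b where "Poly_Mapping.lookup (mu i b) b' \<noteq> 0" by (metis (mono_tags) sum.neutral cvec.scale_zero_left)
  then show "b' \<in> B" using mu_keys [of i b] by (auto simp: in_keys_iff)
qed

lemma pmap_expand: "w = (\<Sum>b\<in>Poly_Mapping.keys w. Poly_Mapping.single b (Poly_Mapping.lookup w b))"
proof (rule poly_mapping_eqI)
  fix k
  have "(\<Sum>b\<in>Poly_Mapping.keys w. if b = k then Poly_Mapping.lookup w b else 0) = Poly_Mapping.lookup w k"
    by (simp add: in_keys_iff)
  then show "Poly_Mapping.lookup w k =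
      Poly_Mapping.lookup (\<Sum>b\<in>Poly_Mapping.keys w. Poly_Mapping.single b (Poly_Mapping.lookup w b)) k"
    by (simp add: lookup_sum lookup_single when_def)
qed

lemma lam_rel:
  assumes "Poly_Mapping.keys w \<subseteq> B"
  shows "lam a (lam b w) = (\<Sum>j\<in>UNIV. \<Sum>k\<in>UNIV. s a b j k *\<^sub>C lam j (lam k w))"
proof -
  interpret lam: cvec_linear "lam i" for i by (rule lam_linear)
  interpret pm: cvec_linear "Poly_Mapping.map (\<lambda>c :: complex. c *\<^sub>C t) :: ('b \<Rightarrow>\<^sub>0 complex) \<Rightarrow> _" for t :: "'i tensor"
    by (rule pmap_linear [OF lin_scale_left])
  have single: "lam a (lam b (Poly_Mapping.single m t)) =
      (\<Sum>j\<in>UNIV. \<Sum>k\<in>UNIV. s a b j k *\<^sub>C lam j (lam k (Poly_Mapping.single m t)))" if "m \<in> B" for m t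
    unfolding lam_single lam_pmap_scale mu_rel [OF that, of b a] by (simp only: pm.sum pm.scale)
  have "lam a (lam b w) = (\<Sum>m\<in>Poly_Mapping.keys w. lam a (lam b (Poly_Mapping.single m (Poly_Mapping.lookup w m))))"
    by (subst pmap_expand) (simp only: lam.sum)
  also have "\<dots> = (\<Sum>m\<in>Poly_Mapping.keys w. \<Sum>j\<in>UNIV. \<Sum>k\<in>UNIV. s a b j k *\<^sub>C lam j (lam k (Poly_Mapping.single m (Poly_Mapping.lookup w m))))"
    by (rule sum.cong) (use single assms in auto)
  also have "\<dots> = (\<Sum>j\<in>UNIV. \<Sum>k\<in>UNIV. \<Sum>m\<in>Poly_Mapping.keys w. s a b j k *\<^sub>C lam j (lam k (Poly_Mapping.single m (Poly_Mapping.lookup w m))))"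
    by (subst sum.swap, rule sum.cong [OF refl], rule sum.swap)
  also have "\<dots> = (\<Sum>j\<in>UNIV. \<Sum>k\<in>UNIV. s a b j k *\<^sub>C lam j (lam k w))"
    by (subst (3) pmap_expand) (simp only: lam.sum cscale_sum_right)
  finally show ?thesis .
qed

definition rhow :: "'i \<Rightarrow> ('b \<Rightarrow>\<^sub>0 'i tensor) \<Rightarrow> 'b \<Rightarrow>\<^sub>0 'i tensor" where
  "rhow i = Poly_Mapping.map (\<lambda>t. tsym s (t * letter i))"

definition sym_coeffs :: "('b \<Rightarrow>\<^sub>0 'i tensor) set" where
  "sym_coeffs = {w. Poly_Mapping.keys w \<subseteq> B \<and> (\<forall>b. tsym s (Poly_Mapping.lookup w b) = Poly_Mapping.lookup w b)}"

lemma lin_rhow: "cvec_linear (\<lambda>t. tsym s (t * letter i))"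
  by (rule cvec_linearI) (simp_all add: distrib_right tsym.add tsym.scale cscale_mult_left)

lemma tsym_rel: "tsym s (t * (letter a * letter b)) = (\<Sum>j\<in>UNIV. \<Sum>k\<in>UNIV. s a b j k *\<^sub>C tsym s (t * (letter j * letter k)))"
proof -
  have "tsym s (t * braid_rel s a b) = 0"
    using braid_ideal_mult_left [OF braid_ideal_gen [of "[]" s a b "[]"], of t] by (simp add: word_Nil tsym_eq_0)
  then show ?thesis
    by (simp add: braid_rel_def right_diff_distrib tsym.diff sum_distrib_left tsym.sum tsym.scale cscale_mult_right word_mult_word)
qed

lemma pmap_tpart_zero:
  fixes w :: "'b \<Rightarrow>\<^sub>0 'i tensor"
  assumes "\<And>q. Poly_Mapping.map (tpart q) w = 0"
  shows "w = 0"
proof (rule poly_mapping_eqI)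
  fix b
  have "tpart q (Poly_Mapping.lookup w b) = 0" for q
    using arg_cong [where f = "\<lambda>x. Poly_Mapping.lookup x b", OF assms [of q]]
    by (simp add: lookup_pmap [OF tpart.cvec_linear_axioms])
  moreover obtain n where "(\<Sum>k<n. tpart k (Poly_Mapping.lookup w b)) = Poly_Mapping.lookup w b"
    using tpart_add_all by blast
  ultimately show "Poly_Mapping.lookup w b = Poly_Mapping.lookup 0 b" by simp
qed

lemma pmap_tpart_bound:
  fixes w :: "'b \<Rightarrow>\<^sub>0 'i tensor"
  shows "\<exists>p. \<forall>q\<ge>p. Poly_Mapping.map (tpart q) w = 0"
proof -
  have "\<exists>n. \<forall>b. \<forall>m\<ge>n b. (\<Sum>k<m. tpart k (Poly_Mapping.lookup w b)) = Poly_Mapping.lookup w b"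
    by (rule choice) (rule allI, rule tpart_add_all)
  then obtain n where n: "\<And>b m. m \<ge> n b \<Longrightarrow> (\<Sum>k<m. tpart k (Poly_Mapping.lookup w b)) = Poly_Mapping.lookup w b"
    by blast
  show "\<exists>p. \<forall>q\<ge>p. Poly_Mapping.map (tpart q) w = 0"
  proof (rule exI [of _ "Max (insert 0 (n ` Poly_Mapping.keys w))"], intro allI impI, rule poly_mapping_eqI)
    fix q b assume q: "q \<ge> Max (insert 0 (n ` Poly_Mapping.keys w))"
    show "Poly_Mapping.lookup (Poly_Mapping.map (tpart q) w) b = Poly_Mapping.lookup 0 b"
    proof (cases "b \<in> Poly_Mapping.keys w")
      case True
      then have "n b \<le> Max (insert 0 (n ` Poly_Mapping.keys w))" by (intro Max_ge) auto
      then have "q \<ge> n b" using q by (rule order_trans)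
      have "tpart q (Poly_Mapping.lookup w b) = tpart q (\<Sum>k<n b. tpart k (Poly_Mapping.lookup w b))"
        by (simp only: n [OF order_refl])
      also have "\<dots> = (\<Sum>k<n b. tpart q (tpart k (Poly_Mapping.lookup w b)))" by (rule tpart.sum)
      also have "\<dots> = 0" using \<open>q \<ge> n b\<close> by (intro sum.neutral) (auto simp: tpart_tpart)
      finally show ?thesis by (simp add: lookup_pmap [OF tpart.cvec_linear_axioms])
    qed (simp add: lookup_pmap [OF tpart.cvec_linear_axioms] in_keys_iff)
  qed
qed

text \<open>Apart from the conditions on \<open>lam\<close>, everything holds for each coefficient
  separately and restates facts on right multiplication, right derivatives and homogeneous
  components.\<close>

sublocale koszul_complex s sym_coeffs rhow "\<lambda>i. Poly_Mapping.map (rder i)" lam "\<lambda>p. Poly_Mapping.map (tpart p)"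
proof (intro koszul_complex.intro koszul_complex_axioms.intro)
  show "braiding s" by unfold_locales
  note lk = lookup_pmap [OF lin_rhow] lookup_pmap [OF rder.cvec_linear_axioms] lookup_pmap [OF tpart.cvec_linear_axioms]
  note keys = subset_trans [OF keys_pmap]
  have lm: "Poly_Mapping.lookup (lam i w) b = (\<Sum>m\<in>Poly_Mapping.keys w. Poly_Mapping.lookup (mu i m) b *\<^sub>C Poly_Mapping.lookup w m)" for i w b
    by (rule lookup_lam [OF finite_keys subset_refl])
  show "cvec.subspace sym_coeffs"
  proof (rule cvec.subspaceI)
    show "x + y \<in> sym_coeffs" if "x \<in> sym_coeffs" "y \<in> sym_coeffs" for x y
      using that keys_add [of x y] unfolding sym_coeffs_def by (auto simp: lookup_add tsym.add)
    show "c *\<^sub>C x \<in> sym_coeffs" if "x \<in> sym_coeffs" for c x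
      using that unfolding sym_coeffs_def by (auto simp: lookup_cscale tsym.scale in_keys_iff)
  qed (simp add: sym_coeffs_def)
  fix i j k a b and p q :: nat and w :: "'b \<Rightarrow>\<^sub>0 'i tensor"
  show "cvec_linear (rhow i)" unfolding rhow_def by (rule pmap_linear [OF lin_rhow])
  show "cvec_linear (Poly_Mapping.map (rder i) :: ('b \<Rightarrow>\<^sub>0 'i tensor) \<Rightarrow> _)" by (rule pmap_linear [OF rder.cvec_linear_axioms])
  show "cvec_linear (lam i)" by (rule lam_linear)
  show "cvec_linear (Poly_Mapping.map (tpart p) :: ('b \<Rightarrow>\<^sub>0 'i tensor) \<Rightarrow> _)" by (rule pmap_linear [OF tpart.cvec_linear_axioms])
  assume w: "w \<in> sym_coeffs"
  then have sw: "tsym s (Poly_Mapping.lookup w b) = Poly_Mapping.lookup w b" and kw: "Poly_Mapping.keys w \<subseteq> B" for b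
    by (auto simp: sym_coeffs_def)
  show "rhow i w \<in> sym_coeffs" using keys [OF kw] by (auto simp: sym_coeffs_def rhow_def lk)
  show "Poly_Mapping.map (rder i) w \<in> sym_coeffs" using keys [OF kw] by (auto simp: sym_coeffs_def lk sw tsym_rder)
  show "lam i w \<in> sym_coeffs" using lam_keys by (auto simp: sym_coeffs_def lm tsym.sum tsym.scale sw)
  show "Poly_Mapping.map (tpart p) w \<in> sym_coeffs" using keys [OF kw] by (auto simp: sym_coeffs_def lk sw tsym_tpart)
  show "Poly_Mapping.map (rder k) (rhow i w) = (if i = k then w else 0) +
      (\<Sum>z\<in>UNIV. \<Sum>y\<in>UNIV. s z i y k *\<^sub>C rhow y (Poly_Mapping.map (rder z) w))"
    by (rule poly_mapping_eqI)
      (auto simp: rhow_def lk lookup_add lookup_sum lookup_cscale rder_mult_letter [OF sw])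
  show "(\<Sum>i\<in>UNIV. rhow i (Poly_Mapping.map (rder i) (Poly_Mapping.map (tpart p) w))) =
      of_nat p *\<^sub>C Poly_Mapping.map (tpart p) w"
  proof (rule poly_mapping_eqI)
    fix b
    have "tsym s (tpart p (Poly_Mapping.lookup w b)) = tpart p (Poly_Mapping.lookup w b)"
      by (simp add: tsym_tpart sw)
    from tsym_euler_right [OF this]
    show "Poly_Mapping.lookup (\<Sum>i\<in>UNIV. rhow i (Poly_Mapping.map (rder i) (Poly_Mapping.map (tpart p) w))) b =
        Poly_Mapping.lookup (of_nat p *\<^sub>C Poly_Mapping.map (tpart p) w) b"
      by (simp add: rhow_def lk lookup_sum lookup_cscale tdeg_tpart)
  qed
  show "rhow b (rhow a w) = (\<Sum>j\<in>UNIV. \<Sum>k\<in>UNIV. s a b j k *\<^sub>C rhow k (rhow j w))"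
    by (rule poly_mapping_eqI)
      (simp add: rhow_def lk lookup_sum lookup_cscale mult.assoc, rule tsym_rel)
  show "lam a (lam b w) = (\<Sum>j\<in>UNIV. \<Sum>k\<in>UNIV. s a b j k *\<^sub>C lam j (lam k w))"
    by (rule lam_rel [OF kw])
  show "rhow i (lam j w) = lam j (rhow i w)" unfolding rhow_def by (rule lam_pmap [OF lin_rhow, symmetric])
  show "Poly_Mapping.map (tpart (Suc p)) (rhow i w) = rhow i (Poly_Mapping.map (tpart p) w)"
    by (rule poly_mapping_eqI) (simp add: rhow_def lk tpart_mult_letter flip: tsym_tpart)
  show "Poly_Mapping.map (tpart 0) (rhow i w) = 0"
    by (rule poly_mapping_eqI) (simp add: rhow_def lk tpart_mult_letter_0 flip: tsym_tpart)
  show "Poly_Mapping.map (tpart p) (Poly_Mapping.map (rder i) w) = Poly_Mapping.map (rder i) (Poly_Mapping.map (tpart (Suc p)) w)"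
    by (rule poly_mapping_eqI) (simp add: lk tpart_rder)
  show "Poly_Mapping.map (tpart p) (lam i w) = lam i (Poly_Mapping.map (tpart p) w)"
    by (rule lam_pmap [OF tpart.cvec_linear_axioms, symmetric])
  show "Poly_Mapping.map (tpart p) (Poly_Mapping.map (tpart q) w) = (if p = q then Poly_Mapping.map (tpart p) w else 0)"
    by (rule poly_mapping_eqI) (auto simp: lk tpart_tpart)
qed (rule pmap_tpart_zero pmap_tpart_bound, (assumption | simp)?)+

end

section \<open>Left modules and projective resolutions\<close>

lemma linear_mapsD:
  assumes "f \<in> linear_maps A M N"
  shows "x \<in> carrier M \<Longrightarrow> f x \<in> carrier N"
    "x \<in> carrier M \<Longrightarrow> y \<in> carrier M \<Longrightarrow> f (x \<oplus>\<^bsub>M\<^esub> y) = f x \<oplus>\<^bsub>N\<^esub> f y"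
    "a \<in> carrier A \<Longrightarrow> x \<in> carrier M \<Longrightarrow> f (a \<odot>\<^bsub>M\<^esub> x) = a \<odot>\<^bsub>N\<^esub> f x"
  using assms by (auto simp: linear_maps_def)

lemma linear_mapsI:
  assumes "\<And>x. x \<in> carrier M \<Longrightarrow> f x \<in> carrier N"
    "\<And>x y. x \<in> carrier M \<Longrightarrow> y \<in> carrier M \<Longrightarrow> f (x \<oplus>\<^bsub>M\<^esub> y) = f x \<oplus>\<^bsub>N\<^esub> f y"
    "\<And>a x. a \<in> carrier A \<Longrightarrow> x \<in> carrier M \<Longrightarrow> f (a \<odot>\<^bsub>M\<^esub> x) = a \<odot>\<^bsub>N\<^esub> f x"
  shows "f \<in> linear_maps A M N"
  using assms by (auto simp: linear_maps_def)

lemma linear_maps_id: "(\<lambda>x. x) \<in> linear_maps A M M"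
  by (rule linear_mapsI) auto

lemma linear_maps_comp: "f \<in> linear_maps A M N \<Longrightarrow> g \<in> linear_maps A N L \<Longrightarrow> (\<lambda>x. g (f x)) \<in> linear_maps A M L"
  by (rule linear_mapsI) (simp_all add: linear_mapsD)

context left_module
begin

lemma smult_l_zero [simp]: "x \<in> carrier M \<Longrightarrow> \<zero> \<odot>\<^bsub>M\<^esub> x = \<zero>\<^bsub>M\<^esub>"
proof -
  assume x: "x \<in> carrier M"
  have "\<zero> \<odot>\<^bsub>M\<^esub> x \<oplus>\<^bsub>M\<^esub> \<zero> \<odot>\<^bsub>M\<^esub> x = \<zero> \<odot>\<^bsub>M\<^esub> x"
    using smult_l_distr [of \<zero> \<zero> x] x by simp
  then show ?thesis using x by (metis M.add.l_cancel_one' smult_closed zero_closed)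
qed

lemma smult_r_zero [simp]: "a \<in> carrier A \<Longrightarrow> a \<odot>\<^bsub>M\<^esub> \<zero>\<^bsub>M\<^esub> = \<zero>\<^bsub>M\<^esub>"
proof -
  assume a: "a \<in> carrier A"
  have "a \<odot>\<^bsub>M\<^esub> \<zero>\<^bsub>M\<^esub> \<oplus>\<^bsub>M\<^esub> a \<odot>\<^bsub>M\<^esub> \<zero>\<^bsub>M\<^esub> = a \<odot>\<^bsub>M\<^esub> \<zero>\<^bsub>M\<^esub>"
    using smult_r_distr [of a "\<zero>\<^bsub>M\<^esub>" "\<zero>\<^bsub>M\<^esub>"] a by simp
  then show ?thesis using a by (metis M.add.l_cancel_one' smult_closed M.zero_closed)
qed

lemma smult_r_minus: "a \<in> carrier A \<Longrightarrow> x \<in> carrier M \<Longrightarrow> a \<odot>\<^bsub>M\<^esub> (\<ominus>\<^bsub>M\<^esub> x) = \<ominus>\<^bsub>M\<^esub> (a \<odot>\<^bsub>M\<^esub> x)"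
  using smult_r_distr [of a "\<ominus>\<^bsub>M\<^esub> x" x] M.minus_equality [of "a \<odot>\<^bsub>M\<^esub> (\<ominus>\<^bsub>M\<^esub> x)" "a \<odot>\<^bsub>M\<^esub> x"]
  by (simp add: M.l_neg)

lemma minus_eq_smult: "x \<in> carrier M \<Longrightarrow> \<ominus>\<^bsub>M\<^esub> x = (\<ominus> \<one>) \<odot>\<^bsub>M\<^esub> x"
  using smult_l_distr [of "\<ominus> \<one>" \<one> x] M.minus_equality [of "(\<ominus> \<one>) \<odot>\<^bsub>M\<^esub> x" x] by (simp add: l_neg)

lemma minus_zero_eq: "\<ominus>\<^bsub>M\<^esub> \<zero>\<^bsub>M\<^esub> = \<zero>\<^bsub>M\<^esub>"
  using M.minus_equality [of "\<zero>\<^bsub>M\<^esub>" "\<zero>\<^bsub>M\<^esub>"] by simp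

lemma add_minus_cancel: "x \<in> carrier M \<Longrightarrow> y \<in> carrier M \<Longrightarrow> x \<oplus>\<^bsub>M\<^esub> (y \<ominus>\<^bsub>M\<^esub> x) = y"
  by (simp add: a_minus_def M.a_lcomm [of x y] M.r_neg)

lemma smult_finsum:
  assumes "a \<in> carrier A" "f \<in> K \<rightarrow> carrier M"
  shows "a \<odot>\<^bsub>M\<^esub> finsum M f K = finsum M (\<lambda>j. a \<odot>\<^bsub>M\<^esub> f j) K"
  using assms(2)
proof (induction K rule: infinite_finite_induct)
  case (insert j K)
  then have *: "f \<in> K \<rightarrow> carrier M" "f j \<in> carrier M" by auto
  then have "(\<lambda>j. a \<odot>\<^bsub>M\<^esub> f j) \<in> K \<rightarrow> carrier M" using assms(1) by auto
  then show ?case using insert * assms(1) by (simp add: M.finsum_insert smult_r_distr M.finsum_closed)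
qed (simp_all add: assms(1) M.finsum_infinite)

lemma submodule_left_module:
  assumes "N \<subseteq> carrier M" "\<zero>\<^bsub>M\<^esub> \<in> N" "\<And>x y. x \<in> N \<Longrightarrow> y \<in> N \<Longrightarrow> x \<oplus>\<^bsub>M\<^esub> y \<in> N"
    "\<And>a x. a \<in> carrier A \<Longrightarrow> x \<in> N \<Longrightarrow> a \<odot>\<^bsub>M\<^esub> x \<in> N"
  shows "left_module A (M\<lparr>carrier := N\<rparr>)"
proof (intro left_module.intro left_module_axioms.intro)
  show "ring A" by (rule ring_axioms)
  show "abelian_group (M\<lparr>carrier := N\<rparr>)"
  proof (rule abelian_groupI; simp)
    show "\<exists>y\<in>N. y \<oplus>\<^bsub>M\<^esub> x = \<zero>\<^bsub>M\<^esub>" if "x \<in> N" for x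
      using that assms(1) assms(4) [of "\<ominus> \<one>" x] M.l_neg [of x]
      by (intro bexI [of _ "\<ominus>\<^bsub>M\<^esub> x"]) (auto simp: minus_eq_smult)
  qed (use assms in \<open>auto intro: M.a_assoc M.a_comm\<close>)
qed (use assms in \<open>auto simp: smult_l_distr smult_r_distr smult_assoc1 subset_iff\<close>)

end

lemma linear_zero:
  assumes "left_module A M" "left_module A N" "f \<in> linear_maps A M N"
  shows "f \<zero>\<^bsub>M\<^esub> = \<zero>\<^bsub>N\<^esub>"
proof -
  interpret M: left_module A M by fact
  interpret N: left_module A N by fact
  have "f \<zero>\<^bsub>M\<^esub> \<oplus>\<^bsub>N\<^esub> f \<zero>\<^bsub>M\<^esub> = f \<zero>\<^bsub>M\<^esub>"
    using linear_mapsD(2) [OF assms(3), of "\<zero>\<^bsub>M\<^esub>" "\<zero>\<^bsub>M\<^esub>"] by simp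
  then show ?thesis using linear_mapsD(1) [OF assms(3), of "\<zero>\<^bsub>M\<^esub>"]
    by (metis M.M.zero_closed N.M.add.l_cancel_one')
qed

lemma linear_neg:
  assumes "left_module A M" "left_module A N" "f \<in> linear_maps A M N" "x \<in> carrier M"
  shows "f (\<ominus>\<^bsub>M\<^esub> x) = \<ominus>\<^bsub>N\<^esub> f x"
proof -
  interpret M: left_module A M by fact
  interpret N: left_module A N by fact
  show ?thesis using assms(4) linear_mapsD [OF assms(3)] by (simp add: M.minus_eq_smult N.minus_eq_smult)
qed

lemma linear_minus:
  assumes "left_module A M" "left_module A N" "f \<in> linear_maps A M N" "x \<in> carrier M" "y \<in> carrier M"
  shows "f (x \<ominus>\<^bsub>M\<^esub> y) = f x \<ominus>\<^bsub>N\<^esub> f y"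
proof -
  interpret M: left_module A M by fact
  show ?thesis
    unfolding a_minus_def
    using linear_mapsD(2) [OF assms(3)] linear_neg [OF assms(1-3)] assms(4,5) by simp
qed

lemma linear_maps_minus:
  assumes "left_module A M" "left_module A N" "f \<in> linear_maps A M N" "g \<in> linear_maps A M N"
  shows "(\<lambda>x. f x \<ominus>\<^bsub>N\<^esub> g x) \<in> linear_maps A M N"
proof -
  interpret M: left_module A M by fact
  interpret N: left_module A N by fact
  note f = linear_mapsD [OF assms(3)] and g = linear_mapsD [OF assms(4)]
  show ?thesis
  proof (rule linear_mapsI)
    fix x y assume x: "x \<in> carrier M" and y: "y \<in> carrier M"
    then have c: "f x \<in> carrier N" "f y \<in> carrier N" "g x \<in> carrier N" "g y \<in> carrier N" using f g by auto
    then show "f (x \<oplus>\<^bsub>M\<^esub> y) \<ominus>\<^bsub>N\<^esub> g (x \<oplus>\<^bsub>M\<^esub> y) = f x \<ominus>\<^bsub>N\<^esub> g x \<oplus>\<^bsub>N\<^esub> (f y \<ominus>\<^bsub>N\<^esub> g y)"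
      using x y f g by (simp add: a_minus_def N.M.minus_add N.M.a_ac)
  qed (use f g in \<open>auto simp: a_minus_def N.smult_r_distr N.smult_r_minus\<close>)
qed

section \<open>Free modules and the lifting property of projective modules\<close>

lemma free_module_simps [simp]:
  "carrier (free_module A J) = {f. (\<forall>j. f j \<in> carrier A) \<and> (\<forall>j. j \<notin> J \<longrightarrow> f j = \<zero>\<^bsub>A\<^esub>) \<and> finite {j. f j \<noteq> \<zero>\<^bsub>A\<^esub>}}"
  "\<zero>\<^bsub>free_module A J\<^esub> = (\<lambda>_. \<zero>\<^bsub>A\<^esub>)" "f \<oplus>\<^bsub>free_module A J\<^esub> g = (\<lambda>j. f j \<oplus>\<^bsub>A\<^esub> g j)"
  "a \<odot>\<^bsub>free_module A J\<^esub> f = (\<lambda>j. a \<otimes>\<^bsub>A\<^esub> f j)"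
  by (simp_all add: free_module_def)

lemma left_module_free:
  fixes A :: "('a, 'r) ring_scheme" and J :: "'b set"
  assumes "ring A" shows "left_module A (free_module A J)"
proof -
  interpret ring A by fact
  have fin: "finite {j. f j \<oplus>\<^bsub>A\<^esub> g j \<noteq> \<zero>\<^bsub>A\<^esub>}" if "finite {j. f j \<noteq> \<zero>\<^bsub>A\<^esub>}" "finite {j. g j \<noteq> \<zero>\<^bsub>A\<^esub>}" for f g :: "'b \<Rightarrow> 'a"
    by (rule finite_subset [of _ "{j. f j \<noteq> \<zero>\<^bsub>A\<^esub>} \<union> {j. g j \<noteq> \<zero>\<^bsub>A\<^esub>}"]) (use that in auto)
  have fin2: "finite {j. a \<otimes>\<^bsub>A\<^esub> f j \<noteq> \<zero>\<^bsub>A\<^esub>}" if "finite {j. f j \<noteq> \<zero>\<^bsub>A\<^esub>}" "a \<in> carrier A" for f :: "'b \<Rightarrow> 'a" and a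
    by (rule finite_subset [of _ "{j. f j \<noteq> \<zero>\<^bsub>A\<^esub>}"]) (use that in auto)
  show ?thesis
  proof (intro left_module.intro left_module_axioms.intro assms)
    show "abelian_group (free_module A J)"
    proof (rule abelian_groupI; simp)
      fix f assume f: "(\<forall>j. f j \<in> carrier A) \<and> (\<forall>j. j \<notin> J \<longrightarrow> f j = \<zero>\<^bsub>A\<^esub>) \<and> finite {j. f j \<noteq> \<zero>\<^bsub>A\<^esub>}"
      have "finite {j. \<ominus>\<^bsub>A\<^esub> f j \<noteq> \<zero>\<^bsub>A\<^esub>}"
        by (rule finite_subset [of _ "{j. f j \<noteq> \<zero>\<^bsub>A\<^esub>}"]) (use f in auto)
      then show "\<exists>g. (\<forall>j. g j \<in> carrier A) \<and> (\<forall>j. j \<notin> J \<longrightarrow> g j = \<zero>\<^bsub>A\<^esub>) \<and> finite {j. g j \<noteq> \<zero>\<^bsub>A\<^esub>} \<and>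
          (\<lambda>j. g j \<oplus>\<^bsub>A\<^esub> f j) = (\<lambda>_. \<zero>\<^bsub>A\<^esub>)"
        using f by (intro exI [of _ "\<lambda>j. \<ominus>\<^bsub>A\<^esub> f j"]) (auto simp: l_neg)
    qed (auto simp: fin a_ac)
  qed (auto simp: fin fin2 l_distr r_distr m_assoc)
qed

definition free_unit :: "('a, 'r) ring_scheme \<Rightarrow> 'j \<Rightarrow> 'j \<Rightarrow> 'a" where
  "free_unit A j = (\<lambda>k. if k = j then \<one>\<^bsub>A\<^esub> else \<zero>\<^bsub>A\<^esub>)"

lemma free_unit_closed: "ring A \<Longrightarrow> j \<in> J \<Longrightarrow> free_unit A j \<in> carrier (free_module A J)"
  unfolding free_unit_def by (auto simp: ring.ring_simprules intro: finite_subset [of _ "{j}"])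

text \<open>Induction on a finite set containing the support: splitting off a coordinate writes x as
  an element with smaller support plus a multiple of a unit vector.\<close>

lemma free_module_ext:
  assumes "ring A" "left_module A Y" "f \<in> linear_maps A (free_module A J) Y" "g \<in> linear_maps A (free_module A J) Y"
    and "\<And>j. j \<in> J \<Longrightarrow> f (free_unit A j) = g (free_unit A j)" and "x \<in> carrier (free_module A J)"
  shows "f x = g x"
proof -
  interpret ring A by fact
  note F = left_module_free [OF assms(1), of J]
  have "f x = g x" if "finite K" "x \<in> carrier (free_module A J)" "{j. x j \<noteq> \<zero>\<^bsub>A\<^esub>} \<subseteq> K" for K x
    using that
  proof (induction K arbitrary: x rule: finite_induct)
    case empty
    then have "x = \<zero>\<^bsub>free_module A J\<^esub>" by auto
    then show ?case using linear_zero [OF F assms(2)] assms(3,4) by metis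
  next
    case (insert j K)
    let ?x = "x(j := \<zero>\<^bsub>A\<^esub>)"
    have "finite {k. ?x k \<noteq> \<zero>\<^bsub>A\<^esub>}"
      by (rule finite_subset [of _ "{j. x j \<noteq> \<zero>\<^bsub>A\<^esub>}"]) (use insert.prems in auto)
    then have x': "?x \<in> carrier (free_module A J)" using insert.prems by auto
    then have eq: "f ?x = g ?x" by (rule insert.IH) (use insert.prems in auto)
    show ?case
    proof (cases "j \<in> J")
      case True
      have u: "free_unit A j \<in> carrier (free_module A J)" by (rule free_unit_closed [OF assms(1) True])
      have xj: "x j \<in> carrier A" using insert.prems by auto
      have "x = ?x \<oplus>\<^bsub>free_module A J\<^esub> (x j \<odot>\<^bsub>free_module A J\<^esub> free_unit A j)"
        using insert.prems by (auto simp: free_unit_def)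
      then have ex: "h x = h ?x \<oplus>\<^bsub>Y\<^esub> x j \<odot>\<^bsub>Y\<^esub> h (free_unit A j)" if "h \<in> linear_maps A (free_module A J) Y" for h
        using linear_mapsD(2) [OF that x' left_module.smult_closed [OF F xj u]] linear_mapsD(3) [OF that xj u] by simp
      show ?thesis by (simp only: ex [OF assms(3)] ex [OF assms(4)] assms(5) [OF True] eq)
    next
      case False
      then have "?x = x" using insert.prems by auto
      then show ?thesis using eq by simp
    qed
  qed
  moreover have "finite {j. x j \<noteq> \<zero>\<^bsub>A\<^esub>}" using assms(6) by simp
  ultimately show ?thesis using assms(6) by blast
qed

lemma free_module_extend:
  assumes "ring A" "left_module A Y" "\<And>j. j \<in> J \<Longrightarrow> y j \<in> carrier Y"
  obtains g where "g \<in> linear_maps A (free_module A J) Y" "\<And>j. j \<in> J \<Longrightarrow> g (free_unit A j) = y j"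
proof -
  interpret ring A by fact
  interpret Y: left_module A Y by fact
  define g where "g f = finsum Y (\<lambda>j. f j \<odot>\<^bsub>Y\<^esub> y j) {j. f j \<noteq> \<zero>\<^bsub>A\<^esub>}" for f
  have tm: "f j \<odot>\<^bsub>Y\<^esub> y j \<in> carrier Y" if "f \<in> carrier (free_module A J)" "f j \<noteq> \<zero>\<^bsub>A\<^esub>" for f j
    using that assms(3) by (auto simp: Y.smult_closed)
  have sup: "g f = finsum Y (\<lambda>j. f j \<odot>\<^bsub>Y\<^esub> y j) K"
    if "finite K" "{j. f j \<noteq> \<zero>\<^bsub>A\<^esub>} \<subseteq> K" "f \<in> carrier (free_module A J)" "K \<subseteq> J" for f K
    unfolding g_def
    by (rule Y.M.add.finprod_mono_neutral_cong_left [OF that(1,2)]) (use that assms(3) in \<open>auto simp: subset_iff\<close>)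
  have "g \<in> linear_maps A (free_module A J) Y"
  proof (rule linear_mapsI)
    fix f assume f: "f \<in> carrier (free_module A J)"
    show "g f \<in> carrier Y" unfolding g_def by (rule Y.M.finsum_closed) (use tm f in auto)
    have suppJ: "{j. f j \<noteq> \<zero>\<^bsub>A\<^esub>} \<subseteq> J" "finite {j. f j \<noteq> \<zero>\<^bsub>A\<^esub>}" using f by auto
    {
      fix f' assume f': "f' \<in> carrier (free_module A J)"
      let ?K = "{j. f j \<noteq> \<zero>\<^bsub>A\<^esub>} \<union> {j. f' j \<noteq> \<zero>\<^bsub>A\<^esub>}"
      have K: "finite ?K" "?K \<subseteq> J" using f f' by auto
      have ff: "f \<oplus>\<^bsub>free_module A J\<^esub> f' \<in> carrier (free_module A J)"
        using left_module_free [OF assms(1), of J] f f' by (meson abelian_groupE(1) left_module.axioms(2))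
      have "g (f \<oplus>\<^bsub>free_module A J\<^esub> f') = finsum Y (\<lambda>j. (f j \<oplus>\<^bsub>A\<^esub> f' j) \<odot>\<^bsub>Y\<^esub> y j) ?K"
        by (subst sup [OF K(1) _ ff K(2)]) auto
      also have "\<dots> = finsum Y (\<lambda>j. f j \<odot>\<^bsub>Y\<^esub> y j \<oplus>\<^bsub>Y\<^esub> f' j \<odot>\<^bsub>Y\<^esub> y j) ?K"
        by (rule Y.M.finsum_cong') (use f f' K assms(3) in \<open>auto simp: Y.smult_l_distr subset_iff\<close>)
      also have "\<dots> = finsum Y (\<lambda>j. f j \<odot>\<^bsub>Y\<^esub> y j) ?K \<oplus>\<^bsub>Y\<^esub> finsum Y (\<lambda>j. f' j \<odot>\<^bsub>Y\<^esub> y j) ?K"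
        by (rule Y.M.finsum_addf) (use f f' K assms(3) in \<open>auto simp: subset_iff\<close>)
      also have "\<dots> = g f \<oplus>\<^bsub>Y\<^esub> g f'"
        using sup [OF K(1) _ f K(2)] sup [OF K(1) _ f' K(2)] by auto
      finally show "g (f \<oplus>\<^bsub>free_module A J\<^esub> f') = g f \<oplus>\<^bsub>Y\<^esub> g f'" .
    }
    fix a assume a: "a \<in> carrier A"
    have af: "a \<odot>\<^bsub>free_module A J\<^esub> f \<in> carrier (free_module A J)"
      by (rule left_module.smult_closed [OF left_module_free [OF assms(1)] a f])
    have "g (a \<odot>\<^bsub>free_module A J\<^esub> f) = finsum Y (\<lambda>j. (a \<otimes>\<^bsub>A\<^esub> f j) \<odot>\<^bsub>Y\<^esub> y j) {j. f j \<noteq> \<zero>\<^bsub>A\<^esub>}"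
      by (subst sup [OF suppJ(2) _ af suppJ(1)]) (use a in auto)
    also have "\<dots> = finsum Y (\<lambda>j. a \<odot>\<^bsub>Y\<^esub> (f j \<odot>\<^bsub>Y\<^esub> y j)) {j. f j \<noteq> \<zero>\<^bsub>A\<^esub>}"
      by (rule Y.M.finsum_cong') (use f a suppJ assms(3) in \<open>auto simp: Y.smult_assoc1 subset_iff\<close>)
    also have "\<dots> = a \<odot>\<^bsub>Y\<^esub> g f"
      unfolding g_def by (rule Y.smult_finsum [symmetric]) (use a f tm in auto)
    finally show "g (a \<odot>\<^bsub>free_module A J\<^esub> f) = a \<odot>\<^bsub>Y\<^esub> g f" .
  qed
  moreover have "g (free_unit A j) = y j" if "j \<in> J" for j
  proof -
    have "g (free_unit A j) = finsum Y (\<lambda>k. free_unit A j k \<odot>\<^bsub>Y\<^esub> y k) {j}"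
      by (rule sup) (use that free_unit_closed [OF assms(1) that] in \<open>auto simp: free_unit_def\<close>)
    then show ?thesis using assms(3) [OF that] by (simp add: free_unit_def)
  qed
  ultimately show ?thesis using that by blast
qed

text \<open>The images of the unit vectors of a free module with P as a summand are lifted one by
  one. Only the image of f has to lie in that of d, which suits maps into a kernel that is known to
  be an image.\<close>

lemma projective_lift:
  fixes P :: "('a, 'b) module"
  assumes P: "projective_module A P" and Z: "left_module A Z" and Y: "left_module A Y"
    and f: "f \<in> linear_maps A P Y" and d: "d \<in> linear_maps A Z Y"
    and img: "\<And>p. p \<in> carrier P \<Longrightarrow> f p \<in> d ` carrier Z"
  obtains g where "g \<in> linear_maps A P Z" "\<And>p. p \<in> carrier P \<Longrightarrow> d (g p) = f p"
proof -
  obtain J :: "'b set" and s r where s: "s \<in> linear_maps A P (free_module A J)"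
    and r: "r \<in> linear_maps A (free_module A J) P" and rs: "\<And>x. x \<in> carrier P \<Longrightarrow> r (s x) = x"
    using P unfolding projective_module_def by blast
  have A: "ring A" using Z by (rule left_module.axioms)
  have "\<exists>x\<in>carrier Z. d x = f (r (free_unit A j))" if "j \<in> J" for j
    using img [OF linear_mapsD(1) [OF r free_unit_closed [OF A that]]] by force
  then obtain x where x: "\<And>j. j \<in> J \<Longrightarrow> x j \<in> carrier Z" "\<And>j. j \<in> J \<Longrightarrow> d (x j) = f (r (free_unit A j))"
    by metis
  obtain g where g: "g \<in> linear_maps A (free_module A J) Z" "\<And>j. j \<in> J \<Longrightarrow> g (free_unit A j) = x j"
    using free_module_extend [where y = x, OF A Z x(1)] by blast
  have "d (g y) = f (r y)" if "y \<in> carrier (free_module A J)" for y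
    by (rule free_module_ext [OF A Y linear_maps_comp [OF g(1) d] linear_maps_comp [OF r f] _ that])
      (simp add: g(2) x(2))
  then have "d (g (s p)) = f p" if "p \<in> carrier P" for p
    using that rs linear_mapsD(1) [OF s that] by simp
  then show ?thesis using that linear_maps_comp [OF s g(1)] by blast
qed

lemma projective_resolutionD:
  assumes "projective_resolution A P d e M"
  shows "projective_module A (P n)" "left_module A (P n)" "d n \<in> linear_maps A (P (Suc n)) (P n)"
    "e \<in> linear_maps A (P 0) M" "e ` carrier (P 0) = carrier M"
    "x \<in> carrier (P 1) \<Longrightarrow> e (d 0 x) = \<zero>\<^bsub>M\<^esub>"
    "x \<in> carrier (P (Suc (Suc n))) \<Longrightarrow> d n (d (Suc n) x) = \<zero>\<^bsub>P n\<^esub>"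
    "y \<in> carrier (P 0) \<Longrightarrow> e y = \<zero>\<^bsub>M\<^esub> \<Longrightarrow> y \<in> d 0 ` carrier (P 1)"
    "z \<in> carrier (P (Suc n)) \<Longrightarrow> d n z = \<zero>\<^bsub>P n\<^esub> \<Longrightarrow> z \<in> d (Suc n) ` carrier (P (Suc (Suc n)))"
proof -
  note a = assms [unfolded projective_resolution_def]
  show P: "projective_module A (P n)" and "d n \<in> linear_maps A (P (Suc n)) (P n)"
    and "e \<in> linear_maps A (P 0) M" and "e ` carrier (P 0) = carrier M" using a by auto
  then show "left_module A (P n)" by (simp add: projective_module_def)
  have 0: "d 0 ` carrier (P 1) = a_kernel (P 0) M e"
    and S: "d (Suc n) ` carrier (P (Suc (Suc n))) = a_kernel (P (Suc n)) (P n) (d n)" using a by auto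
  show "x \<in> carrier (P 1) \<Longrightarrow> e (d 0 x) = \<zero>\<^bsub>M\<^esub>"
    using imageI [of x "carrier (P 1)" "d 0"] unfolding 0 by (simp add: a_kernel_def')
  show "x \<in> carrier (P (Suc (Suc n))) \<Longrightarrow> d n (d (Suc n) x) = \<zero>\<^bsub>P n\<^esub>"
    using imageI [of x "carrier (P (Suc (Suc n)))" "d (Suc n)"] unfolding S by (simp add: a_kernel_def')
  show "y \<in> carrier (P 0) \<Longrightarrow> e y = \<zero>\<^bsub>M\<^esub> \<Longrightarrow> y \<in> d 0 ` carrier (P 1)"
    unfolding 0 by (simp add: a_kernel_def')
  show "z \<in> carrier (P (Suc n)) \<Longrightarrow> d n z = \<zero>\<^bsub>P n\<^esub> \<Longrightarrow> z \<in> d (Suc n) ` carrier (P (Suc (Suc n)))"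
    unfolding S by (simp add: a_kernel_def')
qed

section \<open>The comparison theorem for projective resolutions\<close>

definition chain_map where
  "chain_map A P d Q d' f \<longleftrightarrow> (\<forall>n. f n \<in> linear_maps A (P n) (Q n)) \<and>
     (\<forall>n. \<forall>x\<in>carrier (P (Suc n)). d' n (f (Suc n) x) = f n (d n x))"

lemma resolution_lift:
  assumes M: "left_module A M" and P: "projective_resolution A P d e M" and Q: "projective_resolution A Q d' e' M"
  obtains f where "chain_map A P d Q d' f" "\<And>x. x \<in> carrier (P 0) \<Longrightarrow> e' (f 0 x) = e x"
proof -
  note p = projective_resolutionD [OF P] and q = projective_resolutionD [OF Q]
  \<comment> \<open>The choice in degree n has to make the next one possible: besides being linear,
    f must carry the image of \<open>d n\<close> into the image of \<open>d' n\<close>.\<close>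
  let ?R0 = "\<lambda>n f. f \<in> linear_maps A (P n) (Q n) \<and> (\<forall>x\<in>carrier (P (Suc n)). f (d n x) \<in> d' n ` carrier (Q (Suc n))) \<and>
      (n = 0 \<longrightarrow> (\<forall>x\<in>carrier (P 0). e' (f x) = e x))"
  let ?R1 = "\<lambda>n f g. \<forall>x\<in>carrier (P (Suc n)). d' n (g x) = f (d n x)"
  have base: "\<exists>f. ?R0 0 f"
  proof -
    have img: "e x \<in> e' ` carrier (Q 0)" if "x \<in> carrier (P 0)" for x
      unfolding q(5) by (rule linear_mapsD(1) [OF p(4) that])
    obtain f where f: "f \<in> linear_maps A (P 0) (Q 0)" "\<And>x. x \<in> carrier (P 0) \<Longrightarrow> e' (f x) = e x"
      using projective_lift [OF p(1) q(2) M p(4) q(4) img] by blast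
    have "f (d 0 x) \<in> d' 0 ` carrier (Q (Suc 0))" if x: "x \<in> carrier (P (Suc 0))" for x
    proof -
      have dx: "d 0 x \<in> carrier (P 0)" by (rule linear_mapsD(1) [OF p(3) x])
      then have "e' (f (d 0 x)) = \<zero>\<^bsub>M\<^esub>" using f(2) [OF dx] p(6) x by simp
      from q(8) [OF linear_mapsD(1) [OF f(1) dx] this] show ?thesis by simp
    qed
    then show ?thesis using f by auto
  qed
  have step: "\<exists>g. ?R0 (Suc n) g \<and> ?R1 n f g" if f: "?R0 n f" for n f
  proof -
    have lin: "(\<lambda>x. f (d n x)) \<in> linear_maps A (P (Suc n)) (Q n)"
      using linear_maps_comp [OF p(3) conjunct1 [OF f]] .
    have img: "f (d n x) \<in> d' n ` carrier (Q (Suc n))" if "x \<in> carrier (P (Suc n))" for x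
      using f that by blast
    obtain g where g: "g \<in> linear_maps A (P (Suc n)) (Q (Suc n))" "\<And>x. x \<in> carrier (P (Suc n)) \<Longrightarrow> d' n (g x) = f (d n x)"
      using projective_lift [OF p(1) q(2) q(2) lin q(3) img] by blast
    have "g (d (Suc n) x) \<in> d' (Suc n) ` carrier (Q (Suc (Suc n)))" if x: "x \<in> carrier (P (Suc (Suc n)))" for x
    proof -
      have dx: "d (Suc n) x \<in> carrier (P (Suc n))" by (rule linear_mapsD(1) [OF p(3) x])
      have "d' n (g (d (Suc n) x)) = \<zero>\<^bsub>Q n\<^esub>"
        using g(2) [OF dx] p(7) [OF x] linear_zero [OF p(2) q(2) conjunct1 [OF f]] by simp
      from q(9) [OF linear_mapsD(1) [OF g(1) dx] this] show ?thesis .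
    qed
    then show ?thesis using g by auto
  qed
  obtain f where f: "\<And>n. ?R0 n (f n) \<and> ?R1 n (f n) (f (Suc n))"
    using dependent_nat_choice [of ?R0 ?R1, OF base step] by blast
  then have "chain_map A P d Q d' f" by (auto simp: chain_map_def)
  moreover have "e' (f 0 x) = e x" if "x \<in> carrier (P 0)" for x using f [of 0] that by blast
  ultimately show ?thesis using that by blast
qed

text \<open>A chain map over the zero map of M is null-homotopic. Each h lifts what the previous one
  leaves over, the difference \<open>?t\<close>; this consists of cycles, so exactness supplies the
  image condition.\<close>

lemma resolution_homotopy:
  assumes M: "left_module A M" and P: "projective_resolution A P d e M" and Q: "projective_resolution A Q d' e' M"
    and f: "chain_map A P d Q d' f" and ef: "\<And>x. x \<in> carrier (P 0) \<Longrightarrow> e' (f 0 x) = \<zero>\<^bsub>M\<^esub>"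
  obtains h where "\<And>n. h n \<in> linear_maps A (P n) (Q (Suc n))" "\<And>x. x \<in> carrier (P 0) \<Longrightarrow> f 0 x = d' 0 (h 0 x)"
    "\<And>n x. x \<in> carrier (P (Suc n)) \<Longrightarrow> f (Suc n) x = d' (Suc n) (h (Suc n) x) \<oplus>\<^bsub>Q (Suc n)\<^esub> h n (d n x)"
proof -
  note p = projective_resolutionD [OF P] and q = projective_resolutionD [OF Q]
  have flin: "f n \<in> linear_maps A (P n) (Q n)" and fd: "x \<in> carrier (P (Suc n)) \<Longrightarrow> d' n (f (Suc n) x) = f n (d n x)" for n x
    using f by (auto simp: chain_map_def)
  let ?t = "\<lambda>n h x. f (Suc n) x \<ominus>\<^bsub>Q (Suc n)\<^esub> h (d n x)"
  let ?R0 = "\<lambda>n h. h \<in> linear_maps A (P n) (Q (Suc n)) \<and>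
      (\<forall>x\<in>carrier (P (Suc n)). ?t n h x \<in> d' (Suc n) ` carrier (Q (Suc (Suc n)))) \<and>
      (n = 0 \<longrightarrow> (\<forall>x\<in>carrier (P 0). d' 0 (h x) = f 0 x))"
  let ?R1 = "\<lambda>n h h'. \<forall>x\<in>carrier (P (Suc n)). d' (Suc n) (h' x) = ?t n h x"
  have dc: "d n x \<in> carrier (P n)" if "x \<in> carrier (P (Suc n))" for n x using linear_mapsD(1) [OF p(3) that] .
  have fc: "f n x \<in> carrier (Q n)" if "x \<in> carrier (P n)" for n x using linear_mapsD(1) [OF flin that] .
  have tlin: "?t n h \<in> linear_maps A (P (Suc n)) (Q (Suc n))" if "h \<in> linear_maps A (P n) (Q (Suc n))" for n h
    by (rule linear_maps_minus [OF p(2) q(2) flin linear_maps_comp [OF p(3) that]])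
  have base: "\<exists>h. ?R0 0 h"
  proof -
    have img: "f 0 x \<in> d' 0 ` carrier (Q (Suc 0))" if "x \<in> carrier (P 0)" for x
      using q(8) [OF fc [OF that] ef [OF that]] by simp
    obtain h where h: "h \<in> linear_maps A (P 0) (Q (Suc 0))" "\<And>x. x \<in> carrier (P 0) \<Longrightarrow> d' 0 (h x) = f 0 x"
      using projective_lift [OF p(1) q(2) q(2) flin q(3) img] by blast
    have "?t 0 h x \<in> d' (Suc 0) ` carrier (Q (Suc (Suc 0)))" if x: "x \<in> carrier (P (Suc 0))" for x
    proof -
      interpret Q0: left_module A "Q 0" by (rule q(2))
      have "d' 0 (?t 0 h x) = f 0 (d 0 x) \<ominus>\<^bsub>Q 0\<^esub> f 0 (d 0 x)"
        using linear_minus [OF q(2) q(2) q(3) fc [OF x] linear_mapsD(1) [OF h(1) dc [OF x]]] fd [OF x] h(2) [OF dc [OF x]] by simp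
      also have "\<dots> = \<zero>\<^bsub>Q 0\<^esub>" using fc [OF dc [OF x]] by (simp add: a_minus_def Q0.M.r_neg)
      finally show ?thesis by (rule q(9) [OF linear_mapsD(1) [OF tlin [OF h(1)] x]])
    qed
    then show ?thesis using h by auto
  qed
  have step: "\<exists>h'. ?R0 (Suc n) h' \<and> ?R1 n h h'" if R0: "?R0 n h" for n h
  proof -
    have h: "h \<in> linear_maps A (P n) (Q (Suc n))" using R0 by blast
    have img: "?t n h x \<in> d' (Suc n) ` carrier (Q (Suc (Suc n)))" if "x \<in> carrier (P (Suc n))" for x
      using R0 that by blast
    obtain h' where h': "h' \<in> linear_maps A (P (Suc n)) (Q (Suc (Suc n)))"
      "\<And>x. x \<in> carrier (P (Suc n)) \<Longrightarrow> d' (Suc n) (h' x) = ?t n h x"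
      using projective_lift [OF p(1) q(2) q(2) tlin [OF h] q(3) img] by blast
    have "?t (Suc n) h' x \<in> d' (Suc (Suc n)) ` carrier (Q (Suc (Suc (Suc n))))" if x: "x \<in> carrier (P (Suc (Suc n)))" for x
    proof -
      interpret Qn: left_module A "Q (Suc n)" by (rule q(2))
      have hz: "h (d n (d (Suc n) x)) = \<zero>\<^bsub>Q (Suc n)\<^esub>"
        unfolding p(7) [OF x] by (rule linear_zero [OF p(2) q(2) h])
      have "d' (Suc n) (?t (Suc n) h' x) = f (Suc n) (d (Suc n) x) \<ominus>\<^bsub>Q (Suc n)\<^esub> ?t n h (d (Suc n) x)"
        using linear_minus [OF q(2) q(2) q(3) fc [OF x] linear_mapsD(1) [OF h'(1) dc [OF x]]] fd [OF x] h'(2) [OF dc [OF x]] by simp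
      also have "\<dots> = \<zero>\<^bsub>Q (Suc n)\<^esub>" using fc [OF dc [OF x]] unfolding hz by (simp add: a_minus_def Qn.M.r_neg Qn.minus_zero_eq)
      finally show ?thesis by (rule q(9) [OF linear_mapsD(1) [OF tlin [OF h'(1)] x]])
    qed
    then show ?thesis using h' by auto
  qed
  obtain h where h: "\<And>n. ?R0 n (h n) \<and> ?R1 n (h n) (h (Suc n))"
    using dependent_nat_choice [of ?R0 ?R1, OF base step] by blast
  show ?thesis
  proof (rule that)
    show hl: "h n \<in> linear_maps A (P n) (Q (Suc n))" for n using h by blast
    show "f 0 x = d' 0 (h 0 x)" if "x \<in> carrier (P 0)" for x using h [of 0] that by auto
    show "f (Suc n) x = d' (Suc n) (h (Suc n) x) \<oplus>\<^bsub>Q (Suc n)\<^esub> h n (d n x)" if x: "x \<in> carrier (P (Suc n))" for n x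
    proof -
      interpret Qn: left_module A "Q (Suc n)" by (rule q(2))
      have "d' (Suc n) (h (Suc n) x) = ?t n (h n) x" using h [of n] x by blast
      then show ?thesis using fc [OF x] linear_mapsD(1) [OF hl dc [OF x]]
        by (simp add: a_minus_def Qn.M.a_assoc Qn.M.l_neg)
    qed
  qed
qed

section \<open>Ext with coefficients in the regular module\<close>

lemma dual_module_simps:
  "carrier (dual_module A M) = {f \<in> carrier M \<rightarrow>\<^sub>E carrier A.
        (\<forall>x\<in>carrier M. \<forall>y\<in>carrier M. f (x \<oplus>\<^bsub>M\<^esub> y) = f x \<oplus>\<^bsub>A\<^esub> f y) \<and>
        (\<forall>a\<in>carrier A. \<forall>x\<in>carrier M. f (a \<odot>\<^bsub>M\<^esub> x) = a \<otimes>\<^bsub>A\<^esub> f x)}"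
  "\<zero>\<^bsub>dual_module A M\<^esub> = (\<lambda>x\<in>carrier M. \<zero>\<^bsub>A\<^esub>)"
  "f \<oplus>\<^bsub>dual_module A M\<^esub> g = (\<lambda>x\<in>carrier M. f x \<oplus>\<^bsub>A\<^esub> g x)"
  "a \<odot>\<^bsub>dual_module A M\<^esub> f = (\<lambda>x\<in>carrier M. f x \<otimes>\<^bsub>A\<^esub> a)"
  by (simp_all add: dual_module_def)

lemma dualD:
  assumes "f \<in> carrier (dual_module A M)"
  shows "x \<in> carrier M \<Longrightarrow> f x \<in> carrier A"
    "x \<in> carrier M \<Longrightarrow> y \<in> carrier M \<Longrightarrow> f (x \<oplus>\<^bsub>M\<^esub> y) = f x \<oplus>\<^bsub>A\<^esub> f y"
    "a \<in> carrier A \<Longrightarrow> x \<in> carrier M \<Longrightarrow> f (a \<odot>\<^bsub>M\<^esub> x) = a \<otimes>\<^bsub>A\<^esub> f x"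
    "f \<in> extensional (carrier M)"
  using assms by (auto simp: dual_module_simps PiE_def)

lemma dualI:
  assumes "\<And>x. x \<in> carrier M \<Longrightarrow> f x \<in> carrier A"
    "\<And>x y. x \<in> carrier M \<Longrightarrow> y \<in> carrier M \<Longrightarrow> f (x \<oplus>\<^bsub>M\<^esub> y) = f x \<oplus>\<^bsub>A\<^esub> f y"
    "\<And>a x. a \<in> carrier A \<Longrightarrow> x \<in> carrier M \<Longrightarrow> f (a \<odot>\<^bsub>M\<^esub> x) = a \<otimes>\<^bsub>A\<^esub> f x"
    and "left_module A M"
  shows "restrict f (carrier M) \<in> carrier (dual_module A M)"
proof -
  interpret left_module A M by fact
  show ?thesis using assms(1-3) by (auto simp: dual_module_simps)
qed

lemma dual_eqI:
  assumes "f \<in> carrier (dual_module A M)" "g \<in> carrier (dual_module A M)" "\<And>x. x \<in> carrier M \<Longrightarrow> f x = g x"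
  shows "f = g"
  using extensionalityI [OF dualD(4) [OF assms(1)] dualD(4) [OF assms(2)] assms(3)] .

lemma dual_pull:
  assumes "left_module A P" "g \<in> linear_maps A P Q" "f \<in> carrier (dual_module A Q)"
  shows "(\<lambda>x\<in>carrier P. f (g x)) \<in> carrier (dual_module A P)"
  by (rule dualI) (use dualD [OF assms(3)] linear_mapsD [OF assms(2)] assms(1) in auto)

lemma dual_zero:
  assumes "left_module A M" "f \<in> carrier (dual_module A M)" shows "f \<zero>\<^bsub>M\<^esub> = \<zero>\<^bsub>A\<^esub>"
proof -
  interpret left_module A M by fact
  have "f (\<zero>\<^bsub>A\<^esub> \<odot>\<^bsub>M\<^esub> \<zero>\<^bsub>M\<^esub>) = \<zero>\<^bsub>A\<^esub> \<otimes>\<^bsub>A\<^esub> f \<zero>\<^bsub>M\<^esub>" by (rule dualD(3) [OF assms(2)]) auto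
  then show ?thesis using dualD(1) [OF assms(2), of "\<zero>\<^bsub>M\<^esub>"] by simp
qed

lemma dual_closed:
  assumes M: "left_module A M" and f: "f \<in> carrier (dual_module A M)"
  shows "g \<in> carrier (dual_module A M) \<Longrightarrow> f \<oplus>\<^bsub>dual_module A M\<^esub> g \<in> carrier (dual_module A M)"
    "a \<in> carrier A \<Longrightarrow> a \<odot>\<^bsub>dual_module A M\<^esub> f \<in> carrier (dual_module A M)"
    "(\<lambda>x\<in>carrier M. \<ominus>\<^bsub>A\<^esub> f x) \<in> carrier (dual_module A M)"
proof -
  interpret left_module A M by fact
  note f = dualD [OF f]
  show "f \<oplus>\<^bsub>dual_module A M\<^esub> g \<in> carrier (dual_module A M)" if "g \<in> carrier (dual_module A M)"
    unfolding dual_module_simps(3)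
    by (rule dualI [OF _ _ _ M]) (use f dualD [OF that] in \<open>auto simp: r_distr a_ac\<close>)
  show "a \<odot>\<^bsub>dual_module A M\<^esub> f \<in> carrier (dual_module A M)" if "a \<in> carrier A"
    unfolding dual_module_simps(4)
    by (rule dualI [OF _ _ _ M]) (use f that in \<open>auto simp: l_distr m_assoc\<close>)
  show "(\<lambda>x\<in>carrier M. \<ominus>\<^bsub>A\<^esub> f x) \<in> carrier (dual_module A M)"
    by (rule dualI [OF _ _ _ M]) (use f in \<open>auto simp: minus_add r_minus\<close>)
qed

lemma dual_abelian_group:
  assumes M: "left_module A M" shows "abelian_group (dual_module A M)"
proof -
  interpret left_module A M by fact
  show ?thesis
  proof (rule abelian_groupI)
    show "\<zero>\<^bsub>dual_module A M\<^esub> \<in> carrier (dual_module A M)"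
      unfolding dual_module_simps(2) by (rule dualI [OF _ _ _ M]) auto
    fix f assume f: "f \<in> carrier (dual_module A M)"
    show "\<exists>g\<in>carrier (dual_module A M). g \<oplus>\<^bsub>dual_module A M\<^esub> f = \<zero>\<^bsub>dual_module A M\<^esub>"
      by (rule bexI [OF _ dual_closed(3) [OF M f]]) (use dualD(1) [OF f] in \<open>auto simp: dual_module_simps(2,3) l_neg\<close>)
    show "\<zero>\<^bsub>dual_module A M\<^esub> \<oplus>\<^bsub>dual_module A M\<^esub> f = f"
      unfolding dual_module_simps(2,3)
      by (rule extensionalityI [of _ "carrier M"]) (use dualD [OF f] in auto)
  qed (auto simp: dual_closed [OF M], (auto simp: dual_module_simps a_ac PiE_iff restrict_def intro!: ext)+)
qed

lemma dual_cocyclesD: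
  assumes "f \<in> dual_cocycles A P d n"
  shows "f \<in> carrier (dual_module A (P n))" "x \<in> carrier (P (Suc n)) \<Longrightarrow> f (d n x) = \<zero>\<^bsub>A\<^esub>"
  using assms by (auto simp: dual_cocycles_def)

lemma dual_coboundaries_simps:
  "dual_coboundaries A P d 0 = {\<lambda>x\<in>carrier (P 0). \<zero>\<^bsub>A\<^esub>}"
  "dual_coboundaries A P d (Suc m) = (\<lambda>f. \<lambda>x\<in>carrier (P (Suc m)). f (d m x)) ` carrier (dual_module A (P m))"
  by (simp_all add: dual_coboundaries_def dual_module_simps)

section \<open>Independence of the cohomology from the resolution\<close>

lemma cocycle_pull:
  assumes P: "projective_resolution A P d e M" and Q: "projective_resolution A Q d' e' M"
    and g: "chain_map A Q d' P d g" and f: "f \<in> dual_cocycles A P d n"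
  shows "(\<lambda>x\<in>carrier (Q n). f (g n x)) \<in> dual_cocycles A Q d' n"
proof -
  have gl: "g n \<in> linear_maps A (Q n) (P n)" for n using g by (simp add: chain_map_def)
  have "f (g n (d' n x)) = \<zero>\<^bsub>A\<^esub>" if "x \<in> carrier (Q (Suc n))" for x
    using g that dual_cocyclesD(2) [OF f linear_mapsD(1) [OF gl that]] by (simp add: chain_map_def)
  then show ?thesis
    using dual_pull [OF projective_resolutionD(2) [OF Q] gl dual_cocyclesD(1) [OF f]]
      linear_mapsD(1) [OF projective_resolutionD(3) [OF Q]]
    by (auto simp: dual_cocycles_def)
qed

lemma coboundary_pull:
  assumes P: "projective_resolution A P d e M" and Q: "projective_resolution A Q d' e' M"
    and g: "chain_map A Q d' P d g" and f: "f \<in> dual_coboundaries A P d n"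
  shows "(\<lambda>x\<in>carrier (Q n). f (g n x)) \<in> dual_coboundaries A Q d' n"
proof -
  have gl: "g n \<in> linear_maps A (Q n) (P n)" for n using g by (simp add: chain_map_def)
  show ?thesis
  proof (cases n)
    case 0
    then show ?thesis using f linear_mapsD(1) [OF gl] by (auto simp: dual_coboundaries_simps restrict_def)
  next
    case (Suc m)
    then obtain k where k: "k \<in> carrier (dual_module A (P m))" "f = (\<lambda>x\<in>carrier (P (Suc m)). k (d m x))"
      using f by (auto simp: dual_coboundaries_simps)
    have "(\<lambda>x\<in>carrier (Q n). f (g n x)) = (\<lambda>x\<in>carrier (Q (Suc m)). (\<lambda>x\<in>carrier (Q m). k (g m x)) (d' m x))"
      using k(2) Suc g linear_mapsD(1) [OF gl] linear_mapsD(1) [OF projective_resolutionD(3) [OF Q]]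
      by (auto simp: chain_map_def restrict_def)
    then show ?thesis unfolding Suc dual_coboundaries_simps
      using dual_pull [OF projective_resolutionD(2) [OF Q] gl k(1)] by blast
  qed
qed

text \<open>The difference of g and the identity lies over 0, so it has the form d h + h d; the
  cocycle f kills the first term, and the second gives a coboundary.\<close>

lemma cocycle_homotopy:
  assumes M: "left_module A M" and P: "projective_resolution A P d e M"
    and g: "chain_map A P d P d g" and eg: "\<And>x. x \<in> carrier (P 0) \<Longrightarrow> e (g 0 x) = e x"
    and f: "f \<in> dual_cocycles A P d n"
  obtains k where "k \<in> dual_coboundaries A P d n" "\<And>x. x \<in> carrier (P n) \<Longrightarrow> f (g n x) = f x \<oplus>\<^bsub>A\<^esub> k x"
proof -
  note p = projective_resolutionD [OF P]
  interpret ring A using M by (rule left_module.axioms)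
  have gl: "g n \<in> linear_maps A (P n) (P n)" and gd: "x \<in> carrier (P (Suc n)) \<Longrightarrow> d n (g (Suc n) x) = g n (d n x)" for n x
    using g by (auto simp: chain_map_def)
  have gc: "g n x \<in> carrier (P n)" if "x \<in> carrier (P n)" for n x using linear_mapsD(1) [OF gl that] .
  have dc: "d n x \<in> carrier (P n)" if "x \<in> carrier (P (Suc n))" for n x using linear_mapsD(1) [OF p(3) that] .
  define t where "t n x = g n x \<ominus>\<^bsub>P n\<^esub> x" for n x
  have t: "chain_map A P d P d t"
    unfolding chain_map_def t_def
    using linear_maps_minus [OF p(2) p(2) gl linear_maps_id] linear_minus [OF p(2) p(2) p(3) gc] gd by auto
  have et: "e (t 0 x) = \<zero>\<^bsub>M\<^esub>" if "x \<in> carrier (P 0)" for x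
  proof -
    interpret M: left_module A M by fact
    show ?thesis
      using linear_minus [OF p(2) M p(4) gc that] eg that linear_mapsD(1) [OF p(4) that]
      by (simp add: t_def a_minus_def M.M.r_neg)
  qed
  obtain h where h: "\<And>n. h n \<in> linear_maps A (P n) (P (Suc n))" "\<And>x. x \<in> carrier (P 0) \<Longrightarrow> t 0 x = d 0 (h 0 x)"
    "\<And>n x. x \<in> carrier (P (Suc n)) \<Longrightarrow> t (Suc n) x = d (Suc n) (h (Suc n) x) \<oplus>\<^bsub>P (Suc n)\<^esub> h n (d n x)"
    using resolution_homotopy [OF M P P t et] by blast
  note fD = dualD [OF dual_cocyclesD(1) [OF f]]
  have ft: "f (g n x) = f x \<oplus>\<^bsub>A\<^esub> f (t n x)" if "x \<in> carrier (P n)" for x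
  proof -
    interpret Pn: left_module A "P n" by (rule p(2))
    have "t n x \<in> carrier (P n)" using gc [OF that] that by (simp add: t_def)
    moreover have "g n x = x \<oplus>\<^bsub>P n\<^esub> t n x"
      using gc [OF that] that by (simp add: t_def Pn.add_minus_cancel)
    ultimately show ?thesis using fD(2) that by simp
  qed
  have hc: "h n x \<in> carrier (P (Suc n))" if "x \<in> carrier (P n)" for n x using linear_mapsD(1) [OF h(1) that] .
  show ?thesis
  proof (cases n)
    case 0
    have "f (t 0 x) = \<zero>\<^bsub>A\<^esub>" if "x \<in> carrier (P 0)" for x
      using h(2) [OF that] dual_cocyclesD(2) [OF f] hc [OF that] 0 by simp
    then show ?thesis using ft 0 by (intro that [of "\<lambda>x\<in>carrier (P 0). \<zero>\<^bsub>A\<^esub>"]) (auto simp: dual_coboundaries_simps)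
  next
    case (Suc m)
    have "f (t n x) = f (h m (d m x))" if x: "x \<in> carrier (P n)" for x
    proof -
      have x': "x \<in> carrier (P (Suc m))" using x Suc by simp
      have "f (t n x) = f (d n (h n x)) \<oplus>\<^bsub>A\<^esub> f (h m (d m x))"
        using h(3) [OF x'] fD(2) [of "d n (h n x)" "h m (d m x)"] dc [OF hc [OF x]] hc [OF dc [OF x']] by (simp add: Suc)
      also have "f (d n (h n x)) = \<zero>\<^bsub>A\<^esub>" by (rule dual_cocyclesD(2) [OF f hc [OF x]])
      finally show ?thesis using fD(1) hc [OF dc [OF x']] by (simp add: Suc)
    qed
    moreover have "(\<lambda>y\<in>carrier (P m). f (h m y)) \<in> carrier (dual_module A (P m))"
      using dual_pull [OF p(2) h(1)] dual_cocyclesD(1) [OF f] Suc by blast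
    then have "(\<lambda>x\<in>carrier (P (Suc m)). (\<lambda>y\<in>carrier (P m). f (h m y)) (d m x)) \<in> dual_coboundaries A P d n"
      unfolding Suc dual_coboundaries_simps by (rule imageI)
    ultimately show ?thesis
      by (intro that [of "\<lambda>x\<in>carrier (P (Suc m)). (\<lambda>y\<in>carrier (P m). f (h m y)) (d m x)"]) (use ft dc Suc in auto)
  qed
qed

lemma coboundary_subset:
  assumes "projective_resolution A P d e M"
  shows "dual_coboundaries A P d n \<subseteq> dual_cocycles A P d n"
proof
  note p = projective_resolutionD [OF assms]
  fix f assume f: "f \<in> dual_coboundaries A P d n"
  interpret Pn: left_module A "P n" by (rule p(2))
  show "f \<in> dual_cocycles A P d n"
  proof (cases n)
    case 0
    have "(\<lambda>x\<in>carrier (P n). \<zero>\<^bsub>A\<^esub>) \<in> carrier (dual_module A (P n))"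
      by (rule dualI [OF _ _ _ p(2)]) auto
    then show ?thesis using f 0 linear_mapsD(1) [OF p(3)] by (auto simp: dual_coboundaries_simps dual_cocycles_def)
  next
    case (Suc m)
    then obtain k where k: "k \<in> carrier (dual_module A (P m))" "f = (\<lambda>x\<in>carrier (P (Suc m)). k (d m x))"
      using f by (auto simp: dual_coboundaries_simps)
    then show ?thesis
      using dual_pull [OF p(2) p(3) k(1)] p(7) linear_mapsD(1) [OF p(3)] dual_zero [OF p(2) k(1)] Suc
      by (auto simp: dual_cocycles_def)
  qed
qed

lemma coboundary_diff:
  assumes P: "projective_resolution A P d e M" and b: "b \<in> dual_coboundaries A P d n" and k: "k \<in> dual_coboundaries A P d n"
    and f: "f \<in> carrier (dual_module A (P n))" and eq: "\<And>x. x \<in> carrier (P n) \<Longrightarrow> b x = f x \<oplus>\<^bsub>A\<^esub> k x"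
  shows "f \<in> dual_coboundaries A P d n"
proof -
  note p = projective_resolutionD [OF P]
  interpret Pn: left_module A "P n" by (rule p(2))
  note fD = dualD [OF f]
  show ?thesis
  proof (cases n)
    case 0
    have "f = (\<lambda>x\<in>carrier (P 0). \<zero>\<^bsub>A\<^esub>)"
      by (rule extensionalityI [of _ "carrier (P 0)"])
        (use b k eq fD 0 in \<open>auto simp: dual_coboundaries_simps\<close>)
    then show ?thesis by (simp add: 0 dual_coboundaries_simps)
  next
    case (Suc m)
    obtain u where u: "u \<in> carrier (dual_module A (P m))" "b = (\<lambda>x\<in>carrier (P (Suc m)). u (d m x))"
      using b Suc by (auto simp: dual_coboundaries_simps)
    obtain v where v: "v \<in> carrier (dual_module A (P m))" "k = (\<lambda>x\<in>carrier (P (Suc m)). v (d m x))"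
      using k Suc by (auto simp: dual_coboundaries_simps)
    let ?w = "u \<oplus>\<^bsub>dual_module A (P m)\<^esub> (\<lambda>x\<in>carrier (P m). \<ominus>\<^bsub>A\<^esub> v x)"
    have w: "?w \<in> carrier (dual_module A (P m))" by (intro dual_closed p(2) u(1) v(1))
    have "f = (\<lambda>x\<in>carrier (P (Suc m)). ?w (d m x))"
    proof (rule extensionalityI [of _ "carrier (P (Suc m))"])
      show "f \<in> extensional (carrier (P (Suc m)))" using fD(4) Suc by simp
      fix x assume x: "x \<in> carrier (P (Suc m))"
      have dx: "d m x \<in> carrier (P m)" by (rule linear_mapsD(1) [OF p(3) x])
      have c: "u (d m x) \<in> carrier A" "v (d m x) \<in> carrier A" "f x \<in> carrier A"
        using dualD(1) [OF u(1) dx] dualD(1) [OF v(1) dx] fD(1) x Suc by auto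
      have "u (d m x) = f x \<oplus>\<^bsub>A\<^esub> v (d m x)" using eq [of x] x u(2) v(2) Suc by simp
      then show "f x = (\<lambda>x\<in>carrier (P (Suc m)). ?w (d m x)) x"
        using x dx c by (simp add: dual_module_simps Pn.a_assoc Pn.r_neg)
    qed simp
    then show ?thesis unfolding Suc dual_coboundaries_simps using w by blast
  qed
qed

text \<open>Pulling z back along g and then along f changes it by a coboundary only.\<close>

lemma coboundary_transfer:
  assumes M: "left_module A M" and P: "projective_resolution A P d e M" and Q: "projective_resolution A Q d' e' M"
    and f: "chain_map A P d Q d' f" "\<And>x. x \<in> carrier (P 0) \<Longrightarrow> e' (f 0 x) = e x"
    and g: "chain_map A Q d' P d g" "\<And>x. x \<in> carrier (Q 0) \<Longrightarrow> e (g 0 x) = e' x"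
    and z: "z \<in> dual_cocycles A P d n" and gz: "(\<lambda>x\<in>carrier (Q n). z (g n x)) \<in> dual_coboundaries A Q d' n"
  shows "z \<in> dual_coboundaries A P d n"
proof -
  have fl: "f n x \<in> carrier (Q n)" if "x \<in> carrier (P n)" for n x
    using f(1) linear_mapsD(1) that unfolding chain_map_def by metis
  have gf: "chain_map A P d P d (\<lambda>n x. g n (f n x))"
    using f(1) g(1) fl unfolding chain_map_def by (auto intro: linear_maps_comp)
  have egf: "e (g 0 (f 0 x)) = e x" if "x \<in> carrier (P 0)" for x using f(2) g(2) fl that by simp
  obtain k where k: "k \<in> dual_coboundaries A P d n" "\<And>x. x \<in> carrier (P n) \<Longrightarrow> z (g n (f n x)) = z x \<oplus>\<^bsub>A\<^esub> k x"
    using cocycle_homotopy [OF M P gf egf z] by blast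
  have "(\<lambda>x\<in>carrier (P n). (\<lambda>x\<in>carrier (Q n). z (g n x)) (f n x)) \<in> dual_coboundaries A P d n"
    by (rule coboundary_pull [OF Q P f(1) gz])
  then show ?thesis
    by (rule coboundary_diff [OF P _ k(1) dual_cocyclesD(1) [OF z]]) (use k(2) fl in auto)
qed

lemma Ext_vanishing_transfer:
  assumes M: "left_module A M" and P: "projective_resolution A P d e M" and Q: "projective_resolution A Q d' e' M"
    and "dual_cocycles A Q d' n \<subseteq> dual_coboundaries A Q d' n"
  shows "dual_cocycles A P d n \<subseteq> dual_coboundaries A P d n"
proof
  fix z assume z: "z \<in> dual_cocycles A P d n"
  obtain f where f: "chain_map A P d Q d' f" "\<And>x. x \<in> carrier (P 0) \<Longrightarrow> e' (f 0 x) = e x"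
    using resolution_lift [OF M P Q] by blast
  obtain g where g: "chain_map A Q d' P d g" "\<And>x. x \<in> carrier (Q 0) \<Longrightarrow> e (g 0 x) = e' x"
    using resolution_lift [OF M Q P] by blast
  show "z \<in> dual_coboundaries A P d n"
    by (rule coboundary_transfer [OF M P Q f g z]) (use cocycle_pull [OF P Q g(1) z] assms(4) in auto)
qed

text \<open>An isomorphism from cohomology to T, described on cocycles with the coboundaries as
  kernel, so that the quotient is formed only once, in
  \<open>cohomology_iso_module_isomorphic\<close>.\<close>

definition cohomology_iso where
  "cohomology_iso A P d n T E \<longleftrightarrow>
     (\<forall>z\<in>dual_cocycles A P d n. E z \<in> carrier T) \<and>
     (\<forall>z\<in>dual_cocycles A P d n. \<forall>z'\<in>dual_cocycles A P d n. E (z \<oplus>\<^bsub>dual_module A (P n)\<^esub> z') = E z \<oplus>\<^bsub>T\<^esub> E z') \<and>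
     (\<forall>a\<in>carrier A. \<forall>z\<in>dual_cocycles A P d n. E (a \<odot>\<^bsub>dual_module A (P n)\<^esub> z) = a \<odot>\<^bsub>T\<^esub> E z) \<and>
     (\<forall>z\<in>dual_cocycles A P d n. E z = \<zero>\<^bsub>T\<^esub> \<longleftrightarrow> z \<in> dual_coboundaries A P d n) \<and>
     E ` dual_cocycles A P d n = carrier T"

lemma cohomology_isoD:
  assumes "cohomology_iso A P d n T E" and "z \<in> dual_cocycles A P d n"
  shows "E z \<in> carrier T" "z' \<in> dual_cocycles A P d n \<Longrightarrow> E (z \<oplus>\<^bsub>dual_module A (P n)\<^esub> z') = E z \<oplus>\<^bsub>T\<^esub> E z'"
    "a \<in> carrier A \<Longrightarrow> E (a \<odot>\<^bsub>dual_module A (P n)\<^esub> z) = a \<odot>\<^bsub>T\<^esub> E z"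
    "E z = \<zero>\<^bsub>T\<^esub> \<longleftrightarrow> z \<in> dual_coboundaries A P d n"
  using assms unfolding cohomology_iso_def by blast+

lemma cohomology_iso_transfer:
  assumes M: "left_module A M" and P: "projective_resolution A P d e M" and Q: "projective_resolution A Q d' e' M"
    and T: "left_module A T" and E: "cohomology_iso A Q d' n T E"
  obtains E' where "cohomology_iso A P d n T E'"
proof -
  interpret T: left_module A T by fact
  note p = projective_resolutionD [OF P] and q = projective_resolutionD [OF Q]
  obtain f where f: "chain_map A P d Q d' f" "\<And>x. x \<in> carrier (P 0) \<Longrightarrow> e' (f 0 x) = e x"
    using resolution_lift [OF M P Q] by blast
  obtain g where g: "chain_map A Q d' P d g" "\<And>x. x \<in> carrier (Q 0) \<Longrightarrow> e (g 0 x) = e' x"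
    using resolution_lift [OF M Q P] by blast
  have fl: "f n x \<in> carrier (Q n)" if "x \<in> carrier (P n)" for n x
    using f(1) linear_mapsD(1) that unfolding chain_map_def by metis
  have gl: "g n x \<in> carrier (P n)" if "x \<in> carrier (Q n)" for n x
    using g(1) linear_mapsD(1) that unfolding chain_map_def by metis
  let ?pull = "\<lambda>z. \<lambda>x\<in>carrier (Q n). z (g n x)"
  have pull: "?pull z \<in> dual_cocycles A Q d' n" if "z \<in> dual_cocycles A P d n" for z
    by (rule cocycle_pull [OF P Q g(1) that])
  note ED = cohomology_isoD [OF E]
  have "cohomology_iso A P d n T (\<lambda>z. E (?pull z))"
    unfolding cohomology_iso_def
  proof (intro conjI ballI)
    fix z assume z: "z \<in> dual_cocycles A P d n"
    show "E (?pull z) \<in> carrier T" by (rule ED(1) [OF pull [OF z]])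
    show "E (?pull (z \<oplus>\<^bsub>dual_module A (P n)\<^esub> z')) = E (?pull z) \<oplus>\<^bsub>T\<^esub> E (?pull z')" if "z' \<in> dual_cocycles A P d n" for z'
    proof -
      have "?pull (z \<oplus>\<^bsub>dual_module A (P n)\<^esub> z') = ?pull z \<oplus>\<^bsub>dual_module A (Q n)\<^esub> ?pull z'"
        using gl by (auto simp: dual_module_simps restrict_def)
      then show ?thesis using ED(2) [OF pull [OF z] pull [OF that]] by simp
    qed
    show "E (?pull (a \<odot>\<^bsub>dual_module A (P n)\<^esub> z)) = a \<odot>\<^bsub>T\<^esub> E (?pull z)" if "a \<in> carrier A" for a
    proof -
      have "?pull (a \<odot>\<^bsub>dual_module A (P n)\<^esub> z) = a \<odot>\<^bsub>dual_module A (Q n)\<^esub> ?pull z"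
        using gl by (auto simp: dual_module_simps restrict_def)
      then show ?thesis using ED(3) [OF pull [OF z] that] by simp
    qed
    show "E (?pull z) = \<zero>\<^bsub>T\<^esub> \<longleftrightarrow> z \<in> dual_coboundaries A P d n"
      using ED(4) [OF pull [OF z]] coboundary_transfer [OF M P Q f g z] coboundary_pull [OF P Q g(1)] by blast
  next
    show "(\<lambda>z. E (?pull z)) ` dual_cocycles A P d n = carrier T"
    proof
      show "(\<lambda>z. E (?pull z)) ` dual_cocycles A P d n \<subseteq> carrier T" using ED(1) pull by auto
      show "carrier T \<subseteq> (\<lambda>z. E (?pull z)) ` dual_cocycles A P d n"
      proof
        fix c assume "c \<in> carrier T"
        then have "c \<in> E ` dual_cocycles A Q d' n" using E by (simp add: cohomology_iso_def)
        then obtain y where y: "y \<in> dual_cocycles A Q d' n" "E y = c" by (rule imageE) simp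
        \<comment> \<open>Surjectivity: y pulled back to P and then again to Q differs from y by a
          coboundary, on which E vanishes.\<close>
        let ?z = "\<lambda>x\<in>carrier (P n). y (f n x)"
        have z: "?z \<in> dual_cocycles A P d n" by (rule cocycle_pull [OF Q P f(1) y(1)])
        have fg: "chain_map A Q d' Q d' (\<lambda>n x. f n (g n x))"
          using f(1) g(1) gl unfolding chain_map_def by (auto intro: linear_maps_comp)
        have efg: "e' (f 0 (g 0 x)) = e' x" if "x \<in> carrier (Q 0)" for x using f(2) g(2) gl that by simp
        obtain k where k: "k \<in> dual_coboundaries A Q d' n" "\<And>x. x \<in> carrier (Q n) \<Longrightarrow> y (f n (g n x)) = y x \<oplus>\<^bsub>A\<^esub> k x"
          using cocycle_homotopy [OF M Q fg efg y(1)] by blast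
        have kz: "k \<in> dual_cocycles A Q d' n" using coboundary_subset [OF Q] k(1) by blast
        have "?pull ?z = y \<oplus>\<^bsub>dual_module A (Q n)\<^esub> k"
          using gl k(2) by (auto simp: dual_module_simps restrict_def)
        then have "E (?pull ?z) = c \<oplus>\<^bsub>T\<^esub> \<zero>\<^bsub>T\<^esub>"
          using ED(2) [OF y(1) kz] ED(4) [OF kz] k(1) y(2) by simp
        also have "\<dots> = c" using \<open>c \<in> carrier T\<close> by simp
        finally show "c \<in> (\<lambda>z. E (?pull z)) ` dual_cocycles A P d n" using z by (auto intro!: image_eqI [of _ _ ?z])
      qed
    qed
  qed
  then show ?thesis by (rule that)
qed

section \<open>Cohomology as a quotient module\<close>

lemma dual_cocycles_closed:
  assumes P: "projective_resolution A P d e M" and z: "z \<in> dual_cocycles A P d n"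
  shows "z' \<in> dual_cocycles A P d n \<Longrightarrow> z \<oplus>\<^bsub>dual_module A (P n)\<^esub> z' \<in> dual_cocycles A P d n"
    "a \<in> carrier A \<Longrightarrow> a \<odot>\<^bsub>dual_module A (P n)\<^esub> z \<in> dual_cocycles A P d n"
    "(\<lambda>x\<in>carrier (P n). \<ominus>\<^bsub>A\<^esub> z x) \<in> dual_cocycles A P d n"
proof -
  note p = projective_resolutionD [OF P]
  interpret Pn: left_module A "P n" by (rule p(2))
  have dc: "d n x \<in> carrier (P n)" if "x \<in> carrier (P (Suc n))" for x using linear_mapsD(1) [OF p(3) that] .
  have m0: "\<ominus>\<^bsub>A\<^esub> \<zero>\<^bsub>A\<^esub> = \<zero>\<^bsub>A\<^esub>" using Pn.minus_equality [of "\<zero>\<^bsub>A\<^esub>" "\<zero>\<^bsub>A\<^esub>"] by simp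
  note z' = dual_cocyclesD [OF z]
  show "z \<oplus>\<^bsub>dual_module A (P n)\<^esub> y \<in> dual_cocycles A P d n" if "y \<in> dual_cocycles A P d n" for y
    using dual_closed(1) [OF p(2) z'(1)] dual_cocyclesD [OF that] z'(2) dc
    by (auto simp: dual_cocycles_def dual_module_simps(3))
  show "a \<odot>\<^bsub>dual_module A (P n)\<^esub> z \<in> dual_cocycles A P d n" if "a \<in> carrier A"
    using dual_closed(2) [OF p(2) z'(1) that] z'(2) dc that by (auto simp: dual_cocycles_def dual_module_simps(4))
  show "(\<lambda>x\<in>carrier (P n). \<ominus>\<^bsub>A\<^esub> z x) \<in> dual_cocycles A P d n"
    using dual_closed(3) [OF p(2) z'(1)] z'(2) dc by (auto simp: dual_cocycles_def m0)
qed

lemma coboundary_subgroup: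
  assumes P: "projective_resolution A P d e M"
  shows "abelian_subgroup (dual_coboundaries A P d n) (dual_module A (P n))"
proof -
  note p = projective_resolutionD [OF P]
  interpret Pn: left_module A "P n" by (rule p(2))
  interpret D: abelian_group "dual_module A (P n)" by (rule dual_abelian_group [OF p(2)])
  let ?B = "dual_coboundaries A P d n" and ?D = "dual_module A (P n)"
  have sub: "?B \<subseteq> carrier ?D" using coboundary_subset [OF P] dual_cocyclesD(1) by blast
  have zero: "\<zero>\<^bsub>?D\<^esub> \<in> ?B"
  proof (cases n)
    case (Suc m)
    interpret Pm: left_module A "P m" by (rule p(2))
    have "(\<lambda>x\<in>carrier (P m). \<zero>\<^bsub>A\<^esub>) \<in> carrier (dual_module A (P m))" by (rule dualI [OF _ _ _ p(2)]) auto
    from imageI [OF this, of "\<lambda>f. \<lambda>x\<in>carrier (P (Suc m)). f (d m x)"] show ?thesis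
      using linear_mapsD(1) [OF p(3)] by (simp add: Suc dual_coboundaries_simps dual_module_simps(2) restrict_def cong: if_cong)
  qed (simp add: dual_coboundaries_simps dual_module_simps(2))
  have diff: "x \<ominus>\<^bsub>?D\<^esub> y \<in> ?B" if "x \<in> ?B" "y \<in> ?B" for x y
  proof (rule coboundary_diff [OF P that])
    show xy: "x \<ominus>\<^bsub>?D\<^esub> y \<in> carrier ?D" using that sub by auto
    fix u assume u: "u \<in> carrier (P n)"
    have "x = (x \<ominus>\<^bsub>?D\<^esub> y) \<oplus>\<^bsub>?D\<^esub> y"
      using that sub by (simp add: a_minus_def D.a_assoc D.l_neg subset_iff)
    then have "x u = ((x \<ominus>\<^bsub>?D\<^esub> y) \<oplus>\<^bsub>?D\<^esub> y) u" by simp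
    then show "x u = (x \<ominus>\<^bsub>?D\<^esub> y) u \<oplus>\<^bsub>A\<^esub> y u" using u by (simp add: dual_module_simps(3))
  qed
  have neg: "\<ominus>\<^bsub>?D\<^esub> x \<in> ?B" if "x \<in> ?B" for x
    using diff [OF zero that] that sub by (auto simp: a_minus_def)
  have add: "x \<oplus>\<^bsub>?D\<^esub> y \<in> ?B" if "x \<in> ?B" "y \<in> ?B" for x y
    using diff [OF that(1) neg [OF that(2)]] that sub by (auto simp: a_minus_def)
  show ?thesis
  proof (rule abelian_subgroupI3 [OF additive_subgroupI D.abelian_group_axioms], rule subgroup.intro)
    show "inv\<^bsub>add_monoid ?D\<^esub> x \<in> ?B" if "x \<in> ?B" for x using neg [OF that] by (simp add: a_inv_def)
  qed (use sub zero add in auto)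
qed

lemma subquotient_simps:
  "carrier (subquotient_module M Z B) = (\<lambda>z. B +>\<^bsub>M\<^esub> z) ` Z" "\<zero>\<^bsub>subquotient_module M Z B\<^esub> = B"
  "C \<oplus>\<^bsub>subquotient_module M Z B\<^esub> C' = C <+>\<^bsub>M\<^esub> C'"
  "a \<odot>\<^bsub>subquotient_module M Z B\<^esub> C = (\<Union>x\<in>C. B +>\<^bsub>M\<^esub> (a \<odot>\<^bsub>M\<^esub> x))"
  by (simp_all add: subquotient_module_def)

lemma subquotient_zero:
  assumes P: "projective_resolution A P d e M" and "dual_cocycles A P d n \<subseteq> dual_coboundaries A P d n"
  shows "carrier (subquotient_module (dual_module A (P n)) (dual_cocycles A P d n) (dual_coboundaries A P d n)) =
    {dual_coboundaries A P d n}"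
proof -
  interpret B: abelian_subgroup "dual_coboundaries A P d n" "dual_module A (P n)" by (rule coboundary_subgroup [OF P])
  have eq: "dual_cocycles A P d n = dual_coboundaries A P d n"
    using assms(2) coboundary_subset [OF P] by blast
  have "dual_coboundaries A P d n +>\<^bsub>dual_module A (P n)\<^esub> z = dual_coboundaries A P d n"
    if "z \<in> dual_coboundaries A P d n" for z
    using that B.a_subset B.a_subgroup by (intro B.a_coset_join2) auto
  note cos = this
  have ne: "dual_coboundaries A P d n \<noteq> {}" using additive_subgroup.zero_closed [OF B.additive_subgroup_axioms] by (metis empty_iff)
  have im: "f ` B = {y}" if "\<And>z. z \<in> B \<Longrightarrow> f z = y" "B \<noteq> {}" for f :: "'x \<Rightarrow> 'y" and B y
    using that by auto
  show ?thesis unfolding subquotient_simps(1) eq by (rule im [OF cos ne])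
qed

lemma cohomology_iso_module_isomorphic:
  assumes P: "projective_resolution A P d e M" and T: "left_module A T" and E: "cohomology_iso A P d n T E"
  shows "module_isomorphic A
    (subquotient_module (dual_module A (P n)) (dual_cocycles A P d n) (dual_coboundaries A P d n)) T"
proof -
  let ?D = "dual_module A (P n)" and ?Z = "dual_cocycles A P d n" and ?B = "dual_coboundaries A P d n"
  let ?S = "subquotient_module ?D ?Z ?B"
  interpret T: left_module A T by fact
  interpret B: abelian_subgroup ?B ?D by (rule coboundary_subgroup [OF P])
  note ED = cohomology_isoD [OF E]
  have ZD: "z \<in> carrier ?D" if "z \<in> ?Z" for z using dual_cocyclesD(1) [OF that] .
  have BZ: "b \<in> ?Z" if "b \<in> ?B" for b using coboundary_subset [OF P] that by blast
  note B0 = additive_subgroup.zero_closed [OF B.additive_subgroup_axioms]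
  have coset: "C \<in> ?B +>\<^bsub>?D\<^esub> z \<longleftrightarrow> (\<exists>b\<in>?B. C = b \<oplus>\<^bsub>?D\<^esub> z)" for C z
    by (auto simp: a_r_coset_def r_coset_def)
  have coset_eq: "?B +>\<^bsub>?D\<^esub> z = ?B +>\<^bsub>?D\<^esub> z' \<longleftrightarrow> E z = E z'" if "z \<in> ?Z" "z' \<in> ?Z" for z z'
  proof
    assume "?B +>\<^bsub>?D\<^esub> z = ?B +>\<^bsub>?D\<^esub> z'"
    then have "z \<in> ?B +>\<^bsub>?D\<^esub> z'" using B.a_rcos_self [OF ZD [OF that(1)]] by simp
    then obtain b where b: "b \<in> ?B" "z = b \<oplus>\<^bsub>?D\<^esub> z'" using coset by blast
    then show "E z = E z'" using ED(2) [OF BZ [OF b(1)] that(2)] ED(4) [OF BZ [OF b(1)]] ED(1) [OF that(2)] by simp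
  next
    assume eq: "E z = E z'"
    let ?m = "\<lambda>x\<in>carrier (P n). \<ominus>\<^bsub>A\<^esub> z' x"
    have m: "?m \<in> ?Z" by (rule dual_cocycles_closed(3) [OF P that(2)])
    have mz: "?m \<oplus>\<^bsub>?D\<^esub> z' = \<zero>\<^bsub>?D\<^esub>"
      using dualD(1) [OF ZD [OF that(2)]] by (auto simp: dual_module_simps T.l_neg restrict_def)
    have zm: "z \<oplus>\<^bsub>?D\<^esub> ?m \<in> ?Z" by (rule dual_cocycles_closed(1) [OF P that(1) m])
    have "E (z \<oplus>\<^bsub>?D\<^esub> ?m) = E (z' \<oplus>\<^bsub>?D\<^esub> ?m)" using ED(2) [OF that(1) m] ED(2) [OF that(2) m] eq by simp
    also have "z' \<oplus>\<^bsub>?D\<^esub> ?m = \<zero>\<^bsub>?D\<^esub>" using mz B.a_comm ZD that m by metis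
    also have "E \<zero>\<^bsub>?D\<^esub> = \<zero>\<^bsub>T\<^esub>" using ED(4) [OF BZ [OF B0]] B0 by (rule iffD2)
    finally have "z \<oplus>\<^bsub>?D\<^esub> ?m \<in> ?B" using ED(4) [OF zm] by blast
    moreover have "z = (z \<oplus>\<^bsub>?D\<^esub> ?m) \<oplus>\<^bsub>?D\<^esub> z'"
      using ZD [OF that(1)] ZD [OF m] ZD [OF that(2)] mz by (simp add: B.a_assoc)
    ultimately have "z \<in> ?B +>\<^bsub>?D\<^esub> z'" using coset by blast
    then show "?B +>\<^bsub>?D\<^esub> z = ?B +>\<^bsub>?D\<^esub> z'"
      using B.a_repr_independence [OF _ ZD [OF that(2)] B.a_subgroup] by simp
  qed
  define F where "F C = E (SOME z. z \<in> ?Z \<and> ?B +>\<^bsub>?D\<^esub> z = C)" for C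
  have F: "F (?B +>\<^bsub>?D\<^esub> z) = E z" if "z \<in> ?Z" for z
  proof -
    have "\<exists>z'. z' \<in> ?Z \<and> ?B +>\<^bsub>?D\<^esub> z' = ?B +>\<^bsub>?D\<^esub> z" using that by blast
    from someI_ex [OF this] show ?thesis unfolding F_def using coset_eq that by blast
  qed
  have "F \<in> linear_maps A ?S T"
  proof (rule linear_mapsI)
    show "F C \<in> carrier T" if "C \<in> carrier ?S" for C
      using that F ED(1) by (auto simp: subquotient_simps)
    show "F (C \<oplus>\<^bsub>?S\<^esub> C') = F C \<oplus>\<^bsub>T\<^esub> F C'" if "C \<in> carrier ?S" "C' \<in> carrier ?S" for C C'
    proof -
      obtain z z' where z: "z \<in> ?Z" "C = ?B +>\<^bsub>?D\<^esub> z" "z' \<in> ?Z" "C' = ?B +>\<^bsub>?D\<^esub> z'"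
        using \<open>C \<in> carrier ?S\<close> \<open>C' \<in> carrier ?S\<close> by (auto simp: subquotient_simps)
      have "C \<oplus>\<^bsub>?S\<^esub> C' = ?B +>\<^bsub>?D\<^esub> (z \<oplus>\<^bsub>?D\<^esub> z')"
        unfolding subquotient_simps z by (rule B.a_rcos_sum) (use ZD z in auto)
      then show ?thesis using F [OF dual_cocycles_closed(1) [OF P z(1,3)]] F z ED(2) by simp
    qed
    show "F (a \<odot>\<^bsub>?S\<^esub> C) = a \<odot>\<^bsub>T\<^esub> F C" if a: "a \<in> carrier A" and "C \<in> carrier ?S" for a C
    proof -
      obtain z where z: "z \<in> ?Z" "C = ?B +>\<^bsub>?D\<^esub> z"
        using \<open>C \<in> carrier ?S\<close> by (auto simp: subquotient_simps)
      have az: "a \<odot>\<^bsub>?D\<^esub> z \<in> ?Z" by (rule dual_cocycles_closed(2) [OF P z(1) a])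
      \<comment> \<open>The multiple of a coset is defined as a union of cosets; they coincide,
        because E takes the same value on all elements of C.\<close>
      have "?B +>\<^bsub>?D\<^esub> (a \<odot>\<^bsub>?D\<^esub> x) = ?B +>\<^bsub>?D\<^esub> (a \<odot>\<^bsub>?D\<^esub> z)" if "x \<in> C" for x
      proof -
        obtain b where b: "b \<in> ?B" "x = b \<oplus>\<^bsub>?D\<^esub> z" using coset z \<open>x \<in> C\<close> by blast
        have xZ: "x \<in> ?Z" unfolding b(2) by (rule dual_cocycles_closed(1) [OF P BZ [OF b(1)] z(1)])
        have "E x = E z" using ED(2) [OF BZ [OF b(1)] z(1)] ED(4) [OF BZ [OF b(1)]] ED(1) [OF z(1)] b by simp
        then show ?thesis
          using coset_eq [OF dual_cocycles_closed(2) [OF P xZ a] az] ED(3) [OF xZ a] ED(3) [OF z(1) a] by simp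
      qed
      moreover have "z \<in> C" using B.a_rcos_self [OF ZD [OF z(1)]] z(2) by simp
      ultimately have "a \<odot>\<^bsub>?S\<^esub> C = ?B +>\<^bsub>?D\<^esub> (a \<odot>\<^bsub>?D\<^esub> z)" unfolding subquotient_simps by blast
      then show ?thesis using F [OF az] F [OF z(1)] ED(3) [OF z(1) a] z(2) by simp
    qed
  qed
  moreover have "bij_betw F (carrier ?S) (carrier T)"
  proof -
    have "inj_on F (carrier ?S)"
      using F coset_eq by (auto simp: inj_on_def subquotient_simps)
    moreover have "F ` carrier ?S = E ` ?Z" using F by (auto simp: subquotient_simps image_image)
    moreover have "E ` ?Z = carrier T" using E by (simp add: cohomology_iso_def)
    ultimately show ?thesis by (simp add: bij_betw_def)
  qed
  ultimately show ?thesis unfolding module_isomorphic_def by blast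
qed

section \<open>The Koszul resolution of a module\<close>

locale braid_module = braiding s + M: left_module "braid_algebra s" M
  for s :: "'i::finite braid" and M :: "('i tensor set, 'b) module"
begin

abbreviation scal :: "'i tensor set \<Rightarrow> 'b \<Rightarrow> 'b" where "scal a m \<equiv> a \<odot>\<^bsub>M\<^esub> m"

text \<open>Scalars become constant tensors, so that \<open>ev (embed p)\<close> is the linear
  combination of elements of M with coefficients p; complex numbers act through the constants of the
  algebra.\<close>

definition embed :: "('b \<Rightarrow>\<^sub>0 complex) \<Rightarrow> 'b \<Rightarrow>\<^sub>0 'i tensor" where
  "embed p = Poly_Mapping.map tensor_const p"

text \<open>The action map from the algebra tensored with M to M, with elements of M as their own
  labels.\<close>

definition ev :: "('b \<Rightarrow>\<^sub>0 'i tensor) \<Rightarrow> 'b" where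
  "ev G = finsum M (\<lambda>b. scal (cls s (Poly_Mapping.lookup G b)) b) (Poly_Mapping.keys G)"

lemma const_linear: "cvec_linear (tensor_const :: complex \<Rightarrow> 'i tensor)"
  by (rule cvec_linearI) (simp_all add: tensor_const_def single_add cscale_complex_def poly_mapping_eq_iff fun_eq_iff
      lookup_single lookup_cscale when_def)

lemma lookup_embed: "Poly_Mapping.lookup (embed p) b = tensor_const (Poly_Mapping.lookup p b)"
  by (simp add: embed_def lookup_pmap [OF const_linear])

sublocale embed: cvec_linear embed
  unfolding embed_def [abs_def] by (rule pmap_linear [OF const_linear])

lemma keys_embed: "Poly_Mapping.keys (embed p) = Poly_Mapping.keys p"
  by (auto simp: in_keys_iff lookup_embed tensor_const_def poly_mapping_eq_iff fun_eq_iff lookup_single when_def split: if_splits)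

lemma ev_superset:
  assumes "finite K" "Poly_Mapping.keys G \<subseteq> K" "K \<subseteq> carrier M"
  shows "ev G = finsum M (\<lambda>b. scal (cls s (Poly_Mapping.lookup G b)) b) K"
  unfolding ev_def
proof -
  have z: "scal (cls s (Poly_Mapping.lookup G b)) b = \<zero>\<^bsub>M\<^esub>" if "b \<in> K - Poly_Mapping.keys G" for b
    using that assms(3) M.smult_l_zero [of b] by (auto simp: in_keys_iff cls_zero)
  show "(\<Oplus>\<^bsub>M\<^esub>b\<in>Poly_Mapping.keys G. scal (cls s (Poly_Mapping.lookup G b)) b) =
      (\<Oplus>\<^bsub>M\<^esub>b\<in>K. scal (cls s (Poly_Mapping.lookup G b)) b)"
    by (rule M.M.add.finprod_mono_neutral_cong_left [OF assms(1,2)]) (use z assms(3) in auto)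
qed

lemma ev_closed [simp]: "Poly_Mapping.keys G \<subseteq> carrier M \<Longrightarrow> ev G \<in> carrier M"
  unfolding ev_def by (rule M.M.finsum_closed) auto

lemma ev_0 [simp]: "ev 0 = \<zero>\<^bsub>M\<^esub>"
  by (simp add: ev_def)

lemma ev_add:
  assumes "Poly_Mapping.keys G \<subseteq> carrier M" "Poly_Mapping.keys H \<subseteq> carrier M"
  shows "ev (G + H) = ev G \<oplus>\<^bsub>M\<^esub> ev H"
proof -
  let ?K = "Poly_Mapping.keys G \<union> Poly_Mapping.keys H"
  have K: "finite ?K" "?K \<subseteq> carrier M" using assms by auto
  have "ev (G + H) = finsum M (\<lambda>b. scal (cls s (Poly_Mapping.lookup (G + H) b)) b) ?K"
    by (rule ev_superset [OF K(1) keys_add K(2)])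
  also have "\<dots> = finsum M (\<lambda>b. scal (cls s (Poly_Mapping.lookup G b)) b \<oplus>\<^bsub>M\<^esub> scal (cls s (Poly_Mapping.lookup H b)) b) ?K"
    by (rule M.M.finsum_cong') (use K(2) in \<open>auto simp: lookup_add M.smult_l_distr subset_iff simp flip: cls_add\<close>)
  also have "\<dots> = ev G \<oplus>\<^bsub>M\<^esub> ev H"
    using K(2) by (subst M.M.finsum_addf) (auto simp: ev_superset [OF K(1) _ K(2)])
  finally show ?thesis .
qed

lemma ev_mult:
  assumes "Poly_Mapping.keys G \<subseteq> carrier M"
  shows "ev (Poly_Mapping.map (\<lambda>t'. t * t') G) = scal (cls s t) (ev G)"
proof -
  have lin: "cvec_linear (\<lambda>t'. t * t')" by (rule cvec_linearI) (simp_all add: distrib_left cscale_mult_right)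
  have "ev (Poly_Mapping.map (\<lambda>t'. t * t') G) =
      finsum M (\<lambda>b. scal (cls s t) (scal (cls s (Poly_Mapping.lookup G b)) b)) (Poly_Mapping.keys G)"
    unfolding ev_superset [OF finite_keys keys_pmap assms]
    by (rule M.M.finsum_cong') (use assms in \<open>auto simp: lookup_pmap [OF lin] subset_iff M.smult_assoc1 simp flip: cls_mult\<close>)
  also have "\<dots> = scal (cls s t) (ev G)"
    unfolding ev_def by (rule M.smult_finsum [symmetric]) (use assms in auto)
  finally show ?thesis .
qed

lemma ev_tsym:
  assumes "Poly_Mapping.keys G \<subseteq> carrier M"
  shows "ev (Poly_Mapping.map (\<lambda>t. tsym s (f t)) G) = ev (Poly_Mapping.map f G)"
proof -
  have "Poly_Mapping.keys (Poly_Mapping.map (\<lambda>t. tsym s (f t)) G) \<subseteq> Poly_Mapping.keys G" by (rule keys_pmap)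
  then show ?thesis
    unfolding ev_superset [OF finite_keys _ assms] ev_superset [OF finite_keys keys_pmap assms]
    by (intro M.M.finsum_cong') (use assms in \<open>auto simp: map.rep_eq when_def\<close>)
qed

lemma ev_single: "m \<in> carrier M \<Longrightarrow> ev (Poly_Mapping.single m t) = scal (cls s t) m"
  by (subst ev_superset [of "{m}"]) (auto simp: M.M.finsum_insert)

lemma ev_scale:
  assumes "Poly_Mapping.keys G \<subseteq> carrier M"
  shows "ev (c *\<^sub>C G) = scal (cls s (tensor_const c)) (ev G)"
proof -
  have "Poly_Mapping.map (\<lambda>t'. tensor_const c * t') G = c *\<^sub>C G"
    by (rule poly_mapping_eqI) (auto simp: map.rep_eq when_def const_mult lookup_cscale)
  then show ?thesis using ev_mult [OF assms, of "tensor_const c"] by simp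
qed

lemma keys_cscale: "Poly_Mapping.keys (c *\<^sub>C p) \<subseteq> Poly_Mapping.keys (p :: 'b \<Rightarrow>\<^sub>0 'w::cvec)"
  by (auto simp: in_keys_iff lookup_cscale)

lemma keys_sum_subset:
  assumes "\<And>x. x \<in> Y \<Longrightarrow> Poly_Mapping.keys (f x :: 'b \<Rightarrow>\<^sub>0 'w::cvec) \<subseteq> K"
  shows "Poly_Mapping.keys (\<Sum>x\<in>Y. f x) \<subseteq> K"
  using assms
proof (induction Y rule: infinite_finite_induct)
  case (insert x Y)
  then show ?case using keys_add [of "f x" "\<Sum>x\<in>Y. f x"] by auto
qed auto

lemma ev_sum:
  assumes "finite Y" "\<And>x. x \<in> Y \<Longrightarrow> Poly_Mapping.keys (f x) \<subseteq> carrier M"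
  shows "ev (\<Sum>x\<in>Y. f x) = finsum M (\<lambda>x. ev (f x)) Y"
  using assms
proof (induction Y rule: finite_induct)
  case (insert x Y)
  then have "Poly_Mapping.keys (\<Sum>x\<in>Y. f x) \<subseteq> carrier M" by (intro keys_sum_subset) auto
  then show ?case using insert by (simp add: ev_add M.M.finsum_insert)
qed simp

lemma ev_minus:
  assumes "Poly_Mapping.keys G \<subseteq> carrier M" "Poly_Mapping.keys H \<subseteq> carrier M" "ev G = ev H"
  shows "ev (G - H) = \<zero>\<^bsub>M\<^esub>"
proof -
  have k: "Poly_Mapping.keys (- 1 *\<^sub>C H) \<subseteq> carrier M" using keys_cscale assms(2) by blast
  have "ev H \<oplus>\<^bsub>M\<^esub> ev (- 1 *\<^sub>C H) = \<zero>\<^bsub>M\<^esub>"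
    using ev_add [OF assms(2) k] by simp
  then show ?thesis using ev_add [OF assms(1) k] assms(3) by simp
qed

definition vbasis :: "'b set \<Rightarrow> bool" where
  "vbasis B \<longleftrightarrow> B \<subseteq> carrier M \<and> (\<forall>p. Poly_Mapping.keys p \<subseteq> B \<longrightarrow> ev (embed p) = \<zero>\<^bsub>M\<^esub> \<longrightarrow> p = 0) \<and>
     (\<forall>m\<in>carrier M. \<exists>p. Poly_Mapping.keys p \<subseteq> B \<and> ev (embed p) = m)"

lemma ev_embed_single: "m \<in> carrier M \<Longrightarrow> ev (embed (Poly_Mapping.single m 1)) = m"
proof -
  assume m: "m \<in> carrier M"
  have eq: "embed (Poly_Mapping.single m 1) = Poly_Mapping.single m 1"
    by (rule poly_mapping_eqI) (simp add: lookup_embed lookup_single when_def tensor_const_def single_one flip: zero_list_def)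
  show ?thesis unfolding eq using m by (simp add: ev_single flip: cls_one)
qed

text \<open>Zorn's lemma for independent subsets. The vector space is the carrier of M, with scalars
  acting through the algebra.\<close>

lemma exists_vbasis: "\<exists>B. vbasis B"
proof -
  define ind where "ind = (\<lambda>B. B \<subseteq> carrier M \<and> (\<forall>p. Poly_Mapping.keys p \<subseteq> B \<longrightarrow> ev (embed p) = \<zero>\<^bsub>M\<^esub> \<longrightarrow> p = 0))"
  have indD: "B \<subseteq> carrier M" "Poly_Mapping.keys p \<subseteq> B \<Longrightarrow> ev (embed p) = \<zero>\<^bsub>M\<^esub> \<Longrightarrow> p = 0"
    if "ind B" for B p using that unfolding ind_def by blast+
  have indI: "ind B" if "B \<subseteq> carrier M" "\<And>p. Poly_Mapping.keys p \<subseteq> B \<Longrightarrow> ev (embed p) = \<zero>\<^bsub>M\<^esub> \<Longrightarrow> p = 0" for B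
    using that unfolding ind_def by blast
  have "\<exists>B\<in>{B. ind B}. \<forall>B'\<in>{B. ind B}. B \<subseteq> B' \<longrightarrow> B' = B"
  proof (rule subset_Zorn_nonempty)
    have "ind {}" by (rule indI) auto
    then show "{B. ind B} \<noteq> {}" by blast
    fix C assume C: "C \<noteq> {}" "subset.chain {B. ind B} C"
    have CB: "ind B" if "B \<in> C" for B using C(2) that by (auto simp: subset_chain_def)
    have "p = 0" if p: "Poly_Mapping.keys p \<subseteq> \<Union>C" "ev (embed p) = \<zero>\<^bsub>M\<^esub>" for p
    proof -
      obtain B where "B \<in> C" "Poly_Mapping.keys p \<subseteq> B"
        using finite_subset_Union_chain [OF finite_keys p(1) C] by blast
      then show ?thesis using indD(2) [OF CB] p(2) by blast
    qed
    moreover have "\<Union>C \<subseteq> carrier M" using indD(1) [OF CB] by blast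
    ultimately show "\<Union>C \<in> {B. ind B}" using indI by blast
  qed
  then obtain B where B: "ind B" and mx: "\<And>B'. ind B' \<Longrightarrow> B \<subseteq> B' \<Longrightarrow> B' = B" by blast
  have "\<exists>p. Poly_Mapping.keys p \<subseteq> B \<and> ev (embed p) = m" if m: "m \<in> carrier M" for m
  proof (cases "m \<in> B")
    case True
    then show ?thesis using ev_embed_single [OF m] by (intro exI [of _ "Poly_Mapping.single m 1"]) auto
  next
    case False
    then have "\<not> ind (insert m B)" using mx [of "insert m B"] by blast
    then obtain p where p: "Poly_Mapping.keys p \<subseteq> insert m B" "ev (embed p) = \<zero>\<^bsub>M\<^esub>" "p \<noteq> 0"
      using indI [of "insert m B"] indD(1) [OF B] m by blast
    let ?c = "Poly_Mapping.lookup p m"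
    have c: "?c \<noteq> 0"
    proof
      assume "?c = 0"
      then have "Poly_Mapping.keys p \<subseteq> B" using p(1) by (auto simp: in_keys_iff)
      then show False using indD(2) [OF B] p by blast
    qed
    \<comment> \<open>A relation p that must involve m, solved for m.\<close>
    let ?q = "Poly_Mapping.single m 1 - inverse ?c *\<^sub>C p"
    have kq: "Poly_Mapping.keys ?q \<subseteq> B"
    proof
      fix b assume "b \<in> Poly_Mapping.keys ?q"
      then have "(if m = b then 1 else 0) - inverse ?c * Poly_Mapping.lookup p b \<noteq> 0"
        by (simp add: in_keys_iff lookup_minus lookup_single lookup_cscale cscale_complex_def when_def)
      then have "b \<noteq> m \<and> Poly_Mapping.lookup p b \<noteq> 0" using c by (auto split: if_splits)
      then show "b \<in> B" using p(1) by (auto simp: in_keys_iff)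
    qed
    have kp: "Poly_Mapping.keys (embed p) \<subseteq> carrier M" using p(1) indD(1) [OF B] m by (auto simp: keys_embed)
    have k: "Poly_Mapping.keys (embed ?q) \<subseteq> carrier M" using kq indD(1) [OF B] by (auto simp: keys_embed)
    have kcp: "Poly_Mapping.keys (inverse ?c *\<^sub>C embed p) \<subseteq> carrier M" using keys_cscale kp by blast
    have "embed (Poly_Mapping.single m 1) = embed ?q + inverse ?c *\<^sub>C embed p" by (simp add: embed.diff embed.scale)
    then have "m = ev (embed ?q) \<oplus>\<^bsub>M\<^esub> ev (inverse ?c *\<^sub>C embed p)"
      using ev_embed_single [OF m] ev_add [OF k kcp] by simp
    then have "ev (embed ?q) = m" using ev_scale [OF kp] p(2) k by simp
    then show ?thesis using kq by blast
  qed
  then show ?thesis using indD [OF B] unfolding vbasis_def by blast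
qed

end

locale based_module = normalized_braiding s + braid_module s M
  for s :: "'i::finite braid" and M :: "('i tensor set, 'b) module" +
  fixes B :: "'b set"
  assumes basis: "vbasis B"
begin

lemma B_sub: "B \<subseteq> carrier M"
  using basis by (simp add: vbasis_def)

lemma keys_carrier: "Poly_Mapping.keys G \<subseteq> B \<Longrightarrow> Poly_Mapping.keys G \<subseteq> carrier M"
  using B_sub by blast

lemma embed_carrier: "Poly_Mapping.keys p \<subseteq> B \<Longrightarrow> Poly_Mapping.keys (embed p) \<subseteq> carrier M"
  using B_sub by (simp add: keys_embed)

lemma basis_indep: "Poly_Mapping.keys p \<subseteq> B \<Longrightarrow> ev (embed p) = \<zero>\<^bsub>M\<^esub> \<Longrightarrow> p = 0"
  using basis by (simp add: vbasis_def)

definition co :: "'b \<Rightarrow> 'b \<Rightarrow>\<^sub>0 complex" where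
  "co m = (SOME p. Poly_Mapping.keys p \<subseteq> B \<and> ev (embed p) = m)"

lemma co: "m \<in> carrier M \<Longrightarrow> Poly_Mapping.keys (co m) \<subseteq> B \<and> ev (embed (co m)) = m"
  unfolding co_def by (rule someI_ex) (use basis in \<open>simp add: vbasis_def\<close>)

lemma ev_inj:
  assumes "Poly_Mapping.keys p \<subseteq> B" "Poly_Mapping.keys q \<subseteq> B" "ev (embed p) = ev (embed q)"
  shows "p = q"
proof -
  have k: "Poly_Mapping.keys (p - q) \<subseteq> B" using keys_diff [of p q] assms(1,2) by blast
  have "ev (embed p - embed q) = \<zero>\<^bsub>M\<^esub>" by (intro ev_minus embed_carrier assms)
  then have "ev (embed (p - q)) = \<zero>\<^bsub>M\<^esub>" by (simp only: embed.diff)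
  from basis_indep [OF k this] show ?thesis by simp
qed

text \<open>The structure constants of M. The value 0 off the basis makes the condition on supports
  hold for every label.\<close>

definition mu :: "'i \<Rightarrow> 'b \<Rightarrow> 'b \<Rightarrow>\<^sub>0 complex" where
  "mu i m = (if m \<in> B then co (scal (cls s (letter i)) m) else 0)"

lemma letter_scal_closed: "m \<in> B \<Longrightarrow> scal (cls s (letter i)) m \<in> carrier M"
  using B_sub by (intro M.smult_closed) auto

lemma keys_mu: "Poly_Mapping.keys (mu i m) \<subseteq> B"
  using co [OF letter_scal_closed [of m i]] by (auto simp: mu_def)

lemma ev_mu: "m \<in> B \<Longrightarrow> ev (embed (mu i m)) = scal (cls s (letter i)) m"
  using co [OF letter_scal_closed [of m i]] by (auto simp: mu_def)

definition actp :: "'i \<Rightarrow> ('b \<Rightarrow>\<^sub>0 complex) \<Rightarrow> 'b \<Rightarrow>\<^sub>0 complex" where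
  "actp a p = (\<Sum>m\<in>Poly_Mapping.keys p. Poly_Mapping.lookup p m *\<^sub>C mu a m)"

lemma keys_actp: "Poly_Mapping.keys (actp a p) \<subseteq> B"
  unfolding actp_def using keys_cscale keys_mu by (intro keys_sum_subset) blast

lemma ev_actp:
  assumes "Poly_Mapping.keys p \<subseteq> B"
  shows "ev (embed (actp a p)) = scal (cls s (letter a)) (ev (embed p))"
proof -
  have B: "m \<in> B" "m \<in> carrier M" if "m \<in> Poly_Mapping.keys p" for m using that assms B_sub by auto
  have "embed (actp a p) = (\<Sum>m\<in>Poly_Mapping.keys p. Poly_Mapping.lookup p m *\<^sub>C embed (mu a m))"
    by (simp only: actp_def embed.sum embed.scale)
  also have "ev \<dots> = finsum M (\<lambda>m. ev (Poly_Mapping.lookup p m *\<^sub>C embed (mu a m))) (Poly_Mapping.keys p)"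
    by (rule ev_sum [OF finite_keys subset_trans [OF keys_cscale embed_carrier [OF keys_mu]]])
  also have "\<dots> = finsum M (\<lambda>m. scal (cls s (letter a)) (scal (cls s (Poly_Mapping.lookup (embed p) m)) m)) (Poly_Mapping.keys p)"
  proof (rule M.M.finsum_cong')
    fix m assume "m \<in> Poly_Mapping.keys p"
    note m = B [OF this]
    have "ev (Poly_Mapping.lookup p m *\<^sub>C embed (mu a m)) =
        scal (cls s (tensor_const (Poly_Mapping.lookup p m))) (scal (cls s (letter a)) m)"
      by (simp only: ev_scale [OF embed_carrier [OF keys_mu]] ev_mu [OF m(1)])
    also have "\<dots> = scal (cls s (letter a)) (scal (cls s (Poly_Mapping.lookup (embed p) m)) m)"
      using m(2) by (simp add: lookup_embed cls_mult const_mult mult_const flip: M.smult_assoc1)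
    finally show "ev (Poly_Mapping.lookup p m *\<^sub>C embed (mu a m)) =
        scal (cls s (letter a)) (scal (cls s (Poly_Mapping.lookup (embed p) m)) m)" .
  qed (use B in auto)
  also have "\<dots> = scal (cls s (letter a)) (ev (embed p))"
    unfolding ev_def keys_embed by (rule M.smult_finsum [symmetric]) (use B in auto)
  finally show ?thesis .
qed

lemma keys_sum_cscale:
  assumes "\<And>j k. Poly_Mapping.keys (f j k) \<subseteq> B"
  shows "Poly_Mapping.keys (\<Sum>j\<in>UNIV. \<Sum>k\<in>UNIV. c j k *\<^sub>C f j k :: 'b \<Rightarrow>\<^sub>0 'w::cvec) \<subseteq> B"
  by (intro keys_sum_subset subset_trans [OF keys_cscale] assms)

text \<open>Coordinates are determined by their image under \<open>ev\<close>, so the relation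
  between structure constants follows from the relation between products of generators acting on
  M.\<close>

lemma coeff_module_mu: "coeff_module s B mu"
proof (intro coeff_module.intro coeff_module_axioms.intro)
  show "normalized_braiding s" by unfold_locales
  show "Poly_Mapping.keys (mu i m) \<subseteq> B" for i m by (rule keys_mu)
  fix m a b assume m: "m \<in> B"
  then have mM: "m \<in> carrier M" using B_sub by blast
  have two: "ev (embed (actp a (mu b m))) = scal (cls s (letter a * letter b)) m" for a b
    using mM by (simp add: ev_actp [OF keys_mu] ev_mu [OF m] flip: cls_mult M.smult_assoc1)
  have k: "Poly_Mapping.keys (\<Sum>j\<in>UNIV. \<Sum>k\<in>UNIV. s a b j k *\<^sub>C actp j (mu k m)) \<subseteq> B"
    by (rule keys_sum_cscale [OF keys_actp])
  have "actp a (mu b m) = (\<Sum>j\<in>UNIV. \<Sum>k\<in>UNIV. s a b j k *\<^sub>C actp j (mu k m))"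
  proof (rule ev_inj [OF keys_actp k])
    let ?e = "\<lambda>j k. embed (actp j (mu k m))"
    let ?x = "Poly_Mapping.single m 1 :: 'b \<Rightarrow>\<^sub>0 'i tensor"
    have kc: "Poly_Mapping.keys (s a b j k *\<^sub>C ?e j k) \<subseteq> carrier M" for j k
      by (rule subset_trans [OF keys_cscale embed_carrier [OF keys_actp]])
    have kx: "Poly_Mapping.keys (s a b j k *\<^sub>C Poly_Mapping.single m (letter j * letter k)) \<subseteq> carrier M" for j k
      by (rule subset_trans [OF keys_cscale]) (use mM in auto)
    have kxx: "Poly_Mapping.keys (Poly_Mapping.single m t :: 'b \<Rightarrow>\<^sub>0 'i tensor) \<subseteq> carrier M" for t
      using mM by auto
    have "ev (embed (\<Sum>j\<in>UNIV. \<Sum>k\<in>UNIV. s a b j k *\<^sub>C actp j (mu k m))) =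
        ev (\<Sum>j\<in>UNIV. \<Sum>k\<in>UNIV. s a b j k *\<^sub>C ?e j k)"
      by (simp only: embed.sum embed.scale)
    also have "\<dots> = finsum M (\<lambda>j. finsum M (\<lambda>k. ev (s a b j k *\<^sub>C ?e j k)) UNIV) UNIV"
      by (simp add: ev_sum keys_sum_subset kc)
    also have "\<dots> = finsum M (\<lambda>j. finsum M (\<lambda>k. ev (s a b j k *\<^sub>C Poly_Mapping.single m (letter j * letter k))) UNIV) UNIV"
      by (simp only: ev_scale [OF embed_carrier [OF keys_actp]] ev_scale [OF kxx] two ev_single [OF mM])
    also have "\<dots> = ev (\<Sum>j\<in>UNIV. \<Sum>k\<in>UNIV. s a b j k *\<^sub>C Poly_Mapping.single m (letter j * letter k))"
      by (simp add: ev_sum keys_sum_subset kx)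
    also have "\<dots> = ev (Poly_Mapping.single m (\<Sum>j\<in>UNIV. \<Sum>k\<in>UNIV. s a b j k *\<^sub>C (letter j * letter k)))"
      by (rule arg_cong [where f = ev], rule poly_mapping_eqI) (simp add: lookup_sum lookup_cscale lookup_single when_def)
    also have "\<dots> = scal (cls s (letter a * letter b)) m"
    proof -
      have "cls s (letter a * letter b) = cls s (\<Sum>j\<in>UNIV. \<Sum>k\<in>UNIV. s a b j k *\<^sub>C (letter j * letter k))"
        unfolding cls_eq_iff
        using braid_ideal_gen [of "[]" s a b "[]"]
        by (simp add: tsym_eq_iff braid_rel_def word_Nil word_mult_word)
      then show ?thesis using mM by (simp add: ev_single)
    qed
    finally show "ev (embed (actp a (mu b m))) = ev (embed (\<Sum>j\<in>UNIV. \<Sum>k\<in>UNIV. s a b j k *\<^sub>C actp j (mu k m)))"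
      using two by simp
  qed
  then show "(\<Sum>m'\<in>Poly_Mapping.keys (mu b m). Poly_Mapping.lookup (mu b m) m' *\<^sub>C mu a m') =
      (\<Sum>j\<in>UNIV. \<Sum>k\<in>UNIV. s a b j k *\<^sub>C
        (\<Sum>m'\<in>Poly_Mapping.keys (mu k m). Poly_Mapping.lookup (mu k m) m' *\<^sub>C mu j m'))"
    by (simp only: actp_def)
qed

sublocale coeff_module s B mu by (rule coeff_module_mu)

lemma sym_coeffsD: "w \<in> sym_coeffs \<Longrightarrow> Poly_Mapping.keys w \<subseteq> B" "w \<in> sym_coeffs \<Longrightarrow> tsym s (Poly_Mapping.lookup w b) = Poly_Mapping.lookup w b"
  by (simp_all add: sym_coeffs_def)

text \<open>On a basis element b with coefficient t this is (t x) b = t (x b).\<close>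

lemma ev_rhow_lam:
  assumes G: "Poly_Mapping.keys G \<subseteq> B"
  shows "ev (rhow i G) = ev (lam i G)"
proof -
  let ?t = "\<lambda>b. Poly_Mapping.single b (Poly_Mapping.lookup G b)"
  have single: "ev (rhow i (Poly_Mapping.single b t)) = ev (lam i (Poly_Mapping.single b t))" if "b \<in> B" for b t
  proof -
    have bM: "b \<in> carrier M" using that B_sub by blast
    have "rhow i (Poly_Mapping.single b t) = Poly_Mapping.single b (tsym s (t * letter i))"
      by (rule poly_mapping_eqI) (simp add: rhow_def lookup_pmap [OF lin_rhow] lookup_single when_def)
    moreover have "lam i (Poly_Mapping.single b t) = Poly_Mapping.map (\<lambda>t'. t * t') (embed (mu i b))"
    proof (rule poly_mapping_eqI)
      fix b'
      have lin: "cvec_linear (\<lambda>t'. t * t')" by (rule cvec_linearI) (simp_all add: distrib_left cscale_mult_right)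
      show "Poly_Mapping.lookup (lam i (Poly_Mapping.single b t)) b' =
          Poly_Mapping.lookup (Poly_Mapping.map (\<lambda>t'. t * t') (embed (mu i b))) b'"
        by (simp add: lam_single lookup_pmap [OF lin_scale_left] lookup_pmap [OF lin] lookup_embed mult_const)
    qed
    ultimately show ?thesis
      using bM by (simp add: ev_single ev_mult [OF embed_carrier [OF keys_mu]] ev_mu [OF that] M.smult_assoc1 flip: cls_mult)
  qed
  have kr: "Poly_Mapping.keys (rhow i (?t b)) \<subseteq> carrier M" if "b \<in> Poly_Mapping.keys G" for b
  proof -
    have "Poly_Mapping.keys (rhow i (?t b)) \<subseteq> Poly_Mapping.keys (?t b)" unfolding rhow_def by (rule keys_pmap)
    then show ?thesis using that G B_sub by (auto split: if_splits)
  qed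
  have kl: "Poly_Mapping.keys (lam i (?t b)) \<subseteq> carrier M" for b by (rule keys_carrier [OF lam_keys])
  have "ev (rhow i G) = ev (\<Sum>b\<in>Poly_Mapping.keys G. rhow i (?t b))"
    by (subst pmap_expand) (simp only: rho.sum)
  also have "\<dots> = finsum M (\<lambda>b. ev (rhow i (?t b))) (Poly_Mapping.keys G)"
    by (rule ev_sum [OF finite_keys kr])
  also have "\<dots> = finsum M (\<lambda>b. ev (lam i (?t b))) (Poly_Mapping.keys G)"
    by (rule M.M.finsum_cong') (use single G ev_closed [OF kl] in auto)
  also have "\<dots> = ev (\<Sum>b\<in>Poly_Mapping.keys G. lam i (?t b))"
    by (rule ev_sum [OF finite_keys kl, symmetric])
  also have "\<dots> = ev (lam i G)"
    by (subst (2) pmap_expand) (simp only: lam.sum)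
  finally show ?thesis .
qed

lemma chains_keys: "g \<in> chains n \<Longrightarrow> Poly_Mapping.keys (g u) \<subseteq> B"
  using chainsD(3) sym_coeffsD(1) by blast

lemma ev_bdry:
  assumes g: "g \<in> chains 1"
  shows "ev (bdry 0 g []) = \<zero>\<^bsub>M\<^esub>"
proof -
  have kr: "Poly_Mapping.keys (rhow i (g [i])) \<subseteq> carrier M" for i
    using S_rho [OF chainsD(3) [OF g]] sym_coeffsD(1) keys_carrier by blast
  have kl: "Poly_Mapping.keys (lam i (g [i])) \<subseteq> carrier M" for i by (rule keys_carrier [OF lam_keys])
  have "ev (dL g [] - dR g []) = \<zero>\<^bsub>M\<^esub>"
  proof (rule ev_minus)
    show "Poly_Mapping.keys (dL g []) \<subseteq> carrier M" "Poly_Mapping.keys (dR g []) \<subseteq> carrier M"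
      using kr kl by (auto simp: dL_def dR_def intro!: keys_sum_subset)
    have "ev (dL g []) = finsum M (\<lambda>i. ev (rhow i (g [i]))) UNIV"
      by (simp add: dL_def ev_sum kr)
    also have "\<dots> = finsum M (\<lambda>i. ev (lam i (g [i]))) UNIV"
      by (simp only: ev_rhow_lam [OF chains_keys [OF g]])
    also have "\<dots> = ev (dR g [])" by (simp add: dR_def ev_sum kl)
    finally show "ev (dL g []) = ev (dR g [])" .
  qed
  then show ?thesis by (simp add: bdry_def)
qed

lemma tpart_const:
  assumes "\<And>q. q \<ge> 1 \<Longrightarrow> tpart q t = 0"
  shows "t = tensor_const (Poly_Mapping.lookup t [])"
proof (rule poly_mapping_eqI)
  fix w
  have "Poly_Mapping.lookup t w = 0" if "w \<noteq> []"
    using arg_cong [where f = "\<lambda>t. Poly_Mapping.lookup t w", OF assms [of "length w"]] that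
    by (cases w) (simp_all add: tpart.rep_eq)
  then show "Poly_Mapping.lookup t w = Poly_Mapping.lookup (tensor_const (Poly_Mapping.lookup t [])) w"
    by (auto simp: tensor_const_def lookup_single when_def)
qed

text \<open>Modulo boundaries z is a family of constants, that is, \<open>embed p\<close>. As
  \<open>ev\<close> kills boundaries, p is a linear relation between basis elements and therefore
  0.\<close>

lemma exact_aug:
  assumes z: "z \<in> chains 0" and "ev (z []) = \<zero>\<^bsub>M\<^esub>"
  obtains w where "w \<in> chains 1" "bdry 0 w = z"
proof -
  obtain w where w: "w \<in> chains 1" and pz: "\<And>u q. q \<ge> 1 \<Longrightarrow> Poly_Mapping.map (tpart q) (z u - bdry 0 w u) = 0"
    using bdry_exact_0 [OF z] by blast
  have bw: "bdry 0 w \<in> chains 0" using bdry_chains [of w 0] w by simp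
  let ?D = "z [] - bdry 0 w []"
  define p where "p = Poly_Mapping.map (\<lambda>t. Poly_Mapping.lookup t []) ?D"
  have D: "?D = embed p"
  proof (rule poly_mapping_eqI)
    fix b
    have "tpart q (Poly_Mapping.lookup ?D b) = 0" if "q \<ge> 1" for q
      using arg_cong [where f = "\<lambda>x. Poly_Mapping.lookup x b", OF pz [OF that, of "[]"]]
      by (simp add: lookup_pmap [OF tpart.cvec_linear_axioms])
    from tpart_const [OF this]
    have "Poly_Mapping.lookup ?D b = tensor_const (Poly_Mapping.lookup (Poly_Mapping.lookup ?D b) [])" by simp
    moreover have "Poly_Mapping.lookup p b = Poly_Mapping.lookup (Poly_Mapping.lookup ?D b) []"
      unfolding p_def by (simp add: map.rep_eq when_def)
    ultimately show "Poly_Mapping.lookup ?D b = Poly_Mapping.lookup (embed p) b" by (simp add: lookup_embed)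
  qed
  have "Poly_Mapping.keys ?D \<subseteq> B" using sym_coeffsD(1) [OF S_diff [OF chainsD(3) [OF z] chainsD(3) [OF bw]]] .
  then have kp: "Poly_Mapping.keys p \<subseteq> B" unfolding p_def by (rule subset_trans [OF keys_pmap])
  have "ev ?D = \<zero>\<^bsub>M\<^esub>"
    using ev_minus [OF keys_carrier [OF chains_keys [OF z]] keys_carrier [OF chains_keys [OF bw]]] ev_bdry [OF w] assms(2) by simp
  then have "p = 0" using basis_indep [OF kp] D by simp
  then have "?D = 0" using D by simp
  then have "bdry 0 w u = z u" for u
    using chainsD(1) [OF z, of u] chainsD(1) [OF bw, of u] by (cases u) auto
  then show ?thesis using that [OF w] by blast
qed

lemma aug_surj:
  assumes m: "m \<in> carrier M"
  obtains z where "z \<in> chains 0" "ev (z []) = m"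
proof -
  have "embed (co m) \<in> sym_coeffs" using co [OF m] by (simp add: sym_coeffs_def keys_embed lookup_embed)
  then have "(\<lambda>u. if u = [] then embed (co m) else 0) \<in> chains 0" by (simp add: chains_def)
  then show ?thesis using that co [OF m] by simp
qed

end

text \<open>Projectivity asks for an index set inside the element type of P. The unit vectors of the
  given free module belong to this type and form a copy of K, since 1 and 0 differ.\<close>

lemma projective_retract:
  fixes P :: "('a, 'k \<Rightarrow> 'a) module" and K :: "'k set"
  assumes A: "ring A" and one: "\<one>\<^bsub>A\<^esub> \<noteq> \<zero>\<^bsub>A\<^esub>" and P: "left_module A P"
    and i: "i \<in> linear_maps A P (free_module A K)" and r: "r \<in> linear_maps A (free_module A K) P"
    and ri: "\<And>x. x \<in> carrier P \<Longrightarrow> r (i x) = x"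
  shows "projective_module A P"
proof -
  interpret ring A by fact
  have inj: "inj (free_unit A)"
    using one by (auto simp: inj_def free_unit_def fun_eq_iff split: if_splits)
  let ?J = "free_unit A ` K"
  define \<phi> :: "('k \<Rightarrow> 'a) \<Rightarrow> ('k \<Rightarrow> 'a) \<Rightarrow> 'a"
    where "\<phi> f = (\<lambda>y. if y \<in> ?J then f (the_inv (free_unit A) y) else \<zero>\<^bsub>A\<^esub>)" for f
  define \<psi> where "\<psi> h = (\<lambda>k. if k \<in> K then h (free_unit A k) else \<zero>\<^bsub>A\<^esub>)" for h
  have \<phi>: "\<phi> \<in> linear_maps A (free_module A K) (free_module A ?J)"
  proof (rule linear_mapsI)
    fix f assume f: "f \<in> carrier (free_module A K)"
    have "{y. \<phi> f y \<noteq> \<zero>\<^bsub>A\<^esub>} \<subseteq> free_unit A ` {k. f k \<noteq> \<zero>\<^bsub>A\<^esub>}"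
      by (auto simp: \<phi>_def the_inv_f_f [OF inj] split: if_splits)
    then have "finite {y. \<phi> f y \<noteq> \<zero>\<^bsub>A\<^esub>}" by (rule finite_subset) (use f in auto)
    then show "\<phi> f \<in> carrier (free_module A ?J)" using f by (auto simp: \<phi>_def)
  qed (auto simp: \<phi>_def fun_eq_iff)
  have \<psi>: "\<psi> \<in> linear_maps A (free_module A ?J) (free_module A K)"
  proof (rule linear_mapsI)
    fix h assume h: "h \<in> carrier (free_module A ?J)"
    have "finite (free_unit A -` {y. h y \<noteq> \<zero>\<^bsub>A\<^esub>})" by (rule finite_vimageI [OF _ inj]) (use h in auto)
    then have "finite {k. \<psi> h k \<noteq> \<zero>\<^bsub>A\<^esub>}" by (rule finite_subset [rotated]) (auto simp: \<psi>_def)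
    then show "\<psi> h \<in> carrier (free_module A K)" using h by (auto simp: \<psi>_def)
  qed (auto simp: \<psi>_def fun_eq_iff)
  have "\<psi> (\<phi> f) = f" if "f \<in> carrier (free_module A K)" for f
    using that by (auto simp: \<phi>_def \<psi>_def the_inv_f_f [OF inj])
  then have "r (\<psi> (\<phi> (i x))) = x" if "x \<in> carrier P" for x
    using ri [OF that] linear_mapsD(1) [OF i that] by simp
  then show ?thesis
    unfolding projective_module_def
    using P linear_maps_comp [OF i \<phi>] linear_maps_comp [OF \<psi> r]
    by (intro conjI exI [of _ ?J] bexI [of _ "\<lambda>x. \<phi> (i x)"] bexI [of _ "\<lambda>x. r (\<psi> x)"] ballI)
qed

lemma symz_linear:
  assumes "cvec_linear L" and "length u = n"
  shows "L (symz s n f u) = symz s n (\<lambda>v. L (f v)) u"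
proof -
  interpret cvec_linear L by fact
  show ?thesis
    unfolding symz_expand [OF assms(2), of s f] symz_expand [OF assms(2), of s "\<lambda>v. L (f v)"]
    by (simp only: sum scale)
qed

section \<open>Chains as elements of the prescribed type\<close>

context coeff_module
begin

text \<open>Chains are stored as elements of the free module on \<open>'b \<times> 'a \<times> nat\<close>; the middle component is a dummy.\<close>

definition enc :: "('i list \<Rightarrow> 'b \<Rightarrow>\<^sub>0 'i tensor) \<Rightarrow> ('i tensor set, 'b) resolution_elem" where
  "enc g = (\<lambda>(b, a, k). if a = {} \<and> k \<in> range (to_nat :: 'i list \<Rightarrow> nat)
     then cls s (Poly_Mapping.lookup (g (from_nat k)) b) else \<zero>\<^bsub>braid_algebra s\<^esub>)"

definition dec :: "('i tensor set, 'b) resolution_elem \<Rightarrow> 'i list \<Rightarrow> 'b \<Rightarrow>\<^sub>0 'i tensor" where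
  "dec x u = Poly_Mapping.Abs_poly_mapping (\<lambda>b. rep s (x (b, {}, to_nat u)))"

definition idx :: "nat \<Rightarrow> ('b \<times> 'i tensor set \<times> nat) set" where
  "idx n = B \<times> {{}} \<times> (to_nat :: 'i list \<Rightarrow> nat) ` words n"

abbreviation freemod where "freemod n \<equiv> free_module (braid_algebra s) (idx n)"

definition resmod :: "nat \<Rightarrow> ('i tensor set, ('i tensor set, 'b) resolution_elem) module" where
  "resmod n = (freemod n)\<lparr>carrier := enc ` chains n\<rparr>"

definition lact :: "'i tensor set \<Rightarrow> ('i list \<Rightarrow> 'b \<Rightarrow>\<^sub>0 'i tensor) \<Rightarrow> 'i list \<Rightarrow> 'b \<Rightarrow>\<^sub>0 'i tensor" where
  "lact a g u = Poly_Mapping.map (\<lambda>t. tsym s (rep s a * t)) (g u)"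

text \<open>A retraction of all families onto the antisymmetric ones. It is linear over the algebra
  because the matrix of the antisymmetrizer has scalar entries, and so it exhibits the terms of the
  resolution as summands of free modules.\<close>

definition proj :: "nat \<Rightarrow> ('i list \<Rightarrow> 'b \<Rightarrow>\<^sub>0 'i tensor) \<Rightarrow> 'i list \<Rightarrow> 'b \<Rightarrow>\<^sub>0 'i tensor" where
  "proj n g u = (if length u = n then symz (neg_braid s) n g u else 0)"

definition resdiff where "resdiff n x = enc (bdry n (dec x))"

lemma lin_lact: "cvec_linear (\<lambda>t. tsym s (c * t))"
  by (rule cvec_linearI) (simp_all add: distrib_left tsym.add tsym.scale cscale_mult_right)

lemmas lookup_lact = lookup_pmap [OF lin_lact]

lemma resmod_simps [simp]:
  "carrier (resmod n) = enc ` chains n" "\<zero>\<^bsub>resmod n\<^esub> = (\<lambda>_. \<zero>\<^bsub>braid_algebra s\<^esub>)"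
  "x \<oplus>\<^bsub>resmod n\<^esub> y = (\<lambda>j. x j \<oplus>\<^bsub>braid_algebra s\<^esub> y j)"
  "a \<odot>\<^bsub>resmod n\<^esub> x = (\<lambda>j. a \<otimes>\<^bsub>braid_algebra s\<^esub> x j)"
  by (simp_all add: resmod_def free_module_def)

lemma enc_add: "(\<lambda>j. enc g j \<oplus>\<^bsub>braid_algebra s\<^esub> enc h j) = enc (\<lambda>u. g u + h u)"
  by (auto simp: enc_def fun_eq_iff lookup_add cls_add cls_zero)

lemma enc_lact: "a \<in> carrier (braid_algebra s) \<Longrightarrow> (\<lambda>j. a \<otimes>\<^bsub>braid_algebra s\<^esub> enc g j) = enc (lact a g)"
proof -
  assume a: "a \<in> carrier (braid_algebra s)"
  then have "a \<otimes>\<^bsub>braid_algebra s\<^esub> cls s t = cls s (rep s a * t)" for t using cls_mult [of "rep s a" t] by simp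
  then show ?thesis using a by (auto simp: enc_def fun_eq_iff lact_def lookup_lact)
qed

lemma enc_zero: "(\<lambda>_. \<zero>\<^bsub>braid_algebra s\<^esub>) = enc (\<lambda>_. 0)"
  by (auto simp: enc_def fun_eq_iff cls_zero)

lemma lact_S: "w \<in> sym_coeffs \<Longrightarrow> Poly_Mapping.map (\<lambda>t. tsym s (c * t)) w \<in> sym_coeffs"
  using subset_trans [OF keys_pmap] unfolding sym_coeffs_def by (auto simp: lookup_lact)

lemma lact_chains: "g \<in> chains n \<Longrightarrow> lact a g \<in> chains n"
proof -
  assume g: "g \<in> chains n"
  have "symt (neg_braid s) n (lact a g)"
    unfolding lact_def [abs_def] by (rule symt_linear [OF pmap_linear [OF lin_lact] chainsD(2) [OF g]])
  moreover have "lact a g u = 0" if "length u \<noteq> n" for u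
    using chainsD(1) [OF g that] cvec_linear.zero [OF pmap_linear [OF lin_lact]] by (simp add: lact_def)
  moreover have "lact a g u \<in> sym_coeffs" for u
    unfolding lact_def by (rule lact_S [OF chainsD(3) [OF g]])
  ultimately show ?thesis by (simp add: chains_def)
qed

lemma enc_closed:
  assumes g: "g \<in> chains n"
  shows "enc g \<in> carrier (freemod n)"
proof -
  have keys: "Poly_Mapping.keys (g u) \<subseteq> B" for u using chainsD(3) [OF g] by (simp add: sym_coeffs_def)
  have z: "enc g j = \<zero>\<^bsub>braid_algebra s\<^esub>"
    if "j \<notin> (\<Union>w\<in>words n. Poly_Mapping.keys (g w) \<times> {{}} \<times> {to_nat w})" for j
  proof -
    obtain b a k where j: "j = (b, a, k)" by (cases j)
    show ?thesis
    proof (cases "a = {} \<and> k \<in> range (to_nat :: 'i list \<Rightarrow> nat)")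
      case True
      then obtain w :: "'i list" where w: "k = to_nat w" "a = {}" by blast
      then have "w \<notin> words n \<or> b \<notin> Poly_Mapping.keys (g w)" using that j by blast
      then have "Poly_Mapping.lookup (g w) b = 0"
        using chainsD(1) [OF g, of w] by (auto simp: mem_words in_keys_iff)
      then show ?thesis by (simp add: enc_def j w cls_zero)
    qed (auto simp: enc_def j)
  qed
  have "finite {j. enc g j \<noteq> \<zero>\<^bsub>braid_algebra s\<^esub>}"
    by (rule finite_subset [of _ "\<Union>w\<in>words n. Poly_Mapping.keys (g w) \<times> {{}} \<times> {to_nat w}"])
      (use z in blast, simp add: finite_words)
  moreover have "enc g j \<in> carrier (braid_algebra s)" for j by (auto simp: enc_def split: prod.split)
  moreover have "enc g j = \<zero>\<^bsub>braid_algebra s\<^esub>" if "j \<notin> idx n" for j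
    by (rule z) (use that keys in \<open>auto simp: idx_def\<close>)
  ultimately show ?thesis by simp
qed

text \<open>\<open>Abs_poly_mapping\<close> has the intended values only for finite supports, which
  membership in the free module guarantees.\<close>

lemma lookup_dec:
  assumes x: "x \<in> carrier (freemod n)"
  shows "Poly_Mapping.lookup (dec x u) b = rep s (x (b, {}, to_nat u))"
proof -
  have "{b. rep s (x (b, {}, to_nat u)) \<noteq> 0} \<subseteq> fst ` {j. x j \<noteq> \<zero>\<^bsub>braid_algebra s\<^esub>}"
  proof
    fix b assume "b \<in> {b. rep s (x (b, {}, to_nat u)) \<noteq> 0}"
    then have "x (b, {}, to_nat u) \<noteq> \<zero>\<^bsub>braid_algebra s\<^esub>" by auto
    then show "b \<in> fst ` {j. x j \<noteq> \<zero>\<^bsub>braid_algebra s\<^esub>}"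
      by (intro image_eqI [of _ _ "(b, {}, to_nat u)"]) auto
  qed
  then have "finite {b. rep s (x (b, {}, to_nat u)) \<noteq> 0}" by (rule finite_subset) (use x in simp)
  then show ?thesis by (simp add: dec_def)
qed

lemma dec_enc:
  assumes g: "g \<in> chains n" shows "dec (enc g) = g"
proof
  fix u
  have "tsym s (Poly_Mapping.lookup (g u) b) = Poly_Mapping.lookup (g u) b" for b
    using chainsD(3) [OF g] by (simp add: sym_coeffs_def)
  then have "Poly_Mapping.lookup (dec (enc g) u) b = Poly_Mapping.lookup (g u) b" for b
    by (simp only: lookup_dec [OF enc_closed [OF g]]) (simp add: enc_def)
  then show "dec (enc g) u = g u" by (rule poly_mapping_eqI)
qed

lemma freemod_coord: "x \<in> carrier (freemod n) \<Longrightarrow> x j \<in> carrier (braid_algebra s)"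
  unfolding free_module_simps by blast

lemma dec_S:
  assumes x: "x \<in> carrier (freemod n)" shows "dec x u \<in> sym_coeffs"
proof -
  have "b \<in> B" if "b \<in> Poly_Mapping.keys (dec x u)" for b
  proof -
    have "rep s (x (b, {}, to_nat u)) \<noteq> 0" using that by (simp add: in_keys_iff lookup_dec [OF x])
    then have "x (b, {}, to_nat u) \<noteq> \<zero>\<^bsub>braid_algebra s\<^esub>" by auto
    then have "(b, {}, to_nat u) \<in> idx n" using x by auto
    then show ?thesis by (simp add: idx_def)
  qed
  moreover have "x j \<in> carrier (braid_algebra s)" for j by (rule freemod_coord [OF x])
  ultimately show ?thesis by (auto simp: sym_coeffs_def lookup_dec [OF x] tsym_rep)
qed

lemma dec_add:
  assumes x: "x \<in> carrier (freemod n)" and y: "y \<in> carrier (freemod n)"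
  shows "dec (\<lambda>j. x j \<oplus>\<^bsub>braid_algebra s\<^esub> y j) = (\<lambda>u. dec x u + dec y u)"
proof -
  have xy: "(\<lambda>j. x j \<oplus>\<^bsub>braid_algebra s\<^esub> y j) \<in> carrier (freemod n)"
    using abelian_groupE(1) [OF left_module.axioms(2) [OF left_module_free [OF A.ring_axioms, of "idx n"]] x y] by simp
  have c: "x j \<in> carrier (braid_algebra s)" "y j \<in> carrier (braid_algebra s)" for j by (rule freemod_coord [OF x], rule freemod_coord [OF y])
  show ?thesis
    by (intro ext poly_mapping_eqI) (simp only: lookup_dec [OF xy] lookup_dec [OF x] lookup_dec [OF y] lookup_add rep_add [OF c])
qed

lemma dec_lact:
  assumes x: "x \<in> carrier (freemod n)" and a: "a \<in> carrier (braid_algebra s)"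
  shows "dec (\<lambda>j. a \<otimes>\<^bsub>braid_algebra s\<^esub> x j) = lact a (dec x)"
proof -
  have ax: "(\<lambda>j. a \<otimes>\<^bsub>braid_algebra s\<^esub> x j) \<in> carrier (freemod n)"
    using left_module.smult_closed [OF left_module_free [OF A.ring_axioms, of "idx n"] a x] by simp
  have c: "x j \<in> carrier (braid_algebra s)" for j by (rule freemod_coord [OF x])
  show ?thesis
    by (intro ext poly_mapping_eqI) (simp only: lookup_dec [OF ax] lookup_dec [OF x] lact_def lookup_lact rep_mult [OF a c])
qed

lemma proj_chains:
  assumes "\<And>u. g u \<in> sym_coeffs" shows "proj n g \<in> chains n"
proof -
  interpret N: braiding "neg_braid s" by (rule braiding_neg)
  have "symt (neg_braid s) n (proj n g) \<longleftrightarrow> symt (neg_braid s) n (symz (neg_braid s) n g)"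
    by (rule symt_cong) (simp add: proj_def)
  then have "symt (neg_braid s) n (proj n g)" using N.symt_symz by simp
  moreover have "proj n g u \<in> sym_coeffs" for u
    using assms symz_expand [of u n "neg_braid s" g] by (auto simp: proj_def intro!: S_sum S_scale)
  ultimately show ?thesis by (simp add: chains_def proj_def)
qed

lemma proj_fix:
  assumes g: "g \<in> chains n" shows "proj n g = g"
proof -
  show ?thesis using symz_symt [OF chainsD(2) [OF g]] chainsD(1) [OF g] by (auto simp: proj_def)
qed

lemma proj_add: "proj n (\<lambda>u. g u + h u) = (\<lambda>u. proj n g u + proj n h u)"
  by (auto simp: proj_def symz_add)

lemma proj_lact: "proj n (lact a g) = lact a (proj n g)"
proof -
  note lin = pmap_linear [OF lin_lact]
  show ?thesis
    by (rule ext) (auto simp: proj_def lact_def [abs_def] symz_linear [OF lin] cvec_linear.zero [OF lin])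
qed

lemma left_module_resmod: "left_module (braid_algebra s) (resmod n)"
proof -
  interpret F: left_module "braid_algebra s" "freemod n" by (rule left_module_free [OF A.ring_axioms])
  show ?thesis
    unfolding resmod_def
  proof (rule F.submodule_left_module)
    show "enc ` chains n \<subseteq> carrier (freemod n)" using enc_closed by blast
    have "(\<lambda>_. 0) \<in> chains n" by (simp add: chains_def)
    then show "\<zero>\<^bsub>freemod n\<^esub> \<in> enc ` chains n" by (simp add: enc_zero)
    fix x y assume "x \<in> enc ` chains n" "y \<in> enc ` chains n"
    then show "x \<oplus>\<^bsub>freemod n\<^esub> y \<in> enc ` chains n" by (auto simp: enc_add chains_add)
  next
    fix a x assume "a \<in> carrier (braid_algebra s)" "x \<in> enc ` chains n"
    then show "a \<odot>\<^bsub>freemod n\<^esub> x \<in> enc ` chains n" by (auto simp: enc_lact lact_chains)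
  qed
qed

lemma projective_resmod: "projective_module (braid_algebra s) (resmod n)"
proof (rule projective_retract [OF A.ring_axioms cls_one_neq_zero left_module_resmod])
  show "(\<lambda>x. x) \<in> linear_maps (braid_algebra s) (resmod n) (freemod n)"
    by (rule linear_mapsI) (use enc_closed in auto)
  show "(\<lambda>x. enc (proj n (dec x))) \<in> linear_maps (braid_algebra s) (freemod n) (resmod n)"
  proof (rule linear_mapsI)
    fix x assume x: "x \<in> carrier (freemod n)"
    show "enc (proj n (dec x)) \<in> carrier (resmod n)" using proj_chains [OF dec_S [OF x]] by simp
    show "enc (proj n (dec (x \<oplus>\<^bsub>freemod n\<^esub> y))) = enc (proj n (dec x)) \<oplus>\<^bsub>resmod n\<^esub> enc (proj n (dec y))"
      if y: "y \<in> carrier (freemod n)" for y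
      by (simp only: free_module_simps resmod_simps dec_add [OF x y] proj_add enc_add)
    show "enc (proj n (dec (a \<odot>\<^bsub>freemod n\<^esub> x))) = a \<odot>\<^bsub>resmod n\<^esub> enc (proj n (dec x))"
      if a: "a \<in> carrier (braid_algebra s)" for a
      by (simp only: free_module_simps resmod_simps dec_lact [OF x a] proj_lact enc_lact [OF a])
  qed
  show "enc (proj n (dec x)) = x" if "x \<in> carrier (resmod n)" for x
    using that by (auto simp: dec_enc proj_fix)
qed

text \<open>Left multiplication on the algebra factor commutes with right multiplication by a letter
  and with the action on M.\<close>

lemma bdry_lact: "bdry n (lact a g) = lact a (bdry n g)"
proof -
  note lin = pmap_linear [OF lin_lact]
  interpret L: cvec_linear "Poly_Mapping.map (\<lambda>t. tsym s (rep s a * t)) :: ('b \<Rightarrow>\<^sub>0 'i tensor) \<Rightarrow> _" by (rule lin)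
  have "rhow i (Poly_Mapping.map (\<lambda>t. tsym s (rep s a * t)) w) = Poly_Mapping.map (\<lambda>t. tsym s (rep s a * t)) (rhow i w)" for i w
    by (rule poly_mapping_eqI) (simp add: rhow_def lookup_lact lookup_pmap [OF lin_rhow] mult.assoc)
  then show ?thesis
    by (intro ext) (simp add: bdry_def dL_def dR_def lact_def lam_pmap [OF lin_lact] L.sum L.add L.diff L.scale)
qed

lemma resdiff_enc: "g \<in> chains (Suc n) \<Longrightarrow> resdiff n (enc g) = enc (bdry n g)"
  by (simp add: resdiff_def dec_enc)

lemma resdiff_linear: "resdiff n \<in> linear_maps (braid_algebra s) (resmod (Suc n)) (resmod n)"
proof (rule linear_mapsI)
  fix x assume x: "x \<in> carrier (resmod (Suc n))"
  then obtain g where g: "g \<in> chains (Suc n)" "x = enc g" by auto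
  show "resdiff n x \<in> carrier (resmod n)" using g by (simp add: resdiff_enc bdry_chains)
  show "resdiff n (x \<oplus>\<^bsub>resmod (Suc n)\<^esub> y) = resdiff n x \<oplus>\<^bsub>resmod n\<^esub> resdiff n y" if y: "y \<in> carrier (resmod (Suc n))" for y
  proof -
    obtain h where h: "h \<in> chains (Suc n)" "y = enc h" using y by auto
    have "bdry n (\<lambda>u. g u + h u) = (\<lambda>u. bdry n g u + bdry n h u)" by (rule ext) (rule bdry_add)
    then show ?thesis
      unfolding resmod_simps g(2) h(2) enc_add resdiff_enc [OF g(1)] resdiff_enc [OF h(1)] resdiff_enc [OF chains_add [OF g(1) h(1)]]
      by simp
  qed
  show "resdiff n (a \<odot>\<^bsub>resmod (Suc n)\<^esub> x) = a \<odot>\<^bsub>resmod n\<^esub> resdiff n x" if a: "a \<in> carrier (braid_algebra s)" for a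
    unfolding resmod_simps g(2) enc_lact [OF a] resdiff_enc [OF g(1)] resdiff_enc [OF lact_chains [OF g(1)]] by (simp add: bdry_lact)
qed

lemma enc_eq_zero: "g \<in> chains n \<Longrightarrow> enc g = (\<lambda>_. \<zero>\<^bsub>braid_algebra s\<^esub>) \<longleftrightarrow> g = (\<lambda>_. 0)"
proof
  assume g: "g \<in> chains n" and "enc g = (\<lambda>_. \<zero>\<^bsub>braid_algebra s\<^esub>)"
  then have "dec (enc g) = dec (enc (\<lambda>_. 0))" by (simp add: enc_zero)
  moreover have "(\<lambda>_. 0) \<in> chains n" by (simp add: chains_def)
  ultimately show "g = (\<lambda>_. 0)" using dec_enc g by metis
qed (simp add: enc_zero)

text \<open>The antisymmetric tensors of degree n form a space of dimension N choose n, which is 0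
  for n above N.\<close>

lemma resmod_vanish:
  assumes "n > CARD('i)" shows "carrier (resmod n) = {\<zero>\<^bsub>resmod n\<^esub>}"
proof -
  interpret N: braiding "neg_braid s" by (rule braiding_neg)
  have "symz_trace (neg_braid s) n = of_nat (CARD('i) choose n)"
    by (rule N.symz_trace_minus) (simp add: neg_braid_def sum_negf ptrace)
  then have tr: "symz_trace (neg_braid s) n = 0" using assms by simp
  have "g = (\<lambda>_. 0)" if g: "g \<in> chains n" for g
  proof
    show "g u = 0" for u using N.symt_trace_0 [OF tr chainsD(2) [OF g]] chainsD(1) [OF g] by (cases "length u = n") auto
  qed
  moreover have "(\<lambda>_. 0) \<in> chains n" by (simp add: chains_def)
  ultimately have "chains n = {\<lambda>_. 0}" by blast
  then show ?thesis by (simp add: enc_zero)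
qed

lemma resdiff_exact:
  "resdiff (Suc n) ` carrier (resmod (Suc (Suc n))) = a_kernel (resmod (Suc n)) (resmod n) (resdiff n)"
proof
  show "resdiff (Suc n) ` carrier (resmod (Suc (Suc n))) \<subseteq> a_kernel (resmod (Suc n)) (resmod n) (resdiff n)"
  proof
    fix x assume "x \<in> resdiff (Suc n) ` carrier (resmod (Suc (Suc n)))"
    then obtain g where g: "g \<in> chains (Suc (Suc n))" "x = enc (bdry (Suc n) g)" by (auto simp: resdiff_enc)
    have b: "bdry (Suc n) g \<in> chains (Suc n)" by (rule bdry_chains [OF g(1)])
    have "bdry n (bdry (Suc n) g) = (\<lambda>_. 0)" by (rule ext) (rule bdry_bdry [OF g(1)])
    then show "x \<in> a_kernel (resmod (Suc n)) (resmod n) (resdiff n)"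
      using b by (simp add: a_kernel_def' g(2) resdiff_enc [OF b] enc_zero)
  qed
  show "a_kernel (resmod (Suc n)) (resmod n) (resdiff n) \<subseteq> resdiff (Suc n) ` carrier (resmod (Suc (Suc n)))"
  proof
    fix x assume "x \<in> a_kernel (resmod (Suc n)) (resmod n) (resdiff n)"
    then obtain g where g: "g \<in> chains (Suc n)" "x = enc g" "enc (bdry n g) = (\<lambda>_. \<zero>\<^bsub>braid_algebra s\<^esub>)"
      by (auto simp: a_kernel_def' resdiff_enc)
    then have "bdry n g = (\<lambda>_. 0)" using enc_eq_zero [OF bdry_chains [OF g(1)]] by simp
    then have "bdry n g u = 0" for u by simp
    from bdry_exact [OF g(1) this] obtain w where "w \<in> chains (Suc (Suc n))" "bdry (Suc n) w = g" by blast
    then show "x \<in> resdiff (Suc n) ` carrier (resmod (Suc (Suc n)))"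
      using g(2) by (auto simp: resdiff_enc intro!: image_eqI [of _ _ "enc w"])
  qed
qed

end

context based_module
begin

definition aug where "aug x = ev (dec x [])"

lemma aug_linear: "aug \<in> linear_maps (braid_algebra s) (resmod 0) M"
proof (rule linear_mapsI)
  fix x assume x: "x \<in> carrier (resmod 0)"
  then obtain g where g: "g \<in> chains 0" "x = enc g" by auto
  note k = keys_carrier [OF chains_keys [OF g(1)]]
  show "aug x \<in> carrier M" using k by (simp add: aug_def g dec_enc [OF g(1)])
  show "aug (x \<oplus>\<^bsub>resmod 0\<^esub> y) = aug x \<oplus>\<^bsub>M\<^esub> aug y" if y: "y \<in> carrier (resmod 0)" for y
  proof -
    obtain h where h: "h \<in> chains 0" "y = enc h" using y by auto
    show ?thesis
      unfolding aug_def resmod_simps g(2) h(2) enc_add dec_enc [OF g(1)] dec_enc [OF h(1)] dec_enc [OF chains_add [OF g(1) h(1)]]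
      by (rule ev_add [OF k keys_carrier [OF chains_keys [OF h(1)]]])
  qed
  show "aug (a \<odot>\<^bsub>resmod 0\<^esub> x) = scal a (aug x)" if a: "a \<in> carrier (braid_algebra s)" for a
    unfolding aug_def resmod_simps g(2) enc_lact [OF a] dec_enc [OF g(1)] dec_enc [OF lact_chains [OF g(1)]]
    using ev_mult [OF k, of "rep s a"] ev_tsym [OF k, of "\<lambda>t. rep s a * t"] a by (simp add: lact_def)
qed

lemma resolution: "projective_resolution (braid_algebra s) resmod resdiff aug M"
  unfolding projective_resolution_def
proof (intro conjI allI projective_resmod resdiff_linear aug_linear resdiff_exact)
  have aug_enc: "aug (enc g) = ev (g [])" if "g \<in> chains 0" for g using that by (simp add: aug_def dec_enc)
  show "aug ` carrier (resmod 0) = carrier M"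
  proof
    show "aug ` carrier (resmod 0) \<subseteq> carrier M" using linear_mapsD(1) [OF aug_linear] by blast
    show "carrier M \<subseteq> aug ` carrier (resmod 0)"
    proof
      fix m assume "m \<in> carrier M"
      then obtain z where z: "z \<in> chains 0" "ev (z []) = m" by (rule aug_surj)
      then show "m \<in> aug ` carrier (resmod 0)" by (auto simp: aug_enc intro!: image_eqI [of _ _ "enc z"])
    qed
  qed
  show "resdiff 0 ` carrier (resmod 1) = a_kernel (resmod 0) M aug"
  proof
    show "resdiff 0 ` carrier (resmod 1) \<subseteq> a_kernel (resmod 0) M aug"
    proof
      fix x assume "x \<in> resdiff 0 ` carrier (resmod 1)"
      then obtain g where g: "g \<in> chains 1" "x = enc (bdry 0 g)" by (auto simp: resdiff_enc)
      have b: "bdry 0 g \<in> chains 0" using bdry_chains [of g 0] g(1) by simp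
      then show "x \<in> a_kernel (resmod 0) M aug" using ev_bdry [OF g(1)] by (simp add: a_kernel_def' g(2) aug_enc)
    qed
    show "a_kernel (resmod 0) M aug \<subseteq> resdiff 0 ` carrier (resmod 1)"
    proof
      fix x assume "x \<in> a_kernel (resmod 0) M aug"
      then obtain z where z: "z \<in> chains 0" "x = enc z" "ev (z []) = \<zero>\<^bsub>M\<^esub>" by (auto simp: a_kernel_def' aug_enc)
      obtain w where "w \<in> chains 1" "bdry 0 w = z" by (rule exact_aug [OF z(1,3)])
      then show "x \<in> resdiff 0 ` carrier (resmod 1)"
        using z(2) by (auto simp: resdiff_enc intro!: image_eqI [of _ _ "enc w"])
    qed
  qed
qed

end

lemma (in normalized_braiding) projective_dimension_le:
  assumes "left_module (braid_algebra s) M"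
  shows "projective_dimension (braid_algebra s) M \<le> enat (CARD('i))"
proof -
  interpret M: braid_module s M by (intro braid_module.intro assms) unfold_locales
  obtain B where B: "M.vbasis B" using M.exists_vbasis by blast
  interpret based_module s M B by (intro based_module.intro based_module_axioms.intro B) unfold_locales
  show ?thesis
    unfolding projective_dimension_def
    by (rule Inf_lower) (use resolution resmod_vanish in blast)
qed

section \<open>Extensions of the trivial module by the algebra\<close>

lemma transp_neg_braid: "transp_braid (neg_braid s) = neg_braid (transp_braid s)"
  by (simp add: transp_braid_def neg_braid_def)

lemma transp_neg_transp_braid: "transp_braid (neg_braid (transp_braid s)) = neg_braid s"
  by (simp add: transp_braid_def neg_braid_def)

interpretation tensor_pairing: pairing "\<lambda>x y :: 'i tensor. x * y"
  by standard (simp_all add: distrib_left distrib_right cscale_mult_left cscale_mult_right)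

interpretation tensor_pairing_rev: pairing "\<lambda>x y :: 'i tensor. y * x"
  by standard (simp_all add: distrib_left distrib_right cscale_mult_left cscale_mult_right)

lemma lookup_linear: "cvec_linear (\<lambda>w :: 'b \<Rightarrow>\<^sub>0 'w::cvec. Poly_Mapping.lookup w b)"
  by (rule cvec_linearI) (simp_all add: lookup_add lookup_cscale)

lemma lookup_tsym_Nil [simp]: "Poly_Mapping.lookup (tsym s t) [] = Poly_Mapping.lookup t []"
  by (simp add: tsym.rep_eq)

lemma lookup_mult_Nil: "Poly_Mapping.lookup (p * q) [] = Poly_Mapping.lookup p [] * Poly_Mapping.lookup q []"
  for p q :: "'i tensor"
proof (induction p rule: tensor_induct)
  case (word w)
  show ?case
  proof (cases w)
    case Nil
    then show ?thesis using lookup_word_mult [of "[]" q "[]"] by (simp add: lookup_word)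
  next
    case (Cons i v)
    then show ?thesis by (simp add: lookup_word lookup_word_mult_0)
  qed
qed (simp_all add: distrib_right lookup_add cscale_mult_left lookup_cscale cscale_complex_def)

lemma (in braiding) tsym_one [simp]: "tsym s 1 = (1 :: 'i tensor)"
  using tsym_1 [of 1] by (simp add: tensor_const_def flip: zero_list_def)

lemma (in braiding) delta_cochains:
  assumes "f \<in> cochains n" shows "delta f \<in> cochains (Suc n)"
proof -
  interpret T: braiding "transp_braid s" by (rule braiding_transp)
  interpret N: braiding "neg_braid (transp_braid s)" by (rule T.braiding_neg)
  let ?F = "\<lambda>v. case v of [] \<Rightarrow> 0 | i # v \<Rightarrow> tsym s (letter i * f v)"
  have lin: "cvec_linear (\<lambda>t. tsym s (letter i * t))" for i
    by (rule cvec_linearI) (simp_all add: distrib_left tsym.add tsym.scale cscale_mult_right)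
  have "symt (neg_braid (transp_braid s)) (Suc n) (delta f)"
    unfolding delta_def
    by (rule N.symt_ins) (simp add: symt_linear [OF lin cochainsD(2) [OF assms]])
  moreover have "delta f u = 0" if "length u \<noteq> Suc n" for u
  proof -
    have "?F v = 0" if "length v = length u" for v
      using that \<open>length u \<noteq> Suc n\<close> cochainsD(1) [OF assms] by (cases v) auto
    then have "delta f u = ins (neg_braid (transp_braid s)) (\<lambda>v. 0 :: 'i tensor) u"
      unfolding delta_def by (rule ins_cong)
    also have "\<dots> = 0"
      using ins_scale [of "neg_braid (transp_braid s)" 0 "\<lambda>v. 0 :: 'i tensor" u] by simp
    finally show ?thesis .
  qed
  moreover have "tsym s (delta f u) = delta f u" for u
  proof -
    have "(\<lambda>v. tsym s (?F v)) = ?F" by (auto simp: fun_eq_iff split: list.split)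
    then show ?thesis by (simp add: delta_def ins_linear [OF tsym.cvec_linear_axioms])
  qed
  ultimately show ?thesis by (simp add: cochains_def)
qed

text \<open>A product with a letter has no constant term. This is why the constants in top degree
  survive in cohomology.\<close>

lemma (in braiding) lookup_delta_Nil: "Poly_Mapping.lookup (delta f u) [] = 0"
proof -
  have "Poly_Mapping.lookup (delta f u) [] = ins (neg_braid (transp_braid s)) (\<lambda>v. Poly_Mapping.lookup
      (case v of [] \<Rightarrow> 0 | i # v \<Rightarrow> tsym s (letter i * f v)) []) u"
    unfolding delta_def by (rule ins_linear [OF lookup_linear])
  also have "\<dots> = ins (neg_braid (transp_braid s)) (\<lambda>v. 0 :: complex) u"
    by (rule ins_cong) (auto simp: lookup_letter_mult split: list.split)
  also have "\<dots> = 0"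
    using ins_scale [of "neg_braid (transp_braid s)" 0 "\<lambda>v. 0 :: complex" u] by simp
  finally show ?thesis .
qed

context braiding
begin

text \<open>Elements of the ideal have no constant term, so all tensors in a class have the same one
  and the image in the definition of the trivial module is a singleton.\<close>

lemma aug_the_elem:
  assumes "a \<in> carrier (braid_algebra s)"
  shows "the_elem ((\<lambda>t. Poly_Mapping.lookup t []) ` a) = Poly_Mapping.lookup (rep s a) []"
proof -
  obtain t where t: "a = cls s t" using assms by (auto simp: carrier_cls)
  have "a = (\<lambda>x. x + t) ` braid_ideal s"
    unfolding t quadratic_class_def quadratic_ideal_braid by (auto simp: a_r_coset_def r_coset_def)
  moreover have "Poly_Mapping.lookup x [] = 0" if "x \<in> braid_ideal s" for x
    using lookup_tsym_Nil [of s x] that by (simp add: tsym_eq_0 del: lookup_tsym_Nil)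
  ultimately have "(\<lambda>t. Poly_Mapping.lookup t []) ` a = {Poly_Mapping.lookup t []}"
    using braid_ideal_0 [of s] by (auto simp: image_image lookup_add intro!: image_eqI [of _ _ 0])
  then show ?thesis by (simp add: t)
qed

abbreviation triv :: "('i tensor set, complex) module" where "triv \<equiv> trivial_module (braid_space s)"

lemma triv_simps [simp]:
  "carrier triv = UNIV" "x \<oplus>\<^bsub>triv\<^esub> y = x + y" "\<zero>\<^bsub>triv\<^esub> = 0"
  "a \<in> carrier (braid_algebra s) \<Longrightarrow> a \<odot>\<^bsub>triv\<^esub> x = Poly_Mapping.lookup (rep s a) [] * x"
  by (simp_all add: trivial_module_def aug_the_elem)

lemma left_module_triv: "left_module (braid_algebra s) triv"
proof (intro left_module.intro left_module_axioms.intro A.ring_axioms)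
  show "abelian_group triv"
  proof (rule abelian_groupI; simp)
    show "\<exists>y. y + x = 0" for x :: complex by (rule exI [of _ "- x"]) simp
  qed
  have "Poly_Mapping.lookup (1 :: 'i tensor) [] = 1" by (simp add: lookup_one zero_list_def)
  then show "\<one>\<^bsub>braid_algebra s\<^esub> \<odot>\<^bsub>triv\<^esub> x = x" for x by (simp add: cls_one)
qed (simp_all add: rep_add rep_mult lookup_add lookup_mult_Nil algebra_simps)

end

text \<open>A one-dimensional module on which all generators act by 0. Then \<open>bdry\<close> is
  \<open>dL\<close>, so the complex is the Koszul complex itself. The label b0 has an arbitrary
  type, so that copies of the trivial module in other types are covered.\<close>

locale trivial_coeffs = coeff_module s "{b0}" "\<lambda>_ _. 0" for s :: "'i::finite braid" and b0 :: 'b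
begin

lemma lam_0: "lam i w = 0"
  by (rule poly_mapping_eqI) (simp add: lookup_lam [OF finite_keys subset_refl])

lemma bdry_dL: "bdry n g = dL g"
  by (rule ext) (simp add: bdry_def dR_def lam_0)

text \<open>Evaluation of a cochain at a chain; the coefficients of the chain stand on the left,
  which makes it linear over the algebra.\<close>

definition pr :: "nat \<Rightarrow> ('i list \<Rightarrow> 'b \<Rightarrow>\<^sub>0 'i tensor) \<Rightarrow> ('i list \<Rightarrow> 'i tensor) \<Rightarrow> 'i tensor" where
  "pr n g \<phi> = tsym s (\<Sum>w\<in>words n. Poly_Mapping.lookup (g w) b0 * \<phi> w)"

definition dlt :: "'i list \<Rightarrow> 'i list \<Rightarrow> 'b \<Rightarrow>\<^sub>0 'i tensor" where
  "dlt v u = (if u = v then Poly_Mapping.single b0 1 else 0)"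

lemma dlt_S: "dlt v u \<in> sym_coeffs"
  by (auto simp: dlt_def sym_coeffs_def lookup_single when_def)

lemma proj_dlt: "proj n (dlt v) \<in> chains n"
  by (rule proj_chains) (rule dlt_S)

lemma tsym_pr [simp]: "tsym s (pr n g \<phi>) = pr n g \<phi>"
  by (simp add: pr_def)

lemma pr_cong: "(\<And>v. length v = n \<Longrightarrow> \<phi> v = \<psi> v) \<Longrightarrow> pr n g \<phi> = pr n g \<psi>"
  unfolding pr_def by (intro arg_cong [where f = "tsym s"] sum.cong) (auto simp: mem_words)

lemma pr_proj_dlt:
  assumes \<phi>: "\<phi> \<in> cochains n" and v: "length v = n"
  shows "pr n (proj n (dlt v)) \<phi> = \<phi> v"
proof -
  have "(\<Sum>w\<in>words n. Poly_Mapping.lookup (proj n (dlt v) w) b0 * \<phi> w) =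
      (\<Sum>w\<in>words n. symz (neg_braid s) n (\<lambda>w. Poly_Mapping.lookup (dlt v w) b0) w * \<phi> w)"
    by (rule sum.cong) (auto simp: proj_def mem_words symz_linear [OF lookup_linear])
  also have "\<dots> = (\<Sum>w\<in>words n. Poly_Mapping.lookup (dlt v w) b0 * \<phi> w)"
    by (rule tensor_pairing.pair_symz) (simp add: transp_neg_braid cochainsD(2) [OF \<phi>])
  also have "\<dots> = (\<Sum>w\<in>words n. if w = v then \<phi> w else 0)"
    by (rule sum.cong) (auto simp: dlt_def)
  also have "\<dots> = \<phi> v" using v by (simp add: mem_words finite_words)
  finally show ?thesis using cochainsD(3) [OF \<phi>] by (simp add: pr_def)
qed

lemma symt_coeff: "g \<in> chains n \<Longrightarrow> symt (neg_braid s) n (\<lambda>v. Poly_Mapping.lookup (g v) b0)"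
  by (rule symt_linear [OF lookup_linear chainsD(2)])

text \<open>The n + 1 insertions in \<open>delta\<close> all pair with the antisymmetric g in the
  same way; what remains is the adjointness of left and right multiplication by a letter.\<close>

lemma pr_delta:
  assumes g: "g \<in> chains (Suc n)"
  shows "pr (Suc n) g (delta \<phi>) = of_nat (Suc n) *\<^sub>C pr n (dL g) \<phi>"
proof -
  let ?G = "\<lambda>v. Poly_Mapping.lookup (g v) b0"
  let ?\<psi> = "\<lambda>v. case v of [] \<Rightarrow> 0 | i # v \<Rightarrow> tsym s (letter i * \<phi> v)"
  have "(\<Sum>w\<in>words (Suc n). ?G w * delta \<phi> w) = of_nat (Suc n) *\<^sub>C (\<Sum>w\<in>words (Suc n). ?G w * ?\<psi> w)"
    unfolding delta_def
    by (rule tensor_pairing_rev.pair_ins) (simp only: transp_neg_transp_braid symt_coeff [OF g])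
  moreover have "tsym s (\<Sum>w\<in>words (Suc n). ?G w * ?\<psi> w) = pr n (dL g) \<phi>"
  proof -
    have "tsym s (\<Sum>w\<in>words (Suc n). ?G w * ?\<psi> w) =
        (\<Sum>i\<in>UNIV. \<Sum>w\<in>words n. tsym s (?G (i # w) * (letter i * \<phi> w)))"
      by (simp add: sum_words_Suc tsym.sum)
    also have "\<dots> = (\<Sum>w\<in>words n. \<Sum>i\<in>UNIV. tsym s (tsym s (?G (i # w) * letter i) * \<phi> w))"
      by (subst sum.swap) (simp add: mult.assoc)
    also have "\<dots> = pr n (dL g) \<phi>"
      unfolding pr_def dL_def rhow_def
      by (simp add: lookup_sum lookup_pmap [OF lin_rhow] tsym.sum sum_distrib_right)
    finally show ?thesis .
  qed
  ultimately show ?thesis unfolding pr_def by (simp add: tsym.scale del: of_nat_Suc)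
qed

lemma pr_add: "pr n (\<lambda>u. g u + h u) \<phi> = pr n g \<phi> + pr n h \<phi>"
  by (simp add: pr_def lookup_add distrib_right sum.distrib tsym.add)

lemma pr_lact: "pr n (lact a g) \<phi> = tsym s (rep s a * pr n g \<phi>)"
  by (simp add: pr_def lact_def lookup_lact tsym.sum sum_distrib_left mult.assoc)

lemma pr_scale: "pr n g (\<lambda>v. c *\<^sub>C \<phi> v) = c *\<^sub>C pr n g \<phi>"
  by (simp add: pr_def cscale_mult_right tsym.scale flip: cscale_sum_right)

definition fnl :: "nat \<Rightarrow> ('i list \<Rightarrow> 'i tensor) \<Rightarrow> ('i tensor set, 'b) resolution_elem \<Rightarrow> 'i tensor set" where
  "fnl n \<phi> = (\<lambda>x\<in>carrier (resmod n). cls s (pr n (dec x) \<phi>))"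

lemma fnl_enc: "g \<in> chains n \<Longrightarrow> fnl n \<phi> (enc g) = cls s (pr n g \<phi>)"
  by (simp add: fnl_def dec_enc)

lemma fnl_dual: "fnl n \<phi> \<in> carrier (dual_module (braid_algebra s) (resmod n))"
  unfolding fnl_def
proof (rule dualI [OF _ _ _ left_module_resmod])
  fix x assume x: "x \<in> carrier (resmod n)"
  then obtain g where g: "g \<in> chains n" "x = enc g" by auto
  show "cls s (pr n (dec x) \<phi>) \<in> carrier (braid_algebra s)" by simp
  show "cls s (pr n (dec (x \<oplus>\<^bsub>resmod n\<^esub> y)) \<phi>) = cls s (pr n (dec x) \<phi>) \<oplus>\<^bsub>braid_algebra s\<^esub> cls s (pr n (dec y) \<phi>)"
    if y: "y \<in> carrier (resmod n)" for y
  proof -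
    obtain h where h: "h \<in> chains n" "y = enc h" using y by auto
    show ?thesis
      unfolding resmod_simps g(2) h(2) enc_add dec_enc [OF g(1)] dec_enc [OF h(1)] dec_enc [OF chains_add [OF g(1) h(1)]]
      by (simp add: pr_add cls_add)
  qed
  show "cls s (pr n (dec (a \<odot>\<^bsub>resmod n\<^esub> x)) \<phi>) = a \<otimes>\<^bsub>braid_algebra s\<^esub> cls s (pr n (dec x) \<phi>)"
    if a: "a \<in> carrier (braid_algebra s)" for a
    unfolding resmod_simps g(2) enc_lact [OF a] dec_enc [OF g(1)] dec_enc [OF lact_chains [OF g(1)]]
    using cls_mult [of "rep s a" "pr n g \<phi>"] a by (simp add: pr_lact)
qed

lemma dual_sum:
  assumes f: "f \<in> carrier (dual_module (braid_algebra s) (resmod n))"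
    and h: "\<And>w. h w \<in> chains n" and a: "\<And>w. a w \<in> carrier (braid_algebra s)" and "finite Y"
  shows "(\<lambda>u. \<Sum>w\<in>Y. lact (a w) (h w) u) \<in> chains n \<and>
    f (enc (\<lambda>u. \<Sum>w\<in>Y. lact (a w) (h w) u)) = cls s (\<Sum>w\<in>Y. rep s (a w) * rep s (f (enc (h w))))"
  using \<open>finite Y\<close>
proof (induction Y rule: finite_induct)
  case empty
  have z: "(\<lambda>_. 0) \<in> chains n" by (simp add: chains_def)
  then show ?case using dual_zero [OF left_module_resmod f] by (simp add: enc_zero flip: cls_zero)
next
  case (insert w Y)
  note fD = dualD [OF f]
  let ?h = "\<lambda>u. \<Sum>w\<in>Y. lact (a w) (h w) u"
  have c: "lact (a w) (h w) \<in> chains n" "?h \<in> chains n" using insert lact_chains [OF h] by auto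
  have eh: "enc (h w) \<in> carrier (resmod n)" using h by simp
  have eq: "(\<lambda>u. \<Sum>w\<in>insert w Y. lact (a w) (h w) u) = (\<lambda>u. lact (a w) (h w) u + ?h u)" using insert by simp
  have "f (enc (\<lambda>u. lact (a w) (h w) u + ?h u)) = f (enc (lact (a w) (h w))) \<oplus>\<^bsub>braid_algebra s\<^esub> f (enc ?h)"
    using fD(2) [of "enc (lact (a w) (h w))" "enc ?h"] c by (simp add: enc_add)
  also have "f (enc (lact (a w) (h w))) = a w \<otimes>\<^bsub>braid_algebra s\<^esub> f (enc (h w))"
    using fD(3) [OF a eh, of w] by (simp add: enc_lact [OF a])
  also have "\<dots> = cls s (rep s (a w) * rep s (f (enc (h w))))"
    using cls_mult [of "rep s (a w)" "rep s (f (enc (h w)))"] a fD(1) [OF eh] by simp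
  also have "\<dots> \<oplus>\<^bsub>braid_algebra s\<^esub> f (enc ?h) = cls s (\<Sum>w\<in>insert w Y. rep s (a w) * rep s (f (enc (h w))))"
    using insert by (simp add: cls_add)
  finally show ?case using eq chains_add [OF c] by simp
qed

text \<open>The values of f at the projected unit chains determine f. They are antisymmetrized to
  obtain a cochain, which pairing with an antisymmetric chain does not notice.\<close>

lemma dual_cochain:
  assumes f: "f \<in> carrier (dual_module (braid_algebra s) (resmod n))"
  obtains \<phi> where "\<phi> \<in> cochains n" "f = fnl n \<phi>"
proof -
  interpret T: braiding "transp_braid s" by (rule braiding_transp)
  interpret N: braiding "neg_braid (transp_braid s)" by (rule T.braiding_neg)
  define \<phi>0 where "\<phi>0 w = rep s (f (enc (proj n (dlt w))))" for w
  define \<phi> where "\<phi> w = (if length w = n then symz (neg_braid (transp_braid s)) n \<phi>0 w else 0)" for w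
  have t0: "tsym s (\<phi>0 w) = \<phi>0 w" for w
    unfolding \<phi>0_def by (rule tsym_rep, rule dualD(1) [OF f]) (use proj_dlt in auto)
  have "symt (neg_braid (transp_braid s)) n \<phi> \<longleftrightarrow> symt (neg_braid (transp_braid s)) n (symz (neg_braid (transp_braid s)) n \<phi>0)"
    by (rule symt_cong) (simp add: \<phi>_def)
  moreover have "tsym s (\<phi> w) = \<phi> w" for w
    by (simp add: \<phi>_def symz_linear [OF tsym.cvec_linear_axioms] t0)
  ultimately have \<phi>: "\<phi> \<in> cochains n" using N.symt_symz by (auto simp: cochains_def \<phi>_def)
  have "f = fnl n \<phi>"
  proof (rule dual_eqI [OF f fnl_dual])
    fix x assume "x \<in> carrier (resmod n)"
    then obtain g where g: "g \<in> chains n" "x = enc g" by auto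
    let ?G = "\<lambda>w. Poly_Mapping.lookup (g w) b0"
    have tG: "tsym s (?G w) = ?G w" for w using chainsD(3) [OF g(1)] by (simp add: sym_coeffs_def)
    have gs: "Poly_Mapping.single b0 (?G w) = g w" for w
      using chainsD(3) [OF g(1), of w]
      by (rule_tac poly_mapping_eqI) (auto simp: sym_coeffs_def lookup_single when_def in_keys_iff subset_iff)
    have ld: "lact (cls s (?G w)) (dlt w) u = (if u = w then g u else 0)" for u w
    proof -
      have "lact (cls s (?G w)) (dlt w) u = (if u = w then Poly_Mapping.single b0 (?G w) else 0)"
        by (rule poly_mapping_eqI) (auto simp: lact_def lookup_lact dlt_def lookup_single when_def tG)
      then show ?thesis using gs by simp
    qed
    \<comment> \<open>A chain is its own projection, and before projecting it is a combination of
      unit chains with coefficients in the algebra.\<close>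
    have "g = proj n g" by (rule proj_fix [OF g(1), symmetric])
    also have "\<dots> = proj n (\<lambda>u. \<Sum>w\<in>words n. lact (cls s (?G w)) (dlt w) u)"
      by (rule ext) (auto simp: proj_def ld mem_words finite_words intro!: symz_cong)
    also have "\<dots> = (\<lambda>u. \<Sum>w\<in>words n. lact (cls s (?G w)) (proj n (dlt w)) u)"
      by (rule ext) (simp add: proj_lact [symmetric] proj_def symz_sum)
    finally have ge: "g = (\<lambda>u. \<Sum>w\<in>words n. lact (cls s (?G w)) (proj n (dlt w)) u)" .
    have "f (enc g) = cls s (\<Sum>w\<in>words n. ?G w * \<phi>0 w)"
      using conjunct2 [OF dual_sum [OF f, of "\<lambda>w. proj n (dlt w)" "\<lambda>w. cls s (?G w)" "words n", OF proj_dlt cls_closed finite_words]]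
      unfolding ge [symmetric] by (simp add: tG \<phi>0_def)
    also have "(\<Sum>w\<in>words n. ?G w * \<phi>0 w) = (\<Sum>w\<in>words n. ?G w * symz (neg_braid (transp_braid s)) n \<phi>0 w)"
      by (rule tensor_pairing_rev.pair_symz [symmetric]) (simp only: transp_neg_transp_braid symt_coeff [OF g(1)])
    also have "\<dots> = (\<Sum>w\<in>words n. ?G w * \<phi> w)" by (rule sum.cong) (simp_all add: \<phi>_def mem_words)
    finally show "f x = fnl n \<phi> x" by (simp add: g fnl_enc pr_def)
  qed
  then show ?thesis using that \<phi> by blast
qed

abbreviation "cocyc \<equiv> dual_cocycles (braid_algebra s) resmod resdiff"
abbreviation "cobd \<equiv> dual_coboundaries (braid_algebra s) resmod resdiff"

lemma cocycle_cochain: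
  assumes z: "z \<in> cocyc n"
  obtains \<phi> where "\<phi> \<in> cochains n" "z = fnl n \<phi>" "\<And>u. delta \<phi> u = 0"
proof -
  obtain \<phi> where \<phi>: "\<phi> \<in> cochains n" "z = fnl n \<phi>" by (rule dual_cochain [OF dual_cocyclesD(1) [OF z]])
  note dc = delta_cochains [OF \<phi>(1)]
  have "delta \<phi> v = 0" for v
  proof (cases "length v = Suc n")
    case True
    let ?g = "proj (Suc n) (dlt v)"
    have g: "?g \<in> chains (Suc n)" by (rule proj_dlt)
    have "z (resdiff n (enc ?g)) = \<zero>\<^bsub>braid_algebra s\<^esub>"
      by (rule dual_cocyclesD(2) [OF z]) (use g in simp)
    then have "cls s (pr n (dL ?g) \<phi>) = cls s 0"
      by (simp add: resdiff_enc [OF g] \<phi>(2) fnl_enc [OF bdry_chains [OF g]] bdry_dL dL_chains [OF g] fnl_enc cls_zero)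
    then have "pr n (dL ?g) \<phi> = 0" by (simp only: cls_eq_iff tsym_pr) simp
    then have "pr (Suc n) ?g (delta \<phi>) = 0" using pr_delta [OF g, of \<phi>] by simp
    then show ?thesis using pr_proj_dlt [OF dc True] by simp
  qed (rule cochainsD(1) [OF dc])
  then show ?thesis using that \<phi> by blast
qed

lemma coboundary_delta:
  assumes "\<And>v. length v = Suc m \<Longrightarrow> \<phi> v = delta \<psi> v"
  shows "fnl (Suc m) \<phi> \<in> cobd (Suc m)"
proof -
  \<comment> \<open>The factor makes up for the sum over \<open>Suc m\<close> insertions in
    \<open>delta\<close>.\<close>
  let ?f = "fnl m (\<lambda>v. of_nat (Suc m) *\<^sub>C \<psi> v)"
  have "fnl (Suc m) \<phi> x = ?f (resdiff m x)" if x: "x \<in> carrier (resmod (Suc m))" for x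
  proof -
    obtain g where g: "g \<in> chains (Suc m)" "x = enc g" using x by auto
    show ?thesis
      using pr_cong [of "Suc m" \<phi> "delta \<psi>" g] assms pr_delta [OF g(1), of \<psi>]
      by (simp add: g(2) fnl_enc [OF g(1)] resdiff_enc [OF g(1)] bdry_dL fnl_enc [OF dL_chains [OF g(1)]] pr_scale
        del: of_nat_Suc)
  qed
  moreover have "fnl (Suc m) \<phi> x = undefined" if "x \<notin> carrier (resmod (Suc m))" for x
    using that by (simp add: fnl_def del: resmod_simps)
  ultimately have "fnl (Suc m) \<phi> = (\<lambda>x\<in>carrier (resmod (Suc m)). ?f (resdiff m x))"
    by (intro ext) (auto simp add: restrict_def simp del: resmod_simps of_nat_Suc)
  then show ?thesis unfolding dual_coboundaries_simps using fnl_dual by blast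
qed

text \<open>Below the number of generators the homotopy writes a cocycle as a coboundary, and above
  it 0 is the only cochain. In degree 0 the only coboundary is 0, and there the homotopy shows that
  the cocycle itself vanishes.\<close>

lemma Ext_vanishing:
  assumes "n \<noteq> CARD('i)" shows "cocyc n \<subseteq> cobd n"
proof
  fix z assume "z \<in> cocyc n"
  then obtain \<phi> where \<phi>: "\<phi> \<in> cochains n" "z = fnl n \<phi>" "\<And>u. delta \<phi> u = 0" by (rule cocycle_cochain) blast
  define \<psi> where "\<psi> = kap (\<lambda>v. twt (of_nat (CARD('i) - n)) (\<phi> v))"
  have eq: "delta \<psi> v = \<phi> v" if "n < CARD('i)" "length v = n" for v
    using cocycle_eq [OF \<phi>(1) _ \<phi>(3) that(2)] that(1) by (simp add: \<psi>_def)
  show "z \<in> cobd n"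
  proof (cases n)
    case 0
    have "\<phi> [] = 0" using eq [of "[]"] 0 by (simp add: delta_def)
    then have "z x = \<zero>\<^bsub>braid_algebra s\<^esub>" if "x \<in> carrier (resmod 0)" for x
      using that by (auto simp: \<phi>(2) 0 fnl_enc pr_def words_def cls_zero)
    moreover have "z x = undefined" if "x \<notin> carrier (resmod 0)" for x
      using that by (simp add: \<phi>(2) 0 fnl_def del: resmod_simps)
    ultimately have "z = (\<lambda>x\<in>carrier (resmod 0). \<zero>\<^bsub>braid_algebra s\<^esub>)"
      by (intro ext) (auto simp add: restrict_def simp del: resmod_simps)
    then show ?thesis by (simp add: 0 dual_coboundaries_simps)
  next
    case (Suc m)
    show ?thesis
    proof (cases "n < CARD('i)")
      case True
      show ?thesis unfolding \<phi>(2) Suc by (rule coboundary_delta [where \<psi> = \<psi>]) (use eq True Suc in auto)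
    next
      case False
      interpret T: braiding "transp_braid s" by (rule braiding_transp)
      interpret N: braiding "neg_braid (transp_braid s)" by (rule T.braiding_neg)
      have "symz_trace (neg_braid (transp_braid s)) n = of_nat (CARD('i) choose n)"
        by (rule N.symz_trace_minus) (auto simp: neg_braid_def transp_braid_def sum_negf ptrace)
      then have tr: "symz_trace (neg_braid (transp_braid s)) n = 0" using False assms by simp
      have "\<phi> v = delta (\<lambda>_. 0) v" if "length v = Suc m" for v
      proof -
        have "(\<lambda>_. 0) \<in> cochains m" by (simp add: cochains_def)
        then have "delta (\<lambda>_. 0) v = 0"
          using N.symt_trace_0 [OF tr, of "delta (\<lambda>_. 0)" v] delta_cochains cochainsD(2) Suc that by blast
        then show ?thesis using N.symt_trace_0 [OF tr cochainsD(2) [OF \<phi>(1)]] that Suc by simp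
      qed
      then show ?thesis unfolding \<phi>(2) Suc by (rule coboundary_delta)
    qed
  qed
qed

text \<open>A top cochain is determined by its value at u0, since antisymmetric functions of top
  degree are multiples of \<omega>. The constant term of this value gives the isomorphism: if it is
  0, \<open>cocycle_eq\<close> yields a coboundary, and coboundaries have no constant term.\<close>

lemma Ext_top:
  obtains E where "cohomology_iso (braid_algebra s) resmod resdiff (CARD('i)) triv E"
proof -
  interpret T: braiding "transp_braid s" by (rule braiding_transp)
  interpret N: braiding "neg_braid (transp_braid s)" by (rule T.braiding_neg)
  let ?N = "CARD('i)"
  obtain m where m: "?N = Suc m" by (metis finite_UNIV_card_ge_0 finite_class.finite_UNIV gr0_implies_Suc)
  have "symz_trace (neg_braid (transp_braid s)) ?N = of_nat (?N choose ?N)"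
    by (rule N.symz_trace_minus) (auto simp: neg_braid_def transp_braid_def sum_negf ptrace)
  then have tr: "symz_trace (neg_braid (transp_braid s)) ?N = 1" by simp
  obtain \<omega> :: "'i list \<Rightarrow> complex" and u0 where \<omega>: "length u0 = ?N" "\<omega> u0 = 1" "symt (neg_braid (transp_braid s)) ?N \<omega>"
    and one: "\<And>(f :: 'i list \<Rightarrow> 'i tensor) u. symt (neg_braid (transp_braid s)) ?N f \<Longrightarrow> length u = ?N \<Longrightarrow> f u = \<omega> u *\<^sub>C f u0"
    using N.symt_trace_1 [OF tr] by metis
  let ?x = "enc (proj ?N (dlt u0))"
  have x: "?x \<in> carrier (resmod ?N)" using proj_dlt by simp
  define E where "E z = Poly_Mapping.lookup (rep s (z ?x)) []" for z
  have rep_x: "rep s (fnl ?N \<phi> ?x) = \<phi> u0" if "\<phi> \<in> cochains ?N" for \<phi>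
    using pr_proj_dlt [OF that \<omega>(1)] cochainsD(3) [OF that] by (simp add: fnl_enc [OF proj_dlt])
  have zx: "z ?x \<in> carrier (braid_algebra s)" if "z \<in> cocyc ?N" for z
    by (rule dualD(1) [OF dual_cocyclesD(1) [OF that] x])
  have "cohomology_iso (braid_algebra s) resmod resdiff ?N triv E"
    unfolding cohomology_iso_def
  proof (intro conjI ballI)
    fix z assume z: "z \<in> cocyc ?N"
    show "E z \<in> carrier triv" by simp
    show "E (z \<oplus>\<^bsub>dual_module (braid_algebra s) (resmod ?N)\<^esub> z') = E z \<oplus>\<^bsub>triv\<^esub> E z'" if "z' \<in> cocyc ?N" for z'
      using zx [OF z] zx [OF that] x by (simp add: E_def dual_module_simps(3) rep_add lookup_add del: resmod_simps)
    show "E (a \<odot>\<^bsub>dual_module (braid_algebra s) (resmod ?N)\<^esub> z) = a \<odot>\<^bsub>triv\<^esub> E z" if "a \<in> carrier (braid_algebra s)" for a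
      using zx [OF z] that x by (simp add: E_def dual_module_simps(4) rep_mult lookup_mult_Nil del: resmod_simps)
    obtain \<phi> where \<phi>: "\<phi> \<in> cochains ?N" "z = fnl ?N \<phi>" "\<And>u. delta \<phi> u = 0" by (rule cocycle_cochain [OF z]) blast
    have Ez: "E z = Poly_Mapping.lookup (\<phi> u0) []" by (simp add: E_def \<phi>(2) rep_x [OF \<phi>(1)])
    show "E z = \<zero>\<^bsub>triv\<^esub> \<longleftrightarrow> z \<in> cobd ?N"
    proof
      assume "E z = \<zero>\<^bsub>triv\<^esub>"
      then have "tpart 0 (\<phi> u0) = 0"
        by (intro poly_mapping_eqI) (simp add: Ez tpart.rep_eq)
      then have t0: "tpart 0 (\<phi> v) = 0" if "length v = ?N" for v
        by (simp add: one [OF cochainsD(2) [OF \<phi>(1)] that] tpart.scale)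
      have "\<phi> v = delta (kap (\<lambda>v. twt (of_nat (?N - ?N)) (\<phi> v))) v" if "length v = Suc m" for v
        using cocycle_eq [OF \<phi>(1) order_refl \<phi>(3), of v] that t0 [of v] m by simp
      from coboundary_delta [OF this] show "z \<in> cobd ?N" by (simp only: \<phi>(2) m)
    next
      assume "z \<in> cobd ?N"
      then obtain f where f: "f \<in> carrier (dual_module (braid_algebra s) (resmod m))"
        "z = (\<lambda>x\<in>carrier (resmod ?N). f (resdiff m x))"
        unfolding m dual_coboundaries_simps by blast
      obtain \<psi> where \<psi>: "\<psi> \<in> cochains m" "f = fnl m \<psi>" by (rule dual_cochain [OF f(1)])
      let ?g = "proj ?N (dlt u0)"
      have g: "?g \<in> chains (Suc m)" using proj_dlt [of ?N u0] m by simp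
      have "z ?x = cls s (pr m (dL ?g) \<psi>)"
        using x by (simp add: f(2) \<psi>(2) resdiff_enc [OF g] bdry_dL fnl_enc [OF dL_chains [OF g]] del: resmod_simps)
      moreover have "of_nat (Suc m) *\<^sub>C pr m (dL ?g) \<psi> = delta \<psi> u0"
        using pr_delta [OF g, of \<psi>] pr_proj_dlt [OF delta_cochains [OF \<psi>(1)], of u0] \<omega>(1) by (simp add: m)
      then have "of_nat (Suc m) * Poly_Mapping.lookup (pr m (dL ?g) \<psi>) [] = Poly_Mapping.lookup (delta \<psi> u0) []"
        by (metis lookup_cscale cscale_complex_def)
      then have "Poly_Mapping.lookup (pr m (dL ?g) \<psi>) [] = 0"
        by (simp add: lookup_delta_Nil del: of_nat_Suc)
      ultimately show "E z = \<zero>\<^bsub>triv\<^esub>" by (simp add: E_def)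
    qed
  next
    have "c \<in> E ` cocyc ?N" for c
    proof -
      define \<phi> :: "'i list \<Rightarrow> 'i tensor" where "\<phi> u = (if length u = ?N then \<omega> u *\<^sub>C tensor_const c else 0)" for u
      have lin: "cvec_linear (\<lambda>d :: complex. d *\<^sub>C (tensor_const c :: 'i tensor))" by (rule lin_scale_left)
      have "symt (neg_braid (transp_braid s)) ?N \<phi> \<longleftrightarrow> symt (neg_braid (transp_braid s)) ?N (\<lambda>u. \<omega> u *\<^sub>C (tensor_const c :: 'i tensor))"
        by (rule symt_cong) (simp add: \<phi>_def)
      then have \<phi>: "\<phi> \<in> cochains ?N" using symt_linear [OF lin \<omega>(3)] by (simp add: cochains_def \<phi>_def tsym.scale)
      have "fnl ?N \<phi> (resdiff ?N x) = \<zero>\<^bsub>braid_algebra s\<^esub>" if "x \<in> carrier (resmod (Suc ?N))" for x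
      proof -
        \<comment> \<open>Every cochain of top degree is a cocycle, because the next term of the
          resolution is 0.\<close>
        have "x = \<zero>\<^bsub>resmod (Suc ?N)\<^esub>" using that resmod_vanish [of "Suc ?N"] by blast
        then have "resdiff ?N x = \<zero>\<^bsub>resmod ?N\<^esub>"
          using linear_zero [OF left_module_resmod left_module_resmod resdiff_linear] by blast
        then show ?thesis using dual_zero [OF left_module_resmod fnl_dual] by metis
      qed
      then have "fnl ?N \<phi> \<in> cocyc ?N" using fnl_dual unfolding dual_cocycles_def by blast
      moreover have "E (fnl ?N \<phi>) = c"
        by (simp add: E_def rep_x [OF \<phi>]) (simp add: \<phi>_def \<omega>(1,2) tensor_const_def)
      ultimately show ?thesis by blast
    qed
    then show "E ` cocyc ?N = carrier triv" by auto
  qed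
  then show ?thesis by (rule that)
qed

end

section \<open>Koszulity, global dimension and the Gorenstein property\<close>

lemma lookup_mult_append:
  fixes q :: "'i tensor"
  assumes "p \<in> tensor_degree n" "length u = n"
  shows "Poly_Mapping.lookup (p * q) (u @ v) = Poly_Mapping.lookup p u * Poly_Mapping.lookup q v"
proof (induction p rule: tensor_induct)
  case (word w)
  then have len: "length w = n" using assms(1) by (simp add: tensor_degree_def)
  show ?case
  proof (cases "w = u")
    case True
    then show ?thesis by (simp add: lookup_word lookup_word_mult)
  next
    case False
    then have "Poly_Mapping.lookup (tensor_word w * q) (u @ v) = 0"
      using len assms(2) by (intro lookup_word_mult_0) auto
    then show ?thesis using False by (simp add: lookup_word)
  qed
qed (simp_all add: distrib_right lookup_add cscale_mult_left lookup_cscale cscale_complex_def distrib_left mult.assoc)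

context braiding
begin

lemma lookup_braid_rel:
  "Poly_Mapping.lookup (braid_rel s a b) [j, k] = (if a = j \<and> b = k then 1 else 0) - s a b j k"
proof -
  have "(\<Sum>x\<in>UNIV. \<Sum>y\<in>UNIV. s a b x y * (if x = j \<and> y = k then 1 else 0)) =
      (\<Sum>x\<in>UNIV. \<Sum>y\<in>UNIV. if y = k then if x = j then s a b x y else 0 else 0)"
    by (intro sum.cong) auto
  then show ?thesis
    by (simp add: braid_rel_def lookup_minus lookup_sum lookup_cscale lookup_word cscale_complex_def)
qed

text \<open>To lie in the span with the factor V at a given position is to be an eigenvector, for
  -1, of the transposition at this position; all positions together give antisymmetry.\<close>

lemma koszul_space_braid:
  "koszul_space (braid_space s) n = {t \<in> tensor_degree n. symt (neg_braid s) n (Poly_Mapping.lookup t)}"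
proof (intro Set.set_eqI iffI)
  let ?gen = "\<lambda>r q. {u * v * w | u v w. u \<in> tensor_degree r \<and> v \<in> braid_space s \<and> w \<in> tensor_degree q}"
  have span: "tensor.span Y = cvec.span Y" for Y :: "'i tensor set" by (simp add: tensor_scale_fun)
  {
    fix t assume t: "t \<in> koszul_space (braid_space s) n"
    have "(\<Sum>a\<in>UNIV. \<Sum>b\<in>UNIV. neg_braid s a b j k *\<^sub>C Poly_Mapping.lookup t (u @ a # b # v)) =
        Poly_Mapping.lookup t (u @ j # k # v)" if len: "length u + length v + 2 = n" for u j k v
    proof -
      have "t \<in> cvec.span (?gen (length u) (length v))"
        using t len by (simp add: koszul_space_def span)
      then show ?thesis
      proof (induction rule: cvec.span_induct_alt)
        case (step c x y)
        then obtain p q w where x: "x = p * (q * w)" and pqw: "p \<in> tensor_degree (length u)" "q \<in> braid_space s" "w \<in> tensor_degree (length v)"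
          by (auto simp: mult.assoc)
        have q2: "q \<in> tensor_degree 2" using pqw(2) by (simp add: braid_space_def)
        have lx: "Poly_Mapping.lookup x (u @ a # b # v) = Poly_Mapping.lookup p u * (Poly_Mapping.lookup q [a, b] * Poly_Mapping.lookup w v)" for a b
          using lookup_mult_append [OF pqw(1) refl, of "q * w" "[a, b] @ v"] lookup_mult_append [OF q2, of "[a, b]" w v]
          by (simp add: x)
        have "Poly_Mapping.lookup (tact s q) [j, k] = - Poly_Mapping.lookup q [j, k]"
          using pqw(2) by (simp add: braid_space_def)
        then have lq: "(\<Sum>a\<in>UNIV. \<Sum>b\<in>UNIV. neg_braid s a b j k * Poly_Mapping.lookup q [a, b]) = Poly_Mapping.lookup q [j, k]"
          by (simp add: tact.rep_eq cscale_complex_def neg_braid_def sum_negf)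
        have "(\<Sum>a\<in>UNIV. \<Sum>b\<in>UNIV. neg_braid s a b j k * Poly_Mapping.lookup x (u @ a # b # v)) =
            Poly_Mapping.lookup p u * ((\<Sum>a\<in>UNIV. \<Sum>b\<in>UNIV. neg_braid s a b j k * Poly_Mapping.lookup q [a, b]) * Poly_Mapping.lookup w v)"
          unfolding lx sum_distrib_left sum_distrib_right by (intro sum.cong refl) (simp only: mult_ac)
        also have "\<dots> = Poly_Mapping.lookup x (u @ j # k # v)" unfolding lx lq ..
        finally have ex: "(\<Sum>a\<in>UNIV. \<Sum>b\<in>UNIV. neg_braid s a b j k * Poly_Mapping.lookup x (u @ a # b # v)) =
            Poly_Mapping.lookup x (u @ j # k # v)" .
        have "(\<Sum>a\<in>UNIV. \<Sum>b\<in>UNIV. neg_braid s a b j k *\<^sub>C Poly_Mapping.lookup (c *\<^sub>C x + y) (u @ a # b # v)) =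
            c * (\<Sum>a\<in>UNIV. \<Sum>b\<in>UNIV. neg_braid s a b j k * Poly_Mapping.lookup x (u @ a # b # v)) +
            (\<Sum>a\<in>UNIV. \<Sum>b\<in>UNIV. neg_braid s a b j k *\<^sub>C Poly_Mapping.lookup y (u @ a # b # v))"
          by (simp add: lookup_add lookup_cscale cscale_complex_def distrib_left sum.distrib sum_distrib_left mult.left_commute)
        then show ?case using ex step.IH by (simp add: lookup_add lookup_cscale cscale_complex_def)
      qed simp
    qed
    then show "t \<in> {t \<in> tensor_degree n. symt (neg_braid s) n (Poly_Mapping.lookup t)}"
      using t by (simp add: symt_iff koszul_space_def)
  next
    fix t assume "t \<in> {t \<in> tensor_degree n. symt (neg_braid s) n (Poly_Mapping.lookup t)}"
    then have tn: "t \<in> tensor_degree n" and sy: "symt (neg_braid s) n (Poly_Mapping.lookup t)" by auto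
    have "t \<in> cvec.span (?gen r q)" if rq: "r + q + 2 = n" for r q
    proof -
      let ?G = "\<lambda>u a b v. tensor_word u * braid_rel s a b * tensor_word v"
      have G: "?G u a b v \<in> ?gen r q" if "u \<in> words r" "v \<in> words q" for u a b v
        using that word_degree [of u] word_degree [of v] braid_rel_space [of a b] unfolding words_def by blast
      \<comment> \<open>At the chosen position t is half of t - s t, and 1 - s carries a pair of
        letters to its relation.\<close>
      define t' where "t' = (\<Sum>u\<in>words r. \<Sum>a\<in>UNIV. \<Sum>b\<in>UNIV. \<Sum>v\<in>words q.
        (1 / 2 * Poly_Mapping.lookup t (u @ a # b # v)) *\<^sub>C ?G u a b v)"
      have "t' \<in> cvec.span (?gen r q)"
        unfolding t'_def by (intro cvec.span_sum cvec.span_scale cvec.span_base G)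
      moreover have "t = t'"
      proof (rule poly_mapping_eqI)
        fix x
        show "Poly_Mapping.lookup t x = Poly_Mapping.lookup t' x"
        proof (cases "length x = n")
          case False
          have "Poly_Mapping.lookup (?G u a b v) x = 0" if "u \<in> words r" "v \<in> words q" for u a b v
          proof -
            have ne: "u @ j # k # v \<noteq> x" for j k using that False rq by (auto simp: words_def)
            have "?G u a b v = tensor_word (u @ a # b # v) - (\<Sum>j\<in>UNIV. \<Sum>k\<in>UNIV. s a b j k *\<^sub>C tensor_word (u @ j # k # v))"
              by (simp add: braid_rel_def left_diff_distrib right_diff_distrib sum_distrib_left sum_distrib_right
                  cscale_mult_left cscale_mult_right word_mult_word)
            then show ?thesis using ne by (simp add: lookup_minus lookup_sum lookup_cscale lookup_word)
          qed
          then show ?thesis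
            using tn False by (simp add: t'_def lookup_sum lookup_cscale tensor_degree_iff)
        next
          case True
          define u' where "u' = take r x"
          obtain j k v' where jk: "drop r x = j # k # v'" "length v' = q"
            by (rule length_Suc_SucE [of "drop r x" q]) (use True rq in auto)
          have x: "x = u' @ j # k # v'" and u': "length u' = r" using jk(1) True rq append_take_drop_id [of r x] by (auto simp: u'_def)
          have lG: "Poly_Mapping.lookup (?G u a b v) x =
              (if u = u' then if v = v' then (if a = j \<and> b = k then 1 else 0) - s a b j k else 0 else 0)"
            if "u \<in> words r" "v \<in> words q" for u a b v
          proof -
            have d: "tensor_word u \<in> tensor_degree r" "braid_rel s a b \<in> tensor_degree 2"
              using that word_degree [of u] braid_rel_space [of a b] by (auto simp: words_def braid_space_def)
            show ?thesis
              using lookup_mult_append [OF d(1) u', of "braid_rel s a b * tensor_word v" "[j, k] @ v'"]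
                lookup_mult_append [OF d(2), of "[j, k]" "tensor_word v" v']
              by (simp add: x lookup_word mult.assoc lookup_braid_rel)
          qed
          have "Poly_Mapping.lookup t' x = (\<Sum>u\<in>words r. \<Sum>a\<in>UNIV. \<Sum>b\<in>UNIV. \<Sum>v\<in>words q.
              if u = u' then if v = v' then 1 / 2 * Poly_Mapping.lookup t (u @ a # b # v) *
                ((if a = j \<and> b = k then 1 else 0) - s a b j k) else 0 else 0)"
            unfolding t'_def lookup_sum lookup_cscale cscale_complex_def
            by (intro sum.cong refl) (simp add: lG)
          also have "\<dots> = (\<Sum>u\<in>words r. if u = u' then (\<Sum>a\<in>UNIV. \<Sum>b\<in>UNIV. \<Sum>v\<in>words q.
              if v = v' then 1 / 2 * Poly_Mapping.lookup t (u @ a # b # v) *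
                ((if a = j \<and> b = k then 1 else 0) - s a b j k) else 0) else 0)"
            by (intro sum.cong refl) simp
          also have "\<dots> = (\<Sum>a\<in>UNIV. \<Sum>b\<in>UNIV. 1 / 2 * Poly_Mapping.lookup t (u' @ a # b # v') *
                ((if a = j \<and> b = k then 1 else 0) - s a b j k))"
            using u' jk(2) by (simp add: mem_words)
          also have "\<dots> = 1 / 2 * ((\<Sum>a\<in>UNIV. \<Sum>b\<in>UNIV. if b = k then if a = j then Poly_Mapping.lookup t (u' @ a # b # v') else 0 else 0) +
              (\<Sum>a\<in>UNIV. \<Sum>b\<in>UNIV. neg_braid s a b j k *\<^sub>C Poly_Mapping.lookup t (u' @ a # b # v')))"
            unfolding sum.distrib [symmetric] sum_distrib_left
            by (intro sum.cong refl) (auto simp: neg_braid_def cscale_complex_def algebra_simps)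
          also have "\<dots> = 1 / 2 * (Poly_Mapping.lookup t x + Poly_Mapping.lookup t x)"
          proof -
            have "(\<Sum>a\<in>UNIV. \<Sum>b\<in>UNIV. neg_braid s a b j k *\<^sub>C Poly_Mapping.lookup t (u' @ a # b # v')) = Poly_Mapping.lookup t x"
              using sy u' jk(2) rq by (simp add: symt_iff x)
            moreover have "(\<Sum>a\<in>UNIV. \<Sum>b\<in>UNIV. if b = k then if a = j then Poly_Mapping.lookup t (u' @ a # b # v') else 0 else 0) =
                Poly_Mapping.lookup t x" by (simp add: x)
            ultimately show ?thesis by (simp only:)
          qed
          finally show ?thesis by simp
        qed
      qed
      ultimately show ?thesis by simp
    qed
    then show "t \<in> koszul_space (braid_space s) n" using tn by (simp add: koszul_space_def span)
  }
qed

end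

context trivial_coeffs
begin

definition kc :: "('i list \<Rightarrow> 'b \<Rightarrow>\<^sub>0 'i tensor) \<Rightarrow> 'i list \<Rightarrow> 'i tensor set" where
  "kc g u = cls s (Poly_Mapping.lookup (g u) b0)"

text \<open>A sum of elementary tensors inherits antisymmetry from its second factors. Conversely,
  expanding the projection that fixes g writes it as the sum of all \<open>g w\<close> tensor the
  antisymmetrized word w.\<close>

lemma koszul_chains_kc: "koszul_chains (braid_space s) n = kc ` chains n"
proof
  let ?K = "koszul_space (braid_space s) n"
  have sum: "(\<Oplus>\<^bsub>braid_algebra s\<^esub>t\<in>S. a t \<otimes>\<^bsub>braid_algebra s\<^esub> cls s (tensor_const (Poly_Mapping.lookup t u))) =
      cls s (\<Sum>t\<in>S. Poly_Mapping.lookup t u *\<^sub>C rep s (a t))"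
    if "finite S" "a \<in> S \<rightarrow> carrier (braid_algebra s)" for S a u
  proof -
    have "a t \<otimes>\<^bsub>braid_algebra s\<^esub> cls s (tensor_const (Poly_Mapping.lookup t u)) = cls s (Poly_Mapping.lookup t u *\<^sub>C rep s (a t))"
      if "t \<in> S" for t
      using cls_mult [of "rep s (a t)" "tensor_const (Poly_Mapping.lookup t u)"] \<open>a \<in> S \<rightarrow> _\<close> that
      by (simp add: mult_const Pi_iff)
    then have "(\<Oplus>\<^bsub>braid_algebra s\<^esub>t\<in>S. a t \<otimes>\<^bsub>braid_algebra s\<^esub> cls s (tensor_const (Poly_Mapping.lookup t u))) =
        (\<Oplus>\<^bsub>braid_algebra s\<^esub>t\<in>S. cls s (Poly_Mapping.lookup t u *\<^sub>C rep s (a t)))"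
      by (intro A.finsum_cong') auto
    then show ?thesis using cls_finsum [OF \<open>finite S\<close>] by simp
  qed
  show "koszul_chains (braid_space s) n \<subseteq> kc ` chains n"
  proof
    fix f assume "f \<in> koszul_chains (braid_space s) n"
    then obtain S a where S: "finite S" "S \<subseteq> ?K" "a \<in> S \<rightarrow> carrier (braid_algebra s)"
      and f: "f = (\<lambda>u. \<Oplus>\<^bsub>braid_algebra s\<^esub>t\<in>S. a t \<otimes>\<^bsub>braid_algebra s\<^esub> cls s (tensor_const (Poly_Mapping.lookup t u)))"
      unfolding koszul_chains_def by blast
    define h where "h u = (\<Sum>t\<in>S. Poly_Mapping.lookup t u *\<^sub>C rep s (a t))" for u
    define g :: "'i list \<Rightarrow> 'b \<Rightarrow>\<^sub>0 'i tensor" where "g u = Poly_Mapping.single b0 (h u)" for u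
    have lin1: "cvec_linear (\<lambda>c :: complex. c *\<^sub>C x)" for x :: "'i tensor" by (rule lin_scale_left)
    have lin2: "cvec_linear (Poly_Mapping.single b0 :: 'i tensor \<Rightarrow> 'b \<Rightarrow>\<^sub>0 'i tensor)"
      by (rule cvec_linearI; rule poly_mapping_eqI) (simp_all add: lookup_add lookup_cscale lookup_single when_def)
    have hs: "symt (neg_braid s) n h"
      unfolding h_def [abs_def] using S(2) by (intro symt_sum symt_linear [OF lin1]) (auto simp: koszul_space_braid)
    have "symt (neg_braid s) n g" unfolding g_def [abs_def] by (rule symt_linear [OF lin2 hs])
    moreover have "h u = 0" if "length u \<noteq> n" for u
      unfolding h_def using that S(2) by (intro sum.neutral) (auto simp: koszul_space_braid tensor_degree_iff)
    moreover have "tsym s (h u) = h u" for u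
      using S(3) by (simp add: h_def tsym.sum tsym.scale tsym_rep Pi_iff)
    moreover from this have "g u \<in> sym_coeffs" for u
      by (auto simp: sym_coeffs_def g_def lookup_single when_def)
    ultimately have "g \<in> chains n" by (simp add: chains_def g_def)
    moreover have "f = kc g" unfolding f sum [OF S(1,3)] by (rule ext) (simp add: kc_def g_def h_def)
    ultimately show "f \<in> kc ` chains n" by blast
  qed
  show "kc ` chains n \<subseteq> koszul_chains (braid_space s) n"
  proof
    fix f assume "f \<in> kc ` chains n"
    then obtain g where g: "g \<in> chains n" "f = kc g" by blast
    let ?G = "\<lambda>u. Poly_Mapping.lookup (g u) b0"
    interpret N: braiding "neg_braid s" by (rule braiding_neg)
    define P where "P w = tsym (neg_braid s) (tensor_word w)" for w :: "'i list"
    have PK: "P w \<in> ?K" if "w \<in> words n" for w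
    proof -
      have "symt (neg_braid s) n (Poly_Mapping.lookup (P w))"
        using N.tsym_fix_iff [of "P w"] by (simp add: P_def)
      moreover have "P w \<in> tensor_degree n"
        unfolding P_def by (rule tsym_degree) (use that word_degree [of w] in \<open>simp add: words_def\<close>)
      ultimately show ?thesis by (simp add: koszul_space_braid)
    qed
    define S where "S = P ` words n"
    \<comment> \<open>Different words can have the same antisymmetrization, while chains are defined
      by sums over sets of tensors; so coefficients are added up over each fibre of P.\<close>
    define a where "a t = cls s (\<Sum>w\<in>{w \<in> words n. P w = t}. ?G w)" for t
    have S: "finite S" "S \<subseteq> ?K" "a \<in> S \<rightarrow> carrier (braid_algebra s)" using PK by (auto simp: S_def a_def)
    have tG: "tsym s (?G w) = ?G w" for w using chainsD(3) [OF g(1)] by (simp add: sym_coeffs_def)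
    have "(\<Sum>t\<in>S. Poly_Mapping.lookup t u *\<^sub>C rep s (a t)) = ?G u" for u
    proof -
      have "(\<Sum>t\<in>S. Poly_Mapping.lookup t u *\<^sub>C rep s (a t)) =
          (\<Sum>t\<in>S. \<Sum>w\<in>{w \<in> words n. P w = t}. Poly_Mapping.lookup (P w) u *\<^sub>C ?G w)"
        by (intro sum.cong refl) (simp add: a_def tsym.sum tG cscale_sum_right)
      also have "\<dots> = (\<Sum>w\<in>words n. Poly_Mapping.lookup (P w) u *\<^sub>C ?G w)"
        unfolding S_def by (rule sum.image_gen [symmetric]) simp
      also have "\<dots> = ?G u"
      proof (cases "length u = n")
        case True
        have "(\<Sum>w\<in>words n. Poly_Mapping.lookup (P w) u *\<^sub>C ?G w) =
            (\<Sum>w\<in>words n. symz (neg_braid s) n (\<lambda>v. if v = w then 1 else 0) u *\<^sub>C ?G w)"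
          by (simp add: P_def tsym.rep_eq lookup_word_fun True)
        also have "\<dots> = symz (neg_braid s) n ?G u" by (rule symz_expand [OF True, symmetric])
        also have "\<dots> = ?G u" by (rule symz_symt [OF symt_coeff [OF g(1)] True])
        finally show ?thesis .
      next
        case False
        have "Poly_Mapping.lookup (P w) u = 0" if "w \<in> words n" for w
          using PK [OF that] False by (simp add: koszul_space_braid tensor_degree_iff)
        then show ?thesis using chainsD(1) [OF g(1) False] by simp
      qed
      finally show ?thesis .
    qed
    then have "f = (\<lambda>u. \<Oplus>\<^bsub>braid_algebra s\<^esub>t\<in>S. a t \<otimes>\<^bsub>braid_algebra s\<^esub> cls s (tensor_const (Poly_Mapping.lookup t u)))"
      unfolding sum [OF S(1,3)] g(2) by (intro ext) (simp add: kc_def)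
    then show "f \<in> koszul_chains (braid_space s) n" unfolding koszul_chains_def using S by blast
  qed
qed

lemma koszul_diff_kc: "koszul_diff (braid_space s) (kc g) = kc (dL g)"
proof
  fix u
  have "koszul_diff (braid_space s) (kc g) u = cls s (\<Sum>i\<in>UNIV. Poly_Mapping.lookup (g (i # u)) b0 * letter i)"
    unfolding koszul_diff_def kc_def by (simp add: cls_mult cls_finsum)
  also have "\<dots> = kc (dL g) u"
    by (simp add: kc_def dL_def rhow_def lookup_sum lookup_pmap [OF lin_rhow] cls_eq_iff tsym.sum)
  finally show "koszul_diff (braid_space s) (kc g) u = kc (dL g) u" .
qed

lemma kc_zero_iff:
  assumes g: "g \<in> chains n" shows "kc g = (\<lambda>_. \<zero>\<^bsub>braid_algebra s\<^esub>) \<longleftrightarrow> (\<forall>u. g u = 0)"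
proof -
  have "kc g u = \<zero>\<^bsub>braid_algebra s\<^esub> \<longleftrightarrow> g u = 0" for u
  proof -
    have tG: "tsym s (Poly_Mapping.lookup (g u) b0) = Poly_Mapping.lookup (g u) b0"
      and k: "Poly_Mapping.keys (g u) \<subseteq> {b0}" using chainsD(3) [OF g] by (simp_all add: sym_coeffs_def)
    have "b0 \<notin> Poly_Mapping.keys (g u) \<longleftrightarrow> Poly_Mapping.keys (g u) = {}" using k by blast
    then have "Poly_Mapping.lookup (g u) b0 = 0 \<longleftrightarrow> Poly_Mapping.keys (g u) = {}" by (simp only: not_in_keys_iff_lookup_eq_zero)
    then have "Poly_Mapping.lookup (g u) b0 = 0 \<longleftrightarrow> g u = 0" by (simp only: keys_eq_empty)
    then show ?thesis by (simp add: kc_def cls_zero cls_eq_iff tG)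
  qed
  then show ?thesis by (simp add: fun_eq_iff)
qed

lemma koszul_braid_space: "koszul (braid_space s)"
  unfolding koszul_def
proof (intro allI impI)
  fix n :: nat assume "n \<ge> 1"
  then obtain m where n: "n = Suc m" by (cases n) auto
  show "{f \<in> koszul_chains (braid_space s) n. koszul_diff (braid_space s) f = (\<lambda>_. \<zero>\<^bsub>braid_algebra s\<^esub>)} =
      koszul_diff (braid_space s) ` koszul_chains (braid_space s) (Suc n)"
  proof (intro Set.set_eqI iffI)
    fix f assume "f \<in> {f \<in> koszul_chains (braid_space s) n. koszul_diff (braid_space s) f = (\<lambda>_. \<zero>\<^bsub>braid_algebra s\<^esub>)}"
    then obtain g where g: "g \<in> chains (Suc m)" "f = kc g" "kc (dL g) = (\<lambda>_. \<zero>\<^bsub>braid_algebra s\<^esub>)"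
      by (auto simp: koszul_chains_kc n koszul_diff_kc)
    then have "bdry m g u = 0" for u using kc_zero_iff [OF dL_chains [OF g(1)]] by (simp add: bdry_dL)
    from bdry_exact [OF g(1) this] obtain w where "w \<in> chains (Suc (Suc m))" "dL w = g" unfolding bdry_dL by blast
    then show "f \<in> koszul_diff (braid_space s) ` koszul_chains (braid_space s) (Suc n)"
      by (auto simp: koszul_chains_kc n koszul_diff_kc g(2) image_image)
  next
    fix f assume "f \<in> koszul_diff (braid_space s) ` koszul_chains (braid_space s) (Suc n)"
    then obtain w where w: "w \<in> chains (Suc (Suc m))" "f = kc (dL w)"
      by (auto simp: koszul_chains_kc n koszul_diff_kc)
    have g: "dL w \<in> chains (Suc m)" by (rule dL_chains [OF w(1)])
    have "dL (dL w) u = 0" for u using bdry_bdry [OF w(1), of u] by (simp add: bdry_dL)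
    then have "kc (dL (dL w)) = (\<lambda>_. \<zero>\<^bsub>braid_algebra s\<^esub>)" using kc_zero_iff [OF dL_chains [OF g]] by simp
    then show "f \<in> {f \<in> koszul_chains (braid_space s) n. koszul_diff (braid_space s) f = (\<lambda>_. \<zero>\<^bsub>braid_algebra s\<^esub>)}"
      using g by (auto simp: koszul_chains_kc n w(2) koszul_diff_kc)
  qed
qed

end

section \<open>Global dimension and the Gorenstein property\<close>

context normalized_braiding
begin

text \<open>The hypotheses describe the copies of the trivial module in any type. The Gorenstein
  property uses \<open>triv\<close> itself, but the global dimension ranges over modules with
  elements in another type.\<close>

lemma one_dimensional_resolution:
  fixes M :: "('i tensor set, 'b) module"
  assumes M: "left_module (braid_algebra s) M" and b: "b \<in> carrier M" "b \<noteq> \<zero>\<^bsub>M\<^esub>"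
    and letters: "\<And>i. cls s (letter i) \<odot>\<^bsub>M\<^esub> b = \<zero>\<^bsub>M\<^esub>"
    and span: "\<And>m. m \<in> carrier M \<Longrightarrow> \<exists>c. m = cls s (tensor_const c) \<odot>\<^bsub>M\<^esub> b"
  obtains P :: "nat \<Rightarrow> ('i tensor set, ('i tensor set, 'b) resolution_elem) module" and d e E
  where "projective_resolution (braid_algebra s) P d e M"
    "\<And>n. n \<noteq> CARD('i) \<Longrightarrow> dual_cocycles (braid_algebra s) P d n \<subseteq> dual_coboundaries (braid_algebra s) P d n"
    "cohomology_iso (braid_algebra s) P d (CARD('i)) triv E"
proof -
  interpret M: braid_module s M by (intro braid_module.intro M) unfold_locales
  have ev: "M.ev (M.embed p) = cls s (tensor_const (Poly_Mapping.lookup p b)) \<odot>\<^bsub>M\<^esub> b" if "Poly_Mapping.keys p \<subseteq> {b}" for p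
    using M.ev_superset [of "{b}" "M.embed p"] that b(1) by (simp add: M.keys_embed M.lookup_embed M.M.M.finsum_insert)
  have "p = 0" if p: "Poly_Mapping.keys p \<subseteq> {b}" "M.ev (M.embed p) = \<zero>\<^bsub>M\<^esub>" for p
  proof -
    let ?c = "Poly_Mapping.lookup p b"
    have "?c = 0"
    proof (rule ccontr)
      assume c: "?c \<noteq> 0"
      have "tensor_const (inverse ?c) * tensor_const ?c = (1 :: 'i tensor)"
        using c by (simp add: tensor_const_def mult_single plus_list_def) (simp flip: zero_list_def add: single_one)
      then have "cls s (tensor_const (inverse ?c)) \<odot>\<^bsub>M\<^esub> (cls s (tensor_const ?c) \<odot>\<^bsub>M\<^esub> b) = b"
        using b(1) M.M.smult_assoc1 [of "cls s (tensor_const (inverse ?c))" "cls s (tensor_const ?c)" b]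
        by (simp add: cls_mult flip: cls_one)
      then show False using ev [OF p(1)] p(2) b(2) M.M.smult_r_zero [of "cls s (tensor_const (inverse ?c))"] by simp
    qed
    then have "Poly_Mapping.lookup p k = 0" for k using p(1) by (cases "k = b") (auto simp: in_keys_iff)
    then show ?thesis by (intro poly_mapping_eqI) simp
  qed
  moreover have "\<exists>p. Poly_Mapping.keys p \<subseteq> {b} \<and> M.ev (M.embed p) = m" if m: "m \<in> carrier M" for m
  proof -
    obtain c where c: "m = cls s (tensor_const c) \<odot>\<^bsub>M\<^esub> b" using span [OF m] by blast
    have k: "Poly_Mapping.keys (Poly_Mapping.single b c) \<subseteq> {b}" by auto
    show ?thesis by (rule exI [of _ "Poly_Mapping.single b c"]) (use ev [OF k] k c in simp)
  qed
  ultimately have vb: "M.vbasis {b}" using b(1) unfolding M.vbasis_def by blast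
  interpret Q: based_module s M "{b}" by (intro based_module.intro based_module_axioms.intro vb) unfold_locales
  have "Q.mu i m = 0" for i m
  proof -
    have "Q.co \<zero>\<^bsub>M\<^esub> = 0" using Q.co [of "\<zero>\<^bsub>M\<^esub>"] Q.basis_indep [of "Q.co \<zero>\<^bsub>M\<^esub>"] by simp
    then show ?thesis using letters by (simp add: Q.mu_def)
  qed
  then have mu: "Q.mu = (\<lambda>_ _. 0)" by (intro ext)
  interpret T: trivial_coeffs s b by (intro trivial_coeffs.intro) (use Q.coeff_module_mu in \<open>simp only: mu\<close>)
  obtain E where "cohomology_iso (braid_algebra s) T.resmod T.resdiff (CARD('i)) triv E" by (rule T.Ext_top)
  then show ?thesis using that [OF Q.resolution [unfolded mu] T.Ext_vanishing] by blast
qed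

text \<open>The trivial module transported along an injection f, to be found among the modules in
  the definition of the global dimension.\<close>

definition triv_copy :: "(complex \<Rightarrow> 'b) \<Rightarrow> ('i tensor set, 'b) module" where
  "triv_copy f = \<lparr>carrier = range f, monoid.mult = undefined, one = undefined, zero = f 0,
     add = (\<lambda>x y. f (the_inv f x + the_inv f y)),
     module.smult = (\<lambda>a x. f (Poly_Mapping.lookup (rep s a) [] * the_inv f x))\<rparr>"

lemma triv_copy_simps:
  assumes "inj f"
  shows "carrier (triv_copy f) = range f" "\<zero>\<^bsub>triv_copy f\<^esub> = f 0" "f x \<oplus>\<^bsub>triv_copy f\<^esub> f y = f (x + y)"
    "a \<odot>\<^bsub>triv_copy f\<^esub> f x = f (Poly_Mapping.lookup (rep s a) [] * x)"
  by (simp_all add: triv_copy_def the_inv_f_f [OF assms])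

lemma left_module_triv_copy:
  assumes "inj f" shows "left_module (braid_algebra s) (triv_copy f)"
proof (intro left_module.intro left_module_axioms.intro A.ring_axioms)
  interpret T: left_module "braid_algebra s" triv by (rule left_module_triv)
  note simps = triv_copy_simps [OF assms]
  show "abelian_group (triv_copy f)"
  proof (rule abelian_groupI)
    show "\<exists>y\<in>carrier (triv_copy f). y \<oplus>\<^bsub>triv_copy f\<^esub> x = \<zero>\<^bsub>triv_copy f\<^esub>" if x: "x \<in> carrier (triv_copy f)" for x
    proof -
      obtain c where "x = f c" using x simps(1) by auto
      then show ?thesis by (intro bexI [of _ "f (- c)"]) (simp_all add: simps)
    qed
  qed (auto simp: simps algebra_simps)
  have one: "Poly_Mapping.lookup (rep s \<one>\<^bsub>braid_algebra s\<^esub>) [] = 1"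
    using T.smult_one [of 1] by simp
  show "\<one>\<^bsub>braid_algebra s\<^esub> \<odot>\<^bsub>triv_copy f\<^esub> x = x" if "x \<in> carrier (triv_copy f)" for x using that one by (auto simp: simps)
qed (auto simp: triv_copy_simps [OF assms] rep_add rep_mult lookup_add lookup_mult_Nil algebra_simps)

text \<open>A resolution whose N-th term is 0 would make the N-th extension module by the algebra
  vanish, but this module is isomorphic to the complex numbers.\<close>

lemma projective_dimension_ge:
  fixes M :: "('i tensor set, 'b) module"
  assumes M: "left_module (braid_algebra s) M" and b: "b \<in> carrier M" "b \<noteq> \<zero>\<^bsub>M\<^esub>"
    and letters: "\<And>i. cls s (letter i) \<odot>\<^bsub>M\<^esub> b = \<zero>\<^bsub>M\<^esub>"
    and span: "\<And>m. m \<in> carrier M \<Longrightarrow> \<exists>c. m = cls s (tensor_const c) \<odot>\<^bsub>M\<^esub> b"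
  shows "enat (CARD('i)) \<le> projective_dimension (braid_algebra s) M"
  unfolding projective_dimension_def
proof (rule Inf_greatest)
  let ?A = "braid_algebra s" and ?N = "CARD('i)"
  obtain Q :: "nat \<Rightarrow> ('i tensor set, ('i tensor set, 'b) resolution_elem) module" and d' e' E
    where Q: "projective_resolution ?A Q d' e' M" and E: "cohomology_iso ?A Q d' ?N triv E"
    by (rule one_dimensional_resolution [OF M b letters span])
  fix x assume "x \<in> {enat n | n. \<exists>(P :: nat \<Rightarrow> ('i tensor set, ('i tensor set, 'b) resolution_elem) module) d e.
    projective_resolution ?A P d e M \<and> (\<forall>k>n. carrier (P k) = {\<zero>\<^bsub>P k\<^esub>})}"
  then obtain n and P :: "nat \<Rightarrow> ('i tensor set, ('i tensor set, 'b) resolution_elem) module" and d e where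
    n: "x = enat n" and P: "projective_resolution ?A P d e M" and vanish: "\<And>k. k > n \<Longrightarrow> carrier (P k) = {\<zero>\<^bsub>P k\<^esub>}"
    by blast
  have "\<not> n < ?N"
  proof
    assume "n < ?N"
    then have PN: "carrier (P ?N) = {\<zero>\<^bsub>P ?N\<^esub>}" by (rule vanish)
    have lm: "left_module ?A (P ?N)" by (rule projective_resolutionD(2) [OF P])
    interpret B: abelian_subgroup "dual_coboundaries ?A P d ?N" "dual_module ?A (P ?N)" by (rule coboundary_subgroup [OF P])
    note B0 = additive_subgroup.zero_closed [OF B.additive_subgroup_axioms]
    have "z = \<zero>\<^bsub>dual_module ?A (P ?N)\<^esub>" if "z \<in> dual_cocycles ?A P d ?N" for z
    proof (rule dual_eqI [OF dual_cocyclesD(1) [OF that] B.zero_closed])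
      fix y assume y: "y \<in> carrier (P ?N)"
      then have "y = \<zero>\<^bsub>P ?N\<^esub>" using PN by blast
      then show "z y = \<zero>\<^bsub>dual_module ?A (P ?N)\<^esub> y"
        using dual_zero [OF lm dual_cocyclesD(1) [OF that]] y by (simp add: dual_module_simps(2))
    qed
    then have "dual_cocycles ?A P d ?N \<subseteq> dual_coboundaries ?A P d ?N" using B0 by blast
    from Ext_vanishing_transfer [OF M Q P this]
    have "E z = 0" if "z \<in> dual_cocycles ?A Q d' ?N" for z
      using cohomology_isoD(4) [OF E that] that by auto
    moreover have "E ` dual_cocycles ?A Q d' ?N = UNIV" using E by (simp add: cohomology_iso_def)
    then have "1 \<in> E ` dual_cocycles ?A Q d' ?N" by simp
    ultimately show False by force
  qed
  then show "enat ?N \<le> x" by (simp add: n)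
qed

lemma lookup_const_Nil [simp]: "Poly_Mapping.lookup (tensor_const c) [] = c"
  by (simp add: tensor_const_def)

lemma lookup_rep_letter [simp]: "Poly_Mapping.lookup (rep s (cls s (letter i))) [] = 0"
  by (simp add: lookup_word)

lemma global_dimension_braid: "global_dimension TYPE('u) (braid_algebra s) = enat (CARD('i))"
  unfolding global_dimension_def
proof (rule antisym)
  show "Sup {projective_dimension (braid_algebra s) M | M :: ('i tensor set, 'u \<Rightarrow> 'i tensor set) module.
      left_module (braid_algebra s) M} \<le> enat (CARD('i))"
    by (rule Sup_least) (use projective_dimension_le in blast)
  \<comment> \<open>An injection of the complex numbers into the required function type; constant
    functions work for every \<open>'u\<close>.\<close>
  define f :: "complex \<Rightarrow> 'u \<Rightarrow> 'i tensor set" where "f c = (\<lambda>_. cls s (tensor_const c))" for c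
  have inj: "inj f"
  proof (rule injI)
    fix c c' assume "f c = f c'"
    then have "cls s (tensor_const c) = cls s (tensor_const c')" by (simp add: f_def fun_eq_iff)
    then have "tensor_const c = (tensor_const c' :: 'i tensor)" by (simp only: cls_eq_iff tsym_1)
    then show "c = c'" by (metis lookup_const_Nil)
  qed
  have M: "left_module (braid_algebra s) (triv_copy f)" by (rule left_module_triv_copy [OF inj])
  have "enat (CARD('i)) \<le> projective_dimension (braid_algebra s) (triv_copy f)"
    by (rule projective_dimension_ge [OF M, of "f 1"]) (use inj in \<open>auto simp: triv_copy_simps inj_eq lookup_word\<close>)
  also have "\<dots> \<le> Sup {projective_dimension (braid_algebra s) M | M :: ('i tensor set, 'u \<Rightarrow> 'i tensor set) module.
      left_module (braid_algebra s) M}"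
    by (rule Sup_upper) (use M in blast)
  finally show "enat (CARD('i)) \<le> Sup {projective_dimension (braid_algebra s) M | M :: ('i tensor set, 'u \<Rightarrow> 'i tensor set) module.
      left_module (braid_algebra s) M}" .
qed

text \<open>\<open>Ext_regular\<close> uses an unspecified choice. The existence of the Koszul
  resolution makes the choice a resolution, and the comparison theorem transfers the cohomology to
  it.\<close>

lemma gorenstein_braid: "gorenstein TYPE('u) (braid_algebra s) triv"
  unfolding gorenstein_def
proof (intro exI conjI allI impI)
  let ?A = "braid_algebra s" and ?N = "CARD('i)"
  show "global_dimension TYPE('u) ?A = enat ?N" by (rule global_dimension_braid)
  obtain Q :: "nat \<Rightarrow> ('i tensor set, ('i tensor set, complex) resolution_elem) module" and d' e' E
    where Q: "projective_resolution ?A Q d' e' triv"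
      and van: "\<And>n. n \<noteq> ?N \<Longrightarrow> dual_cocycles ?A Q d' n \<subseteq> dual_coboundaries ?A Q d' n"
      and E: "cohomology_iso ?A Q d' ?N triv E"
    by (rule one_dimensional_resolution [OF left_module_triv, of 1]) (auto simp: lookup_word)
  obtain P d e where Pde: "some_resolution ?A triv = (P, d, e)" by (cases "some_resolution ?A triv")
  have P: "projective_resolution ?A P d e triv"
  proof -
    have "case (Q, d', e') of (P, d, e) \<Rightarrow> projective_resolution ?A P d e triv" unfolding prod.case by (rule Q)
    then have "case some_resolution ?A triv of (P, d, e) \<Rightarrow> projective_resolution ?A P d e triv"
      unfolding some_resolution_def by (rule someI)
    then show ?thesis unfolding Pde prod.case .
  qed
  have Ext: "Ext_regular n ?A triv = subquotient_module (dual_module ?A (P n)) (dual_cocycles ?A P d n) (dual_coboundaries ?A P d n)" for n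
    by (simp add: Ext_regular_def Pde)
  show "carrier (Ext_regular n ?A triv) = {\<zero>\<^bsub>Ext_regular n ?A triv\<^esub>}" if "n \<noteq> ?N" for n
    unfolding Ext subquotient_simps(2)
    by (rule subquotient_zero [OF P Ext_vanishing_transfer [OF left_module_triv P Q van [OF that]]])
  obtain E' where "cohomology_iso ?A P d ?N triv E'"
    by (rule cohomology_iso_transfer [OF left_module_triv P Q left_module_triv E])
  then show "module_isomorphic ?A (Ext_regular ?N ?A triv) triv"
    unfolding Ext by (rule cohomology_iso_module_isomorphic [OF P left_module_triv])
qed

lemma koszul_braid: "koszul (braid_space s)"
proof -
  interpret trivial_coeffs s "()"
    by unfold_locales auto
  show ?thesis by (rule koszul_braid_space)
qed

end

theorem theorem2p3:
  fixes R :: "('m::finite, 'n::finite) rmatrix"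
  assumes "condition_C1 R" and "condition_C2 R" and "condition_C3 R"
  shows "koszul (relations R) \<and>
    global_dimension TYPE('u) (quadratic_algebra (relations R)) = enat (CARD('m) + CARD('n)) \<and>
    gorenstein TYPE('u) (quadratic_algebra (relations R)) (trivial_module (relations R)) \<and>
    polynomial_growth (relations R) \<and>
    poincare_series (relations R) = 1 / (1 - fps_X) ^ (CARD('m) + CARD('n)) \<and>
    poincare_series (quadratic_dual (relations R)) = (1 + fps_X) ^ (CARD('m) + CARD('n))"
proof -
  interpret normalized_braiding "R_braid R" by (rule normalized_braiding_R [OF assms])
  interpret T: braiding "transp_braid (R_braid R)" by (rule braiding_transp)
  interpret N: braiding "neg_braid (transp_braid (R_braid R))" by (rule T.braiding_neg)
  have card: "CARD('m + 'n) = CARD('m) + CARD('n)" by simp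
  \<comment> \<open>The Koszul dual belongs to the negative of the transpose, whose partial trace is
    minus the identity.\<close>
  have "poincare_series (braid_space (neg_braid (transp_braid (R_braid R)))) = (1 + fps_X) ^ CARD('m + 'n)"
    by (rule N.poincare_series_minus) (auto simp: neg_braid_def transp_braid_def sum_negf ptrace)
  then show ?thesis
    unfolding relations_braid_space [OF assms] quadratic_dual_braid card [symmetric]
    using koszul_braid global_dimension_braid gorenstein_braid polynomial_growth_plus [OF ptrace]
      poincare_series_plus [OF ptrace] by blast
qed

end
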